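(* For every $1\le r\le\infty$ and $\sigma>\frac{3}{2r'}$, where $\frac1r+\frac1{r'}=1$, there exists $C_{\sigma,r}>0$, independent of $\hbar>0$, such that for all operators $\gamma_0$ on $L^2(\mathbb{R}^3)$ for which the respective right-hand side is finite, $$\big\|\rho^\hbar_{\mathcal{U}^\hbar(t)\gamma_0\mathcal{U}^\hbar(t)^*}\big\|_{L^r_x(\mathbb{R}^3)}\le C_{\sigma,r}\,\|\langle\hbar\nabla\rangle^\sigma\gamma_0\langle\hbar\nabla\rangle^\sigma\|_{\mathfrak{L}^r_\hbar}\qquad(t\in\mathbb{R}),$$ $$\big\|\rho^\hbar_{\mathcal{U}^\hbar(t)\gamma_0\mathcal{U}^\hbar(t)^*}\big\|_{L^r_x(\mathbb{R}^3)}\le\frac{C_{\sigma,r}}{|t|^{3/r'}}\,\|\langle x\rangle^\sigma\gamma_0\langle x\rangle^\sigma\|_{\mathfrak{L}^r_\hbar}\qquad(t\in\mathbb{R}\setminus\{0\}).$$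
   Context: $\mathcal{U}^\hbar(t)=e^{\frac{it\hbar}{2}\Delta}$ on $L^2(\mathbb{R}^3)$; $\langle y\rangle=(1+|y|^2)^{1/2}$; $\langle\hbar\nabla\rangle=(1-\hbar^2\Delta)^{1/2}$; $\langle x\rangle^\sigma$ is a multiplication operator. For $1\le r<\infty$, $\|A\|_{\mathfrak{L}^r_\hbar}=(2\pi\hbar)^{3/r}(\mathrm{Tr}|A|^r)^{1/r}$; for $r=\infty$ it is the operator norm on $L^2(\mathbb{R}^3)$. The density of an operator $A$ with kernel $A(x,x')$ is $\rho^\hbar_A(x)=(2\pi\hbar)^3A(x,x)$, defined for smooth finite-rank operators and extended to larger classes via the linear estimates; equivalently it is characterized by duality, $\int_{\mathbb{R}^3}V\rho^\hbar_A\,dx=(2\pi\hbar)^3\mathrm{Tr}(VA)$ for $V\in C_c^\infty(\mathbb{R}^3)$. *)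

theory Defs
  imports "HOL-Probability.Probability" "HOL-Computational_Algebra.Polynomial"
begin

section \<open>The Hilbert space of square-integrable functions\<close>

definition square_integrable :: "(real^3 \<Rightarrow> complex) \<Rightarrow> bool" where
  "square_integrable f \<longleftrightarrow>
     f \<in> borel_measurable lborel \<and> integrable lborel (\<lambda>x. (cmod (f x))\<^sup>2)"

lemma square_integrable_zero: "square_integrable (\<lambda>x. 0)"
  by (simp add: square_integrable_def)

lemma square_integrable_add:
  assumes "square_integrable f" "square_integrable g"
  shows "square_integrable (\<lambda>x. f x + g x)"
proof -
  have [measurable]: "f \<in> borel_measurable lborel" "g \<in> borel_measurable lborel"
    using assms by (auto simp: square_integrable_def)
  have b: "(cmod (f x + g x))\<^sup>2 \<le> 2 * (cmod (f x))\<^sup>2 + 2 * (cmod (g x))\<^sup>2" for x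
  proof -
    have "(cmod (f x + g x))\<^sup>2 \<le> (cmod (f x) + cmod (g x))\<^sup>2"
      by (intro power_mono norm_triangle_ineq) auto
    also have "\<dots> \<le> 2 * (cmod (f x))\<^sup>2 + 2 * (cmod (g x))\<^sup>2"
      using sum_squares_bound[of "cmod (f x)" "cmod (g x)"]
      by (simp add: power2_sum)
    finally show ?thesis .
  qed
  have "integrable lborel (\<lambda>x. 2 * (cmod (f x))\<^sup>2 + 2 * (cmod (g x))\<^sup>2)"
    using assms by (auto simp: square_integrable_def)
  then have "integrable lborel (\<lambda>x. (cmod (f x + g x))\<^sup>2)"
    by (rule Bochner_Integration.integrable_bound) (use b in auto)
  then show ?thesis
    by (simp add: square_integrable_def)
qed

lemma square_integrable_cmult:
  assumes "square_integrable f"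
  shows "square_integrable (\<lambda>x. c * f x)"
  using assms by (auto simp: square_integrable_def norm_mult power_mult_distrib)

lemma square_integrable_uminus:
  assumes "square_integrable f"
  shows "square_integrable (\<lambda>x. - f x)"
  using square_integrable_cmult[OF assms, of "-1"] by simp

lemma square_integrable_diff:
  assumes "square_integrable f" "square_integrable g"
  shows "square_integrable (\<lambda>x. f x - g x)"
  using square_integrable_add[OF assms(1) square_integrable_uminus[OF assms(2)]] by simp

lemma square_integrable_cnj_mult:
  assumes "square_integrable f" "square_integrable g"
  shows "integrable lborel (\<lambda>x. cnj (f x) * g x)"
proof -
  have [measurable]: "f \<in> borel_measurable lborel" "g \<in> borel_measurable lborel"
    using assms by (auto simp: square_integrable_def)
  have b: "cmod (f x) * cmod (g x) \<le> (cmod (f x))\<^sup>2 + (cmod (g x))\<^sup>2" for x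
  proof -
    have "0 \<le> cmod (f x) * cmod (g x)"
      by simp
    then show ?thesis
      using sum_squares_bound[of "cmod (f x)" "cmod (g x)"] unfolding mult.assoc by linarith
  qed
  have "integrable lborel (\<lambda>x. (cmod (f x))\<^sup>2 + (cmod (g x))\<^sup>2)"
    using assms by (auto simp: square_integrable_def)
  moreover have "(\<lambda>x. cnj (f x) * g x) \<in> borel_measurable lborel"
    by (intro borel_measurable_times borel_measurable_continuous_on[of cnj] continuous_intros) auto
  ultimately show ?thesis
    by (rule Bochner_Integration.integrable_bound) (use b in \<open>auto simp: norm_mult\<close>)
qed

quotient_type L2 = "real^3 \<Rightarrow> complex" / partial:
  "\<lambda>f g. square_integrable f \<and> square_integrable g \<and> (AE x in lborel. f x = g x)"
  morphisms fun_of Abs_L2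
proof (rule part_equivpI)
  show "\<exists>f. square_integrable f \<and> square_integrable f \<and> (AE x in lborel. f x = f x)"
    using square_integrable_zero by auto
qed (auto simp: symp_def transp_def)

instantiation L2 :: real_vector
begin

lift_definition zero_L2 :: L2 is "\<lambda>x. 0"
  by (simp add: square_integrable_zero)

lift_definition plus_L2 :: "L2 \<Rightarrow> L2 \<Rightarrow> L2" is "\<lambda>f g x. f x + g x"
  by (auto intro: square_integrable_add)

lift_definition uminus_L2 :: "L2 \<Rightarrow> L2" is "\<lambda>f x. - f x"
  by (auto intro: square_integrable_uminus)

lift_definition minus_L2 :: "L2 \<Rightarrow> L2 \<Rightarrow> L2" is "\<lambda>f g x. f x - g x"
  by (auto intro: square_integrable_diff)

lift_definition scaleR_L2 :: "real \<Rightarrow> L2 \<Rightarrow> L2" is "\<lambda>r f x. complex_of_real r * f x"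
  by (auto intro: square_integrable_cmult)

instance
proof
  fix a b c :: L2 and r s :: real
  show "a + b + c = a + (b + c)"
    by transfer (auto intro: square_integrable_add simp: algebra_simps)
  show "a + b = b + a"
    by transfer (auto intro: square_integrable_add simp: algebra_simps)
  show "0 + a = a"
    by transfer (auto simp: algebra_simps)
  show "- a + a = 0"
    by transfer (auto simp: square_integrable_zero)
  show "a - b = a + - b"
    by transfer (auto intro: square_integrable_diff)
  show "r *\<^sub>R (a + b) = r *\<^sub>R a + r *\<^sub>R b"
    by transfer (auto intro!: square_integrable_add square_integrable_cmult simp: distrib_left)
  show "(r + s) *\<^sub>R a = r *\<^sub>R a + s *\<^sub>R a"
    by transfer (auto intro!: square_integrable_add square_integrable_cmult simp: distrib_right)
  show "r *\<^sub>R s *\<^sub>R a = (r * s) *\<^sub>R a"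
    by transfer (auto intro!: square_integrable_cmult simp: mult.assoc)
  show "1 *\<^sub>R a = a"
    by transfer auto
qed

end

lift_definition scaleC :: "complex \<Rightarrow> L2 \<Rightarrow> L2" is "\<lambda>c f x. c * f x"
  by (auto intro: square_integrable_cmult)

lemma vector_space_scaleC: "vector_space scaleC"
proof
  fix a b :: complex and x y :: L2
  show "scaleC a (x + y) = scaleC a x + scaleC a y"
    by transfer (auto intro!: square_integrable_add square_integrable_cmult simp: distrib_left)
  show "scaleC (a + b) x = scaleC a x + scaleC b x"
    by transfer (auto intro!: square_integrable_add square_integrable_cmult simp: distrib_right)
  show "scaleC a (scaleC b x) = scaleC (a * b) x"
    by transfer (auto intro!: square_integrable_cmult simp: mult.assoc)
  show "scaleC 1 x = x"
    by transfer auto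
qed

lift_definition cinner :: "L2 \<Rightarrow> L2 \<Rightarrow> complex" is
  "\<lambda>f g. LINT x|lborel. cnj (f x) * g x"
proof -
  fix f1 f2 g1 g2 :: "real^3 \<Rightarrow> complex"
  assume 1: "square_integrable f1 \<and> square_integrable f2 \<and> (AE x in lborel. f1 x = f2 x)"
    and 2: "square_integrable g1 \<and> square_integrable g2 \<and> (AE x in lborel. g1 x = g2 x)"
  have "AE x in lborel. cnj (f1 x) * g1 x = cnj (f2 x) * g2 x"
    using 1 2 by auto
  then show "(LINT x|lborel. cnj (f1 x) * g1 x) = (LINT x|lborel. cnj (f2 x) * g2 x)"
    using 1 2 by (intro integral_cong_AE borel_measurable_integrable square_integrable_cnj_mult) auto
qed

lemma cinner_add_right: "cinner x (y + z) = cinner x y + cinner x z"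
  by transfer (auto simp: distrib_left square_integrable_cnj_mult)

lemma cinner_add_left: "cinner (x + y) z = cinner x z + cinner y z"
  by transfer (auto simp: distrib_right square_integrable_cnj_mult)

lemma cinner_scaleC_right: "cinner x (scaleC c y) = c * cinner x y"
proof transfer
  fix f g :: "real^3 \<Rightarrow> complex" and c :: complex
  have "(\<lambda>x. cnj (f x) * (c * g x)) = (\<lambda>x. c * (cnj (f x) * g x))"
    by (rule ext) (rule mult.left_commute)
  then show "(LINT x|lborel. cnj (f x) * (c * g x)) = c * (LINT x|lborel. cnj (f x) * g x)"
    by (simp only: integral_mult_right_zero)
qed

lemma cinner_commute: "cinner x y = cnj (cinner y x)"
proof transfer
  fix f g :: "real^3 \<Rightarrow> complex"
  have "(\<lambda>x. cnj (f x) * g x) = (\<lambda>x. cnj (cnj (g x) * f x))"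
    by (simp add: fun_eq_iff mult.commute)
  then show "(LINT x|lborel. cnj (f x) * g x) = cnj (LINT x|lborel. cnj (g x) * f x)"
    by (simp only: Bochner_Integration.integral_cnj)
qed

lemma square_integrable_fun_of: "square_integrable (fun_of x)"
  using Quotient_rep_reflp[OF Quotient_L2] by blast

lemma Abs_L2_fun_of: "Abs_L2 (fun_of x) = x"
  by (rule Quotient_abs_rep[OF Quotient_L2])

lemma cinner_fun_of: "cinner x y = (LINT t|lborel. cnj (fun_of x t) * fun_of y t)"
proof -
  have "cinner (Abs_L2 (fun_of x)) (Abs_L2 (fun_of y)) =
      (LINT t|lborel. cnj (fun_of x t) * fun_of y t)"
    by (rule cinner.abs_eq) (auto intro: square_integrable_fun_of)
  then show ?thesis
    by (simp only: Abs_L2_fun_of)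
qed

lemma cinner_self: "cinner x x = of_real (LINT t|lborel. (cmod (fun_of x t))\<^sup>2)"
proof -
  have "(\<lambda>t. cnj (fun_of x t) * fun_of x t) = (\<lambda>t. of_real ((cmod (fun_of x t))\<^sup>2))"
    by (rule ext) (metis complex_norm_square mult.commute)
  then show ?thesis
    by (simp only: cinner_fun_of integral_complex_of_real)
qed

instantiation L2 :: real_inner
begin

definition inner_L2 :: "L2 \<Rightarrow> L2 \<Rightarrow> real" where
  "inner_L2 x y = Re (cinner x y)"

definition norm_L2 :: "L2 \<Rightarrow> real" where
  "norm_L2 x = sqrt (inner x x)"

definition sgn_L2 :: "L2 \<Rightarrow> L2" where
  "sgn_L2 x = x /\<^sub>R norm x"

definition dist_L2 :: "L2 \<Rightarrow> L2 \<Rightarrow> real" where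
  "dist_L2 x y = norm (x - y)"

definition uniformity_L2 :: "(L2 \<times> L2) filter" where
  "uniformity_L2 = (INF e\<in>{0<..}. principal {(x, y). dist x y < e})"

definition open_L2 :: "L2 set \<Rightarrow> bool" where
  "open_L2 U \<longleftrightarrow> (\<forall>x\<in>U. eventually (\<lambda>(x', y). x' = x \<longrightarrow> y \<in> U) uniformity)"

instance
proof
  fix x y z :: L2 and r :: real
  show "inner x y = inner y x"
    unfolding inner_L2_def by (subst cinner_commute) simp
  show "inner (x + y) z = inner x z + inner y z"
    by (simp add: inner_L2_def cinner_add_left)
  show "inner (r *\<^sub>R x) y = r * inner x y"
    unfolding inner_L2_def by transfer (simp add: mult.assoc)
  show "0 \<le> inner x x"
    by (simp add: inner_L2_def cinner_self)
  show "inner x x = 0 \<longleftrightarrow> x = 0"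
  proof
    assume "inner x x = 0"
    then have "(LINT t|lborel. (cmod (fun_of x t))\<^sup>2) = 0"
      by (simp add: inner_L2_def cinner_self)
    moreover note s = square_integrable_fun_of[of x]
    ultimately have "AE t in lborel. fun_of x t = 0"
      by (subst (asm) integral_nonneg_eq_0_iff_AE) (auto simp: square_integrable_def)
    then have "Abs_L2 (fun_of x) = Abs_L2 (\<lambda>t. 0)"
      using s square_integrable_zero by (intro Quotient_rel_abs[OF Quotient_L2]) auto
    then show "x = 0"
      by (simp add: zero_L2_def Quotient_abs_rep[OF Quotient_L2])
  next
    assume "x = 0"
    then show "inner x x = 0"
      unfolding inner_L2_def by (simp, transfer) simp
  qed
qed (simp_all add: norm_L2_def sgn_L2_def dist_L2_def uniformity_L2_def open_L2_def)

end

text \<open>The class of a function, and \<open>0\<close> if the function is not square-integrable.\<close>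

definition L2_of :: "(real^3 \<Rightarrow> complex) \<Rightarrow> L2" where
  "L2_of f = (if square_integrable f then Abs_L2 f else 0)"


section \<open>Bounded operators, functional calculus, trace, Schatten norms\<close>

abbreviation clinear :: "(L2 \<Rightarrow> L2) \<Rightarrow> bool" where
  "clinear \<equiv> Vector_Spaces.linear scaleC scaleC"

definition bounded_clinear :: "(L2 \<Rightarrow> L2) \<Rightarrow> bool" where
  "bounded_clinear A \<longleftrightarrow> clinear A \<and> bounded_linear A"

text \<open>
  The library's \<^const>\<open>adjoint\<close> refers to the real inner product \<open>Re \<langle>\<cdot>,\<cdot>\<rangle>\<close>; on complex-linear
  operators it is the usual complex adjoint.
\<close>

definition poly_op :: "real poly \<Rightarrow> (L2 \<Rightarrow> L2) \<Rightarrow> L2 \<Rightarrow> L2" where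
  "poly_op p P u = (\<Sum>i\<le>degree p. coeff p i *\<^sub>R (P ^^ i) u)"

text \<open>
  Continuous functional calculus \<open>f(P)\<close> of a bounded positive operator \<open>P\<close>: the operator-norm
  limit of \<open>p\<^sub>n(P)\<close> for polynomials \<open>p\<^sub>n\<close> converging to \<open>f\<close> uniformly on \<open>[0,\<parallel>P\<parallel>]\<close>, an interval
  that contains the spectrum of \<open>P\<close>.
\<close>

definition pos_cfc :: "(real \<Rightarrow> real) \<Rightarrow> (L2 \<Rightarrow> L2) \<Rightarrow> (L2 \<Rightarrow> L2)" where
  "pos_cfc f P = (THE Q. bounded_clinear Q \<and>
     (\<exists>p. uniform_limit {0..onorm P} (\<lambda>n. poly (p n)) f sequentially \<and>
          (\<lambda>n. onorm (\<lambda>u. poly_op (p n) P u - Q u)) \<longlonglongrightarrow> 0))"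

definition op_abs :: "(L2 \<Rightarrow> L2) \<Rightarrow> (L2 \<Rightarrow> L2)" where
  "op_abs A = pos_cfc sqrt (adjoint A \<circ> A)"

definition op_powr :: "(L2 \<Rightarrow> L2) \<Rightarrow> real \<Rightarrow> (L2 \<Rightarrow> L2)" where
  "op_powr P a = pos_cfc (\<lambda>s. s powr a) P"

definition is_onb :: "L2 set \<Rightarrow> bool" where
  "is_onb B \<longleftrightarrow> (\<forall>e\<in>B. \<forall>f\<in>B. cinner e f = (if e = f then 1 else 0)) \<and>
                (\<forall>u. (\<forall>e\<in>B. cinner e u = 0) \<longrightarrow> u = 0)"

text \<open>
  The traces below do not depend on the basis: \<open>pos_trace\<close> is used for positive operators only,
  \<open>op_trace\<close> for trace-class operators only.
\<close>

definition some_onb :: "L2 set" where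
  "some_onb = (SOME B. is_onb B)"

definition pos_trace :: "(L2 \<Rightarrow> L2) \<Rightarrow> ennreal" where
  "pos_trace P = (\<Sum>\<^sub>\<infinity>e\<in>some_onb. ennreal (Re (cinner e (P e))))"

definition trace_class :: "(L2 \<Rightarrow> L2) \<Rightarrow> bool" where
  "trace_class A \<longleftrightarrow> bounded_clinear A \<and> pos_trace (op_abs A) < \<infinity>"

definition op_trace :: "(L2 \<Rightarrow> L2) \<Rightarrow> complex" where
  "op_trace A = (\<Sum>\<^sub>\<infinity>e\<in>some_onb. cinner e (A e))"

text \<open>Real powers with positive exponent on \<open>[0,\<infinity>]\<close>.\<close>

definition ennpowr :: "ennreal \<Rightarrow> real \<Rightarrow> ennreal" where
  "ennpowr x a = (if x = \<infinity> then \<infinity> else ennreal (enn2real x powr a))"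

text \<open>For bounded \<open>A\<close> and \<open>1 \<le> r \<le> \<infinity>\<close>; the value is \<open>\<infinity>\<close> if \<open>A\<close> is not in the Schatten class.\<close>

definition schatten_norm :: "real \<Rightarrow> ennreal \<Rightarrow> (L2 \<Rightarrow> L2) \<Rightarrow> ennreal" where
  "schatten_norm h r A =
     (if r = \<infinity> then ennreal (onorm A)
      else ennreal ((2 * pi * h) powr (3 / enn2real r)) *
           ennpowr (pos_trace (op_powr (op_abs A) (enn2real r))) (1 / enn2real r))"


section \<open>Multiplication operators and Fourier multipliers\<close>

text \<open>
  A possibly unbounded operator is represented by its graph. Multiplication operators and Fourier
  multipliers carry their maximal domain.
\<close>

definition mult_graph :: "(real^3 \<Rightarrow> complex) \<Rightarrow> (L2 \<times> L2) set" where
  "mult_graph m = {(u, v). AE x in lborel. fun_of v x = m x * fun_of u x}"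

text \<open>
  Unitary Fourier transform \<open>(2\<pi>)\<^sup>-\<^sup>3\<^sup>/\<^sup>2 \<integral> exp(-i\<xi>\<cdot>x) u(x) dx\<close>, as the limit in \<open>L\<^sup>2\<close> of the integrals
  over balls of radius \<open>n\<close>.
\<close>

definition fourier :: "L2 \<Rightarrow> L2" where
  "fourier u = lim (\<lambda>n::nat. L2_of (\<lambda>\<xi>.
     of_real ((2 * pi) powr (-3/2)) *
       (LINT x:cball 0 (real n)|lborel. cis (- (\<xi> \<bullet> x)) * fun_of u x)))"

text \<open>The operator \<open>m(-i\<nabla>)\<close>.\<close>

definition fourier_mult_graph :: "(real^3 \<Rightarrow> complex) \<Rightarrow> (L2 \<times> L2) set" where
  "fourier_mult_graph m = {(u, v). (fourier u, fourier v) \<in> mult_graph m}"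

definition japanese_bracket :: "real^3 \<Rightarrow> real" where
  "japanese_bracket y = sqrt (1 + (norm y)\<^sup>2)"

text \<open>\<open>\<langle>x\<rangle>\<^sup>\<sigma>\<close>\<close>

definition position_weight :: "real \<Rightarrow> (L2 \<times> L2) set" where
  "position_weight \<sigma> = mult_graph (\<lambda>x. of_real (japanese_bracket x powr \<sigma>))"

text \<open>\<open>\<langle>h\<nabla>\<rangle>\<^sup>\<sigma> = (1 - h\<^sup>2\<Delta>)\<^sup>\<sigma>\<^sup>/\<^sup>2\<close>, with symbol \<open>(1 + h\<^sup>2\<bar>\<xi>\<bar>\<^sup>2)\<^sup>\<sigma>\<^sup>/\<^sup>2\<close>\<close>

definition momentum_weight :: "real \<Rightarrow> real \<Rightarrow> (L2 \<times> L2) set" where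
  "momentum_weight h \<sigma> = fourier_mult_graph (\<lambda>\<xi>. of_real (japanese_bracket (h *\<^sub>R \<xi>) powr \<sigma>))"

text \<open>\<open>exp(ith\<Delta>/2)\<close>, with symbol \<open>exp(-ith\<bar>\<xi>\<bar>\<^sup>2/2)\<close>\<close>

definition free_propagator :: "real \<Rightarrow> real \<Rightarrow> L2 \<Rightarrow> L2" where
  "free_propagator h t u =
     (THE v. (u, v) \<in> fourier_mult_graph (\<lambda>\<xi>. cis (- (t * h / 2 * (norm \<xi>)\<^sup>2))))"

definition evolve :: "real \<Rightarrow> real \<Rightarrow> (L2 \<Rightarrow> L2) \<Rightarrow> (L2 \<Rightarrow> L2)" where
  "evolve h t \<gamma> = free_propagator h t \<circ> \<gamma> \<circ> adjoint (free_propagator h t)"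

text \<open>
  For \<open>W\<close> densely defined, \<open>W \<gamma> W\<close> is bounded if \<open>\<gamma>\<close> maps the range of \<open>W\<close> into the domain of \<open>W\<close>
  and \<open>W \<gamma> W\<close>, defined on the whole domain of \<open>W\<close>, is the restriction of an everywhere defined
  bounded operator \<open>A\<close> (which is then unique). Its Schatten norm is that of \<open>A\<close>, and it is \<open>\<infinity>\<close> if
  \<open>W \<gamma> W\<close> is not bounded.
\<close>

definition is_sandwich :: "(L2 \<times> L2) set \<Rightarrow> (L2 \<Rightarrow> L2) \<Rightarrow> (L2 \<Rightarrow> L2) \<Rightarrow> bool" where
  "is_sandwich W \<gamma> A \<longleftrightarrow> bounded_clinear A \<and> (\<forall>(u, v) \<in> W. (\<gamma> v, A u) \<in> W)"

definition sandwich_norm ::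
    "real \<Rightarrow> ennreal \<Rightarrow> (L2 \<times> L2) set \<Rightarrow> (L2 \<Rightarrow> L2) \<Rightarrow> ennreal" where
  "sandwich_norm h r W \<gamma> =
     (if \<exists>A. is_sandwich W \<gamma> A then schatten_norm h r (THE A. is_sandwich W \<gamma> A) else \<infinity>)"


section \<open>Densities\<close>

primrec C_k :: "nat \<Rightarrow> (real^3 \<Rightarrow> complex) \<Rightarrow> bool" where
  "C_k 0 f \<longleftrightarrow> continuous_on UNIV f"
| "C_k (Suc k) f \<longleftrightarrow> (\<forall>x. f differentiable (at x)) \<and>
     (\<forall>b\<in>Basis. C_k k (\<lambda>x. frechet_derivative f (at x) b))"

definition support :: "(real^3 \<Rightarrow> complex) \<Rightarrow> (real^3) set" where
  "support f = closure {x. f x \<noteq> 0}"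

definition test_function :: "(real^3 \<Rightarrow> complex) \<Rightarrow> bool" where
  "test_function f \<longleftrightarrow> (\<forall>k. C_k k f) \<and> compact (support f)"

definition mult_op :: "(real^3 \<Rightarrow> complex) \<Rightarrow> L2 \<Rightarrow> L2" where
  "mult_op V u = L2_of (\<lambda>x. V x * fun_of u x)"

text \<open>
  The density is characterised by \<open>\<integral> V \<rho> = (2\<pi>h)\<^sup>3 Tr(V A)\<close> for all test functions \<open>V\<close>. An operator
  with a density is in general only locally of trace class (a function of momentum never is of
  trace class, unless it is zero), and then \<open>V A\<close> itself need not be of trace class. As usual,
  \<open>Tr(V A)\<close> stands for \<open>Tr(V A \<eta>)\<close>, where \<open>\<eta>\<close> is any cut-off that is \<open>1\<close> on the support of \<open>V\<close>; by
  cyclicity this equals \<open>Tr(V A)\<close> whenever \<open>V A\<close> is of trace class.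
\<close>

definition is_density :: "real \<Rightarrow> (L2 \<Rightarrow> L2) \<Rightarrow> (real^3 \<Rightarrow> complex) \<Rightarrow> bool" where
  "is_density h A \<rho> \<longleftrightarrow>
     \<rho> \<in> borel_measurable lborel \<and>
     (\<forall>K. compact K \<longrightarrow> set_integrable lborel K \<rho>) \<and>
     (\<forall>V \<eta>. test_function V \<and> test_function \<eta> \<and> (\<forall>x\<in>support V. \<eta> x = 1) \<longrightarrow>
        trace_class (mult_op V \<circ> A \<circ> mult_op \<eta>) \<and>
        (LINT x|lborel. V x * \<rho> x) =
          of_real ((2 * pi * h) ^ 3) * op_trace (mult_op V \<circ> A \<circ> mult_op \<eta>))"

definition has_density :: "real \<Rightarrow> (L2 \<Rightarrow> L2) \<Rightarrow> bool" where
  "has_density h A \<longleftrightarrow> (\<exists>\<rho>. is_density h A \<rho>)"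

text \<open>Unique up to null sets.\<close>

definition density_of :: "real \<Rightarrow> (L2 \<Rightarrow> L2) \<Rightarrow> (real^3 \<Rightarrow> complex)" where
  "density_of h A = (SOME \<rho>. is_density h A \<rho>)"

definition Lr_norm :: "ennreal \<Rightarrow> (real^3 \<Rightarrow> complex) \<Rightarrow> ennreal" where
  "Lr_norm r f =
     (if r = \<infinity> then esssup lborel (\<lambda>x. ennreal (cmod (f x)))
      else ennpowr (\<integral>\<^sup>+x. ennreal (cmod (f x) powr enn2real r) \<partial>lborel) (1 / enn2real r))"

end

theory Submission
  imports Defs "HOL-Computational_Algebra.Fundamental_Theorem_Algebra"
    "HOL-Complex_Analysis.Complex_Analysis"
begin

text \<open>
  Let \<open>W\<close> be either weight, \<open>A = W \<gamma>\<^sub>0 W\<close> and \<open>B = U(t) W\<^sup>-\<^sup>1\<close>, so that the evolved operator is \<open>B A B\<^sup>*\<close>.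
  In both cases \<open>B\<close> is the product of a multiplication by a phase, the unitary transform with kernel
  \<open>(\<bar>s\<bar>/2\<pi>)\<^sup>3\<^sup>/\<^sup>2 exp(i s x\<cdot>y)\<close>, a multiplication by a function of modulus \<open>\<langle>\<lambda>y\<rangle>\<^sup>-\<^sup>\<sigma>\<close>, and a contraction:
  for the momentum weight by definition of \<open>U(t)\<close> (\<open>s = 1\<close>, \<open>\<lambda> = h\<close>), for the position weight by
  the explicit kernel of \<open>U(t)\<close> (\<open>s = -1/(th)\<close>, \<open>\<lambda> = 1\<close>).

  With the polar decomposition \<open>A = V\<bar>A\<bar>\<close>, the density of \<open>B A B\<^sup>*\<close> is a pairing of \<open>X = B V \<bar>A\<bar>\<^sup>1\<^sup>/\<^sup>2\<close> and
  \<open>X' = B \<bar>A\<bar>\<^sup>1\<^sup>/\<^sup>2\<close>, hence it is dominated by \<open>\<Sum>\<^sub>n \<bar>X e\<^sub>n(x)\<bar>\<^sup>2\<close> and the same sum for \<open>X'\<close>, where \<open>(e\<^sub>n)\<close> is an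
  orthonormal basis. To estimate these sums in \<open>L\<^sup>r\<close>, cut the weight into the dyadic shells
  \<open>2\<^sup>k \<le> \<langle>\<lambda>y\<rangle> < 2\<^sup>k\<^sup>+\<^sup>1\<close>. The part \<open>B\<^sub>k\<close> of \<open>B\<close> on one shell has norm at most \<open>2\<^sup>-\<^sup>k\<^sup>\<sigma>\<close>, and \<open>B\<^sub>k u(x) = \<langle>b\<^sub>k\<^sub>,\<^sub>x, u\<rangle>\<close>
  with \<open>\<parallel>b\<^sub>k\<^sub>,\<^sub>x\<parallel>\<^sup>2\<close> of order \<open>8\<^sup>k 4\<^sup>-\<^sup>k\<^sup>\<sigma>\<close>. Jensen's inequality \<open>\<langle>b,\<bar>A\<bar>b\<rangle>\<^sup>r \<le> \<parallel>b\<parallel>\<^sup>2\<^sup>r\<^sup>-\<^sup>2 \<langle>b,\<bar>A\<bar>\<^sup>r b\<rangle>\<close> then bounds the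
  \<open>r\<close>-th power of the \<open>L\<^sup>r\<close> norm on the shell by a multiple of \<open>8\<^sup>k\<^sup>(\<^sup>r\<^sup>-\<^sup>1\<^sup>) 4\<^sup>-\<^sup>k\<^sup>\<sigma>\<^sup>r Tr\<bar>A\<bar>\<^sup>r\<close>, which decays
  geometrically in \<open>k\<close> exactly when \<open>\<sigma> > 3/(2r')\<close>.
\<close>

section \<open>Square-integrable functions and bounded operators\<close>

text \<open>What forces the cut into shells is that evaluation of B u at a point is in general not a
  bounded functional of u: the vector representing it would have modulus of order <lam
  y>^(-\<sigma>), which is square-integrable on R^3 only for \<sigma> > 3/2, whereas finite r admits
  smaller exponents. On one shell the vector exists, so Jensen's inequality is applied there, and
  the shells are put together at each point x by the triangle inequality with geometric weights c^k.
  The largest weighted shell term at x is bounded by the sum of all of them, the function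
  \<open>Q\<close>, because a sum can be integrated. The powers of h meet in a single factor (h |s|
  / lam)^(3/r'): it is 1 for s = 1, lam = h and |t|^(-3/r') for s = -1/(th), lam = 1. X and X' are
  in general not Hilbert-Schmidt, as B A B^* is in general not of trace class; their densities are
  only locally integrable, so traces are formed after cutting off with test functions. The unbounded
  weights enter only through their inverses, which are bounded and injective.\<close>

lemma fun_of_measurable [measurable]: "fun_of u \<in> borel_measurable lborel"
  using square_integrable_fun_of[of u] by (simp add: square_integrable_def)

lemma borel_measurable_cnj [measurable (raw)]:
  "f \<in> borel_measurable M \<Longrightarrow> (\<lambda>x. cnj (f x)) \<in> borel_measurable M"
  by (rule borel_measurable_continuous_on[of cnj]) (auto intro: continuous_intros)

text \<open>\<open>fun_of\<close> picks an arbitrary representative of the class, so identities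
  between representatives are available only almost everywhere.\<close>

lemma fun_of_Abs_L2:
  assumes "square_integrable f"
  shows "AE x in lborel. fun_of (Abs_L2 f) x = f x"
  using Quotient_rep_abs[OF Quotient_L2, of f] assms by auto

lemma fun_of_L2_of:
  assumes "square_integrable f"
  shows "AE x in lborel. fun_of (L2_of f) x = f x"
  using fun_of_Abs_L2[OF assms] assms by (simp add: L2_of_def)

lemma L2_of_fun_of [simp]: "L2_of (fun_of u) = u"
  by (simp add: L2_of_def square_integrable_fun_of Abs_L2_fun_of)

lemma L2_eqI:
  assumes "AE x in lborel. fun_of u x = fun_of v x"
  shows "u = v"
proof -
  have "Abs_L2 (fun_of u) = Abs_L2 (fun_of v)"
    using assms square_integrable_fun_of by (intro Quotient_rel_abs[OF Quotient_L2]) auto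
  then show ?thesis by (simp add: Abs_L2_fun_of)
qed

lemma L2_of_eqI:
  assumes "square_integrable f" "AE x in lborel. f x = fun_of v x"
  shows "L2_of f = v"
  by (rule L2_eqI) (use fun_of_L2_of[OF assms(1)] assms(2) in auto)

lemma fun_of_add: "AE x in lborel. fun_of (u + v) x = fun_of u x + fun_of v x"
  unfolding plus_L2_def map_fun_def
  by (simp add: fun_of_Abs_L2 square_integrable_add square_integrable_fun_of)

lemma fun_of_diff: "AE x in lborel. fun_of (u - v) x = fun_of u x - fun_of v x"
  unfolding minus_L2_def map_fun_def
  by (simp add: fun_of_Abs_L2 square_integrable_diff square_integrable_fun_of)

lemma fun_of_scaleC: "AE x in lborel. fun_of (scaleC c u) x = c * fun_of u x"
  unfolding scaleC_def map_fun_def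
  by (simp add: fun_of_Abs_L2 square_integrable_cmult square_integrable_fun_of)

lemma fun_of_zero: "AE x in lborel. fun_of 0 x = 0"
  unfolding zero_L2_def map_fun_def
  by (simp add: fun_of_Abs_L2 square_integrable_zero)

lemma scaleR_eq_scaleC: "r *\<^sub>R u = scaleC (of_real r) u"
  unfolding scaleR_L2_def scaleC_def map_fun_def by simp

lemma fun_of_sum: "AE x in lborel. fun_of (\<Sum>i\<in>I. u i) x = (\<Sum>i\<in>I. fun_of (u i) x)"
proof (induction I rule: infinite_finite_induct)
  case (insert i I)
  then show ?case
    using fun_of_add[of "u i" "\<Sum>i\<in>I. u i"] by auto
qed (use fun_of_zero in auto)

global_interpretation L2: vector_space scaleC
  by (rule vector_space_scaleC)

lemma cinner_scaleC_left: "cinner (scaleC c x) y = cnj c * cinner x y"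
  by (subst cinner_commute) (simp add: cinner_scaleC_right cinner_commute[of y x])

lemma cinner_scaleR_right: "cinner x (r *\<^sub>R y) = of_real r * cinner x y"
  by (simp add: scaleR_eq_scaleC cinner_scaleC_right)

lemma cinner_scaleR_left: "cinner (r *\<^sub>R x) y = of_real r * cinner x y"
  by (simp add: scaleR_eq_scaleC cinner_scaleC_left)

lemma cinner_zero_right [simp]: "cinner x 0 = 0"
  using cinner_add_right[of x 0 0] by simp

lemma cinner_zero_left [simp]: "cinner 0 x = 0"
  using cinner_add_left[of 0 0 x] by simp

lemma cinner_minus_right: "cinner x (- y) = - cinner x y"
  using cinner_add_right[of x y "- y"] by (simp add: add_eq_0_iff)

lemma cinner_minus_left: "cinner (- x) y = - cinner x y"
  using cinner_add_left[of x "- x" y] by (simp add: add_eq_0_iff)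

lemma cinner_diff_right: "cinner x (y - z) = cinner x y - cinner x z"
  using cinner_add_right[of x y "- z"] by (simp add: cinner_minus_right)

lemma cinner_diff_left: "cinner (x - y) z = cinner x z - cinner y z"
  using cinner_add_left[of x "- y" z] by (simp add: cinner_minus_left)

lemma cinner_sum_right: "cinner x (\<Sum>i\<in>I. f i) = (\<Sum>i\<in>I. cinner x (f i))"
  by (induction I rule: infinite_finite_induct) (auto simp: cinner_add_right)

lemma cinner_sum_left: "cinner (\<Sum>i\<in>I. f i) x = (\<Sum>i\<in>I. cinner (f i) x)"
  by (induction I rule: infinite_finite_induct) (auto simp: cinner_add_left)

lemma norm_L2_sq: "(norm u)\<^sup>2 = (LINT t|lborel. (cmod (fun_of u t))\<^sup>2)"
  by (simp add: norm_L2_def inner_L2_def cinner_self)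

lemma cinner_self_norm: "cinner u u = of_real ((norm u)\<^sup>2)"
  by (simp add: cinner_self norm_L2_sq)

lemma Re_cinner_self: "Re (cinner u u) = (norm u)\<^sup>2"
  by (simp add: cinner_self_norm)

lemma norm_scaleC: "norm (scaleC c u) = cmod c * norm u"
proof -
  have "complex_of_real ((norm (scaleC c u))\<^sup>2) = of_real ((cmod c * norm u)\<^sup>2)"
    unfolding cinner_self_norm[symmetric] cinner_scaleC_left cinner_scaleC_right
    using complex_norm_square[of c] by (simp add: cinner_self_norm power_mult_distrib mult.assoc mult.left_commute)
  then have "(norm (scaleC c u))\<^sup>2 = (cmod c * norm u)\<^sup>2"
    by (simp only: of_real_eq_iff)
  then show ?thesis
    by simp
qed

text \<open>The real Cauchy-Schwarz inequality only sees the real part of \<open>cinner u v\<close>.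
  Rotating u by the phase \<open>c\<close> makes the inner product equal to its modulus;
  \<open>sgn 0 = 0\<close> covers the orthogonal case.\<close>

lemma cmod_cinner_le: "cmod (cinner u v) \<le> norm u * norm v"
proof -
  define c where "c = sgn (cinner u v)"
  have "cinner (scaleC c u) v = of_real (cmod (cinner u v))"
    unfolding cinner_scaleC_left c_def sgn_div_norm
    by (cases "cinner u v = 0")
       (simp_all add: scaleR_conv_of_real complex_norm_square[symmetric] mult.commute[of "cnj _"] divide_simps power2_eq_square
          flip: of_real_mult)
  then have "cmod (cinner u v) = inner (scaleC c u) v"
    by (simp add: inner_L2_def)
  also have "\<dots> \<le> norm (scaleC c u) * norm v"
    by (rule norm_cauchy_schwarz)
  also have "\<dots> \<le> norm u * norm v"
    by (intro mult_right_mono) (auto simp: norm_scaleC c_def norm_sgn)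
  finally show ?thesis .
qed

lemma bounded_linear_cinner_right: "bounded_linear (cinner x)"
  by (rule bounded_linear_intro[where K = "norm x"])
     (auto simp: cinner_add_right cinner_scaleR_right scaleR_conv_of_real mult.commute[of "norm _" "norm x"] cmod_cinner_le)

lemma bounded_linear_cinner_left: "bounded_linear (\<lambda>x. cinner x y)"
  by (rule bounded_linear_intro[where K = "norm y"])
     (auto simp: cinner_add_left cinner_scaleR_left scaleR_conv_of_real cmod_cinner_le)

lemma cinner_eqI:
  assumes "\<And>w. cinner w u = cinner w v"
  shows "u = v"
proof -
  have "cinner (u - v) (u - v) = 0"
    using assms[of "u - v"] by (simp add: cinner_diff_right)
  then show ?thesis by (simp add: cinner_self_norm)
qed

lemma cinner_L2_of:
  assumes "square_integrable f" "square_integrable g"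
  shows "cinner (L2_of f) (L2_of g) = (LINT x|lborel. cnj (f x) * g x)"
  using cinner.abs_eq[of f g] assms by (simp add: L2_of_def)

lemma integrable_norm_sq: "integrable lborel (\<lambda>x. (cmod (fun_of u x))\<^sup>2)"
  using square_integrable_fun_of[of u] by (simp add: square_integrable_def)

lemma nn_integral_norm_sq: "(\<integral>\<^sup>+x. ennreal ((cmod (fun_of u x))\<^sup>2) \<partial>lborel) = ennreal ((norm u)\<^sup>2)"
  by (subst nn_integral_eq_integral) (auto simp: norm_L2_sq integrable_norm_sq)

lemma square_integrableI:
  assumes [measurable]: "f \<in> borel_measurable lborel"
    and "(\<integral>\<^sup>+x. ennreal ((cmod (f x))\<^sup>2) \<partial>lborel) < \<infinity>"
  shows "square_integrable f"
  unfolding square_integrable_def using assms by (auto intro!: integrableI_bounded)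

lemma norm_L2_of:
  assumes "square_integrable f"
  shows "ennreal ((norm (L2_of f))\<^sup>2) = (\<integral>\<^sup>+x. ennreal ((cmod (f x))\<^sup>2) \<partial>lborel)"
  unfolding nn_integral_norm_sq[symmetric]
  by (intro nn_integral_cong_AE) (use fun_of_L2_of[OF assms] in auto)

lemma square_integrable_bounded_mult:
  assumes "square_integrable f" and [measurable]: "m \<in> borel_measurable lborel"
    and "\<And>x. cmod (m x) \<le> K"
  shows "square_integrable (\<lambda>x. m x * f x)"
proof -
  have [measurable]: "f \<in> borel_measurable lborel"
    using assms(1) by (simp add: square_integrable_def)
  have "integrable lborel (\<lambda>x. K\<^sup>2 * (cmod (f x))\<^sup>2)"
    using assms(1) by (simp add: square_integrable_def)
  then have "integrable lborel (\<lambda>x. (cmod (m x * f x))\<^sup>2)"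
  proof (rule Bochner_Integration.integrable_bound)
    show "AE x in lborel. norm ((cmod (m x * f x))\<^sup>2) \<le> norm (K\<^sup>2 * (cmod (f x))\<^sup>2)"
      using assms(3) by (auto simp: norm_mult power_mult_distrib intro!: mult_right_mono power_mono)
  qed simp
  then show ?thesis by (simp add: square_integrable_def)
qed

section \<open>Completeness of the space of square-integrable functions\<close>

text \<open>Fatou's lemma, applied in m to the squares of u m - u n, bounds the distance from u n to
  the pointwise limit. The lemma also serves later to identify a norm limit with an explicit
  function.\<close>

lemma L2_limit_AE:
  fixes u :: "nat \<Rightarrow> L2"
  assumes "Cauchy u" and [measurable]: "f \<in> borel_measurable lborel"
    and lim: "AE x in lborel. (\<lambda>n. fun_of (u n) x) \<longlonglongrightarrow> f x"
  shows "square_integrable f \<and> u \<longlonglongrightarrow> L2_of f"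
proof -
  have est: "(\<integral>\<^sup>+x. ennreal ((cmod (f x - fun_of (u n) x))\<^sup>2) \<partial>lborel) \<le> ennreal (e\<^sup>2)"
    if N: "\<And>m. m \<ge> N \<Longrightarrow> norm (u m - u n) < e" for n N e
  proof -
    have "(\<integral>\<^sup>+x. ennreal ((cmod (f x - fun_of (u n) x))\<^sup>2) \<partial>lborel)
        = (\<integral>\<^sup>+x. liminf (\<lambda>m. ennreal ((cmod (fun_of (u m) x - fun_of (u n) x))\<^sup>2)) \<partial>lborel)"
    proof (rule nn_integral_cong_AE)
      show "AE x in lborel. ennreal ((cmod (f x - fun_of (u n) x))\<^sup>2)
          = liminf (\<lambda>m. ennreal ((cmod (fun_of (u m) x - fun_of (u n) x))\<^sup>2))"
        using lim
      proof eventually_elim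
        case (elim x)
        then have "(\<lambda>m. ennreal ((cmod (fun_of (u m) x - fun_of (u n) x))\<^sup>2))
            \<longlonglongrightarrow> ennreal ((cmod (f x - fun_of (u n) x))\<^sup>2)"
          by (intro tendsto_intros)
        then show ?case
          by (rule lim_imp_Liminf[symmetric, rotated]) simp
      qed
    qed
    also have "\<dots> \<le> liminf (\<lambda>m. \<integral>\<^sup>+x. ennreal ((cmod (fun_of (u m) x - fun_of (u n) x))\<^sup>2) \<partial>lborel)"
      by (rule nn_integral_liminf) measurable
    also have "\<dots> = liminf (\<lambda>m. ennreal ((norm (u m - u n))\<^sup>2))"
    proof -
      have "(\<integral>\<^sup>+x. ennreal ((cmod (fun_of (u m) x - fun_of (u n) x))\<^sup>2) \<partial>lborel) = ennreal ((norm (u m - u n))\<^sup>2)" for m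
        unfolding nn_integral_norm_sq[symmetric]
        by (intro nn_integral_cong_AE) (use fun_of_diff[of "u m" "u n"] in auto)
      then show ?thesis by simp
    qed
    also have "\<dots> \<le> ennreal (e\<^sup>2)"
    proof (rule Liminf_le)
      show "\<forall>\<^sub>F m in sequentially. ennreal ((norm (u m - u n))\<^sup>2) \<le> ennreal (e\<^sup>2)"
        unfolding eventually_sequentially
        by (intro exI[of _ N] allI impI ennreal_leI power_mono) (use N less_imp_le in auto)
    qed simp
    finally show ?thesis .
  qed
  have sq: "square_integrable f"
  proof -
    obtain N where N: "\<And>m n. m \<ge> N \<Longrightarrow> n \<ge> N \<Longrightarrow> norm (u m - u n) < 1"
      using assms(1) unfolding Cauchy_iff by (metis zero_less_one)
    have "square_integrable (\<lambda>x. f x - fun_of (u N) x)"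
      by (rule square_integrableI) (use est[of N N 1] N in \<open>auto intro: le_less_trans\<close>)
    from square_integrable_add[OF this square_integrable_fun_of[of "u N"]] show ?thesis by simp
  qed
  moreover have "u \<longlonglongrightarrow> L2_of f"
  proof (rule LIMSEQ_I)
    fix e :: real assume e: "e > 0"
    then obtain N where N: "\<And>m n. m \<ge> N \<Longrightarrow> n \<ge> N \<Longrightarrow> norm (u m - u n) < e / 2"
      using assms(1) unfolding Cauchy_iff by (metis half_gt_zero)
    have "norm (u n - L2_of f) < e" if "n \<ge> N" for n
    proof -
      have "ennreal ((norm (L2_of f - u n))\<^sup>2) = (\<integral>\<^sup>+x. ennreal ((cmod (f x - fun_of (u n) x))\<^sup>2) \<partial>lborel)"
        unfolding nn_integral_norm_sq[symmetric]
        by (intro nn_integral_cong_AE) (use fun_of_diff[of "L2_of f" "u n"] fun_of_L2_of[OF sq] in auto)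
      also have "\<dots> \<le> ennreal ((e/2)\<^sup>2)"
        by (rule est[of N]) (use N that in auto)
      finally have "(norm (L2_of f - u n))\<^sup>2 \<le> (e/2)\<^sup>2"
        by (subst (asm) ennreal_le_iff) auto
      then have "norm (L2_of f - u n) \<le> e / 2"
        by (rule power2_le_imp_le) (use e in simp)
      then show ?thesis using e by (simp add: norm_minus_commute)
    qed
    then show "\<exists>no. \<forall>n\<ge>no. norm (u n - L2_of f) < e" by blast
  qed
  ultimately show ?thesis ..
qed

text \<open>The squared partial sums of the moduli have integrals bounded by the square of the sum
  of the norms, so by monotone convergence their supremum is finite almost everywhere.\<close>

lemma L2_summable_AE:
  fixes f :: "nat \<Rightarrow> L2"
  assumes "summable (\<lambda>k. norm (f k))"
  shows "AE x in lborel. summable (\<lambda>k. cmod (fun_of (f k) x))"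
proof -
  define M where "M = (\<Sum>k. norm (f k))"
  \<comment> \<open>The classes of the moduli: with them the triangle inequality of the norm of
    \<open>L2\<close> serves as Minkowski's inequality.\<close>
  define a where "a k = L2_of (\<lambda>x. of_real (cmod (fun_of (f k) x)))" for k
  have sq: "square_integrable (\<lambda>x. of_real (cmod (fun_of (f k) x)))" for k
    using square_integrable_fun_of[of "f k"] by (simp add: square_integrable_def)
  have na: "norm (a k) = norm (f k)" for k
  proof -
    have "ennreal ((norm (a k))\<^sup>2) = ennreal ((norm (f k))\<^sup>2)"
      unfolding a_def norm_L2_of[OF sq] nn_integral_norm_sq[of "f k", symmetric] by simp
    then show ?thesis by simp
  qed
  have b: "(\<integral>\<^sup>+x. ennreal ((\<Sum>k<N. cmod (fun_of (f k) x))\<^sup>2) \<partial>lborel) \<le> ennreal (M\<^sup>2)" for N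
  proof -
    have "(\<integral>\<^sup>+x. ennreal ((\<Sum>k<N. cmod (fun_of (f k) x))\<^sup>2) \<partial>lborel)
        = (\<integral>\<^sup>+x. ennreal ((cmod (fun_of (\<Sum>k<N. a k) x))\<^sup>2) \<partial>lborel)"
    proof (rule nn_integral_cong_AE)
      have "AE x in lborel. \<forall>k\<in>{..<N}. fun_of (a k) x = of_real (cmod (fun_of (f k) x))"
        by (rule AE_finite_allI) (use fun_of_L2_of[OF sq] in \<open>auto simp: a_def\<close>)
      then show "AE x in lborel. ennreal ((\<Sum>k<N. cmod (fun_of (f k) x))\<^sup>2) = ennreal ((cmod (fun_of (\<Sum>k<N. a k) x))\<^sup>2)"
        using fun_of_sum[of a "{..<N}"]
      proof eventually_elim
        case (elim x)
        have "fun_of (\<Sum>k<N. a k) x = of_real (\<Sum>k<N. cmod (fun_of (f k) x))"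
          using elim by simp
        then show ?case by (simp only: norm_of_real power2_abs)
      qed
    qed
    also have "\<dots> = ennreal ((norm (\<Sum>k<N. a k))\<^sup>2)" by (rule nn_integral_norm_sq)
    also have "\<dots> \<le> ennreal (M\<^sup>2)"
    proof (intro ennreal_leI power_mono)
      have "norm (\<Sum>k<N. a k) \<le> (\<Sum>k<N. norm (a k))" by (rule norm_sum)
      also have "\<dots> \<le> M" unfolding na M_def by (rule sum_le_suminf[OF assms]) auto
      finally show "norm (\<Sum>k<N. a k) \<le> M" .
    qed simp
    finally show ?thesis .
  qed
  have "(\<integral>\<^sup>+x. (SUP N. ennreal ((\<Sum>k<N. cmod (fun_of (f k) x))\<^sup>2)) \<partial>lborel)
      = (SUP N. \<integral>\<^sup>+x. ennreal ((\<Sum>k<N. cmod (fun_of (f k) x))\<^sup>2) \<partial>lborel)"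
    by (rule nn_integral_monotone_convergence_SUP)
       (auto simp: incseq_def le_fun_def intro!: ennreal_leI power_mono sum_mono2 sum_nonneg)
  also have "\<dots> \<le> ennreal (M\<^sup>2)"
    using b by (rule SUP_least)
  finally have "(\<integral>\<^sup>+x. (SUP N. ennreal ((\<Sum>k<N. cmod (fun_of (f k) x))\<^sup>2)) \<partial>lborel) \<noteq> \<infinity>"
    using ennreal_less_top by (auto simp: top_unique)
  then have "AE x in lborel. (SUP N. ennreal ((\<Sum>k<N. cmod (fun_of (f k) x))\<^sup>2)) \<noteq> \<infinity>"
    by (intro nn_integral_PInf_AE) auto
  then show ?thesis
  proof eventually_elim
    case (elim x)
    define S where "S = (SUP N. ennreal ((\<Sum>k<N. cmod (fun_of (f k) x))\<^sup>2))"
    have "(\<Sum>k<N. cmod (fun_of (f k) x)) \<le> sqrt (enn2real S)" for N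
    proof (rule real_le_rsqrt)
      have "ennreal ((\<Sum>k<N. cmod (fun_of (f k) x))\<^sup>2) \<le> S"
        unfolding S_def by (rule SUP_upper) simp
      then have "enn2real (ennreal ((\<Sum>k<N. cmod (fun_of (f k) x))\<^sup>2)) \<le> enn2real S"
        using elim unfolding S_def[symmetric] by (intro enn2real_mono) (simp_all add: less_top)
      then show "(\<Sum>k<N. cmod (fun_of (f k) x))\<^sup>2 \<le> enn2real S" by simp
    qed
    then show ?case
      by (intro bounded_imp_summable[where B = "sqrt (enn2real S)"])
         (auto simp: lessThan_Suc_atMost[symmetric] simp del: sum.lessThan_Suc)
  qed
qed

text \<open>Norm limit and pointwise limit are delivered by the same v. Besides completeness, this
  is what later turns the series of dyadic shells into a pointwise series.\<close>

lemma L2_series: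
  fixes f :: "nat \<Rightarrow> L2"
  assumes "summable (\<lambda>k. norm (f k))"
  shows "\<exists>v. f sums v \<and> (AE x in lborel. (\<lambda>k. fun_of (f k) x) sums fun_of v x)"
proof -
  define g where "g x = (\<Sum>k. fun_of (f k) x)" for x
  have [measurable]: "g \<in> borel_measurable lborel" unfolding g_def by measurable
  have s: "AE x in lborel. (\<lambda>k. fun_of (f k) x) sums g x"
    using L2_summable_AE[OF assms] by eventually_elim (auto simp: g_def intro: summable_norm_cancel)
  have "AE x in lborel. \<forall>N. fun_of (\<Sum>k<N. f k) x = (\<Sum>k<N. fun_of (f k) x)"
    unfolding AE_all_countable using fun_of_sum by auto
  then have l: "AE x in lborel. (\<lambda>N. fun_of (\<Sum>k<N. f k) x) \<longlonglongrightarrow> g x"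
    using s by eventually_elim (auto simp: sums_def)
  have "Cauchy (\<lambda>N. \<Sum>k<N. f k)"
    unfolding Cauchy_iff
  proof (intro allI impI)
    fix e :: real assume "e > 0"
    then obtain N where N: "\<And>m n. m \<ge> N \<Longrightarrow> norm (\<Sum>k=m..<n. norm (f k)) < e"
      using assms unfolding summable_Cauchy by meson
    have *: "norm ((\<Sum>k<m. f k) - (\<Sum>k<n. f k)) < e" if "m \<ge> N" "n \<le> m" "n \<ge> N" for m n
    proof -
      have "(\<Sum>k<m. f k) - (\<Sum>k<n. f k) = (\<Sum>k=n..<m. f k)"
        using sum_diff_nat_ivl[of 0 n m f] that by (simp add: atLeast0LessThan)
      also have "norm \<dots> \<le> (\<Sum>k=n..<m. norm (f k))" by (rule norm_sum)
      also have "\<dots> < e" using N[of n m] that by simp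
      finally show ?thesis .
    qed
    show "\<exists>M. \<forall>m\<ge>M. \<forall>n\<ge>M. norm ((\<Sum>k<m. f k) - (\<Sum>k<n. f k)) < e"
      by (rule exI[of _ N]) (metis * norm_minus_commute nle_le)
  qed
  from L2_limit_AE[OF this _ l] have sq: "square_integrable g" and "(\<lambda>N. \<Sum>k<N. f k) \<longlonglongrightarrow> L2_of g"
    by auto
  then have "f sums L2_of g" by (simp add: sums_def)
  moreover have "AE x in lborel. (\<lambda>k. fun_of (f k) x) sums fun_of (L2_of g) x"
    using s fun_of_L2_of[OF sq] by eventually_elim simp
  ultimately show ?thesis by blast
qed

instance L2 :: banach
proof
  fix u :: "nat \<Rightarrow> L2"
  assume c: "Cauchy u"
  have "\<exists>K. \<forall>m\<ge>K. \<forall>n\<ge>K. norm (u m - u n) < (1/2) ^ j" for j :: nat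
    using c unfolding Cauchy_iff by (metis half_gt_zero_iff zero_less_one zero_less_power)
  then obtain K where K: "\<And>j m n. m \<ge> K j \<Longrightarrow> n \<ge> K j \<Longrightarrow> norm (u m - u n) < (1/2) ^ j"
    by metis
  \<comment> \<open>Adding up the \<open>K i\<close> makes r dominate each of them, and the summand
    j makes it strictly increasing, so that u along r has increments below (1/2)^j.\<close>
  define r where "r j = (\<Sum>i\<le>j. K i) + j" for j
  have r_mono: "strict_mono r"
    by (rule strict_mono_Suc_iff[THEN iffD2]) (auto simp: r_def)
  have rK: "r j \<ge> K j" for j
    using member_le_sum[of j "{..j}" K] by (simp add: r_def)
  define f where "f j = u (r (Suc j)) - u (r j)" for j
  have "norm (f j) \<le> (1/2) ^ j" for j
    unfolding f_def using K[of j "r (Suc j)" "r j"] rK[of j] strict_monoD[OF r_mono, of j "Suc j"] by simp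
  then have "summable (\<lambda>j. norm (f j))"
    by (intro summable_comparison_test[OF _ summable_geometric[of "1/2::real"]]) auto
  then obtain v where "f sums v" using L2_series by blast
  then have "(\<lambda>N. \<Sum>j<N. f j) \<longlonglongrightarrow> v" by (simp add: sums_def)
  moreover have "(\<Sum>j<N. f j) = u (r N) - u (r 0)" for N
    unfolding f_def by (rule sum_lessThan_telescope)
  ultimately have "(\<lambda>N. u (r N) - u (r 0)) \<longlonglongrightarrow> v" by simp
  then have "(\<lambda>N. u (r N) - u (r 0) + u (r 0)) \<longlonglongrightarrow> v + u (r 0)"
    by (intro tendsto_intros)
  then have "(u \<circ> r) \<longlonglongrightarrow> v + u (r 0)" by (simp add: o_def)
  then show "convergent u"
    using LIMSEQ_subseq_LIMSEQ Cauchy_converges_subseq c r_mono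
    by (metis convergentI)
qed

section \<open>Bounded complex-linear operators and multiplication operators\<close>

lemma bounded_clinearI:
  assumes "\<And>x y. A (x + y) = A x + A y" "\<And>c x. A (scaleC c x) = scaleC c (A x)"
    and "\<And>x. norm (A x) \<le> K * norm x"
  shows "bounded_clinear A"
proof -
  have "clinear A"
    unfolding Vector_Spaces.linear_def module_hom_def module_hom_axioms_def
    using assms vector_space_scaleC L2.module_axioms by auto
  moreover have "bounded_linear A"
    by (rule bounded_linear_intro[where K = K]) (use assms in \<open>auto simp: scaleR_eq_scaleC mult.commute\<close>)
  ultimately show ?thesis by (simp add: bounded_clinear_def)
qed

lemma clinear_add: "clinear A \<Longrightarrow> A (x + y) = A x + A y"
  by (simp add: Vector_Spaces.linear_def module_hom_def module_hom_axioms_def)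

lemma clinear_scaleC: "clinear A \<Longrightarrow> A (scaleC c x) = scaleC c (A x)"
  by (simp add: Vector_Spaces.linear_def module_hom_def module_hom_axioms_def)

lemma bounded_clinear_add: "bounded_clinear A \<Longrightarrow> A (x + y) = A x + A y"
  by (simp add: bounded_clinear_def clinear_add)

lemma bounded_clinear_scaleC: "bounded_clinear A \<Longrightarrow> A (scaleC c x) = scaleC c (A x)"
  by (simp add: bounded_clinear_def clinear_scaleC)

lemma bounded_clinear_bounded_linear: "bounded_clinear A \<Longrightarrow> bounded_linear A"
  by (simp add: bounded_clinear_def)

lemmas bounded_clinear_diff = linear_diff[OF bounded_linear.linear[OF bounded_clinear_bounded_linear]]
lemmas bounded_clinear_zero = linear_0[OF bounded_linear.linear[OF bounded_clinear_bounded_linear]]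
lemmas bounded_clinear_sum = linear_sum[OF bounded_linear.linear[OF bounded_clinear_bounded_linear]]
lemmas bounded_clinear_norm = onorm[OF bounded_clinear_bounded_linear]
lemmas bounded_clinear_onorm_pos = onorm_pos_le[OF bounded_clinear_bounded_linear]
lemmas bounded_clinear_tendsto = bounded_linear.tendsto[OF bounded_clinear_bounded_linear]

lemma bounded_clinear_compose:
  assumes "bounded_clinear A" "bounded_clinear B"
  shows "bounded_clinear (\<lambda>x. A (B x))"
proof (rule bounded_clinearI[where K = "onorm A * onorm B"])
  show "norm (A (B x)) \<le> onorm A * onorm B * norm x" for x
  proof -
    have "norm (A (B x)) \<le> onorm A * norm (B x)" by (rule bounded_clinear_norm[OF assms(1)])
    also have "\<dots> \<le> onorm A * (onorm B * norm x)"
      by (intro mult_left_mono bounded_clinear_norm bounded_clinear_onorm_pos assms)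
    finally show ?thesis by (simp add: mult.assoc)
  qed
qed (simp_all add: bounded_clinear_add bounded_clinear_scaleC assms)

lemma bounded_clinear_comp:
  "bounded_clinear A \<Longrightarrow> bounded_clinear B \<Longrightarrow> bounded_clinear (A \<circ> B)"
  using bounded_clinear_compose[of A B] by (simp add: o_def)

lemma bounded_clinear_id: "bounded_clinear (\<lambda>x. x)"
  by (rule bounded_clinearI[where K = 1]) auto

lemma bounded_clinear_diff_op:
  assumes "bounded_clinear A" "bounded_clinear B"
  shows "bounded_clinear (\<lambda>x. A x - B x)"
proof (rule bounded_clinearI[where K = "onorm A + onorm B"])
  show "norm (A x - B x) \<le> (onorm A + onorm B) * norm x" for x
    using norm_triangle_ineq4[of "A x" "B x"] bounded_clinear_norm[OF assms(1), of x] bounded_clinear_norm[OF assms(2), of x]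
    by (simp add: distrib_right)
qed (simp_all add: bounded_clinear_add bounded_clinear_scaleC assms L2.scale_right_diff_distrib)

lemma square_integrable_mult_fun_of:
  assumes "m \<in> borel_measurable lborel" "\<And>x. cmod (m x) \<le> K"
  shows "square_integrable (\<lambda>x. m x * fun_of u x)"
  by (rule square_integrable_bounded_mult[OF square_integrable_fun_of assms])

lemma fun_of_mult_op:
  assumes "m \<in> borel_measurable lborel" "\<And>x. cmod (m x) \<le> K"
  shows "AE x in lborel. fun_of (mult_op m u) x = m x * fun_of u x"
  unfolding mult_op_def by (rule fun_of_L2_of[OF square_integrable_mult_fun_of[OF assms]])

lemma norm_mult_op_le:
  assumes [measurable]: "m \<in> borel_measurable lborel" and "\<And>x. cmod (m x) \<le> K"
  shows "norm (mult_op m u) \<le> K * norm u"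
proof -
  have K: "K \<ge> 0" using assms(2)[of 0] norm_ge_zero order_trans by blast
  have "ennreal ((norm (mult_op m u))\<^sup>2) = (\<integral>\<^sup>+x. ennreal ((cmod (m x * fun_of u x))\<^sup>2) \<partial>lborel)"
    unfolding mult_op_def by (rule norm_L2_of[OF square_integrable_mult_fun_of[OF assms]])
  also have "\<dots> \<le> (\<integral>\<^sup>+x. ennreal (K\<^sup>2) * ennreal ((cmod (fun_of u x))\<^sup>2) \<partial>lborel)"
    using assms(2) by (intro nn_integral_mono)
      (auto simp: norm_mult power_mult_distrib ennreal_mult[symmetric] intro!: ennreal_leI mult_right_mono power_mono)
  also have "\<dots> = ennreal ((K * norm u)\<^sup>2)"
    by (subst nn_integral_cmult) (simp_all add: nn_integral_norm_sq ennreal_mult power_mult_distrib)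
  finally have "(norm (mult_op m u))\<^sup>2 \<le> (K * norm u)\<^sup>2" by simp
  then show ?thesis
    by (rule power2_le_imp_le) (use K in simp)
qed

lemma bounded_clinear_mult_op:
  assumes "m \<in> borel_measurable lborel" "\<And>x. cmod (m x) \<le> K"
  shows "bounded_clinear (mult_op m)"
proof (rule bounded_clinearI[where K = K])
  note f = fun_of_mult_op[OF assms]
  show "mult_op m (u + v) = mult_op m u + mult_op m v" for u v
    by (rule L2_eqI) (use f[of "u + v"] f[of u] f[of v] fun_of_add[of u v] fun_of_add[of "mult_op m u" "mult_op m v"]
        in \<open>auto simp: distrib_left\<close>)
  show "mult_op m (scaleC c u) = scaleC c (mult_op m u)" for c u
    by (rule L2_eqI) (use f[of "scaleC c u"] f[of u] fun_of_scaleC[of c u] fun_of_scaleC[of c "mult_op m u"]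
        in \<open>auto simp: mult.left_commute\<close>)
qed (rule norm_mult_op_le[OF assms])

lemma cinner_cong_AE:
  assumes [measurable]: "f \<in> borel_measurable lborel" "g \<in> borel_measurable lborel"
    and "AE x in lborel. fun_of u x = f x" "AE x in lborel. fun_of v x = g x"
  shows "cinner u v = (LINT x|lborel. cnj (f x) * g x)"
  unfolding cinner_fun_of
proof (rule integral_cong_AE)
  show "AE x in lborel. cnj (fun_of u x) * fun_of v x = cnj (f x) * g x"
    using assms(3,4) by eventually_elim simp
qed measurable

lemma cinner_mult_op:
  assumes [measurable]: "m \<in> borel_measurable lborel" and b: "\<And>x. cmod (m x) \<le> K"
  shows "cinner (mult_op m u) v = cinner u (mult_op (\<lambda>x. cnj (m x)) v)"
proof -
  have "cinner (mult_op m u) v = (LINT x|lborel. cnj (m x * fun_of u x) * fun_of v x)"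
    by (rule cinner_cong_AE) (use fun_of_mult_op[OF assms] in auto)
  also have "\<dots> = (LINT x|lborel. cnj (fun_of u x) * (cnj (m x) * fun_of v x))"
    by (simp add: mult_ac)
  also have "\<dots> = cinner u (mult_op (\<lambda>x. cnj (m x)) v)"
  proof (rule cinner_cong_AE[symmetric])
    show "AE x in lborel. fun_of (mult_op (\<lambda>x. cnj (m x)) v) x = cnj (m x) * fun_of v x"
      by (rule fun_of_mult_op[where K = K]) (use b in auto)
  qed auto
  finally show ?thesis .
qed

section \<open>Orthonormal expansions and adjoints\<close>

text \<open>The positive and the negative part of g, restricted to a bounded box, are densities of
  two finite measures that agree on all boxes. Boxes are stable under intersection and generate the
  Borel sets, so the measures and hence their densities coincide.\<close>

lemma AE_zero_of_box_integrals_real: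
  fixes g :: "real^3 \<Rightarrow> real"
  assumes int: "\<And>a b. set_integrable lborel (box a b) g"
    and zero: "\<And>a b. (LINT x:box a b|lborel. g x) = 0"
    and [measurable]: "g \<in> borel_measurable lborel"
  shows "AE x in lborel. g x = 0"
proof -
  \<comment> \<open>Localisation: g is integrable on bounded boxes only. Boxes are used for this as
    well, because their intersections with \<open>box a b\<close> are again boxes.\<close>
  define K :: "nat \<Rightarrow> (real^3) set" where "K n = box (- (real n *\<^sub>R One)) (real n *\<^sub>R One)" for n
  have [measurable]: "K n \<in> sets borel" for n by (simp add: K_def)
  have Kint: "set_integrable lborel (box a b \<inter> K n) g" "(LINT x:box a b \<inter> K n|lborel. g x) = 0" for a b n
    unfolding K_def box_Int_box by (rule int, rule zero)
  have "AE x in lborel. x \<in> K n \<longrightarrow> g x = 0" for n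
  proof -
    define M where "M = density lborel (\<lambda>x. ennreal (indicator (K n) x * max 0 (g x)))"
    define N where "N = density lborel (\<lambda>x. ennreal (indicator (K n) x * max 0 (- g x)))"
    have eM: "emeasure M (box a b) = ennreal (LINT x:box a b \<inter> K n|lborel. max 0 (g x))"
      and eN: "emeasure N (box a b) = ennreal (LINT x:box a b \<inter> K n|lborel. max 0 (- g x))"
      and eq: "(LINT x:box a b \<inter> K n|lborel. max 0 (g x)) = (LINT x:box a b \<inter> K n|lborel. max 0 (- g x))"
      for a b
    proof -
      have i1: "set_integrable lborel (box a b \<inter> K n) (\<lambda>x. max 0 (g x))"
        and i2: "set_integrable lborel (box a b \<inter> K n) (\<lambda>x. max 0 (- g x))"
        by (rule set_integrable_bound[OF Kint(1)[of a b n]]; auto simp: set_borel_measurable_def)+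
      show "emeasure M (box a b) = ennreal (LINT x:box a b \<inter> K n|lborel. max 0 (g x))"
        unfolding M_def set_lebesgue_integral_def using i1 unfolding set_integrable_def
        by (subst emeasure_density)
           (auto simp: nn_integral_eq_integral[symmetric] indicator_inter_arith ennreal_mult' mult_ac
              intro!: nn_integral_cong split: split_indicator)
      show "emeasure N (box a b) = ennreal (LINT x:box a b \<inter> K n|lborel. max 0 (- g x))"
        unfolding N_def set_lebesgue_integral_def using i2 unfolding set_integrable_def
        by (subst emeasure_density)
           (auto simp: nn_integral_eq_integral[symmetric] indicator_inter_arith ennreal_mult' mult_ac
              intro!: nn_integral_cong split: split_indicator)
      have "(LINT x:box a b \<inter> K n|lborel. max 0 (g x)) - (LINT x:box a b \<inter> K n|lborel. max 0 (- g x))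
          = (LINT x:box a b \<inter> K n|lborel. max 0 (g x) - max 0 (- g x))"
        using set_integral_diff(2)[OF i1 i2] by simp
      also have "(\<lambda>x. max 0 (g x) - max 0 (- g x)) = g" by (auto simp: fun_eq_iff)
      finally show "(LINT x:box a b \<inter> K n|lborel. max 0 (g x)) = (LINT x:box a b \<inter> K n|lborel. max 0 (- g x))"
        using Kint(2) by simp
    qed
    have "M = N"
    proof (rule measure_eqI_generator_eq)
      let ?E = "range (\<lambda>(a, b). box a b::(real^3) set)"
      show "Int_stable ?E"
        by (auto simp: Int_stable_def box_Int_box)
      show "?E \<subseteq> Pow UNIV" "sets M = sigma_sets UNIV ?E" "sets N = sigma_sets UNIV ?E"
        by (simp_all add: M_def N_def borel_eq_box)
      show "range K \<subseteq> ?E" "(\<Union>i. K i) = UNIV"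
        unfolding K_def UN_box_eq_UNIV by auto
      show "emeasure M (K i) \<noteq> \<infinity>" for i
        using eM[of "- (real i *\<^sub>R One)" "real i *\<^sub>R One"] by (simp add: K_def)
      show "emeasure M X = emeasure N X" if "X \<in> ?E" for X
        using that eM eN eq by auto
    qed
    then have "AE x in lborel. ennreal (indicator (K n) x * max 0 (g x)) = ennreal (indicator (K n) x * max 0 (- g x))"
      unfolding M_def N_def by (intro sigma_finite_measure.density_unique[OF sigma_finite_lborel]) auto
    then show ?thesis
      by eventually_elim (auto simp: max_def split: if_splits)
  qed
  then have "AE x in lborel. \<forall>n. x \<in> K n \<longrightarrow> g x = 0"
    unfolding AE_all_countable by blast
  moreover have "(\<Union>n. K n) = UNIV"
    unfolding K_def UN_box_eq_UNIV ..
  ultimately show ?thesis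
    by (auto elim!: eventually_mono)
qed

lemma AE_zero_of_box_integrals:
  fixes f :: "real^3 \<Rightarrow> complex"
  assumes int: "\<And>a b. set_integrable lborel (box a b) f"
    and zero: "\<And>a b. (LINT x:box a b|lborel. f x) = 0"
    and [measurable]: "f \<in> borel_measurable lborel"
  shows "AE x in lborel. f x = 0"
proof -
  have "AE x in lborel. Re (f x) = 0"
  proof (rule AE_zero_of_box_integrals_real)
    fix a b
    have "integrable lborel (\<lambda>x. Re (indicator (box a b) x *\<^sub>R f x))"
      using int[of a b] unfolding set_integrable_def by (rule integrable_Re)
    then show "set_integrable lborel (box a b) (\<lambda>x. Re (f x))"
      unfolding set_integrable_def by simp
    have "(LINT x|lborel. Re (indicator (box a b) x *\<^sub>R f x)) = Re (LINT x:box a b|lborel. f x)"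
      using int[of a b] unfolding set_lebesgue_integral_def set_integrable_def by (rule integral_Re)
    then show "(LINT x:box a b|lborel. Re (f x)) = 0"
      using zero[of a b] by (simp add: set_lebesgue_integral_def)
  qed simp
  moreover have "AE x in lborel. Im (f x) = 0"
  proof (rule AE_zero_of_box_integrals_real)
    fix a b
    have "integrable lborel (\<lambda>x. Im (indicator (box a b) x *\<^sub>R f x))"
      using int[of a b] unfolding set_integrable_def by (rule integrable_Im)
    then show "set_integrable lborel (box a b) (\<lambda>x. Im (f x))"
      unfolding set_integrable_def by simp
    have "(LINT x|lborel. Im (indicator (box a b) x *\<^sub>R f x)) = Im (LINT x:box a b|lborel. f x)"
      using int[of a b] unfolding set_lebesgue_integral_def set_integrable_def by (rule integral_Im)
    then show "(LINT x:box a b|lborel. Im (f x)) = 0"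
      using zero[of a b] by (simp add: set_lebesgue_integral_def)
  qed simp
  ultimately show ?thesis
    by eventually_elim (simp add: complex_eq_iff)
qed

definition box_fun :: "real^3 \<Rightarrow> real^3 \<Rightarrow> L2" where
  "box_fun a b = L2_of (\<lambda>x. of_real (indicator (box a b) x))"

lemma square_integrable_box: "square_integrable (\<lambda>x. of_real (indicator (box a b) x))"
proof (rule square_integrableI)
  have "(\<integral>\<^sup>+x. ennreal ((cmod (complex_of_real (indicator (box a b) x)))\<^sup>2) \<partial>lborel)
      = (\<integral>\<^sup>+x. indicator (box a b) x \<partial>lborel)"
    by (intro nn_integral_cong) (auto split: split_indicator)
  then show "(\<integral>\<^sup>+x. ennreal ((cmod (complex_of_real (indicator (box a b) x)))\<^sup>2) \<partial>lborel) < \<infinity>"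
    using emeasure_bounded_finite[of "box a b"] by (simp add: bounded_box less_top)
qed auto

lemma fun_of_box_fun: "AE x in lborel. fun_of (box_fun a b) x = of_real (indicator (box a b) x)"
  unfolding box_fun_def by (rule fun_of_L2_of[OF square_integrable_box])

lemma set_integrable_fun_of_box: "set_integrable lborel (box a b) (fun_of u)"
proof -
  have "integrable lborel (\<lambda>x. cnj (of_real (indicator (box a b) x)) * fun_of u x)"
    by (intro square_integrable_cnj_mult square_integrable_box square_integrable_fun_of)
  then show ?thesis by (simp add: set_integrable_def scaleR_conv_of_real)
qed

lemma cinner_box_fun: "cinner (box_fun a b) u = (LINT x:box a b|lborel. fun_of u x)"
proof -
  have "cinner (box_fun a b) u = (LINT x|lborel. cnj (of_real (indicator (box a b) x)) * fun_of u x)"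
    by (rule cinner_cong_AE) (use fun_of_box_fun in auto)
  then show ?thesis by (simp add: set_lebesgue_integral_def scaleR_conv_of_real)
qed

lemma box_fun_total:
  assumes "\<And>a b. cinner (box_fun a b) u = 0"
  shows "u = 0"
proof (rule L2_eqI)
  have "AE x in lborel. fun_of u x = 0"
    by (rule AE_zero_of_box_integrals)
       (use assms in \<open>auto simp: set_integrable_fun_of_box cinner_box_fun\<close>)
  then show "AE x in lborel. fun_of u x = fun_of 0 x"
    using fun_of_zero by eventually_elim simp
qed

text \<open>A box is exhausted from inside by boxes with rational corners, and dominated convergence
  carries the vanishing integrals over. The countability of this total family is the separability of
  the space.\<close>

lemma rational_box_fun_total:
  assumes r: "\<And>a b. (\<forall>i. a $ i \<in> \<rat>) \<Longrightarrow> (\<forall>i. b $ i \<in> \<rat>) \<Longrightarrow> cinner (box_fun a b) u = 0"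
  shows "u = 0"
proof (rule box_fun_total)
  fix a b :: "real^3"
  \<comment> \<open>In each coordinate the smallest multiple of 1/(n+1) strictly above a, hence at
    distance at most 1/(n+1); \<open>B\<close> is the mirror image below b.\<close>
  define A where "A n = (\<chi> i. (of_int \<lfloor>real (Suc n) * a $ i\<rfloor> + 1) / real (Suc n))" for n
  define B where "B n = (\<chi> i. (of_int \<lceil>real (Suc n) * b $ i\<rceil> - 1) / real (Suc n))" for n
  have A: "A n $ i > a $ i" "A n $ i \<le> a $ i + 1 / real (Suc n)" for n i
    unfolding A_def vec_lambda_beta
    using real_of_int_floor_add_one_gt[of "real (Suc n) * a $ i"] of_int_floor_le[of "real (Suc n) * a $ i"]
    by (simp_all add: field_simps del: of_nat_Suc)
  have B: "B n $ i < b $ i" "B n $ i \<ge> b $ i - 1 / real (Suc n)" for n i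
    unfolding B_def vec_lambda_beta
    using of_int_ceiling_diff_one_le[of "real (Suc n) * b $ i"] le_of_int_ceiling[of "real (Suc n) * b $ i"]
      ceiling_correct[of "real (Suc n) * b $ i"]
    by (simp_all add: field_simps del: of_nat_Suc)
  have Q: "A n $ i \<in> \<rat>" "B n $ i \<in> \<rat>" for n i
    by (auto simp: A_def B_def simp del: of_nat_Suc)
  have lim: "(\<lambda>n. LINT x|lborel. indicator (box (A n) (B n)) x *\<^sub>R fun_of u x)
      \<longlonglongrightarrow> (LINT x|lborel. indicator (box a b) x *\<^sub>R fun_of u x)"
  proof (rule integral_dominated_convergence[where w = "\<lambda>x. norm (indicator (box a b) x *\<^sub>R fun_of u x)"])
    show "integrable lborel (\<lambda>x. norm (indicator (box a b) x *\<^sub>R fun_of u x))"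
      using set_integrable_fun_of_box[of a b u] unfolding set_integrable_def by (rule integrable_norm)
    have sub: "box (A n) (B n) \<subseteq> box a b" for n
      using A(1) B(1) by (force simp: mem_box_cart subset_eq intro: less_trans)
    show "AE x in lborel. norm (indicator (box (A n) (B n)) x *\<^sub>R fun_of u x) \<le> norm (indicator (box a b) x *\<^sub>R fun_of u x)" for n
      using sub[of n] by (auto split: split_indicator)
    show "AE x in lborel. (\<lambda>n. indicator (box (A n) (B n)) x *\<^sub>R fun_of u x) \<longlonglongrightarrow> indicator (box a b) x *\<^sub>R fun_of u x"
    proof (rule AE_I2)
      fix x :: "real^3"
      show "(\<lambda>n. indicator (box (A n) (B n)) x *\<^sub>R fun_of u x) \<longlonglongrightarrow> indicator (box a b) x *\<^sub>R fun_of u x"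
      proof (cases "x \<in> box a b")
        case False
        then have "x \<notin> box (A n) (B n)" for n using sub by blast
        then show ?thesis using False by simp
      next
        case True
        have "\<forall>\<^sub>F n in sequentially. \<forall>i\<in>UNIV. A n $ i < x $ i \<and> x $ i < B n $ i"
        proof (rule eventually_ball_finite)
          show "\<forall>i\<in>UNIV. \<forall>\<^sub>F n in sequentially. A n $ i < x $ i \<and> x $ i < B n $ i"
          proof
            fix i :: 3
            have "(\<lambda>n. 1 / real (Suc n)) \<longlonglongrightarrow> 0"
              using LIMSEQ_inverse_real_of_nat by (simp add: inverse_eq_divide)
            moreover have "min (x $ i - a $ i) (b $ i - x $ i) > 0"
              using True by (simp add: mem_box_cart)
            ultimately have "\<forall>\<^sub>F n in sequentially. 1 / real (Suc n) < min (x $ i - a $ i) (b $ i - x $ i)"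
              by (rule order_tendstoD)
            then show "\<forall>\<^sub>F n in sequentially. A n $ i < x $ i \<and> x $ i < B n $ i"
            proof eventually_elim
              case (elim n)
              then show ?case using A(2)[of n i] B(2)[of i n] by simp
            qed
          qed
        qed simp
        then have "\<forall>\<^sub>F n in sequentially. indicator (box (A n) (B n)) x *\<^sub>R fun_of u x = indicator (box a b) x *\<^sub>R fun_of u x"
          by eventually_elim (use True in \<open>simp add: mem_box_cart\<close>)
        then show ?thesis by (rule tendsto_eventually)
      qed
    qed
  qed auto
  have "(LINT x|lborel. indicator (box (A n) (B n)) x *\<^sub>R fun_of u x) = 0" for n
    using r[of "A n" "B n"] Q by (simp add: cinner_box_fun set_lebesgue_integral_def)
  with lim show "cinner (box_fun a b) u = 0"
    by (simp add: cinner_box_fun set_lebesgue_integral_def LIMSEQ_const_iff)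
qed

text \<open>v is the projection of u to the span of F, and the squared norm of u - v is the
  difference of the two sides.\<close>

lemma bessel_finite:
  assumes "finite F" and orth: "\<And>e f. e \<in> F \<Longrightarrow> f \<in> F \<Longrightarrow> cinner e f = (if e = f then 1 else 0)"
  shows "(\<Sum>e\<in>F. (cmod (cinner e u))\<^sup>2) \<le> (norm u)\<^sup>2"
proof -
  define v where "v = (\<Sum>e\<in>F. scaleC (cinner e u) e)"
  have vu: "cinner v u = of_real (\<Sum>e\<in>F. (cmod (cinner e u))\<^sup>2)"
    unfolding v_def cinner_sum_left cinner_scaleC_left of_real_sum
    by (intro sum.cong refl) (simp only: complex_norm_square mult.commute)
  have ev: "cinner e v = cinner e u" if "e \<in> F" for e
    unfolding v_def cinner_sum_right cinner_scaleC_right using that assms(1)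
    by (subst sum.cong[OF refl, where h = "\<lambda>f. if f = e then cinner e u else 0"]) (auto simp: orth)
  have vv: "cinner v v = of_real (\<Sum>e\<in>F. (cmod (cinner e u))\<^sup>2)"
    by (subst (1) v_def) (simp add: cinner_sum_left cinner_scaleC_left ev of_real_sum complex_norm_square mult.commute del: of_real_power)
  have "cinner (u - v) (u - v) = cinner u u - cinner v u - cinner u v + cinner v v"
    by (simp add: cinner_diff_left cinner_diff_right)
  also have "cinner u v = cnj (cinner v u)" by (rule cinner_commute)
  finally have "Re (cinner (u - v) (u - v)) = (norm u)\<^sup>2 - (\<Sum>e\<in>F. (cmod (cinner e u))\<^sup>2)"
    unfolding vu vv by (simp add: Re_cinner_self)
  moreover have "Re (cinner (u - v) (u - v)) \<ge> 0" by (simp add: Re_cinner_self)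
  ultimately show ?thesis by simp
qed

text \<open>\<open>some_onb\<close> is a choice, so existence has to be shown: Zorn's lemma gives a
  maximal orthonormal set, and a nonzero vector orthogonal to it could be normalised and
  added.\<close>

lemma is_onb_some_onb: "is_onb some_onb"
proof -
  define O1 where "O1 = {B. \<forall>e\<in>B. \<forall>f\<in>B. cinner e f = (if e = f then 1 else (0::complex))}"
  have "\<exists>M\<in>O1. \<forall>X\<in>O1. M \<subseteq> X \<longrightarrow> X = M"
  proof (rule subset_Zorn_nonempty)
    show "O1 \<noteq> {}" by (auto simp: O1_def)
    fix C assume "C \<noteq> {}" and C: "subset.chain O1 C"
    show "\<Union>C \<in> O1"
      unfolding O1_def mem_Collect_eq
    proof (intro ballI)
      fix e f assume "e \<in> \<Union>C" "f \<in> \<Union>C"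
      then obtain X Y where "e \<in> X" "f \<in> Y" "X \<in> C" "Y \<in> C" by auto
      moreover from this C have "X \<subseteq> Y \<or> Y \<subseteq> X" "X \<in> O1" "Y \<in> O1"
        by (auto simp: subset.chain_def subset_iff_psubset_eq)
      ultimately show "cinner e f = (if e = f then 1 else 0)" unfolding O1_def by blast
    qed
  qed
  then obtain M where M: "M \<in> O1" and max: "\<And>X. X \<in> O1 \<Longrightarrow> M \<subseteq> X \<Longrightarrow> X = M" by blast
  have "is_onb M"
    unfolding is_onb_def
  proof (intro conjI allI impI)
    show "\<forall>e\<in>M. \<forall>f\<in>M. cinner e f = (if e = f then 1 else 0)" using M by (simp add: O1_def)
    fix u assume u: "\<forall>e\<in>M. cinner e u = 0"
    show "u = 0"
    proof (rule ccontr)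
      assume "u \<noteq> 0"
      define v where "v = scaleC (of_real (1 / norm u)) u"
      have v1: "cinner v v = 1"
        using \<open>u \<noteq> 0\<close> by (simp add: cinner_self_norm v_def norm_scaleC norm_divide)
      have ev: "cinner e v = 0" "cinner v e = 0" if "e \<in> M" for e
        using u that cinner_commute[of v e] by (auto simp: v_def cinner_scaleC_right)
      have "insert v M \<in> O1"
        using M v1 ev unfolding O1_def by auto
      then have "v \<in> M" using max by blast
      then show False using ev v1 by auto
    qed
  qed
  then show ?thesis unfolding some_onb_def by (rule someI)
qed

text \<open>By Bessel's inequality each vector is non-orthogonal to only countably many basis
  elements, and every basis element is non-orthogonal to one of the countably many rational
  boxes.\<close>

lemma countable_some_onb: "countable some_onb"
proof -
  define Q where "Q = {a::real^3. \<forall>i. a $ i \<in> \<rat>}"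
  have "countable Q" unfolding Q_def by (intro countable_vector countable_rat)
  have orth: "cinner e f = (if e = f then 1 else 0)" if "e \<in> some_onb" "f \<in> some_onb" for e f
    using is_onb_some_onb that by (simp add: is_onb_def)
  have c: "countable {e \<in> some_onb. cinner e u \<noteq> 0}" for u
  proof -
    have "(\<lambda>e. (cmod (cinner e u))\<^sup>2) summable_on some_onb"
    proof (rule nonneg_bounded_partial_sums_imp_summable_on)
      show "\<forall>\<^sub>F X in finite_subsets_at_top some_onb. (\<Sum>e\<in>X. (cmod (cinner e u))\<^sup>2) \<le> (norm u)\<^sup>2"
        by (rule eventually_finite_subsets_at_top_weakI) (intro bessel_finite orth, auto)
    qed simp
    from summable_countable_real[OF this] show ?thesis by simp
  qed
  have "some_onb \<subseteq> (\<Union>a\<in>Q. \<Union>b\<in>Q. {e \<in> some_onb. cinner e (box_fun a b) \<noteq> 0})"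
  proof
    fix e assume e: "e \<in> some_onb"
    then have "e \<noteq> 0" using orth[of e e] by auto
    then obtain a b where "a \<in> Q" "b \<in> Q" "cinner (box_fun a b) e \<noteq> 0"
      using rational_box_fun_total[of e] unfolding Q_def by blast
    then show "e \<in> (\<Union>a\<in>Q. \<Union>b\<in>Q. {e \<in> some_onb. cinner e (box_fun a b) \<noteq> 0})"
      using e cinner_commute[of "box_fun a b" e] by auto
  qed
  then show ?thesis
    by (rule countable_subset) (intro countable_UN \<open>countable Q\<close> c)
qed

text \<open>An enumeration of the basis, padded with zeros so that it is total on the natural numbers.\<close>

definition onb_seq :: "nat \<Rightarrow> L2" where
  "onb_seq n = (if n \<in> to_nat_on some_onb ` some_onb then from_nat_into some_onb n else 0)"

lemma onb_seq_to_nat_on: "e \<in> some_onb \<Longrightarrow> onb_seq (to_nat_on some_onb e) = e"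
  by (auto simp: onb_seq_def countable_some_onb)

lemma onb_seq_cases:
  obtains "onb_seq n = 0" | e where "e \<in> some_onb" "n = to_nat_on some_onb e" "onb_seq n = e"
  by (cases "n \<in> to_nat_on some_onb ` some_onb") (auto simp: onb_seq_def countable_some_onb)

lemma cinner_onb_seq: "cinner (onb_seq m) (onb_seq n) = (if m = n \<and> onb_seq n \<noteq> 0 then 1 else 0)"
proof -
  have "cinner e f = (if e = f then 1 else 0)" if "e \<in> some_onb" "f \<in> some_onb" for e f
    using is_onb_some_onb that by (simp add: is_onb_def)
  moreover from this have "0 \<notin> some_onb" by force
  moreover have "to_nat_on some_onb e = to_nat_on some_onb f \<longleftrightarrow> e = f" if "e \<in> some_onb" "f \<in> some_onb" for e f
    using inj_on_to_nat_on[OF countable_some_onb] that by (auto simp: inj_on_def)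
  ultimately show ?thesis
    by (cases m rule: onb_seq_cases; cases n rule: onb_seq_cases) (auto simp: onb_seq_to_nat_on)
qed

lemma onb_seq_total:
  assumes "\<And>n. cinner (onb_seq n) u = 0"
  shows "u = 0"
proof -
  have "cinner e u = 0" if "e \<in> some_onb" for e
    using assms[of "to_nat_on some_onb e"] onb_seq_to_nat_on[OF that] by simp
  then show ?thesis using is_onb_some_onb by (auto simp: is_onb_def)
qed

lemma orthogonal_sum_norm: "(norm (\<Sum>n\<in>F. scaleC (c n) (onb_seq n)))\<^sup>2 = (\<Sum>n\<in>F. (cmod (c n))\<^sup>2 * (norm (onb_seq n))\<^sup>2)"
proof (cases "finite F")
  case True
  have "cinner (\<Sum>n\<in>F. scaleC (c n) (onb_seq n)) (\<Sum>n\<in>F. scaleC (c n) (onb_seq n))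
      = (\<Sum>m\<in>F. \<Sum>n\<in>F. cnj (c m) * (c n * cinner (onb_seq m) (onb_seq n)))"
    unfolding cinner_sum_left cinner_scaleC_left unfolding cinner_sum_right cinner_scaleC_right sum_distrib_left ..
  also have "\<dots> = (\<Sum>m\<in>F. \<Sum>n\<in>F. if n = m then cnj (c m) * (c m * cinner (onb_seq m) (onb_seq m)) else 0)"
    by (intro sum.cong refl) (auto simp: cinner_onb_seq)
  also have "\<dots> = (\<Sum>m\<in>F. of_real ((cmod (c m))\<^sup>2 * (norm (onb_seq m))\<^sup>2))"
  proof (intro sum.cong refl)
    fix m assume "m \<in> F"
    have "cnj (c m) * (c m * cinner (onb_seq m) (onb_seq m)) = (c m * cnj (c m)) * cinner (onb_seq m) (onb_seq m)"
      by (simp only: mult_ac)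
    then show "(\<Sum>n\<in>F. if n = m then cnj (c m) * (c m * cinner (onb_seq m) (onb_seq m)) else 0)
        = of_real ((cmod (c m))\<^sup>2 * (norm (onb_seq m))\<^sup>2)"
      using True \<open>m \<in> F\<close> by (simp only: sum.delta if_True complex_norm_square[symmetric] cinner_self_norm of_real_mult)
  qed
  finally have "complex_of_real ((norm (\<Sum>n\<in>F. scaleC (c n) (onb_seq n)))\<^sup>2) = of_real (\<Sum>n\<in>F. (cmod (c n))\<^sup>2 * (norm (onb_seq n))\<^sup>2)"
    unfolding cinner_self_norm by simp
  then show ?thesis by (simp only: of_real_eq_iff)
qed simp

lemma norm_onb_seq: "norm (onb_seq n) = (if onb_seq n = 0 then 0 else 1)"
proof -
  have "complex_of_real ((norm (onb_seq n))\<^sup>2) = (if onb_seq n = 0 then 0 else 1)"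
    unfolding cinner_self_norm[symmetric] cinner_onb_seq by simp
  then have "(norm (onb_seq n))\<^sup>2 = (if onb_seq n = 0 then 0 else 1)"
    by (metis of_real_0 of_real_1 of_real_eq_iff)
  then have "norm (onb_seq n) = sqrt (if onb_seq n = 0 then 0 else 1)"
    by (metis norm_ge_zero real_sqrt_abs abs_of_nonneg)
  then show ?thesis by simp
qed

lemma orthogonal_series_summable:
  assumes "summable (\<lambda>n. (cmod (c n))\<^sup>2)"
  shows "summable (\<lambda>n. scaleC (c n) (onb_seq n))"
  unfolding summable_Cauchy
proof (intro allI impI)
  fix e :: real assume e: "e > 0"
  then obtain N where N: "\<And>m n. m \<ge> N \<Longrightarrow> norm (\<Sum>k=m..<n. (cmod (c k))\<^sup>2) < e\<^sup>2"
    using assms unfolding summable_Cauchy by (meson zero_less_power)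
  have "norm (\<Sum>k=m..<n. scaleC (c k) (onb_seq k)) < e" if "m \<ge> N" for m n
  proof -
    have "(norm (\<Sum>k=m..<n. scaleC (c k) (onb_seq k)))\<^sup>2 \<le> (\<Sum>k=m..<n. (cmod (c k))\<^sup>2)"
      unfolding orthogonal_sum_norm by (intro sum_mono) (auto simp: norm_onb_seq)
    also have "\<dots> < e\<^sup>2" using N[OF that, of n] by simp
    finally show ?thesis using e by (simp add: power2_less_imp_less)
  qed
  then show "\<exists>N. \<forall>m\<ge>N. \<forall>n. norm (\<Sum>k=m..<n. scaleC (c k) (onb_seq k)) < e" by blast
qed

lemma bessel_onb_seq: "(\<Sum>n\<in>F. (cmod (cinner (onb_seq n) u))\<^sup>2) \<le> (norm u)\<^sup>2"
proof (cases "finite F")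
  case True
  \<comment> \<open>Without the padding zeros the enumeration is injective, so that the sum becomes
    one over distinct basis vectors.\<close>
  define G where "G = {n \<in> F. onb_seq n \<noteq> 0}"
  have inj: "inj_on onb_seq G"
  proof (rule inj_onI)
    fix m n assume "m \<in> G" "n \<in> G" "onb_seq m = onb_seq n"
    then show "m = n" using cinner_onb_seq[of m n] cinner_onb_seq[of n n] by (auto simp: G_def split: if_splits)
  qed
  have "(\<Sum>n\<in>F. (cmod (cinner (onb_seq n) u))\<^sup>2) = (\<Sum>n\<in>G. (cmod (cinner (onb_seq n) u))\<^sup>2)"
    by (rule sum.mono_neutral_right) (use True in \<open>auto simp: G_def\<close>)
  also have "\<dots> = (\<Sum>e\<in>onb_seq ` G. (cmod (cinner e u))\<^sup>2)"
    by (simp add: sum.reindex[OF inj])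
  also have "\<dots> \<le> (norm u)\<^sup>2"
  proof (rule bessel_finite)
    show "finite (onb_seq ` G)" using True by (simp add: G_def)
    show "cinner e f = (if e = f then 1 else 0)" if "e \<in> onb_seq ` G" "f \<in> onb_seq ` G" for e f
      using that inj by (auto simp: cinner_onb_seq G_def inj_on_def)
  qed
  finally show ?thesis .
qed simp

lemma expansion_onb_seq: "(\<lambda>n. scaleC (cinner (onb_seq n) u) (onb_seq n)) sums u"
proof -
  have "summable (\<lambda>n. (cmod (cinner (onb_seq n) u))\<^sup>2)"
    by (rule bounded_imp_summable[where B = "(norm u)\<^sup>2"]) (use bessel_onb_seq in auto)
  from orthogonal_series_summable[OF this]
  obtain v where v: "(\<lambda>n. scaleC (cinner (onb_seq n) u) (onb_seq n)) sums v" by (auto simp: summable_def)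
  have "cinner (onb_seq m) (u - v) = 0" for m
  proof -
    have "(\<lambda>n. cinner (onb_seq m) (scaleC (cinner (onb_seq n) u) (onb_seq n))) sums cinner (onb_seq m) v"
      by (rule bounded_linear.sums[OF bounded_linear_cinner_right v])
    moreover have "(\<lambda>n. cinner (onb_seq m) (scaleC (cinner (onb_seq n) u) (onb_seq n))) = (\<lambda>n. if n = m then cinner (onb_seq m) u else 0)"
      by (auto simp: fun_eq_iff cinner_scaleC_right cinner_onb_seq)
    moreover have "(\<lambda>n. if n = m then cinner (onb_seq m) u else 0) sums cinner (onb_seq m) u"
      using sums_single[of m "\<lambda>_. cinner (onb_seq m) u"] by simp
    ultimately have "cinner (onb_seq m) v = cinner (onb_seq m) u" using sums_unique2 by metis
    then show ?thesis by (simp add: cinner_diff_right)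
  qed
  then have "u - v = 0" by (rule onb_seq_total)
  then show ?thesis using v by simp
qed

lemma parseval: "(\<lambda>n. cinner u (onb_seq n) * cinner (onb_seq n) v) sums cinner u v"
proof -
  have "(\<lambda>n. cinner u (scaleC (cinner (onb_seq n) v) (onb_seq n))) sums cinner u v"
    by (rule bounded_linear.sums[OF bounded_linear_cinner_right expansion_onb_seq])
  then show ?thesis by (simp add: cinner_scaleC_right mult.commute)
qed

lemma parseval_norm: "(\<lambda>n. (cmod (cinner (onb_seq n) u))\<^sup>2) sums (norm u)\<^sup>2"
proof -
  have "(\<lambda>n. Re (cinner u (onb_seq n) * cinner (onb_seq n) u)) sums Re (cinner u u)"
    by (intro sums_Re parseval)
  moreover have "Re (cinner u (onb_seq n) * cinner (onb_seq n) u) = (cmod (cinner (onb_seq n) u))\<^sup>2" for n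
    using cinner_commute[of u "onb_seq n"] complex_norm_square[of "cinner (onb_seq n) u"]
    by (metis Re_complex_of_real mult.commute)
  ultimately show ?thesis by (simp add: Re_cinner_self)
qed

lemma parseval_ennreal: "(\<Sum>n. ennreal ((cmod (cinner (onb_seq n) u))\<^sup>2)) = ennreal ((norm u)\<^sup>2)"
  using parseval_norm[of u] by (intro suminf_ennreal_eq) auto

text \<open>The candidate is the series of \<open>cnj (\<phi> (onb_seq n))\<close> times
  \<open>onb_seq n\<close>. Testing \<phi> on its partial sums x bounds the square of norm x by K
  times norm x, which makes the coefficients square-summable; continuity then gives \<phi> on all
  expansions.\<close>

lemma riesz_representation:
  assumes add: "\<And>x y. \<phi> (x + y) = \<phi> x + \<phi> y" and sc: "\<And>c x. \<phi> (scaleC c x) = c * \<phi> x"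
    and bd: "\<And>x. cmod (\<phi> x) \<le> K * norm x"
  shows "\<exists>w. \<forall>u. \<phi> u = cinner w u"
proof -
  have bl: "bounded_linear \<phi>"
    by (rule bounded_linear_intro[where K = K])
       (use assms in \<open>auto simp: scaleR_eq_scaleC scaleR_conv_of_real mult.commute\<close>)
  have z: "\<phi> 0 = 0"
    using sc[of 0 0] by simp
  have "(\<Sum>n<N. (cmod (\<phi> (onb_seq n)))\<^sup>2) \<le> K\<^sup>2" for N
  proof -
    define x where "x = (\<Sum>n<N. scaleC (cnj (\<phi> (onb_seq n))) (onb_seq n))"
    have nx: "(norm x)\<^sup>2 = (\<Sum>n<N. (cmod (\<phi> (onb_seq n)))\<^sup>2)"
      unfolding x_def orthogonal_sum_norm by (intro sum.cong refl) (auto simp: norm_onb_seq z)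
    have "\<phi> x = (\<Sum>n<N. cnj (\<phi> (onb_seq n)) * \<phi> (onb_seq n))"
      unfolding x_def linear_sum[OF bounded_linear.linear[OF bl]] sc ..
    also have "\<dots> = of_real ((norm x)\<^sup>2)"
      unfolding nx of_real_sum by (intro sum.cong refl) (simp only: complex_norm_square mult.commute)
    finally have "cmod (\<phi> x) = (norm x)\<^sup>2" by (simp only: norm_of_real) simp
    then have *: "(norm x)\<^sup>2 \<le> K * norm x" using bd[of x] by simp
    have "norm x \<le> \<bar>K\<bar>"
    proof (cases "norm x = 0")
      case False
      then have "norm x \<le> K" using * by (simp add: power2_eq_square)
      then show ?thesis by linarith
    qed simp
    then show ?thesis unfolding nx[symmetric] using abs_le_square_iff[of "norm x" K] by simp
  qed
  then have s: "summable (\<lambda>n. (cmod (cnj (\<phi> (onb_seq n))))\<^sup>2)"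
    by (intro bounded_imp_summable[where B = "K\<^sup>2"]) (auto simp: lessThan_Suc_atMost[symmetric] simp del: sum.lessThan_Suc)
  from orthogonal_series_summable[OF s]
  obtain w where w: "(\<lambda>n. scaleC (cnj (\<phi> (onb_seq n))) (onb_seq n)) sums w" by (auto simp: summable_def)
  have "\<phi> u = cinner w u" for u
  proof -
    have "(\<lambda>n. \<phi> (scaleC (cinner (onb_seq n) u) (onb_seq n))) sums \<phi> u"
      by (rule bounded_linear.sums[OF bl expansion_onb_seq])
    moreover have "(\<lambda>n. cinner (scaleC (cnj (\<phi> (onb_seq n))) (onb_seq n)) u) sums cinner w u"
      by (rule bounded_linear.sums[OF bounded_linear_cinner_left w])
    ultimately show ?thesis
      by (simp add: sc cinner_scaleC_left mult.commute sums_unique2)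
  qed
  then show ?thesis by blast
qed

text \<open>Taking real parts gives the defining property of \<open>adjoint\<close> for the real
  inner product, whose solution is unique.\<close>

lemma adjoint_eqI:
  assumes "\<And>u v. cinner (A u) v = cinner u (B v)"
  shows "adjoint A = B"
  by (rule adjoint_unique) (simp add: inner_L2_def assms)

text \<open>\<open>adjoint\<close> is a choice that is meaningful only if some adjoint exists. Riesz
  representation supplies a complex one, and uniqueness identifies it with the chosen one.\<close>

lemma cinner_adjoint:
  assumes A: "bounded_clinear A"
  shows "cinner u (adjoint A v) = cinner (A u) v"
proof -
  have "\<exists>w. \<forall>u. cinner v (A u) = cinner w u" for v
  proof (rule riesz_representation[where K = "norm v * onorm A"])
    show "cmod (cinner v (A x)) \<le> norm v * onorm A * norm x" for x
    proof -
      have "cmod (cinner v (A x)) \<le> norm v * norm (A x)" by (rule cmod_cinner_le)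
      also have "\<dots> \<le> norm v * (onorm A * norm x)"
        by (intro mult_left_mono bounded_clinear_norm[OF A]) simp
      finally show ?thesis by (simp add: mult.assoc)
    qed
  qed (simp_all add: bounded_clinear_add[OF A] bounded_clinear_scaleC[OF A] cinner_add_right cinner_scaleC_right)
  then obtain B where B: "\<And>v u. cinner v (A u) = cinner (B v) u" by metis
  have B': "cinner (A u) v = cinner u (B v)" for u v
    using B[of v u] cinner_commute[of "A u" v] cinner_commute[of u "B v"] by simp
  have "adjoint A = B" by (rule adjoint_eqI) (rule B')
  then show ?thesis using B' by simp
qed

lemma cinner_adjoint_left:
  assumes "bounded_clinear A"
  shows "cinner (adjoint A u) v = cinner u (A v)"
  using cinner_adjoint[OF assms, of v u] cinner_commute[of "adjoint A u" v] cinner_commute[of u "A v"] by simp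

lemma norm_adjoint_le:
  assumes A: "bounded_clinear A" and K: "\<And>u. norm (A u) \<le> K * norm u" "0 \<le> K"
  shows "norm (adjoint A v) \<le> K * norm v"
proof -
  have "(norm (adjoint A v))\<^sup>2 = cmod (cinner (adjoint A v) (adjoint A v))"
    by (simp add: cinner_self_norm norm_power)
  also have "\<dots> = cmod (cinner (A (adjoint A v)) v)" by (simp add: cinner_adjoint[OF A])
  also have "\<dots> \<le> norm (A (adjoint A v)) * norm v" by (rule cmod_cinner_le)
  also have "\<dots> \<le> K * norm (adjoint A v) * norm v" by (intro mult_right_mono K) simp
  finally have *: "norm (adjoint A v) * norm (adjoint A v) \<le> norm (adjoint A v) * (K * norm v)"
    by (simp add: power2_eq_square mult_ac)
  show ?thesis
  proof (cases "norm (adjoint A v) = 0")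
    case False
    then have "norm (adjoint A v) > 0" by simp
    with * show ?thesis by (simp only: mult_le_cancel_left_pos)
  qed (use K in simp)
qed

lemma bounded_clinear_adjoint:
  assumes A: "bounded_clinear A"
  shows "bounded_clinear (adjoint A)"
proof (rule bounded_clinearI[where K = "onorm A"])
  show "adjoint A (x + y) = adjoint A x + adjoint A y" for x y
    by (rule cinner_eqI) (simp add: cinner_adjoint[OF A] cinner_add_right)
  show "adjoint A (scaleC c x) = scaleC c (adjoint A x)" for c x
    by (rule cinner_eqI) (simp add: cinner_adjoint[OF A] cinner_scaleC_right)
  show "norm (adjoint A x) \<le> onorm A * norm x" for x
    by (rule norm_adjoint_le[OF A bounded_clinear_norm[OF A] bounded_clinear_onorm_pos[OF A]])
qed

lemma adjoint_adjoint_L2: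
  assumes A: "bounded_clinear A"
  shows "adjoint (adjoint A) = A"
  by (rule adjoint_eqI) (simp add: cinner_adjoint_left[OF A])

lemma adjoint_compose:
  assumes "bounded_clinear A" "bounded_clinear B"
  shows "adjoint (\<lambda>u. A (B u)) = (\<lambda>u. adjoint B (adjoint A u))"
  by (rule adjoint_eqI) (simp add: cinner_adjoint assms)

lemma adjoint_mult_op:
  assumes "m \<in> borel_measurable lborel" "\<And>x. cmod (m x) \<le> K"
  shows "adjoint (mult_op m) = mult_op (\<lambda>x. cnj (m x))"
  by (rule adjoint_eqI) (rule cinner_mult_op[OF assms])

section \<open>Traces as series over the enumerated basis\<close>

lemma infsum_some_onb_has_sum:
  fixes f :: "L2 \<Rightarrow> 'b::{comm_monoid_add,t2_space}"
  assumes "f 0 = 0"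
  shows "(f has_sum s) some_onb \<longleftrightarrow> ((\<lambda>n. f (onb_seq n)) has_sum s) UNIV"
proof -
  have inj: "inj_on (to_nat_on some_onb) some_onb" by (rule inj_on_to_nat_on[OF countable_some_onb])
  have "(f has_sum s) some_onb \<longleftrightarrow> (((\<lambda>n. f (onb_seq n)) \<circ> to_nat_on some_onb) has_sum s) some_onb"
    by (rule has_sum_cong) (simp add: onb_seq_to_nat_on)
  also have "\<dots> \<longleftrightarrow> ((\<lambda>n. f (onb_seq n)) has_sum s) (to_nat_on some_onb ` some_onb)"
    by (rule has_sum_reindex[OF inj, symmetric])
  also have "\<dots> \<longleftrightarrow> ((\<lambda>n. f (onb_seq n)) has_sum s) UNIV"
    by (rule has_sum_cong_neutral) (auto simp: onb_seq_def assms)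
  finally show ?thesis .
qed

lemma pos_trace_onb_seq:
  assumes "P 0 = 0"
  shows "pos_trace P = (\<Sum>n. ennreal (Re (cinner (onb_seq n) (P (onb_seq n)))))"
proof -
  have "((\<lambda>e. ennreal (Re (cinner e (P e)))) has_sum pos_trace P) some_onb"
    unfolding pos_trace_def by (intro has_sum_infsum nonneg_summable_on_complete) simp
  then have "((\<lambda>n. ennreal (Re (cinner (onb_seq n) (P (onb_seq n))))) has_sum pos_trace P) UNIV"
    by (subst (asm) infsum_some_onb_has_sum) (simp_all add: assms)
  then show ?thesis by (intro sums_unique has_sum_imp_sums)
qed

text \<open>\<open>op_trace\<close> is an unordered sum over the basis; absolute convergence makes
  it agree with the series along the enumeration.\<close>

lemma op_trace_onb_seq:
  assumes "P 0 = 0" and "summable (\<lambda>n. cmod (cinner (onb_seq n) (P (onb_seq n))))"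
  shows "(\<lambda>n. cinner (onb_seq n) (P (onb_seq n))) sums op_trace P"
proof -
  have "(\<lambda>n. cinner (onb_seq n) (P (onb_seq n))) summable_on UNIV"
    by (rule norm_summable_imp_summable_on) (use assms in simp)
  then obtain s where s: "((\<lambda>n. cinner (onb_seq n) (P (onb_seq n))) has_sum s) UNIV"
    by (auto simp: summable_on_def)
  then have "((\<lambda>e. cinner e (P e)) has_sum s) some_onb"
    by (subst infsum_some_onb_has_sum) (simp_all add: assms)
  then have "op_trace P = s" unfolding op_trace_def by (rule infsumI)
  with s show ?thesis by (simp add: has_sum_imp_sums)
qed

section \<open>Functional calculus of positive operators\<close>

definition pos_op :: "(L2 \<Rightarrow> L2) \<Rightarrow> bool" where
  "pos_op P \<longleftrightarrow> bounded_clinear P \<and> (\<forall>u v. cinner (P u) v = cinner u (P v)) \<and> (\<forall>u. 0 \<le> Re (cinner u (P u)))"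

lemma pos_opD:
  assumes "pos_op P"
  shows "bounded_clinear P" "cinner (P u) v = cinner u (P v)" "0 \<le> Re (cinner u (P u))"
  using assms by (auto simp: pos_op_def)

lemma selfadjoint_cinner_real:
  assumes "\<And>u v. cinner (P u) v = cinner u (P v)"
  shows "cinner u (P u) = of_real (Re (cinner u (P u)))"
  using assms[of u u] cinner_commute[of u "P u"] by (metis Reals_cnj_iff of_real_Re)

lemma pos_op_le_onorm:
  assumes "pos_op P"
  shows "Re (cinner u (P u)) \<le> onorm P * (norm u)\<^sup>2"
proof -
  have "Re (cinner u (P u)) \<le> cmod (cinner u (P u))" by (rule complex_Re_le_cmod)
  also have "\<dots> \<le> norm u * norm (P u)" by (rule cmod_cinner_le)
  also have "\<dots> \<le> norm u * (onorm P * norm u)"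
    by (intro mult_left_mono bounded_clinear_norm pos_opD[OF assms]) simp
  finally show ?thesis by (simp add: power2_eq_square mult_ac)
qed

text \<open>Complex coefficients allow the factorisation into linear factors on which
  \<open>cpoly_op_bounded_below\<close> rests; the calculus itself is built on real
  polynomials.\<close>

definition cpoly_op :: "complex poly \<Rightarrow> (L2 \<Rightarrow> L2) \<Rightarrow> L2 \<Rightarrow> L2" where
  "cpoly_op p P u = (\<Sum>i\<le>degree p. scaleC (coeff p i) ((P ^^ i) u))"

lemma cpoly_op_altdef:
  assumes "degree p \<le> n"
  shows "cpoly_op p P u = (\<Sum>i\<le>n. scaleC (coeff p i) ((P ^^ i) u))"
  unfolding cpoly_op_def
  by (rule sum.mono_neutral_left) (use assms in \<open>auto simp: coeff_eq_0\<close>)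

lemma cpoly_op_0: "cpoly_op 0 P u = 0"
  by (simp add: cpoly_op_def)

lemma cpoly_op_pCons:
  assumes "bounded_clinear P"
  shows "cpoly_op (pCons a p) P u = scaleC a u + P (cpoly_op p P u)"
proof -
  have "cpoly_op (pCons a p) P u = (\<Sum>i\<le>Suc (degree p). scaleC (coeff (pCons a p) i) ((P ^^ i) u))"
    by (rule cpoly_op_altdef) (rule degree_pCons_le)
  also have "\<dots> = scaleC a u + (\<Sum>i\<le>degree p. scaleC (coeff p i) (P ((P ^^ i) u)))"
    by (simp add: sum.atMost_Suc_shift del: sum.atMost_Suc)
  also have "(\<Sum>i\<le>degree p. scaleC (coeff p i) (P ((P ^^ i) u))) = P (cpoly_op p P u)"
    by (simp add: cpoly_op_def bounded_clinear_sum[OF assms] bounded_clinear_scaleC[OF assms])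
  finally show ?thesis .
qed

lemma cpoly_op_add: "cpoly_op (p + q) P u = cpoly_op p P u + cpoly_op q P u"
proof -
  define n where "n = max (degree p) (degree q)"
  show ?thesis
    using cpoly_op_altdef[of p n P u] cpoly_op_altdef[of q n P u] cpoly_op_altdef[of "p + q" n P u]
    by (simp add: n_def degree_add_le L2.scale_left_distrib sum.distrib)
qed

lemma cpoly_op_smult: "cpoly_op (smult a p) P u = scaleC a (cpoly_op p P u)"
  using cpoly_op_altdef[of p "degree p" P u] cpoly_op_altdef[of "smult a p" "degree p" P u]
  by (simp add: degree_smult_le L2.scale_sum_right)

lemma cpoly_op_mult:
  assumes "bounded_clinear P"
  shows "cpoly_op (p * q) P u = cpoly_op p P (cpoly_op q P u)"
proof (induction p)
  case 0
  then show ?case by (simp add: cpoly_op_0)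
next
  case (pCons a p)
  then show ?case
    by (simp add: mult_pCons_left cpoly_op_add cpoly_op_smult cpoly_op_pCons[OF assms])
qed

lemma poly_op_cpoly_op: "poly_op p P u = cpoly_op (map_poly of_real p) P u"
  by (simp add: poly_op_def cpoly_op_def coeff_map_poly scaleR_eq_scaleC degree_map_poly)

lemma map_poly_of_real_mult: "map_poly complex_of_real (p * q) = map_poly of_real p * map_poly of_real q"
  by (rule poly_eqI) (simp add: coeff_map_poly coeff_mult)

lemma map_poly_of_real_add: "map_poly complex_of_real (p + q) = map_poly of_real p + map_poly of_real q"
  by (rule poly_eqI) (simp add: coeff_map_poly)

lemma poly_map_poly_of_real: "poly (map_poly complex_of_real p) (of_real x) = of_real (poly p x)"
  by (induction p) (auto simp: map_poly_pCons)

lemma poly_op_0: "poly_op 0 P u = 0"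
  by (simp add: poly_op_def)

lemma poly_op_pCons:
  assumes "bounded_clinear P"
  shows "poly_op (pCons a p) P u = a *\<^sub>R u + P (poly_op p P u)"
  by (simp add: poly_op_cpoly_op map_poly_pCons cpoly_op_pCons[OF assms] scaleR_eq_scaleC)

lemma poly_op_mult:
  "bounded_clinear P \<Longrightarrow> poly_op (p * q) P u = poly_op p P (poly_op q P u)"
  by (simp add: poly_op_cpoly_op map_poly_of_real_mult cpoly_op_mult)

lemma poly_op_add: "poly_op (p + q) P u = poly_op p P u + poly_op q P u"
  by (simp add: poly_op_cpoly_op map_poly_of_real_add cpoly_op_add)

lemma poly_op_smult: "poly_op (smult a p) P u = a *\<^sub>R poly_op p P u"
  using cpoly_op_smult[of "of_real a" "map_poly of_real p" P u]
  by (simp add: poly_op_cpoly_op scaleR_eq_scaleC map_poly_smult)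

lemma poly_op_diff: "poly_op (p - q) P u = poly_op p P u - poly_op q P u"
proof -
  have "p - q = p + smult (-1) q" by simp
  then show ?thesis by (simp only: poly_op_add poly_op_smult) simp
qed

lemma bounded_clinear_add_op:
  assumes "bounded_clinear A" "bounded_clinear B"
  shows "bounded_clinear (\<lambda>x. A x + B x)"
proof (rule bounded_clinearI[where K = "onorm A + onorm B"])
  show "norm (A x + B x) \<le> (onorm A + onorm B) * norm x" for x
    using norm_triangle_ineq[of "A x" "B x"] bounded_clinear_norm[OF assms(1), of x] bounded_clinear_norm[OF assms(2), of x]
    by (simp add: distrib_right)
qed (simp_all add: bounded_clinear_add bounded_clinear_scaleC assms L2.scale_right_distrib)

lemma bounded_clinear_scaleC_op:
  assumes "bounded_clinear A"
  shows "bounded_clinear (\<lambda>x. scaleC c (A x))"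
proof (rule bounded_clinearI[where K = "cmod c * onorm A"])
  show "norm (scaleC c (A x)) \<le> cmod c * onorm A * norm x" for x
    using mult_left_mono[OF bounded_clinear_norm[OF assms, of x], of "cmod c"] by (simp add: norm_scaleC mult.assoc)
qed (simp_all add: bounded_clinear_add bounded_clinear_scaleC assms L2.scale_right_distrib mult.commute)

lemma bounded_clinear_scaleR_op:
  "bounded_clinear A \<Longrightarrow> bounded_clinear (\<lambda>x. r *\<^sub>R (A x))"
  by (simp add: scaleR_eq_scaleC bounded_clinear_scaleC_op)

lemma bounded_clinear_0: "bounded_clinear (\<lambda>x. 0)"
  by (rule bounded_clinearI[where K = 0]) auto

lemma bounded_clinear_poly_op:
  assumes "bounded_clinear P"
  shows "bounded_clinear (poly_op p P)"
proof (induction p)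
  case 0
  have "poly_op 0 P = (\<lambda>u. 0)" by (simp add: fun_eq_iff poly_op_0)
  then show ?case by (simp add: bounded_clinear_0)
next
  case (pCons a p)
  have "poly_op (pCons a p) P = (\<lambda>u. a *\<^sub>R u + P (poly_op p P u))"
    by (simp add: fun_eq_iff poly_op_pCons[OF assms])
  then show ?case
    by (simp add: bounded_clinear_add_op bounded_clinear_scaleR_op bounded_clinear_id bounded_clinear_compose[OF assms pCons(2)])
qed

lemma poly_op_selfadjoint:
  assumes "pos_op P"
  shows "cinner (poly_op p P u) v = cinner u (poly_op p P v)"
proof (induction p arbitrary: u v)
  case (pCons a p)
  \<comment> \<open>P and p(P) commute because multiplication of polynomials does.\<close>
  have comm: "poly_op p P (P v) = P (poly_op p P v)" for v
  proof -
    have "poly_op p P (P v) = poly_op (p * [:0, 1:]) P v"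
      unfolding poly_op_mult[OF pos_opD(1)[OF assms]]
      by (simp add: poly_op_pCons[OF pos_opD(1)[OF assms]] poly_op_0 bounded_clinear_zero[OF pos_opD(1)[OF assms]])
    also have "\<dots> = poly_op ([:0, 1:] * p) P v" by (simp only: mult.commute)
    also have "\<dots> = P (poly_op p P v)"
      unfolding poly_op_mult[OF pos_opD(1)[OF assms]]
      by (simp add: poly_op_pCons[OF pos_opD(1)[OF assms]] poly_op_0 bounded_clinear_zero[OF pos_opD(1)[OF assms]])
    finally show ?thesis .
  qed
  show ?case
    by (simp add: poly_op_pCons[OF pos_opD(1)[OF assms]] cinner_add_left cinner_add_right cinner_scaleR_left
        cinner_scaleR_right pos_opD(2)[OF assms] pCons.IH comm)
qed (simp add: poly_op_0)

text \<open>The quadratic form of P at w lies between 0 and \<open>onorm P\<close> times the squared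
  norm of w, so the form of P - z stays away from 0: by its imaginary part if z is not real, by its
  real part if z lies to the left or to the right of the interval.\<close>

lemma resolvent_bounded_below:
  assumes P: "pos_op P" and z: "z \<notin> of_real ` {0..onorm P}"
  shows "\<exists>d>0. \<forall>w. d * norm w \<le> norm (P w - scaleC z w)"
proof -
  define a b where "a = Re z" and "b = Im z"
  have eq: "cinner w (P w - scaleC z w) = of_real (Re (cinner w (P w))) - z * of_real ((norm w)\<^sup>2)" for w
    using selfadjoint_cinner_real[OF pos_opD(2)[OF P], of w]
    by (simp add: cinner_diff_right cinner_scaleC_right cinner_self_norm)
  have ba: "d * norm w \<le> norm (P w - scaleC z w)"
    if "d * (norm w)\<^sup>2 \<le> cmod (cinner w (P w - scaleC z w))" for d w
  proof (cases "norm w = 0")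
    case False
    have "d * (norm w)\<^sup>2 \<le> norm w * norm (P w - scaleC z w)"
      using that cmod_cinner_le order_trans by blast
    then show ?thesis using False by (simp add: power2_eq_square)
  qed simp
  consider "b \<noteq> 0" | "b = 0" "a < 0" | "b = 0" "a > onorm P"
    using z by (force simp: a_def b_def image_iff complex_eq_iff)
  then show ?thesis
  proof cases
    case 1
    have "\<bar>b\<bar> * norm w \<le> norm (P w - scaleC z w)" for w
    proof (rule ba)
      have "\<bar>Im (cinner w (P w - scaleC z w))\<bar> = \<bar>b\<bar> * (norm w)\<^sup>2"
        unfolding eq by (simp add: b_def abs_mult)
      then show "\<bar>b\<bar> * (norm w)\<^sup>2 \<le> cmod (cinner w (P w - scaleC z w))"
        using abs_Im_le_cmod by metis
    qed
    then show ?thesis using 1 by (intro exI[of _ "\<bar>b\<bar>"]) auto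
  next
    case 2
    have "- a * norm w \<le> norm (P w - scaleC z w)" for w
    proof (rule ba)
      have "Re (cinner w (P w - scaleC z w)) \<ge> - a * (norm w)\<^sup>2"
        unfolding eq using pos_opD(3)[OF P, of w] by (simp add: a_def)
      then show "- a * (norm w)\<^sup>2 \<le> cmod (cinner w (P w - scaleC z w))"
        using complex_Re_le_cmod order_trans by blast
    qed
    then show ?thesis using 2 by (intro exI[of _ "- a"]) auto
  next
    case 3
    have "(a - onorm P) * norm w \<le> norm (P w - scaleC z w)" for w
    proof (rule ba)
      have "- Re (cinner w (P w - scaleC z w)) \<ge> (a - onorm P) * (norm w)\<^sup>2"
        unfolding eq using pos_op_le_onorm[OF P, of w] by (simp add: a_def algebra_simps)
      then show "(a - onorm P) * (norm w)\<^sup>2 \<le> cmod (cinner w (P w - scaleC z w))"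
        using abs_Re_le_cmod[of "cinner w (P w - scaleC z w)"] by linarith
    qed
    then show ?thesis using 3 by (intro exI[of _ "a - onorm P"]) auto
  qed
qed

text \<open>Splitting off linear factors, each of which is bounded below because its root is not in
  the interval, replaces the spectral mapping theorem.\<close>

lemma cpoly_op_bounded_below:
  assumes P: "pos_op P"
  shows "(\<And>x. x \<in> {0..onorm P} \<Longrightarrow> poly q (of_real x) \<noteq> 0) \<Longrightarrow> \<exists>d>0. \<forall>u. d * norm u \<le> norm (cpoly_op q P u)"
proof (induction "degree q" arbitrary: q)
  case 0
  then obtain a where a: "q = [:a:]" using degree_eq_zeroE by metis
  have "a \<noteq> 0" using 0(2)[of 0] bounded_clinear_onorm_pos[OF pos_opD(1)[OF P]] by (simp add: a)
  then show ?case
    by (intro exI[of _ "cmod a"])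
       (simp add: a cpoly_op_pCons[OF pos_opD(1)[OF P]] cpoly_op_0 bounded_clinear_zero[OF pos_opD(1)[OF P]] norm_scaleC)
next
  case (Suc n)
  then have "\<not> constant (poly q)" by (simp add: constant_degree)
  then obtain z where z: "poly q z = 0" using Fundamental_Theorem_Algebra.fundamental_theorem_of_algebra by blast
  then have "[:- z, 1:] dvd q" by (simp only: poly_eq_0_iff_dvd)
  then obtain r where r: "q = [:- z, 1:] * r" by (rule dvdE)
  have "r \<noteq> 0" using Suc(2) unfolding r by (metis degree_0 mult_zero_right nat.distinct(1))
  then have "degree q = Suc (degree r)" unfolding r by (subst degree_mult_eq) simp_all
  then have "degree r = n" using Suc(2) by simp
  moreover have "poly r (of_real x) \<noteq> 0" if "x \<in> {0..onorm P}" for x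
    using Suc(3)[OF that] unfolding r by simp
  ultimately obtain d where d: "d > 0" "\<And>u. d * norm u \<le> norm (cpoly_op r P u)"
    using Suc(1)[of r] by blast
  have "z \<notin> of_real ` {0..onorm P}" using Suc(3) z by auto
  from resolvent_bounded_below[OF P this] obtain e where
    e: "e > 0" "\<And>w. e * norm w \<le> norm (P w - scaleC z w)" by blast
  have "(e * d) * norm u \<le> norm (cpoly_op q P u)" for u
  proof -
    have "(e * d) * norm u \<le> e * norm (cpoly_op r P u)"
      using d(2)[of u] e(1) by (simp add: mult.assoc)
    also have "\<dots> \<le> norm (P (cpoly_op r P u) - scaleC z (cpoly_op r P u))" by (rule e)
    also have "P (cpoly_op r P u) - scaleC z (cpoly_op r P u) = cpoly_op q P u"
      unfolding r cpoly_op_mult[OF pos_opD(1)[OF P]]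
      by (simp add: cpoly_op_pCons[OF pos_opD(1)[OF P]] cpoly_op_0 bounded_clinear_zero[OF pos_opD(1)[OF P]]
         algebra_simps L2.scale_minus_left)
    finally show ?thesis .
  qed
  then show ?case using d(1) e(1) by (intro exI[of _ "e * d"]) auto
qed

text \<open>Suppose the norm N of T = p(P) exceeded m. Then N^2 - p^2 has no zero on the interval,
  so N^2 - T^2 is bounded below by some d > 0; for a self-adjoint T this forces the norm of T
  strictly below N.\<close>

lemma norm_poly_op_le:
  assumes P: "pos_op P" and m: "\<And>x. x \<in> {0..onorm P} \<Longrightarrow> \<bar>poly p x\<bar> \<le> m"
  shows "norm (poly_op p P u) \<le> m * norm u"
proof -
  define T where "T = poly_op p P"
  have bT: "bounded_clinear T" unfolding T_def by (rule bounded_clinear_poly_op[OF pos_opD(1)[OF P]])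
  have m0: "m \<ge> 0" using m[of 0] bounded_clinear_onorm_pos[OF pos_opD(1)[OF P]] by force
  define N where "N = onorm T"
  have "N \<le> m"
  proof (rule ccontr)
    assume "\<not> N \<le> m"
    then have Nm: "N > m" by simp
    then have N0: "N > 0" using m0 by simp
    define q where "q = [:N\<^sup>2:] - p * p"
    have "poly (map_poly of_real q) (complex_of_real x) \<noteq> 0" if "x \<in> {0..onorm P}" for x
    proof -
      have "\<bar>poly p x\<bar> < N" using m[OF that] Nm by simp
      then have "(poly p x)\<^sup>2 < N\<^sup>2" using abs_square_less_1 N0 by (simp add: abs_less_iff power2_strict_mono)
      then have "poly q x \<noteq> 0" by (simp add: q_def power2_eq_square)
      then show ?thesis unfolding poly_map_poly_of_real by simp
    qed
    from cpoly_op_bounded_below[OF P this] obtain d where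
      d: "d > 0" "\<And>u. d * norm u \<le> norm (poly_op q P u)"
      by (auto simp: poly_op_cpoly_op)
    have q: "poly_op q P u = N\<^sup>2 *\<^sub>R u - T (T u)" for u
      by (simp add: q_def poly_op_diff poly_op_mult[OF pos_opD(1)[OF P]] T_def poly_op_0
          poly_op_pCons[OF pos_opD(1)[OF P]] bounded_clinear_zero[OF pos_opD(1)[OF P]])
    \<comment> \<open>The squared norm of N^2 u - T (T u) is expanded; its mixed term is the squared
      norm of T u by self-adjointness, and the norm of T (T u) is at most N times that of T
      u.\<close>
    have key: "d\<^sup>2 * (norm u)\<^sup>2 \<le> N\<^sup>2 * (N\<^sup>2 * (norm u)\<^sup>2 - (norm (T u))\<^sup>2)" for u
    proof -
      have "inner u (T (T u)) = (norm (T u))\<^sup>2"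
        using poly_op_selfadjoint[OF P, of p u "T u"]
        by (simp add: inner_L2_def T_def[symmetric] Re_cinner_self[symmetric])
      then have "(norm (N\<^sup>2 *\<^sub>R u - T (T u)))\<^sup>2 = N^4 * (norm u)\<^sup>2 - 2 * N\<^sup>2 * (norm (T u))\<^sup>2 + (norm (T (T u)))\<^sup>2"
        using dot_norm_neg[of "N\<^sup>2 *\<^sub>R u" "T (T u)"]
        by (simp add: power_mult_distrib field_simps power4_eq_xxxx power2_eq_square)
      also have "(norm (T (T u)))\<^sup>2 \<le> (N * norm (T u))\<^sup>2"
        unfolding N_def by (intro power_mono bounded_clinear_norm[OF bT]) simp
      finally have "(norm (poly_op q P u))\<^sup>2 \<le> N\<^sup>2 * (N\<^sup>2 * (norm u)\<^sup>2 - (norm (T u))\<^sup>2)"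
        by (simp add: q power_mult_distrib algebra_simps power4_eq_xxxx power2_eq_square)
      moreover have "(d * norm u)\<^sup>2 \<le> (norm (poly_op q P u))\<^sup>2"
        by (intro power_mono d) (use d(1) in auto)
      ultimately show ?thesis by (simp add: power_mult_distrib)
    qed
    \<comment> \<open>The improved norm bound that \<open>key\<close> yields; \<open>max 0\<close>
      keeps the radicand nonnegative without a comparison of d with N^2.\<close>
    define N' where "N' = sqrt (max 0 (N\<^sup>2 - d\<^sup>2 / N\<^sup>2))"
    have "norm (T u) \<le> N' * norm u" for u
    proof (rule power2_le_imp_le)
      have "(norm (T u))\<^sup>2 \<le> (N\<^sup>2 - d\<^sup>2 / N\<^sup>2) * (norm u)\<^sup>2"
      proof -
        have "d\<^sup>2 / N\<^sup>2 * (norm u)\<^sup>2 \<le> N\<^sup>2 * (norm u)\<^sup>2 - (norm (T u))\<^sup>2"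
          using key[of u] N0 by (simp add: field_simps)
        then show ?thesis by (simp add: algebra_simps)
      qed
      also have "\<dots> \<le> max 0 (N\<^sup>2 - d\<^sup>2 / N\<^sup>2) * (norm u)\<^sup>2"
        by (intro mult_right_mono) auto
      finally show "(norm (T u))\<^sup>2 \<le> (N' * norm u)\<^sup>2"
        by (simp add: N'_def power_mult_distrib)
    qed (simp add: N'_def)
    then have "N \<le> N'" unfolding N_def by (intro onorm_bound) (auto simp: N'_def)
    moreover have "N' < N"
      unfolding N'_def using N0 d(1) by (intro real_less_lsqrt) auto
    ultimately show False by simp
  qed
  have "norm (T u) \<le> N * norm u" unfolding N_def by (rule bounded_clinear_norm[OF bT])
  also have "\<dots> \<le> m * norm u" by (intro mult_right_mono \<open>N \<le> m\<close>) simp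
  finally show ?thesis by (simp add: T_def)
qed

section \<open>Continuous functions of a positive operator\<close>

lemma weierstrass_poly_sequence:
  fixes f :: "real \<Rightarrow> real"
  assumes "continuous_on {a..b} f"
  shows "\<exists>p. uniform_limit {a..b} (\<lambda>n. poly (p n)) f sequentially"
proof -
  have "\<exists>p. \<forall>x\<in>{a..b}. \<bar>f x - poly p x\<bar> < e" if e: "e > 0" for e :: real
  proof -
    obtain g where g: "real_polynomial_function g" "\<And>x. x \<in> {a..b} \<Longrightarrow> \<bar>f x - g x\<bar> < e"
      using Stone_Weierstrass_real_polynomial_function[OF compact_Icc assms e] by metis
    then obtain c n where "g = (\<lambda>x. \<Sum>i\<le>n. c i * x ^ i)"
      unfolding real_polynomial_function_iff_sum by blast
    then have "g x = poly (\<Sum>i\<le>n. monom (c i) i) x" for x :: real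
      by (simp add: poly_sum poly_monom)
    then show ?thesis using g(2) by metis
  qed
  then have "\<forall>n. \<exists>p. \<forall>x\<in>{a..b}. \<bar>f x - poly p x\<bar> < inverse (real (Suc n))"
    by simp
  then obtain p where p: "\<And>n x. x \<in> {a..b} \<Longrightarrow> \<bar>f x - poly (p n) x\<bar> < inverse (real (Suc n))"
    by metis
  have "uniform_limit {a..b} (\<lambda>n. poly (p n)) f sequentially"
  proof (rule uniform_limitI)
    fix e :: real assume "e > 0"
    then have "\<forall>\<^sub>F n in sequentially. inverse (real (Suc n)) < e"
      by (intro order_tendstoD(2)[OF LIMSEQ_inverse_real_of_nat])
    then show "\<forall>\<^sub>F n in sequentially. \<forall>x\<in>{a..b}. dist (poly (p n) x) (f x) < e"
    proof eventually_elim
      case (elim n)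
      show ?case using less_trans[OF p elim] by (simp add: dist_real_def abs_minus_commute)
    qed
  qed
  then show ?thesis by blast
qed

text \<open>Two sequences at once: p = q gives the Cauchy property, different p and q give
  independence of the limit from the approximating sequence.\<close>

lemma poly_op_uniform_Cauchy:
  assumes P: "pos_op P"
    and p: "uniform_limit {0..onorm P} (\<lambda>n. poly (p n)) f sequentially"
    and q: "uniform_limit {0..onorm P} (\<lambda>n. poly (q n)) f sequentially" and e: "e > 0"
  shows "\<exists>N. \<forall>m\<ge>N. \<forall>n\<ge>N. \<forall>u. norm (poly_op (p m) P u - poly_op (q n) P u) \<le> e * norm u"
proof -
  obtain N1 where N1: "\<And>n x. n \<ge> N1 \<Longrightarrow> x \<in> {0..onorm P} \<Longrightarrow> \<bar>poly (p n) x - f x\<bar> < e / 2"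
    using p e unfolding uniform_limit_sequentially_iff dist_real_def by (metis half_gt_zero)
  obtain N2 where N2: "\<And>n x. n \<ge> N2 \<Longrightarrow> x \<in> {0..onorm P} \<Longrightarrow> \<bar>poly (q n) x - f x\<bar> < e / 2"
    using q e unfolding uniform_limit_sequentially_iff dist_real_def by (metis half_gt_zero)
  have "norm (poly_op (p m) P u - poly_op (q n) P u) \<le> e * norm u" if "m \<ge> max N1 N2" "n \<ge> max N1 N2" for m n u
    unfolding poly_op_diff[symmetric]
  proof (rule norm_poly_op_le[OF P])
    show "\<bar>poly (p m - q n) x\<bar> \<le> e" if "x \<in> {0..onorm P}" for x
    proof -
      have "\<bar>poly (p m) x - f x\<bar> < e / 2" "\<bar>poly (q n) x - f x\<bar> < e / 2"
        by (rule N1[OF _ that] N2[OF _ that]; use \<open>m \<ge> _\<close> \<open>n \<ge> _\<close> in simp)+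
      then show ?thesis unfolding poly_diff by linarith
    qed
  qed
  then show ?thesis by blast
qed

lemma shrink_less: "0 < e \<Longrightarrow> 0 \<le> x \<Longrightarrow> e / (x + 1) * x < (e::real)"
  by (simp add: divide_less_eq distrib_left)

text \<open>\<open>pos_cfc\<close> is a definite description, so its use rests on existence and
  uniqueness of the operator. The second part gives strong convergence along every approximating
  sequence, not only along the one witnessing the definition; the algebraic rules below are derived
  from it.\<close>

lemma pos_cfc_spec:
  assumes P: "pos_op P" and f: "continuous_on {0..onorm P} f"
  shows "bounded_clinear (pos_cfc f P)"
    and "\<And>p u. uniform_limit {0..onorm P} (\<lambda>n. poly (p n)) f sequentially \<Longrightarrow>
      (\<lambda>n. poly_op (p n) P u) \<longlonglongrightarrow> pos_cfc f P u"
proof -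
  define spec where "spec Q \<longleftrightarrow> bounded_clinear Q \<and>
     (\<exists>p. uniform_limit {0..onorm P} (\<lambda>n. poly (p n)) f sequentially \<and>
          (\<lambda>n. onorm (\<lambda>u. poly_op (p n) P u - Q u)) \<longlonglongrightarrow> 0)" for Q
  have lim: "(\<lambda>n. poly_op (q n) P u) \<longlonglongrightarrow> Q u"
    if "spec Q" and q: "uniform_limit {0..onorm P} (\<lambda>n. poly (q n)) f sequentially" for Q q u
  proof -
    from that obtain p where Q: "bounded_clinear Q"
      and p: "uniform_limit {0..onorm P} (\<lambda>n. poly (p n)) f sequentially"
      and l: "(\<lambda>n. onorm (\<lambda>u. poly_op (p n) P u - Q u)) \<longlonglongrightarrow> 0"
      by (auto simp: spec_def)
    have "(\<lambda>n. poly_op (p n) P u - Q u) \<longlonglongrightarrow> 0"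
    proof (rule Lim_null_comparison)
      show "\<forall>\<^sub>F n in sequentially. norm (poly_op (p n) P u - Q u) \<le> onorm (\<lambda>u. poly_op (p n) P u - Q u) * norm u"
        by (intro always_eventually allI bounded_clinear_norm bounded_clinear_diff_op
            bounded_clinear_poly_op pos_opD(1)[OF P] Q)
      show "(\<lambda>n. onorm (\<lambda>u. poly_op (p n) P u - Q u) * norm u) \<longlonglongrightarrow> 0"
        using tendsto_mult_right[OF l, of "norm u"] by simp
    qed
    moreover have "(\<lambda>n. poly_op (p n) P u - poly_op (q n) P u) \<longlonglongrightarrow> 0"
    proof (rule LIMSEQ_I)
      fix e :: real assume e: "e > 0"
      have "e / (norm u + 1) > 0" using e by (simp add: add_nonneg_pos)
      from poly_op_uniform_Cauchy[OF P p q this] obtain N where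
        N: "\<And>m n u'. m \<ge> N \<Longrightarrow> n \<ge> N \<Longrightarrow> norm (poly_op (p m) P u' - poly_op (q n) P u') \<le> e / (norm u + 1) * norm u'"
        by blast
      have "e / (norm u + 1) * norm u < e"
        by (rule shrink_less[OF e norm_ge_zero])
      then show "\<exists>no. \<forall>n\<ge>no. norm (poly_op (p n) P u - poly_op (q n) P u - 0) < e"
        using N[of _ _ u] by (intro exI[of _ N]) force
    qed
    ultimately have "(\<lambda>n. (poly_op (p n) P u - Q u) - (poly_op (p n) P u - poly_op (q n) P u)) \<longlonglongrightarrow> 0 - 0"
      by (intro tendsto_diff)
    then have "(\<lambda>n. poly_op (q n) P u - Q u) \<longlonglongrightarrow> 0" by simp
    then show ?thesis by (simp add: LIM_zero_iff)
  qed
  obtain p where p: "uniform_limit {0..onorm P} (\<lambda>n. poly (p n)) f sequentially"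
    using weierstrass_poly_sequence[OF f] by blast
  define Q where "Q u = lim (\<lambda>n. poly_op (p n) P u)" for u
  have Cau: "Cauchy (\<lambda>n. poly_op (p n) P u)" for u
    unfolding Cauchy_iff
  proof (intro allI impI)
    fix e :: real assume e: "e > 0"
    have "e / (norm u + 1) > 0" using e by (simp add: add_nonneg_pos)
    from poly_op_uniform_Cauchy[OF P p p this] obtain N where
      N: "\<And>m n u'. m \<ge> N \<Longrightarrow> n \<ge> N \<Longrightarrow> norm (poly_op (p m) P u' - poly_op (p n) P u') \<le> e / (norm u + 1) * norm u'"
      by blast
    have "e / (norm u + 1) * norm u < e"
      by (rule shrink_less[OF e norm_ge_zero])
    then show "\<exists>M. \<forall>m\<ge>M. \<forall>n\<ge>M. norm (poly_op (p m) P u - poly_op (p n) P u) < e"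
      using N[of _ _ u] by (intro exI[of _ N]) force
  qed
  have Ql: "(\<lambda>n. poly_op (p n) P u) \<longlonglongrightarrow> Q u" for u
    using Cauchy_convergent[OF Cau[of u]] by (simp add: Q_def convergent_LIMSEQ_iff)
  note bp = bounded_clinear_poly_op[OF pos_opD(1)[OF P]]
  \<comment> \<open>The definition asks for convergence of operator norms, hence the uniformity in
    u; it survives when m tends to infinity in the Cauchy estimate.\<close>
  have est: "\<exists>N. \<forall>n\<ge>N. \<forall>u. norm (poly_op (p n) P u - Q u) \<le> e * norm u" if e: "e > 0" for e
  proof -
    from poly_op_uniform_Cauchy[OF P p p e] obtain N where
      N: "\<And>m n u'. m \<ge> N \<Longrightarrow> n \<ge> N \<Longrightarrow> norm (poly_op (p m) P u' - poly_op (p n) P u') \<le> e * norm u'"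
      by blast
    have "norm (poly_op (p n) P u - Q u) \<le> e * norm u" if "n \<ge> N" for n u
    proof (rule tendsto_upperbound)
      show "(\<lambda>m. norm (poly_op (p n) P u - poly_op (p m) P u)) \<longlonglongrightarrow> norm (poly_op (p n) P u - Q u)"
        by (intro tendsto_intros Ql)
      show "\<forall>\<^sub>F m in sequentially. norm (poly_op (p n) P u - poly_op (p m) P u) \<le> e * norm u"
        using N that by (auto simp: eventually_sequentially)
    qed simp
    then show ?thesis by blast
  qed
  have bQ: "bounded_clinear Q"
  proof -
    obtain N where N: "\<And>n u. n \<ge> N \<Longrightarrow> norm (poly_op (p n) P u - Q u) \<le> 1 * norm u"
      using est[of 1] by auto
    show ?thesis
    proof (rule bounded_clinearI[where K = "onorm (poly_op (p N) P) + 1"])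
      show "Q (x + y) = Q x + Q y" for x y
        using LIMSEQ_unique[OF Ql[of "x + y"]] tendsto_add[OF Ql[of x] Ql[of y]]
        by (simp add: bounded_clinear_add[OF bp])
      show "Q (scaleC c x) = scaleC c (Q x)" for c x
        using LIMSEQ_unique[OF Ql[of "scaleC c x"]]
          bounded_clinear_tendsto[OF bounded_clinear_scaleC_op[OF bounded_clinear_id] Ql[of x], of c]
        by (simp add: bounded_clinear_scaleC[OF bp])
      show "norm (Q x) \<le> (onorm (poly_op (p N) P) + 1) * norm x" for x
        using N[of N x] bounded_clinear_norm[OF bp, of "p N" x] norm_triangle_sub[of "Q x" "poly_op (p N) P x"]
        by (simp add: norm_minus_commute distrib_right)
    qed
  qed
  have "(\<lambda>n. onorm (\<lambda>u. poly_op (p n) P u - Q u)) \<longlonglongrightarrow> 0"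
  proof (rule LIMSEQ_I)
    fix e :: real assume e: "e > 0"
    then obtain N where N: "\<And>n u. n \<ge> N \<Longrightarrow> norm (poly_op (p n) P u - Q u) \<le> e/2 * norm u"
      using est[of "e/2"] by auto
    have "norm (onorm (\<lambda>u. poly_op (p n) P u - Q u) - 0) < e" if "n \<ge> N" for n
    proof -
      have "onorm (\<lambda>u. poly_op (p n) P u - Q u) \<le> e / 2"
        by (rule onorm_bound) (use N that e in auto)
      moreover have "0 \<le> onorm (\<lambda>u. poly_op (p n) P u - Q u)"
        by (intro bounded_clinear_onorm_pos bounded_clinear_diff_op bp bQ)
      ultimately show ?thesis using e by simp
    qed
    then show "\<exists>no. \<forall>n\<ge>no. norm (onorm (\<lambda>u. poly_op (p n) P u - Q u) - 0) < e" by blast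
  qed
  then have sQ: "spec Q" unfolding spec_def using bQ p by blast
  have "pos_cfc f P = Q"
    unfolding pos_cfc_def spec_def[symmetric]
  proof (rule the_equality)
    show "spec Q" by (rule sQ)
    fix Q' assume "spec Q'"
    then show "Q' = Q"
      using LIMSEQ_unique[OF lim[OF _ p] Ql] by blast
  qed
  then show "bounded_clinear (pos_cfc f P)"
    "\<And>p u. uniform_limit {0..onorm P} (\<lambda>n. poly (p n)) f sequentially \<Longrightarrow>
      (\<lambda>n. poly_op (p n) P u) \<longlonglongrightarrow> pos_cfc f P u"
    using bQ lim[OF sQ] by simp_all
qed

lemma pos_cfc_poly:
  assumes P: "pos_op P"
  shows "pos_cfc (poly p) P u = poly_op p P u"
proof -
  have "(\<lambda>n::nat. poly_op p P u) \<longlonglongrightarrow> pos_cfc (poly p) P u"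
    by (rule pos_cfc_spec(2)[OF P]) (auto intro!: continuous_intros uniform_limit_const)
  then show ?thesis by (simp add: LIMSEQ_const_iff)
qed

lemma pos_cfc_const:
  assumes P: "pos_op P"
  shows "pos_cfc (\<lambda>x. c) P u = c *\<^sub>R u"
proof -
  have "(\<lambda>x. c) = poly [:c:]" by (simp add: fun_eq_iff)
  then show ?thesis using pos_cfc_poly[OF P, of "[:c:]" u]
    by (simp add: poly_op_pCons[OF pos_opD(1)[OF P]] poly_op_0 bounded_clinear_zero[OF pos_opD(1)[OF P]])
qed

lemma pos_cfc_id:
  assumes P: "pos_op P"
  shows "pos_cfc (\<lambda>x. x) P u = P u"
proof -
  have "(\<lambda>x. x) = poly [:0, 1::real:]" by (simp add: fun_eq_iff)
  then show ?thesis using pos_cfc_poly[OF P, of "[:0, 1:]" u]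
    by (simp add: poly_op_pCons[OF pos_opD(1)[OF P]] poly_op_0 bounded_clinear_zero[OF pos_opD(1)[OF P]])
qed

lemma pos_cfc_cong:
  assumes "\<And>x. x \<in> {0..onorm P} \<Longrightarrow> f x = g x"
  shows "pos_cfc f P = pos_cfc g P"
proof -
  have "uniform_limit {0..onorm P} (\<lambda>n. poly (p n)) f sequentially \<longleftrightarrow>
        uniform_limit {0..onorm P} (\<lambda>n. poly (p n)) g sequentially" for p :: "nat \<Rightarrow> real poly"
    by (rule uniform_limit_cong) (use assms in auto)
  then show ?thesis unfolding pos_cfc_def by simp
qed

text \<open>The approximating polynomials eventually exceed m by at most e on the interval; e tends
  to 0 at the end.\<close>

lemma pos_cfc_norm:
  assumes P: "pos_op P" and f: "continuous_on {0..onorm P} f"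
    and m: "\<And>x. x \<in> {0..onorm P} \<Longrightarrow> \<bar>f x\<bar> \<le> m"
  shows "norm (pos_cfc f P u) \<le> m * norm u"
proof -
  obtain p where p: "uniform_limit {0..onorm P} (\<lambda>n. poly (p n)) f sequentially"
    using weierstrass_poly_sequence[OF f] by blast
  have "norm (pos_cfc f P u) \<le> (m + e) * norm u" if e: "e > 0" for e
  proof (rule tendsto_upperbound)
    show "(\<lambda>n. norm (poly_op (p n) P u)) \<longlonglongrightarrow> norm (pos_cfc f P u)"
      by (intro tendsto_norm pos_cfc_spec(2)[OF P f p])
    show "\<forall>\<^sub>F n in sequentially. norm (poly_op (p n) P u) \<le> (m + e) * norm u"
      using uniform_limitD[OF p e]
    proof eventually_elim
      case (elim n)
      show ?case
        by (rule norm_poly_op_le[OF P]) (use elim m in \<open>force simp: dist_real_def\<close>)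
    qed
  qed simp
  then have "\<forall>\<^sub>F e in at_right 0. norm (pos_cfc f P u) \<le> (m + e) * norm u"
    by (simp add: eventually_at_right_less eventually_mono[OF eventually_at_right_less[of "0::real"]])
  moreover have "((\<lambda>e. (m + e) * norm u) \<longlongrightarrow> (m + 0) * norm u) (at_right 0)"
    by (intro tendsto_intros)
  ultimately show ?thesis
    by (intro tendsto_lowerbound[where f = "\<lambda>e. (m + e) * norm u" and F = "at_right 0"]) auto
qed

lemma pos_cfc_add:
  assumes P: "pos_op P" and f: "continuous_on {0..onorm P} f" and g: "continuous_on {0..onorm P} g"
  shows "pos_cfc (\<lambda>x. f x + g x) P u = pos_cfc f P u + pos_cfc g P u"
proof -
  obtain p where p: "uniform_limit {0..onorm P} (\<lambda>n. poly (p n)) f sequentially"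
    using weierstrass_poly_sequence[OF f] by blast
  obtain q where q: "uniform_limit {0..onorm P} (\<lambda>n. poly (q n)) g sequentially"
    using weierstrass_poly_sequence[OF g] by blast
  have "uniform_limit {0..onorm P} (\<lambda>n. poly (p n + q n)) (\<lambda>x. f x + g x) sequentially"
    unfolding poly_add by (intro uniform_limit_add p q)
  from pos_cfc_spec(2)[OF P continuous_on_add[OF f g] this, of u]
  have "(\<lambda>n. poly_op (p n) P u + poly_op (q n) P u) \<longlonglongrightarrow> pos_cfc (\<lambda>x. f x + g x) P u"
    by (simp add: poly_op_add)
  moreover have "(\<lambda>n. poly_op (p n) P u + poly_op (q n) P u) \<longlonglongrightarrow> pos_cfc f P u + pos_cfc g P u"
    by (intro tendsto_add pos_cfc_spec(2)[OF P] p q f g)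
  ultimately show ?thesis by (rule LIMSEQ_unique)
qed

lemma pos_cfc_mult:
  assumes P: "pos_op P" and f: "continuous_on {0..onorm P} f" and g: "continuous_on {0..onorm P} g"
  shows "pos_cfc (\<lambda>x. f x * g x) P u = pos_cfc f P (pos_cfc g P u)"
proof -
  obtain p where p: "uniform_limit {0..onorm P} (\<lambda>n. poly (p n)) f sequentially"
    using weierstrass_poly_sequence[OF f] by blast
  obtain q where q: "uniform_limit {0..onorm P} (\<lambda>n. poly (q n)) g sequentially"
    using weierstrass_poly_sequence[OF g] by blast
  have bf: "bounded (f ` {0..onorm P})" and bg: "bounded (g ` {0..onorm P})"
    by (auto intro!: compact_imp_bounded compact_continuous_image f g)
  have "uniform_limit {0..onorm P} (\<lambda>n. poly (p n * q n)) (\<lambda>x. f x * g x) sequentially"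
    unfolding poly_mult by (intro uniform_lim_mult p q bf bg)
  from pos_cfc_spec(2)[OF P continuous_on_mult[OF f g] this, of u]
  have 1: "(\<lambda>n. poly_op (p n) P (poly_op (q n) P u)) \<longlonglongrightarrow> pos_cfc (\<lambda>x. f x * g x) P u"
    by (simp add: poly_op_mult[OF pos_opD(1)[OF P]])
  obtain K where "\<forall>y\<in>f ` {0..onorm P}. norm y \<le> K"
    using bf unfolding bounded_iff by blast
  then have K: "\<bar>f x\<bar> \<le> K" if "x \<in> {0..onorm P}" for x
    using that by auto
  \<comment> \<open>Both factors vary with n. The operators \<open>poly_op (p n) P\<close> are
    eventually bounded by K + 1, which reduces the claim to the convergence of each factor
    separately.\<close>
  have "(\<lambda>n. poly_op (p n) P (poly_op (q n) P u) - poly_op (p n) P (pos_cfc g P u)) \<longlonglongrightarrow> 0"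
  proof (rule Lim_null_comparison)
    show "\<forall>\<^sub>F n in sequentially. norm (poly_op (p n) P (poly_op (q n) P u) - poly_op (p n) P (pos_cfc g P u))
        \<le> (K + 1) * norm (poly_op (q n) P u - pos_cfc g P u)"
      using uniform_limitD[OF p zero_less_one]
    proof eventually_elim
      case (elim n)
      show ?case
        unfolding bounded_clinear_diff[OF bounded_clinear_poly_op[OF pos_opD(1)[OF P]], symmetric]
        by (rule norm_poly_op_le[OF P]) (use elim K in \<open>force simp: dist_real_def\<close>)
    qed
    have "(\<lambda>n. (K + 1) * norm (poly_op (q n) P u - pos_cfc g P u)) \<longlonglongrightarrow> (K + 1) * norm (pos_cfc g P u - pos_cfc g P u)"
      by (intro tendsto_intros pos_cfc_spec(2)[OF P g q])
    then show "(\<lambda>n. (K + 1) * norm (poly_op (q n) P u - pos_cfc g P u)) \<longlonglongrightarrow> 0" by simp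
  qed
  moreover have "(\<lambda>n. poly_op (p n) P (pos_cfc g P u)) \<longlonglongrightarrow> pos_cfc f P (pos_cfc g P u)"
    by (rule pos_cfc_spec(2)[OF P f p])
  ultimately have "(\<lambda>n. (poly_op (p n) P (poly_op (q n) P u) - poly_op (p n) P (pos_cfc g P u)) + poly_op (p n) P (pos_cfc g P u))
      \<longlonglongrightarrow> 0 + pos_cfc f P (pos_cfc g P u)"
    by (rule tendsto_add)
  then show ?thesis using 1 by (simp add: LIMSEQ_unique)
qed

lemma pos_cfc_scale:
  assumes P: "pos_op P" and f: "continuous_on {0..onorm P} f"
  shows "pos_cfc (\<lambda>x. c * f x) P u = c *\<^sub>R pos_cfc f P u"
  using pos_cfc_mult[OF P continuous_on_const f, of c u] by (simp add: pos_cfc_const[OF P])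

lemma pos_cfc_diff:
  assumes P: "pos_op P" and f: "continuous_on {0..onorm P} f" and g: "continuous_on {0..onorm P} g"
  shows "pos_cfc (\<lambda>x. f x - g x) P u = pos_cfc f P u - pos_cfc g P u"
  using pos_cfc_add[OF P f, of "\<lambda>x. -1 * g x" u] pos_cfc_scale[OF P g, of "-1" u] g
  by (simp add: continuous_on_minus)

lemma pos_cfc_selfadjoint:
  assumes P: "pos_op P" and f: "continuous_on {0..onorm P} f"
  shows "cinner (pos_cfc f P u) v = cinner u (pos_cfc f P v)"
proof -
  obtain p where p: "uniform_limit {0..onorm P} (\<lambda>n. poly (p n)) f sequentially"
    using weierstrass_poly_sequence[OF f] by blast
  have "(\<lambda>n. cinner (poly_op (p n) P u) v) \<longlonglongrightarrow> cinner (pos_cfc f P u) v"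
    by (intro bounded_linear.tendsto[OF bounded_linear_cinner_left] pos_cfc_spec(2)[OF P f p])
  moreover have "(\<lambda>n. cinner u (poly_op (p n) P v)) \<longlonglongrightarrow> cinner u (pos_cfc f P v)"
    by (intro bounded_linear.tendsto[OF bounded_linear_cinner_right] pos_cfc_spec(2)[OF P f p])
  ultimately show ?thesis by (simp add: poly_op_selfadjoint[OF P] LIMSEQ_unique)
qed

text \<open>Multiplicativity splits f into two square roots, one of which moves to the other side of
  the inner product. Positivity and monotonicity of the calculus follow from this.\<close>

lemma pos_cfc_sqrt_norm:
  assumes P: "pos_op P" and f: "continuous_on {0..onorm P} f" and nn: "\<And>x. x \<in> {0..onorm P} \<Longrightarrow> 0 \<le> f x"
  shows "cinner u (pos_cfc f P u) = of_real ((norm (pos_cfc (\<lambda>x. sqrt (f x)) P u))\<^sup>2)"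
proof -
  have s: "continuous_on {0..onorm P} (\<lambda>x. sqrt (f x))" by (intro continuous_intros f)
  have "pos_cfc f P = pos_cfc (\<lambda>x. sqrt (f x) * sqrt (f x)) P"
    by (rule pos_cfc_cong) (use nn in simp)
  then show ?thesis
    by (simp only: pos_cfc_mult[OF P s s] pos_cfc_selfadjoint[OF P s, symmetric] cinner_self_norm)
qed

lemma pos_cfc_nonneg:
  assumes "pos_op P" "continuous_on {0..onorm P} f" "\<And>x. x \<in> {0..onorm P} \<Longrightarrow> 0 \<le> f x"
  shows "0 \<le> Re (cinner u (pos_cfc f P u))"
  using pos_cfc_sqrt_norm[OF assms, of u] by simp

lemma pos_cfc_mono:
  assumes P: "pos_op P" and f: "continuous_on {0..onorm P} f" and g: "continuous_on {0..onorm P} g"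
    and le: "\<And>x. x \<in> {0..onorm P} \<Longrightarrow> f x \<le> g x"
  shows "Re (cinner u (pos_cfc f P u)) \<le> Re (cinner u (pos_cfc g P u))"
  using pos_cfc_nonneg[OF P continuous_on_diff[OF g f], of u] le
  by (simp add: pos_cfc_diff[OF P g f] cinner_diff_right)

lemma pos_op_pos_cfc:
  assumes P: "pos_op P" and f: "continuous_on {0..onorm P} f" and nn: "\<And>x. x \<in> {0..onorm P} \<Longrightarrow> 0 \<le> f x"
  shows "pos_op (pos_cfc f P)"
  unfolding pos_op_def
  using pos_cfc_spec(1)[OF P f] pos_cfc_selfadjoint[OF P f] pos_cfc_nonneg[OF P f nn] by blast

section \<open>Polar decomposition and Hilbert-Schmidt operators\<close>

lemma pos_op_adjoint_comp:
  assumes A: "bounded_clinear A"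
  shows "pos_op (adjoint A \<circ> A)"
  unfolding pos_op_def
  by (auto simp: cinner_adjoint[OF A] cinner_adjoint_left[OF A] Re_cinner_self
      intro: bounded_clinear_comp A bounded_clinear_adjoint[OF A])

lemma op_abs_pos:
  assumes A: "bounded_clinear A"
  shows "pos_op (op_abs A)"
  unfolding op_abs_def by (rule pos_op_pos_cfc[OF pos_op_adjoint_comp[OF A]]) (auto intro!: continuous_intros)

lemma op_abs_square:
  assumes A: "bounded_clinear A"
  shows "op_abs A (op_abs A u) = adjoint A (A u)"
proof -
  note P = pos_op_adjoint_comp[OF A]
  have s: "continuous_on {0..onorm (adjoint A \<circ> A)} sqrt" by (intro continuous_intros)
  have "pos_cfc (\<lambda>x. sqrt x * sqrt x) (adjoint A \<circ> A) = pos_cfc (\<lambda>x. x) (adjoint A \<circ> A)"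
    by (rule pos_cfc_cong) simp
  then show ?thesis
    using pos_cfc_mult[OF P s s, of u] by (simp only: op_abs_def pos_cfc_id[OF P] o_apply)
qed

lemma norm_op_abs:
  assumes A: "bounded_clinear A"
  shows "norm (op_abs A u) = norm (A u)"
proof -
  have "complex_of_real ((norm (op_abs A u))\<^sup>2) = of_real ((norm (A u))\<^sup>2)"
    unfolding cinner_self_norm[symmetric]
    by (simp add: pos_opD(2)[OF op_abs_pos[OF A]] op_abs_square[OF A] cinner_adjoint[OF A])
  then have "(norm (op_abs A u))\<^sup>2 = (norm (A u))\<^sup>2" by (simp only: of_real_eq_iff)
  then show ?thesis by simp
qed

lemma onorm_op_abs:
  assumes A: "bounded_clinear A"
  shows "onorm (op_abs A) = onorm A"
  unfolding onorm_def norm_op_abs[OF A] ..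

text \<open>The partial isometry is the strong limit of \<open>A f\<^sub>n(\<bar>A\<bar>)\<close> with \<open>f\<^sub>n(s) = 1 / (s + 1/(n+1))\<close>, which exists
  because \<open>s f\<^sub>n(s)\<close> increases with \<open>n\<close>.\<close>

lemma polar_decomposition:
  assumes A: "bounded_clinear A"
  shows "\<exists>U. bounded_clinear U \<and> (\<forall>u. norm (U u) \<le> norm u) \<and> (\<forall>u. U (op_abs A u) = A u) \<and>
    (\<forall>u. adjoint U (A u) = op_abs A u)"
proof -
  define S where "S = op_abs A"
  define I where "I = {0..onorm S}"
  have P: "pos_op S" unfolding S_def by (rule op_abs_pos[OF A])
  note bS = pos_opD(1)[OF P]
  have nS: "norm (S u) = norm (A u)" for u by (simp add: S_def norm_op_abs[OF A])
  define d where "d n = inverse (real (Suc n))" for n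
  have d0: "d n > 0" for n by (simp add: d_def)
  have dlim: "d \<longlonglongrightarrow> 0" unfolding d_def by (rule LIMSEQ_inverse_real_of_nat)
  have dmono: "d m \<le> d n" if "n \<le> m" for m n using that by (simp add: d_def field_simps)
  define f where "f n s = 1 / (s + d n)" for n s
  define g where "g n s = s / (s + d n)" for n s
  have pos: "s + d n > 0" if "s \<in> I" for s n using that d0[of n] by (auto simp: I_def)
  have cf: "continuous_on {0..onorm S} (f n)" for n
    unfolding f_def I_def[symmetric] by (intro continuous_intros ballI) (use pos less_irrefl in metis)
  have cg: "continuous_on {0..onorm S} (g n)" for n
    unfolding g_def I_def[symmetric] by (intro continuous_intros ballI) (use pos less_irrefl in metis)
  have g01: "0 \<le> g n s" "g n s \<le> 1" if "s \<in> I" for n s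
    using that d0[of n] pos[OF that, of n] by (auto simp: g_def I_def)
  have gmono: "g n s \<le> g m s" if "s \<in> I" "n \<le> m" for n m s
    unfolding g_def using dmono[OF that(2)] pos[OF that(1)] that d0
    by (intro divide_left_mono mult_pos_pos) (auto simp: I_def)
  have cid: "continuous_on {0..onorm S} (\<lambda>s. s)" by (rule continuous_on_id)
  have SPhi: "S (pos_cfc (f n) S u) = pos_cfc (g n) S u" "pos_cfc (f n) S (S u) = pos_cfc (g n) S u" for n u
  proof -
    have e: "(\<lambda>s. s * f n s) = g n" "(\<lambda>s. f n s * s) = g n" by (auto simp: f_def g_def fun_eq_iff)
    show "S (pos_cfc (f n) S u) = pos_cfc (g n) S u"
      using pos_cfc_mult[OF P cid cf, of n u] by (simp add: e pos_cfc_id[OF P])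
    show "pos_cfc (f n) S (S u) = pos_cfc (g n) S u"
      using pos_cfc_mult[OF P cf cid, of n u] by (simp add: e pos_cfc_id[OF P])
  qed
  define V where "V n u = A (pos_cfc (f n) S u)" for n u
  have nUn: "norm (V n u) = norm (pos_cfc (g n) S u)" for n u
    by (simp add: V_def nS[symmetric] SPhi)
  have nUn_le: "norm (V n u) \<le> norm u" for n u
    unfolding nUn using pos_cfc_norm[OF P cg, of n 1 u] g01 by (auto simp: I_def)
  \<comment> \<open>A bounded increasing sequence of numbers whose increments dominate the squared
    distances between the vectors \<open>V n u\<close>.\<close>
  define a where "a u n = Re (cinner u (pos_cfc (\<lambda>s. (g n s)\<^sup>2) S u))" for u and n :: nat
  have cg2: "continuous_on {0..onorm S} (\<lambda>s. (g n s)\<^sup>2)" for n by (intro continuous_intros cg)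
  have a_inc: "incseq (a u)" for u
    unfolding incseq_def a_def
    by (intro allI impI pos_cfc_mono[OF P cg2 cg2]) (use gmono g01 in \<open>auto simp: I_def intro!: power_mono\<close>)
  have a_bd: "a u n \<le> (norm u)\<^sup>2" for u n
  proof -
    have "a u n \<le> Re (cinner u (pos_cfc (\<lambda>s. 1) S u))"
      unfolding a_def
      by (intro pos_cfc_mono[OF P cg2]) (use g01 in \<open>auto simp: I_def power_le_one_iff intro!: power_le_one\<close>)
    then show ?thesis by (simp add: pos_cfc_const[OF P] Re_cinner_self)
  qed
  have Un_diff: "(norm (V m u - V n u))\<^sup>2 \<le> a u m - a u n" if "n \<le> m" for m n u
  proof -
    define k where "k s = g m s - g n s" for s
    have ck: "continuous_on {0..onorm S} k" unfolding k_def by (intro continuous_intros cg)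
    have "V m u - V n u = A (pos_cfc (f m) S u - pos_cfc (f n) S u)"
      by (simp add: V_def bounded_clinear_diff[OF A])
    then have "norm (V m u - V n u) = norm (S (pos_cfc (f m) S u - pos_cfc (f n) S u))" by (simp add: nS)
    also have "\<dots> = norm (pos_cfc k S u)"
      unfolding k_def pos_cfc_diff[OF P cg cg] by (simp add: bounded_clinear_diff[OF bS] SPhi)
    finally have "complex_of_real ((norm (V m u - V n u))\<^sup>2) = cinner (pos_cfc k S u) (pos_cfc k S u)"
      by (simp add: cinner_self_norm)
    also have "\<dots> = cinner u (pos_cfc (\<lambda>s. k s * k s) S u)"
      by (simp add: pos_cfc_mult[OF P ck ck] pos_cfc_selfadjoint[OF P ck])
    finally have "(norm (V m u - V n u))\<^sup>2 = Re (cinner u (pos_cfc (\<lambda>s. k s * k s) S u))"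
      by (metis Re_complex_of_real)
    also have "\<dots> \<le> Re (cinner u (pos_cfc (\<lambda>s. (g m s)\<^sup>2 - (g n s)\<^sup>2) S u))"
    proof (intro pos_cfc_mono[OF P] continuous_intros ck cg)
      fix s assume "s \<in> {0..onorm S}"
      then have "0 \<le> g n s" "g n s \<le> g m s" using g01 gmono that by (auto simp: I_def)
      \<comment> \<open>For 0 <= y <= x one has (x - y)^2 <= x^2 - y^2.\<close>
      then have "g n s * (g m s - g n s) \<ge> 0" by simp
      then show "k s * k s \<le> (g m s)\<^sup>2 - (g n s)\<^sup>2" by (simp add: k_def power2_eq_square algebra_simps)
    qed
    also have "\<dots> = a u m - a u n"
      by (simp add: a_def pos_cfc_diff[OF P cg2 cg2] cinner_diff_right)
    finally show ?thesis .
  qed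
  have Cau: "Cauchy (\<lambda>n. V n u)" for u
  proof -
    have "\<forall>i. a u i \<le> (norm u)\<^sup>2" by (intro allI a_bd)
    then have "convergent (a u)" using incseq_convergent[OF a_inc] convergentI by metis
    then have Ca: "Cauchy (a u)" by (rule convergent_Cauchy)
    show ?thesis
      unfolding Cauchy_iff
    proof (intro allI impI)
      fix e :: real assume e: "e > 0"
      then obtain M where M: "\<And>m n. m \<ge> M \<Longrightarrow> n \<ge> M \<Longrightarrow> norm (a u m - a u n) < e\<^sup>2"
        using Ca unfolding Cauchy_iff by (meson zero_less_power)
      have *: "norm (V m u - V n u) < e" if "m \<ge> M" "n \<ge> M" "n \<le> m" for m n
      proof -
        have "(norm (V m u - V n u))\<^sup>2 < e\<^sup>2"
          using Un_diff[OF that(3), of u] M[OF that(1,2)] by simp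
        then show ?thesis using e by (simp add: power2_less_imp_less)
      qed
      show "\<exists>M. \<forall>m\<ge>M. \<forall>n\<ge>M. norm (V m u - V n u) < e"
        by (rule exI[of _ M]) (metis * norm_minus_commute nle_le)
    qed
  qed
  define U where "U u = lim (\<lambda>n. V n u)" for u
  have Ul: "(\<lambda>n. V n u) \<longlonglongrightarrow> U u" for u
    using Cauchy_convergent[OF Cau[of u]] by (simp add: U_def convergent_LIMSEQ_iff)
  note bf = pos_cfc_spec(1)[OF P cf]
  have nU: "norm (U u) \<le> norm u" for u
    by (rule tendsto_upperbound[OF tendsto_norm[OF Ul]]) (auto simp: nUn_le)
  have bU: "bounded_clinear U"
  proof (rule bounded_clinearI[where K = 1])
    show "U (x + y) = U x + U y" for x y
      using LIMSEQ_unique[OF Ul[of "x + y"]] tendsto_add[OF Ul[of x] Ul[of y]]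
      by (simp add: V_def bounded_clinear_add[OF A] bounded_clinear_add[OF bf])
    show "U (scaleC c x) = scaleC c (U x)" for c x
      using LIMSEQ_unique[OF Ul[of "scaleC c x"]]
        bounded_clinear_tendsto[OF bounded_clinear_scaleC_op[OF bounded_clinear_id] Ul[of x], of c]
      by (simp add: V_def bounded_clinear_scaleC[OF A] bounded_clinear_scaleC[OF bf])
  qed (simp add: nU)
  \<comment> \<open>The functions \<open>g n\<close> vanish at s = 0 and do not converge to 1
    uniformly; multiplied by s they differ from s by at most \<open>d n\<close>. So their
    convergence is used only behind a factor S.\<close>
  have gS: "norm (S (pos_cfc (g n) S u - u)) \<le> d n * norm u" for n u
  proof -
    have c: "continuous_on {0..onorm S} (\<lambda>s. s * g n s - s)" by (intro continuous_intros cg)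
    have "S (pos_cfc (g n) S u - u) = pos_cfc (\<lambda>s. s * g n s - s) S u"
      using pos_cfc_diff[OF P continuous_on_mult[OF cid cg] cid, of n u] pos_cfc_mult[OF P cid cg, of n u]
      by (simp add: bounded_clinear_diff[OF bS] pos_cfc_id[OF P])
    also have "norm \<dots> \<le> d n * norm u"
    proof (rule pos_cfc_norm[OF P c])
      fix s assume "s \<in> {0..onorm S}"
      then have s: "s \<in> I" by (simp add: I_def)
      have "s * g n s - s = - (d n * g n s)"
        unfolding g_def using pos[OF s, of n] by (simp add: field_simps)
      then show "\<bar>s * g n s - s\<bar> \<le> d n"
        using g01[OF s, of n] d0[of n] by (simp add: abs_mult)
    qed
    finally show ?thesis .
  qed
  have US: "U (S u) = A u" for u
  proof -
    have "(\<lambda>n. V n (S u) - A u) \<longlonglongrightarrow> 0"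
    proof (rule Lim_null_comparison)
      show "\<forall>\<^sub>F n in sequentially. norm (V n (S u) - A u) \<le> d n * norm u"
        using gS[of _ u] by (simp add: V_def SPhi bounded_clinear_diff[OF A, symmetric] nS)
      show "(\<lambda>n. d n * norm u) \<longlonglongrightarrow> 0" using tendsto_mult_right[OF dlim, of "norm u"] by simp
    qed
    then have "(\<lambda>n. V n (S u)) \<longlonglongrightarrow> A u" by (simp add: LIM_zero_iff)
    then show ?thesis using Ul LIMSEQ_unique by blast
  qed
  \<comment> \<open>Weakly: the inner products of \<open>V n v\<close> with \<open>A u\<close> are
    rewritten by means of \<open>adjoint A (A u) = S (S u)\<close>, and both expressions
    converge.\<close>
  have "adjoint U (A u) = S u" for u
  proof (rule cinner_eqI)
    fix v
    have "(\<lambda>n. cinner (V n v) (A u)) \<longlonglongrightarrow> cinner (U v) (A u)"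
      by (rule bounded_linear.tendsto[OF bounded_linear_cinner_left Ul])
    moreover have "cinner (V n v) (A u) = cinner v (S (pos_cfc (g n) S u))" for n
    proof -
      have "cinner (V n v) (A u) = cinner (pos_cfc (f n) S v) (S (S u))"
        unfolding V_def cinner_adjoint[OF A, symmetric] S_def op_abs_square[OF A] ..
      also have "\<dots> = cinner (S (pos_cfc (f n) S v)) (S u)" by (rule pos_opD(2)[OF P, symmetric])
      also have "\<dots> = cinner v (pos_cfc (g n) S (S u))" by (simp add: SPhi pos_cfc_selfadjoint[OF P cg])
      also have "pos_cfc (g n) S (S u) = S (pos_cfc (g n) S u)"
        using pos_cfc_mult[OF P cg cid, of n u] pos_cfc_mult[OF P cid cg, of n u]
        by (simp add: pos_cfc_id[OF P] mult.commute)
      finally show ?thesis .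
    qed
    moreover have "(\<lambda>n. cinner v (S (pos_cfc (g n) S u))) \<longlonglongrightarrow> cinner v (S u)"
    proof (rule bounded_linear.tendsto[OF bounded_linear_cinner_right])
      have "(\<lambda>n. S (pos_cfc (g n) S u) - S u) \<longlonglongrightarrow> 0"
      proof (rule Lim_null_comparison)
        show "\<forall>\<^sub>F n in sequentially. norm (S (pos_cfc (g n) S u) - S u) \<le> d n * norm u"
          using gS[of _ u] by (simp add: bounded_clinear_diff[OF bS])
        show "(\<lambda>n. d n * norm u) \<longlonglongrightarrow> 0" using tendsto_mult_right[OF dlim, of "norm u"] by simp
      qed
      then show "(\<lambda>n. S (pos_cfc (g n) S u)) \<longlonglongrightarrow> S u" by (simp add: LIM_zero_iff)
    qed
    ultimately show "cinner v (adjoint U (A u)) = cinner v (S u)"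
      using LIMSEQ_unique by (simp add: cinner_adjoint[OF bU]) blast
  qed
  then show ?thesis using bU nU US unfolding S_def by blast
qed

section \<open>Hilbert-Schmidt operators and cyclicity of the trace\<close>

text \<open>The square of the Hilbert-Schmidt norm, as an extended number so that no finiteness has
  to be known in advance.\<close>

definition hs_sq :: "(L2 \<Rightarrow> L2) \<Rightarrow> ennreal" where
  "hs_sq X = (\<Sum>n. ennreal ((norm (X (onb_seq n)))\<^sup>2))"

lemma suminf_ennreal_swap:
  fixes f :: "nat \<Rightarrow> nat \<Rightarrow> ennreal"
  shows "(\<Sum>m. \<Sum>n. f m n) = (\<Sum>n. \<Sum>m. f m n)"
  using nn_integral_suminf[of "\<lambda>n m. f m n" "count_space UNIV"]
  by (simp add: nn_integral_count_space_nat)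

text \<open>Expanding each norm by Parseval turns both sides into the double sum of the squared
  matrix entries, read by rows and by columns.\<close>

lemma hs_sq_adjoint:
  assumes X: "bounded_clinear X"
  shows "hs_sq (adjoint X) = hs_sq X"
proof -
  have "hs_sq (adjoint X) = (\<Sum>n. \<Sum>m. ennreal ((cmod (cinner (onb_seq m) (adjoint X (onb_seq n))))\<^sup>2))"
    unfolding hs_sq_def parseval_ennreal ..
  also have "\<dots> = (\<Sum>n. \<Sum>m. ennreal ((cmod (cinner (onb_seq n) (X (onb_seq m))))\<^sup>2))"
  proof -
    have "cmod (cinner (onb_seq m) (adjoint X (onb_seq n))) = cmod (cinner (onb_seq n) (X (onb_seq m)))" for m n
      unfolding cinner_adjoint[OF X] by (subst cinner_commute) simp
    then show ?thesis by simp
  qed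
  also have "\<dots> = (\<Sum>m. \<Sum>n. ennreal ((cmod (cinner (onb_seq n) (X (onb_seq m))))\<^sup>2))"
    by (rule suminf_ennreal_swap)
  also have "\<dots> = hs_sq X"
    unfolding hs_sq_def parseval_ennreal ..
  finally show ?thesis .
qed

lemma hs_sq_comp_left:
  assumes "\<And>u. norm (U u) \<le> K * norm u"
  shows "hs_sq (\<lambda>u. U (X u)) \<le> ennreal (K\<^sup>2) * hs_sq X"
proof -
  have "hs_sq (\<lambda>u. U (X u)) \<le> (\<Sum>n. ennreal (K\<^sup>2) * ennreal ((norm (X (onb_seq n)))\<^sup>2))"
    unfolding hs_sq_def
    by (intro suminf_le) (auto simp: ennreal_mult[symmetric] power_mult_distrib[symmetric] intro!: ennreal_leI power_mono assms)
  then show ?thesis by (simp add: hs_sq_def)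
qed

lemma hs_sq_comp_right:
  assumes X: "bounded_clinear X" and U: "bounded_clinear U" and K: "\<And>u. norm (U u) \<le> K * norm u" "0 \<le> K"
  shows "hs_sq (\<lambda>u. X (U u)) \<le> ennreal (K\<^sup>2) * hs_sq X"
proof -
  have "hs_sq (\<lambda>u. X (U u)) = hs_sq (\<lambda>u. adjoint U (adjoint X u))"
    using hs_sq_adjoint[OF bounded_clinear_compose[OF X U]] by (simp add: adjoint_compose[OF X U])
  also have "\<dots> \<le> ennreal (K\<^sup>2) * hs_sq (adjoint X)"
    by (rule hs_sq_comp_left) (rule norm_adjoint_le[OF U K])
  finally show ?thesis by (simp add: hs_sq_adjoint[OF X])
qed

lemma hs_sq_sums:
  assumes "hs_sq X < \<infinity>"
  shows "(\<lambda>n. (norm (X (onb_seq n)))\<^sup>2) sums enn2real (hs_sq X)"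
proof -
  have s: "summable (\<lambda>n. (norm (X (onb_seq n)))\<^sup>2)"
    by (rule summable_suminf_not_top) (use assms in \<open>auto simp: hs_sq_def\<close>)
  then have "hs_sq X = ennreal (\<Sum>n. (norm (X (onb_seq n)))\<^sup>2)"
    unfolding hs_sq_def by (intro suminf_ennreal2) auto
  then show ?thesis using s by (simp add: summable_sums_iff suminf_nonneg)
qed

lemma norm_add_sq: "(norm (x + y))\<^sup>2 = (norm x)\<^sup>2 + (norm y)\<^sup>2 + 2 * Re (cinner x y)" for x y :: L2
  using dot_norm[of x y] by (simp add: inner_L2_def field_simps)

lemma hs_sq_add_finite:
  assumes "hs_sq X < \<infinity>" "hs_sq Y < \<infinity>"
  shows "hs_sq (\<lambda>u. X u + Y u) < \<infinity>"
proof -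
  have "(norm (x + y))\<^sup>2 \<le> 2 * (norm x)\<^sup>2 + 2 * (norm y)\<^sup>2" for x y :: L2
    using power_mono[OF norm_triangle_ineq[of x y], of 2] sum_squares_bound[of "norm x" "norm y"]
    by (simp add: power2_sum)
  then have "hs_sq (\<lambda>u. X u + Y u) \<le> (\<Sum>n. 2 * ennreal ((norm (X (onb_seq n)))\<^sup>2) + 2 * ennreal ((norm (Y (onb_seq n)))\<^sup>2))"
    unfolding hs_sq_def
    by (intro suminf_le) (auto simp: ennreal_plus[symmetric] ennreal_mult'' [symmetric] ennreal_numeral[symmetric]
          simp del: ennreal_plus ennreal_numeral intro!: ennreal_leI)
  also have "\<dots> = 2 * hs_sq X + 2 * hs_sq Y"
    unfolding hs_sq_def by (simp add: suminf_add[symmetric])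
  also have "\<dots> < \<infinity>" using assms by (simp add: ennreal_mult_less_top)
  finally show ?thesis .
qed

lemma norm_mult_le_half: "norm x * norm y \<le> (norm x)\<^sup>2 + (norm y)\<^sup>2"
  using sum_squares_bound[of "norm x" "norm y"] mult_nonneg_nonneg[OF norm_ge_zero[of x] norm_ge_zero[of y]]
  unfolding mult.assoc by linarith

text \<open>With the partial isometry W of T the diagonal entries of \<open>op_abs T\<close> become
  inner products of \<open>adjoint X (W e)\<close> and \<open>adjoint Y e\<close>, and both families
  are square-summable over the basis.\<close>

lemma trace_class_hs_product:
  assumes X: "bounded_clinear X" and Y: "bounded_clinear Y" and hX: "hs_sq X < \<infinity>" and hY: "hs_sq Y < \<infinity>"
  shows "trace_class (\<lambda>u. X (adjoint Y u))"
proof -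
  define T where "T u = X (adjoint Y u)" for u
  have bT: "bounded_clinear T"
    unfolding T_def by (rule bounded_clinear_compose[OF X bounded_clinear_adjoint[OF Y]])
  obtain W where W: "bounded_clinear W" "\<And>u. norm (W u) \<le> norm u" "\<And>u. adjoint W (T u) = op_abs T u"
    using polar_decomposition[OF bT] by blast
  have "pos_trace (op_abs T) = (\<Sum>n. ennreal (Re (cinner (onb_seq n) (op_abs T (onb_seq n)))))"
    by (rule pos_trace_onb_seq) (rule bounded_clinear_zero[OF pos_opD(1)[OF op_abs_pos[OF bT]]])
  also have "\<dots> \<le> (\<Sum>n. ennreal ((norm (adjoint X (W (onb_seq n))))\<^sup>2) + ennreal ((norm (adjoint Y (onb_seq n)))\<^sup>2))"
  proof (intro suminf_le)
    fix n
    have "Re (cinner (onb_seq n) (op_abs T (onb_seq n))) = Re (cinner (adjoint X (W (onb_seq n))) (adjoint Y (onb_seq n)))"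
      unfolding W(3)[symmetric] cinner_adjoint[OF W(1)] T_def cinner_adjoint_left[OF X] ..
    also have "\<dots> \<le> norm (adjoint X (W (onb_seq n))) * norm (adjoint Y (onb_seq n))"
      by (rule order_trans[OF complex_Re_le_cmod cmod_cinner_le])
    also have "\<dots> \<le> (norm (adjoint X (W (onb_seq n))))\<^sup>2 + (norm (adjoint Y (onb_seq n)))\<^sup>2"
      by (rule norm_mult_le_half)
    finally show "ennreal (Re (cinner (onb_seq n) (op_abs T (onb_seq n))))
        \<le> ennreal ((norm (adjoint X (W (onb_seq n))))\<^sup>2) + ennreal ((norm (adjoint Y (onb_seq n)))\<^sup>2)"
      by (simp add: ennreal_plus[symmetric] ennreal_leI del: ennreal_plus)
  qed auto
  also have "\<dots> = hs_sq (\<lambda>u. adjoint X (W u)) + hs_sq (adjoint Y)"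
    unfolding hs_sq_def by (rule suminf_add[symmetric]) auto
  also have "\<dots> \<le> ennreal (1\<^sup>2) * hs_sq (adjoint X) + hs_sq (adjoint Y)"
    by (intro add_right_mono hs_sq_comp_right bounded_clinear_adjoint X W) (use W(2) in auto)
  also have "\<dots> < \<infinity>" using hX hY by (simp add: hs_sq_adjoint X Y)
  finally have "pos_trace (op_abs T) < \<infinity>" .
  then show ?thesis using bT unfolding trace_class_def T_def by blast
qed

text \<open>Cyclicity of the trace by polarisation: \<open>hs_sq\<close> takes the same value on Z =
  X + cnj c Y as on its adjoint, likewise for X and for Y, so the mixed terms have equal sums. The
  scalar c serves to extract real and imaginary parts.\<close>

lemma hs_product_polarize:
  assumes X: "bounded_clinear X" and Y: "bounded_clinear Y" and hX: "hs_sq X < \<infinity>" and hY: "hs_sq Y < \<infinity>"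
  shows "\<exists>s. (\<lambda>n. Re (c * cinner (adjoint X (onb_seq n)) (adjoint Y (onb_seq n)))) sums s \<and>
    (\<lambda>n. Re (c * cinner (Y (onb_seq n)) (X (onb_seq n)))) sums s"
proof -
  define Z where "Z u = X u + scaleC (cnj c) (Y u)" for u
  note cY = bounded_clinear_scaleC_op[OF Y, of "cnj c"]
  have bZ: "bounded_clinear Z" unfolding Z_def by (intro bounded_clinear_add_op X cY)
  have "hs_sq (\<lambda>u. scaleC (cnj c) (Y u)) \<le> ennreal ((cmod c)\<^sup>2) * hs_sq Y"
    by (rule hs_sq_comp_left) (simp add: norm_scaleC)
  also have "\<dots> < \<infinity>" using hY by (simp add: ennreal_mult_less_top)
  finally have hZ: "hs_sq Z < \<infinity>" unfolding Z_def by (intro hs_sq_add_finite hX)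
  have aZ: "adjoint Z u = adjoint X u + scaleC c (adjoint Y u)" for u
  proof -
    have "adjoint Z = (\<lambda>u. adjoint X u + scaleC c (adjoint Y u))"
      by (rule adjoint_eqI)
        (simp add: Z_def cinner_add_left cinner_add_right cinner_scaleC_left cinner_scaleC_right cinner_adjoint X Y)
    then show ?thesis by simp
  qed
  have 1: "(\<lambda>n. (norm (Z (onb_seq n)))\<^sup>2 - (norm (X (onb_seq n)))\<^sup>2 - (cmod c)\<^sup>2 * (norm (Y (onb_seq n)))\<^sup>2)
      sums (enn2real (hs_sq Z) - enn2real (hs_sq X) - (cmod c)\<^sup>2 * enn2real (hs_sq Y))"
    by (intro sums_diff sums_mult hs_sq_sums hX hY hZ)
  have 2: "(\<lambda>n. (norm (adjoint Z (onb_seq n)))\<^sup>2 - (norm (adjoint X (onb_seq n)))\<^sup>2 - (cmod c)\<^sup>2 * (norm (adjoint Y (onb_seq n)))\<^sup>2)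
      sums (enn2real (hs_sq Z) - enn2real (hs_sq X) - (cmod c)\<^sup>2 * enn2real (hs_sq Y))"
    using hs_sq_sums[of "adjoint X"] hs_sq_sums[of "adjoint Y"] hs_sq_sums[of "adjoint Z"] hX hY hZ
    by (intro sums_diff sums_mult) (simp_all add: hs_sq_adjoint X Y bZ)
  have e1: "(norm (Z u))\<^sup>2 - (norm (X u))\<^sup>2 - (cmod c)\<^sup>2 * (norm (Y u))\<^sup>2 = 2 * Re (c * cinner (Y u) (X u))" for u
  proof -
    have "Re (cnj c * cinner (X u) (Y u)) = Re (c * cinner (Y u) (X u))"
      by (subst cinner_commute) simp
    then show ?thesis
      unfolding Z_def norm_add_sq cinner_scaleC_right norm_scaleC power_mult_distrib complex_mod_cnj by simp
  qed
  have e2: "(norm (adjoint Z u))\<^sup>2 - (norm (adjoint X u))\<^sup>2 - (cmod c)\<^sup>2 * (norm (adjoint Y u))\<^sup>2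
      = 2 * Re (c * cinner (adjoint X u) (adjoint Y u))" for u
    unfolding aZ norm_add_sq cinner_scaleC_right norm_scaleC power_mult_distrib by simp
  show ?thesis
    using sums_divide[OF 1, of 2] sums_divide[OF 2, of 2] unfolding e1 e2
    by (auto simp del: times_complex.sel)
qed

lemma op_trace_hs_product:
  assumes X: "bounded_clinear X" and Y: "bounded_clinear Y" and hX: "hs_sq X < \<infinity>" and hY: "hs_sq Y < \<infinity>"
  shows "(\<lambda>n. cinner (Y (onb_seq n)) (X (onb_seq n))) sums op_trace (\<lambda>u. X (adjoint Y u))"
proof -
  define T where "T u = X (adjoint Y u)" for u
  have bT: "bounded_clinear T"
    unfolding T_def by (rule bounded_clinear_compose[OF X bounded_clinear_adjoint[OF Y]])
  have eq: "cinner (onb_seq n) (T (onb_seq n)) = cinner (adjoint X (onb_seq n)) (adjoint Y (onb_seq n))" for n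
    unfolding T_def cinner_adjoint_left[OF X] ..
  have "summable (\<lambda>n. (norm (adjoint X (onb_seq n)))\<^sup>2 + (norm (adjoint Y (onb_seq n)))\<^sup>2)"
    using hs_sq_sums[of "adjoint X"] hs_sq_sums[of "adjoint Y"] hX hY
    by (intro summable_add) (auto simp: hs_sq_adjoint X Y sums_iff)
  then have "summable (\<lambda>n. cmod (cinner (onb_seq n) (T (onb_seq n))))"
    unfolding eq by (rule summable_comparison_test'[where N = 0])
      (use order_trans[OF cmod_cinner_le norm_mult_le_half] in auto)
  from op_trace_onb_seq[OF bounded_clinear_zero[OF bT] this]
  have t: "(\<lambda>n. cinner (adjoint X (onb_seq n)) (adjoint Y (onb_seq n))) sums op_trace T" unfolding eq .
  obtain s where s: "(\<lambda>n. Re (1 * cinner (adjoint X (onb_seq n)) (adjoint Y (onb_seq n)))) sums s"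
      "(\<lambda>n. Re (1 * cinner (Y (onb_seq n)) (X (onb_seq n)))) sums s"
    using hs_product_polarize[OF X Y hX hY] by blast
  \<comment> \<open>\<open>Re (- \<i> * z) = Im z\<close>.\<close>
  obtain s' where s': "(\<lambda>n. Re ((- \<i>) * cinner (adjoint X (onb_seq n)) (adjoint Y (onb_seq n)))) sums s'"
      "(\<lambda>n. Re ((- \<i>) * cinner (Y (onb_seq n)) (X (onb_seq n)))) sums s'"
    using hs_product_polarize[OF X Y hX hY] by blast
  have "s = Re (op_trace T)" using sums_unique2[OF s(1)] sums_Re[OF t] by simp
  moreover have "s' = Im (op_trace T)" using sums_unique2[OF s'(1)] sums_Im[OF t] by simp
  ultimately show ?thesis
    using s(2) s'(2) unfolding T_def[symmetric] by (simp add: sums_complex_iff)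
qed

lemma pos_trace_pos_cfc:
  assumes P: "pos_op P" and f: "continuous_on {0..onorm P} f" and nn: "\<And>x. x \<in> {0..onorm P} \<Longrightarrow> 0 \<le> f x"
  shows "pos_trace (pos_cfc f P) = hs_sq (pos_cfc (\<lambda>x. sqrt (f x)) P)"
proof -
  have "Re (cinner u (pos_cfc f P u)) = (norm (pos_cfc (\<lambda>x. sqrt (f x)) P u))\<^sup>2" for u
    by (subst pos_cfc_sqrt_norm[OF P f nn]) auto
  then show ?thesis
    unfolding hs_sq_def by (subst pos_trace_onb_seq) (simp_all add: bounded_clinear_zero[OF pos_cfc_spec(1)[OF P f]])
qed

text \<open>Convexity of the power on the open half-line; the end point s = 0 lies outside and is
  computed directly.\<close>

lemma powr_above_tangent:
  fixes s l r :: real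
  assumes r: "1 \<le> r" and l: "0 < l" and s: "0 \<le> s"
  shows "l powr r + r * l powr (r - 1) * (s - l) \<le> s powr r"
proof (cases "s = 0")
  case True
  have "l powr (r - 1) * l = l powr r"
    using l by (simp add: powr_diff)
  then have "l powr r + r * l powr (r - 1) * (s - l) = (1 - r) * l powr r"
    using True by (simp add: algebra_simps)
  also have "\<dots> \<le> 0" using r by (simp add: mult_nonpos_nonneg)
  finally show ?thesis using True by simp
next
  case False
  have "r * l powr (r - 1) * (s - l) \<le> s powr r - l powr r"
  proof (rule convex_on_imp_above_tangent[where A = "{0<..}"])
    show "convex_on {0<..} (\<lambda>x. x powr r)" by (rule powr_convex[OF r])
    show "((\<lambda>x. x powr r) has_real_derivative r * l powr (r - 1)) (at l within {0<..})"
      using l by (auto intro!: derivative_eq_intros)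
  qed (use l s False in \<open>auto simp: interior_open\<close>)
  then show ?thesis by simp
qed

lemma continuous_on_powr_nonneg: "0 < r \<Longrightarrow> continuous_on {0..M} (\<lambda>s::real. s powr r)"
  by (intro continuous_on_powr' continuous_intros) auto

text \<open>The tangent of s^r at l lies below s^r, and the functional calculus carries this over to
  the quadratic forms at c; l = a / b is the best choice. With an upper bound b in place of the
  squared norm itself, the estimate can be used uniformly over all kernel vectors of a
  shell.\<close>

lemma pos_op_jensen:
  assumes P: "pos_op P" and r: "1 \<le> r" and b: "(norm c)\<^sup>2 \<le> b" "0 < b"
  shows "Re (cinner c (P c)) powr r \<le> b powr (r - 1) * Re (cinner c (pos_cfc (\<lambda>s. s powr r) P c))"
proof -
  define a where "a = Re (cinner c (P c))"
  have a0: "a \<ge> 0" unfolding a_def by (rule pos_opD(3)[OF P])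
  have cr: "continuous_on {0..onorm P} (\<lambda>s. s powr r)" using r by (intro continuous_on_powr_nonneg) simp
  show ?thesis
  proof (cases "a = 0")
    case True
    have "0 \<le> Re (cinner c (pos_cfc (\<lambda>s. s powr r) P c))" by (rule pos_cfc_nonneg[OF P cr]) simp
    then show ?thesis using True by (simp add: a_def[symmetric])
  next
    case False
    define l where "l = a / b"
    have l: "l > 0" using False a0 b by (simp add: l_def)
    define A B where "A = l powr r - r * l powr (r - 1) * l" and "B = r * l powr (r - 1)"
    have "Re (cinner c (pos_cfc (\<lambda>s. A + B * s) P c)) \<le> Re (cinner c (pos_cfc (\<lambda>s. s powr r) P c))"
    proof (intro pos_cfc_mono[OF P _ cr])
      show "A + B * s \<le> s powr r" if "s \<in> {0..onorm P}" for s
        using powr_above_tangent[OF r l, of s] that by (simp add: A_def B_def algebra_simps)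
    qed (intro continuous_intros)
    moreover have "pos_cfc (\<lambda>s. A + B * s) P c = A *\<^sub>R c + B *\<^sub>R P c"
      using pos_cfc_add[OF P continuous_on_const continuous_on_mult[OF continuous_on_const continuous_on_id], of A B c]
        pos_cfc_scale[OF P continuous_on_id, of B c]
      by (simp add: pos_cfc_const[OF P] pos_cfc_id[OF P])
    ultimately have 1: "A * (norm c)\<^sup>2 + B * a \<le> Re (cinner c (pos_cfc (\<lambda>s. s powr r) P c))"
      by (simp add: cinner_add_right cinner_scaleR_right Re_cinner_self a_def)
    have ll: "l powr (r - 1) * l = l powr r" using l by (simp add: powr_diff)
    then have A: "A = (1 - r) * l powr r" by (simp add: A_def algebra_simps)
    \<comment> \<open>The intercept A = (1 - r) l^r of the tangent is nonpositive, so enlarging the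
      squared norm to b only lowers the left side.\<close>
    have "A * b \<le> A * (norm c)\<^sup>2"
      using b r by (intro mult_left_mono_neg) (auto simp: A mult_nonpos_nonneg)
    with 1 have 2: "A * b + B * a \<le> Re (cinner c (pos_cfc (\<lambda>s. s powr r) P c))" by linarith
    have "a = l * b" using b by (simp add: l_def)
    then have "A * b + B * a = l powr r * b" using ll by (simp add: A B_def algebra_simps)
    then have "b powr (r - 1) * (A * b + B * a) = (l * b) powr r"
      using b l by (simp add: powr_mult powr_diff)
    also have "l * b = a" using b by (simp add: l_def)
    finally have "a powr r = b powr (r - 1) * (A * b + B * a)" by simp
    also have "\<dots> \<le> b powr (r - 1) * Re (cinner c (pos_cfc (\<lambda>s. s powr r) P c))"
      by (intro mult_left_mono 2) simp
    finally show ?thesis by (simp add: a_def)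
  qed
qed

section \<open>Uniqueness and existence of densities\<close>

text \<open>The base case asks nothing, not even continuity, so it is \<open>smooth1 (Suc k)\<close>
  that guarantees continuous derivatives up to order k; hence the shift by one in
  \<open>C_k_prod_fun\<close>.\<close>

primrec smooth1 :: "nat \<Rightarrow> (real \<Rightarrow> real) \<Rightarrow> bool" where
  "smooth1 0 f \<longleftrightarrow> True"
| "smooth1 (Suc k) f \<longleftrightarrow> (\<exists>f'. (\<forall>t. (f has_real_derivative f' t) (at t)) \<and> smooth1 k f')"

lemma smooth1_Suc_imp: "smooth1 (Suc k) f \<Longrightarrow> smooth1 k f"
proof (induction k arbitrary: f)
  case (Suc k)
  then obtain f' where "\<forall>t. (f has_real_derivative f' t) (at t)" "smooth1 (Suc k) f'" by auto
  with Suc.IH[of f'] show ?case by auto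
qed simp

lemma smooth1_add: "smooth1 k f \<Longrightarrow> smooth1 k g \<Longrightarrow> smooth1 k (\<lambda>t. f t + g t)"
proof (induction k arbitrary: f g)
  case (Suc k)
  then obtain f' g' where "\<forall>t. (f has_real_derivative f' t) (at t)" "smooth1 k f'"
      "\<forall>t. (g has_real_derivative g' t) (at t)" "smooth1 k g'" by auto
  with Suc.IH[of f' g'] show ?case
    by (auto intro!: exI[of _ "\<lambda>t. f' t + g' t"] derivative_eq_intros)
qed simp

lemma smooth1_mult: "smooth1 k f \<Longrightarrow> smooth1 k g \<Longrightarrow> smooth1 k (\<lambda>t. f t * g t)"
proof (induction k arbitrary: f g)
  case (Suc k)
  then obtain f' g' where f': "\<forall>t. (f has_real_derivative f' t) (at t)" "smooth1 k f'"
     and g': "\<forall>t. (g has_real_derivative g' t) (at t)" "smooth1 k g'" by auto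
  have "smooth1 k (\<lambda>t. f' t * g t + f t * g' t)"
    by (intro smooth1_add Suc.IH f' g' smooth1_Suc_imp[OF Suc.prems(1)] smooth1_Suc_imp[OF Suc.prems(2)])
  then show ?case
    unfolding smooth1.simps
    by (intro exI[of _ "\<lambda>t. f' t * g t + f t * g' t"]) (use f' g' in \<open>auto intro!: derivative_eq_intros\<close>)
qed simp

lemma smooth1_const: "smooth1 k (\<lambda>t. c)"
  by (induction k arbitrary: c) (auto intro!: exI[of _ "\<lambda>t. 0"] derivative_eq_intros)

lemma smooth1_inverse: "smooth1 k f \<Longrightarrow> (\<And>t. f t \<noteq> 0) \<Longrightarrow> smooth1 k (\<lambda>t. inverse (f t))"
proof (induction k)
  case (Suc k)
  then obtain f' where f': "\<forall>t. (f has_real_derivative f' t) (at t)" "smooth1 k f'" by auto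
  have i: "smooth1 k (\<lambda>t. inverse (f t))" using Suc smooth1_Suc_imp by blast
  have "smooth1 k (\<lambda>t. (-1) * f' t * (inverse (f t) * inverse (f t)))"
    by (intro smooth1_mult smooth1_const f' i)
  moreover have "((\<lambda>t. inverse (f t)) has_real_derivative (-1) * f' t * (inverse (f t) * inverse (f t))) (at t)" for t
    using f'(1) Suc(3) by (auto intro!: derivative_eq_intros simp: divide_simps)
  ultimately show ?case
    unfolding smooth1.simps by (intro exI[of _ "\<lambda>t. (-1) * f' t * (inverse (f t) * inverse (f t))"] conjI allI)
qed simp

lemma smooth1_affine: "smooth1 k f \<Longrightarrow> smooth1 k (\<lambda>t. f (a * t + b))"
proof (induction k arbitrary: f)
  case (Suc k)
  then obtain f' where f': "\<forall>t. (f has_real_derivative f' t) (at t)" "smooth1 k f'" by auto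
  have "smooth1 k (\<lambda>t. f' (a * t + b) * a)"
    by (intro smooth1_mult smooth1_const Suc.IH f')
  moreover have "((\<lambda>t. f (a * t + b)) has_real_derivative f' (a * t + b) * a) (at t)" for t
    by (rule DERIV_chain2[OF f'(1)[rule_format]]) (auto intro!: derivative_eq_intros)
  ultimately show ?case
    unfolding smooth1.simps by (intro exI[of _ "\<lambda>t. f' (a * t + b) * a"] conjI allI)
qed simp

text \<open>The functions \<open>q(1/t) exp(-1/t)\<close> for \<open>t > 0\<close>, extended by zero, form a class closed under differentiation.\<close>

definition flat :: "real poly \<Rightarrow> real \<Rightarrow> real" where
  "flat q t = (if t \<le> 0 then 0 else poly q (1 / t) * exp (- (1 / t)))"

lemma poly_div_exp_tendsto_0: "((\<lambda>x. poly q x * exp (- x)) \<longlongrightarrow> (0::real)) at_top"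
proof -
  have "((\<lambda>x. \<Sum>i\<le>degree q. coeff q i * (x ^ i / exp x)) \<longlongrightarrow> (\<Sum>i\<le>degree q. coeff q i * 0)) at_top"
    by (intro tendsto_sum tendsto_mult tendsto_const tendsto_power_div_exp_0)
  moreover have "(\<lambda>x. poly q x * exp (- x)) = (\<lambda>x. \<Sum>i\<le>degree q. coeff q i * (x ^ i / exp x))"
    by (simp add: fun_eq_iff poly_altdef sum_distrib_right exp_minus divide_inverse mult.assoc)
  ultimately show ?thesis by simp
qed

text \<open>For t > 0 the derivative is x^2 (q(x) - q'(x)) exp(-x) at x = 1/t. At t = 0 the right
  difference quotient is x q(x) exp(-x) with x tending to infinity, hence the
  \<open>pCons 0 q\<close>.\<close>

lemma flat_derivative: "(flat q has_real_derivative flat ([:0, 0, 1:] * (q - pderiv q)) t) (at t)"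
proof -
  consider "t < 0" | "t > 0" | "t = 0" by linarith
  then show ?thesis
  proof cases
    case 1
    have "((\<lambda>t. 0) has_real_derivative flat ([:0, 0, 1:] * (q - pderiv q)) t) (at t)"
      using 1 by (simp add: flat_def)
    then show ?thesis
      by (rule has_field_derivative_transform_within_open[of _ _ _ "{..<0}"]) (use 1 in \<open>auto simp: flat_def\<close>)
  next
    case 2
    have "((\<lambda>t. poly q (1 / t) * exp (- (1 / t))) has_real_derivative flat ([:0, 0, 1:] * (q - pderiv q)) t) (at t)"
      using 2 by (auto intro!: derivative_eq_intros simp: flat_def power2_eq_square field_simps)
    then show ?thesis
      by (rule has_field_derivative_transform_within_open[of _ _ _ "{0<..}"]) (use 2 in \<open>auto simp: flat_def\<close>)
  next
    case 3
    have "((\<lambda>x. poly (pCons 0 q) x * exp (- x)) \<longlongrightarrow> 0) at_top" by (rule poly_div_exp_tendsto_0)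
    from filterlim_compose[OF this filterlim_inverse_at_top_right]
    have "((\<lambda>h. poly (pCons 0 q) (inverse h) * exp (- inverse h)) \<longlongrightarrow> 0) (at_right 0)" .
    then have r: "((\<lambda>h. flat q h / h) \<longlongrightarrow> 0) (at_right 0)"
    proof (rule Lim_transform_eventually)
      show "\<forall>\<^sub>F h in at_right 0. poly (pCons 0 q) (inverse h) * exp (- inverse h) = flat q h / h"
        using eventually_at_right_less by eventually_elim (simp add: flat_def field_simps)
    qed
    have l: "((\<lambda>h. flat q h / h) \<longlongrightarrow> 0) (at_left 0)"
    proof (rule tendsto_eventually)
      show "\<forall>\<^sub>F h in at_left 0. flat q h / h = 0"
        unfolding eventually_at_left_field by (intro exI[of _ "-1"]) (auto simp: flat_def)
    qed
    have "((\<lambda>h. flat q h / h) \<longlongrightarrow> 0) (at 0)"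
      by (rule filterlim_split_at[OF l r])
    then show ?thesis using 3 by (simp add: DERIV_def flat_def)
  qed
qed

lemma smooth1_flat: "smooth1 k (flat q)"
proof (induction k arbitrary: q)
  case (Suc k)
  then show ?case unfolding smooth1.simps using flat_derivative by blast
qed simp

text \<open>The quotient is exactly 1 from t = 1 on, so that products of such functions can equal 1
  on a prescribed box, as a cut-off must.\<close>

definition step :: "real \<Rightarrow> real" where
  "step t = flat 1 t * inverse (flat 1 t + flat 1 (1 - t))"

lemma flat_1_nonneg: "0 \<le> flat 1 t"
  by (simp add: flat_def)

lemma flat_1_pos: "0 < t \<Longrightarrow> 0 < flat 1 t"
  by (simp add: flat_def)

lemma step_denominator_pos: "0 < flat 1 t + flat 1 (1 - t)"
proof (cases "t > 0")
  case True
  then show ?thesis using flat_1_pos[of t] flat_1_nonneg[of "1 - t"] by linarith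
next
  case False
  then show ?thesis using flat_1_pos[of "1 - t"] flat_1_nonneg[of t] by linarith
qed

lemma smooth1_step: "smooth1 k step"
proof -
  have "smooth1 k (\<lambda>t. flat 1 ((-1) * t + 1))" by (intro smooth1_affine smooth1_flat)
  then have "smooth1 k (\<lambda>t. flat 1 t + flat 1 (1 - t))"
    using smooth1_add[OF smooth1_flat] by simp
  then have "smooth1 k (\<lambda>t. inverse (flat 1 t + flat 1 (1 - t)))"
    by (rule smooth1_inverse) (use step_denominator_pos less_irrefl in metis)
  then show ?thesis using smooth1_mult[OF smooth1_flat] unfolding step_def[abs_def] by blast
qed

lemma step_0: "t \<le> 0 \<Longrightarrow> step t = 0"
  by (simp add: step_def flat_def)

lemma step_1: "t \<ge> 1 \<Longrightarrow> step t = 1"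
  using flat_1_pos[of t] by (simp add: step_def flat_def[of 1 "1 - t"])

lemma step_bounds: "0 \<le> step t" "step t \<le> 1"
  using step_denominator_pos[of t] flat_1_nonneg[of t] flat_1_nonneg[of "1 - t"]
  by (auto simp: step_def divide_inverse[symmetric])

text \<open>A class closed under partial derivatives: differentiating in direction i replaces the
  factor \<open>f i\<close> by its derivative. This makes \<open>C_k\<close> accessible to
  induction.\<close>

definition prod_fun :: "(3 \<Rightarrow> real \<Rightarrow> real) \<Rightarrow> real^3 \<Rightarrow> complex" where
  "prod_fun f x = of_real (\<Prod>i\<in>UNIV. f i (x $ i))"

lemma prod_fun_has_derivative:
  assumes "\<And>i t. (f i has_real_derivative f' i t) (at t)"
  shows "(prod_fun f has_derivative (\<lambda>h. \<Sum>i\<in>UNIV. of_real (h $ i) * prod_fun (f(i := f' i)) x)) (at x)"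
proof -
  have 1: "((\<lambda>x. f i (x $ i)) has_derivative (\<lambda>h. f' i (x $ i) * h $ i)) (at x)" for i
  proof -
    have v: "((\<lambda>x. x $ i) has_derivative (\<lambda>h. h $ i)) (at x)"
      by (rule bounded_linear_imp_has_derivative[OF bounded_linear_vec_nth])
    have d: "(f i has_derivative (\<lambda>y. f' i (x $ i) * y)) (at (x $ i))"
      using assms[of i "x $ i"] unfolding has_field_derivative_def .
    show ?thesis by (rule has_derivative_compose[OF v d])
  qed
  have 2: "((\<lambda>x. \<Prod>i\<in>UNIV. f i (x $ i)) has_derivative
      (\<lambda>h. \<Sum>i\<in>UNIV. (f' i (x $ i) * h $ i) * (\<Prod>j\<in>UNIV - {i}. f j (x $ j)))) (at x)"
    by (rule has_derivative_prod) (rule 1)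
  have 3: "(f' i (x $ i) * h $ i) * (\<Prod>j\<in>UNIV - {i}. f j (x $ j)) = h $ i * (\<Prod>j\<in>UNIV. (f(i := f' i)) j (x $ j))"
    for i and h :: "real^3"
  proof -
    have "(\<Prod>j\<in>UNIV. (f(i := f' i)) j (x $ j)) = f' i (x $ i) * (\<Prod>j\<in>UNIV - {i}. (f(i := f' i)) j (x $ j))"
      by (subst prod.remove[of UNIV i]) auto
    also have "(\<Prod>j\<in>UNIV - {i}. (f(i := f' i)) j (x $ j)) = (\<Prod>j\<in>UNIV - {i}. f j (x $ j))"
      by (intro prod.cong) auto
    finally show ?thesis by simp
  qed
  have "((\<lambda>x. complex_of_real (\<Prod>i\<in>UNIV. f i (x $ i))) has_derivative
      (\<lambda>h. of_real (\<Sum>i\<in>UNIV. h $ i * (\<Prod>j\<in>UNIV. (f(i := f' i)) j (x $ j))))) (at x)"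
    using bounded_linear.has_derivative[OF bounded_linear_of_real 2] unfolding 3 .
  then show ?thesis unfolding prod_fun_def[abs_def] by (simp add: of_real_sum)
qed

lemma C_k_prod_fun: "(\<And>i. smooth1 (Suc k) (f i)) \<Longrightarrow> C_k k (prod_fun f)"
proof (induction k arbitrary: f)
  case 0
  then have "\<forall>i. \<exists>f'. \<forall>t. (f i has_real_derivative f' t) (at t)" by simp
  then obtain f' where f': "\<And>i t. (f i has_real_derivative f' i t) (at t)" by metis
  then have "prod_fun f differentiable at x" for x
    using prod_fun_has_derivative differentiable_def by blast
  then show ?case
    by (simp add: continuous_at_imp_continuous_on differentiable_imp_continuous_within)
next
  case (Suc k)
  then have "\<forall>i. \<exists>f'. (\<forall>t. (f i has_real_derivative f' t) (at t)) \<and> smooth1 (Suc k) f'" by simp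
  then obtain f' where f': "\<And>i t. (f i has_real_derivative f' i t) (at t)" "\<And>i. smooth1 (Suc k) (f' i)" by metis
  have d: "(prod_fun f has_derivative (\<lambda>h. \<Sum>i\<in>UNIV. of_real (h $ i) * prod_fun (f(i := f' i)) x)) (at x)" for x
    by (rule prod_fun_has_derivative) (rule f'(1))
  have "frechet_derivative (prod_fun f) (at x) (axis j 1) = prod_fun (f(j := f' j)) x" for j x
  proof -
    have "frechet_derivative (prod_fun f) (at x) (axis j 1) = (\<Sum>i\<in>UNIV. of_real (axis j 1 $ i) * prod_fun (f(i := f' i)) x)"
      by (subst frechet_derivative_at[OF d, symmetric]) (rule refl)
    also have "\<dots> = (\<Sum>i\<in>UNIV. if i = j then prod_fun (f(i := f' i)) x else 0)"
      by (intro sum.cong) (auto simp: axis_def)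
    finally show ?thesis by simp
  qed
  moreover have "C_k k (prod_fun (f(j := f' j)))" for j
  proof (rule Suc.IH)
    show "smooth1 (Suc k) ((f(j := f' j)) i)" for i
      using f'(2)[of j] smooth1_Suc_imp[OF Suc.prems, of i] by (cases "i = j") (simp_all del: smooth1.simps)
  qed
  moreover have "prod_fun f differentiable (at x)" for x
    using d differentiable_def by blast
  ultimately show ?case
    by (auto simp: Basis_vec_def)
qed

text \<open>For n > 0 the parameter is the steepness of the edges: the function is 1 at distance 1/n
  from the faces, vanishes outside the open box, and tends to the indicator of that box as n
  grows.\<close>

definition bump :: "real \<Rightarrow> real^3 \<Rightarrow> real^3 \<Rightarrow> real^3 \<Rightarrow> complex" where
  "bump n a b = prod_fun (\<lambda>i t. step (n * (t - a $ i)) * step (n * (b $ i - t)))"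

lemma bump_outside:
  assumes "x \<notin> box a b" "n \<ge> 0"
  shows "bump n a b x = 0"
proof -
  obtain i where "x $ i \<le> a $ i \<or> b $ i \<le> x $ i" using assms(1) by (auto simp: mem_box_cart not_less)
  then have "step (n * (x $ i - a $ i)) * step (n * (b $ i - x $ i)) = 0"
    using assms(2) by (auto simp: step_0 mult_nonneg_nonpos)
  then show ?thesis unfolding bump_def prod_fun_def by (auto intro!: prod_zero)
qed

lemma bump_inside:
  fixes x a b :: "real^3"
  assumes "\<And>i. n * (x $ i - a $ i) \<ge> 1" "\<And>i. n * (b $ i - x $ i) \<ge> 1"
  shows "bump n a b x = 1"
  unfolding bump_def prod_fun_def by (simp add: step_1 assms)

lemma cmod_bump_le: "cmod (bump n a b x) \<le> 1"
  unfolding bump_def prod_fun_def norm_of_real abs_prod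
  by (rule prod_le_1) (auto simp: abs_mult step_bounds mult_le_one)

lemma support_bump:
  assumes "n \<ge> 0"
  shows "support (bump n a b) \<subseteq> cbox a b"
  unfolding support_def
proof (rule closure_minimal)
  show "{x. bump n a b x \<noteq> 0} \<subseteq> cbox a b"
    using bump_outside[OF _ assms] box_subset_cbox by blast
qed (rule closed_cbox)

lemma test_function_bump:
  assumes "n \<ge> 0"
  shows "test_function (bump n a b)"
proof -
  have "smooth1 k (\<lambda>t. step (n * (t - a $ i)) * step (n * (b $ i - t)))" for k i
  proof (rule smooth1_mult)
    show "smooth1 k (\<lambda>t. step (n * (t - a $ i)))"
      using smooth1_affine[OF smooth1_step, of k n "- (n * a $ i)"] by (simp add: algebra_simps)
    show "smooth1 k (\<lambda>t. step (n * (b $ i - t)))"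
      using smooth1_affine[OF smooth1_step, of k "- n" "n * b $ i"] by (simp add: algebra_simps)
  qed
  then have "C_k k (bump n a b)" for k unfolding bump_def by (intro C_k_prod_fun)
  moreover have "compact (support (bump n a b))"
  proof -
    have "compact (cbox a b \<inter> support (bump n a b))"
      by (intro compact_Int_closed compact_cbox) (simp add: support_def)
    then show ?thesis using support_bump[OF assms, of a b] by (simp add: Int_absorb1)
  qed
  ultimately show ?thesis by (simp add: test_function_def)
qed

lemma test_function_measurable: "test_function V \<Longrightarrow> V \<in> borel_measurable lborel"
proof -
  assume "test_function V"
  then have "C_k 0 V" unfolding test_function_def by blast
  then show ?thesis by (simp add: borel_measurable_continuous_onI)
qed

lemma test_function_bounded:
  assumes "test_function V"
  obtains K where "\<And>x. cmod (V x) \<le> K" "0 \<le> K"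
proof -
  have "C_k 0 V" and c: "compact (support V)" using assms unfolding test_function_def by blast+
  then have "continuous_on UNIV V" by simp
  then have "compact (V ` support V)"
    by (intro compact_continuous_image c) (rule continuous_on_subset, auto)
  then obtain K where K: "\<And>x. x \<in> support V \<Longrightarrow> cmod (V x) \<le> K"
    using compact_imp_bounded bounded_iff by (metis imageI)
  have "cmod (V x) \<le> max K 0" for x
  proof (cases "V x = 0")
    case False
    then have "x \<in> support V" unfolding support_def using closure_subset[of "{x. V x \<noteq> 0}"] by auto
    then show ?thesis using K by (simp add: le_max_iff_disj)
  qed simp
  then show ?thesis by (rule that) simp
qed

lemma not_in_support: "x \<notin> support V \<Longrightarrow> V x = 0"
  unfolding support_def using closure_subset[of "{x. V x \<noteq> 0}"] by auto

lemma test_function_mult_integrable: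
  assumes V: "test_function V" and r: "\<rho> \<in> borel_measurable lborel" "\<And>K. compact K \<Longrightarrow> set_integrable lborel K \<rho>"
  shows "integrable lborel (\<lambda>x. V x * \<rho> x)"
proof -
  obtain K where K: "\<And>x. cmod (V x) \<le> K" "0 \<le> K" using test_function_bounded[OF V] by blast
  have c: "compact (support V)" using V by (simp add: test_function_def)
  have [measurable]: "V \<in> borel_measurable borel" "\<rho> \<in> borel_measurable borel"
    using test_function_measurable[OF V] r(1) by simp_all
  have "integrable lborel (\<lambda>x. K * norm (indicator (support V) x *\<^sub>R \<rho> x))"
    using r(2)[OF c] unfolding set_integrable_def by (intro integrable_mult_right integrable_norm)
  then show ?thesis
  proof (rule Bochner_Integration.integrable_bound)
    show "AE x in lborel. norm (V x * \<rho> x) \<le> norm (K * norm (indicator (support V) x *\<^sub>R \<rho> x))"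
    proof (rule AE_I2)
      fix x
      show "norm (V x * \<rho> x) \<le> norm (K * norm (indicator (support V) x *\<^sub>R \<rho> x))"
        by (cases "x \<in> support V") (use K in \<open>auto simp: not_in_support norm_mult abs_mult intro!: mult_right_mono\<close>)
    qed
  qed simp
qed

lemma is_densityD:
  assumes "is_density h A \<rho>"
  shows "\<rho> \<in> borel_measurable lborel" "compact K \<Longrightarrow> set_integrable lborel K \<rho>"
    and "test_function V \<Longrightarrow> test_function \<eta> \<Longrightarrow> \<forall>x\<in>support V. \<eta> x = 1 \<Longrightarrow>
      (LINT x|lborel. V x * \<rho> x) = of_real ((2 * pi * h) ^ 3) * op_trace (mult_op V \<circ> A \<circ> mult_op \<eta>)"
  using assms unfolding is_density_def by simp_all

text \<open>The trace formula fixes the integrals against bumps, which converge to box indicators,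
  and the integrals over boxes determine a locally integrable function almost everywhere.\<close>

lemma is_density_unique:
  assumes 1: "is_density h A \<rho>\<^sub>1" and 2: "is_density h A \<rho>\<^sub>2"
  shows "AE x in lborel. \<rho>\<^sub>1 x = \<rho>\<^sub>2 x"
proof -
  define f where "f x = \<rho>\<^sub>1 x - \<rho>\<^sub>2 x" for x
  note m = is_densityD(1)[OF 1] is_densityD(1)[OF 2]
  note l = is_densityD(2)[OF 1] is_densityD(2)[OF 2]
  have [measurable]: "f \<in> borel_measurable borel" unfolding f_def using m by simp
  have box: "set_integrable lborel (box a b) f" for a b
  proof (rule set_integrable_subset)
    show "set_integrable lborel (cbox a b) f" unfolding f_def by (intro set_integral_diff l compact_cbox)
  qed (auto simp: box_subset_cbox)
  have "AE x in lborel. f x = 0"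
  proof (rule AE_zero_of_box_integrals[OF box])
    fix a b :: "real^3"
    have z: "(LINT x|lborel. bump (real n) a b x * f x) = 0" for n
    proof -
      define V where "V = bump (real n) a b"
      \<comment> \<open>Steepness 1 and a box larger by 1 in every coordinate make this 1 on the
        closed box, which contains the support of V.\<close>
      define \<eta> where "\<eta> = bump 1 (a - 1) (b + 1)"
      have V: "test_function V" "test_function \<eta>" unfolding V_def \<eta>_def by (simp_all add: test_function_bump)
      have "\<forall>x\<in>support V. \<eta> x = 1"
      proof
        fix x assume "x \<in> support V"
        then have "x \<in> cbox a b" using support_bump[of "real n" a b] unfolding V_def by auto
        then show "\<eta> x = 1" unfolding \<eta>_def by (intro bump_inside) (auto simp: mem_box_cart)
      qed
      then have "(LINT x|lborel. V x * \<rho>\<^sub>1 x) = (LINT x|lborel. V x * \<rho>\<^sub>2 x)"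
        using is_densityD(3)[OF 1 V] is_densityD(3)[OF 2 V] by simp
      moreover have "integrable lborel (\<lambda>x. V x * \<rho>\<^sub>1 x)" "integrable lborel (\<lambda>x. V x * \<rho>\<^sub>2 x)"
        by (intro test_function_mult_integrable V m l; assumption)+
      ultimately show ?thesis unfolding f_def V_def[symmetric] by (simp add: right_diff_distrib)
    qed
    have "(\<lambda>n. LINT x|lborel. bump (real n) a b x * f x) \<longlonglongrightarrow> (LINT x|lborel. indicator (box a b) x *\<^sub>R f x)"
    proof (rule integral_dominated_convergence[where w = "\<lambda>x. norm (indicator (box a b) x *\<^sub>R f x)"])
      show "integrable lborel (\<lambda>x. norm (indicator (box a b) x *\<^sub>R f x))"
        using box[of a b] unfolding set_integrable_def by (rule integrable_norm)
      show "AE x in lborel. norm (bump (real n) a b x * f x) \<le> norm (indicator (box a b) x *\<^sub>R f x)" for n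
      proof (rule AE_I2)
        fix x
        show "norm (bump (real n) a b x * f x) \<le> norm (indicator (box a b) x *\<^sub>R f x)"
          by (cases "x \<in> box a b") (auto simp: bump_outside norm_mult intro!: mult_left_le_one_le cmod_bump_le)
      qed
      show "AE x in lborel. (\<lambda>n. bump (real n) a b x * f x) \<longlonglongrightarrow> indicator (box a b) x *\<^sub>R f x"
      proof (rule AE_I2)
        fix x
        show "(\<lambda>n. bump (real n) a b x * f x) \<longlonglongrightarrow> indicator (box a b) x *\<^sub>R f x"
        proof (cases "x \<in> box a b")
          case True
          have ev: "\<forall>\<^sub>F n in sequentially. real n * c \<ge> 1" if c: "c > 0" for c
          proof -
            obtain N :: nat where N: "1 < real N * c" using ex_less_of_nat_mult[OF c] by blast
            then show ?thesis unfolding eventually_sequentially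
              by (intro exI[of _ N]) (use c in \<open>auto intro: order_trans[OF less_imp_le[OF N] mult_right_mono]\<close>)
          qed
          have "\<forall>\<^sub>F n in sequentially. \<forall>i\<in>UNIV. real n * (x $ i - a $ i) \<ge> 1 \<and> real n * (b $ i - x $ i) \<ge> 1"
          proof (rule eventually_ball_finite)
            show "\<forall>i\<in>UNIV. \<forall>\<^sub>F n in sequentially. real n * (x $ i - a $ i) \<ge> 1 \<and> real n * (b $ i - x $ i) \<ge> 1"
              by (intro ballI eventually_conj ev) (use True in \<open>auto simp: mem_box_cart\<close>)
          qed simp
          then have "\<forall>\<^sub>F n in sequentially. bump (real n) a b x * f x = indicator (box a b) x *\<^sub>R f x"
            by eventually_elim (use True in \<open>simp add: bump_inside\<close>)
          then show ?thesis by (rule tendsto_eventually)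
        qed (simp add: bump_outside)
      qed
      show "(\<lambda>x. bump (real n) a b x * f x) \<in> borel_measurable lborel" for n
        using test_function_measurable[OF test_function_bump[of "real n" a b]] by simp
    qed simp
    then show "(LINT x:box a b|lborel. f x) = 0"
      by (simp add: z set_lebesgue_integral_def LIMSEQ_const_iff)
  qed simp
  then show ?thesis by (simp add: f_def)
qed

section \<open>Densities of operator products\<close>

definition dens :: "(L2 \<Rightarrow> L2) \<Rightarrow> real^3 \<Rightarrow> ennreal" where
  "dens X x = (\<Sum>n. ennreal ((cmod (fun_of (X (onb_seq n)) x))\<^sup>2))"

text \<open>Formally the diagonal of the kernel of X Y^*; it is meaningful where both
  \<open>dens X\<close> and \<open>dens Y\<close> are finite.\<close>

definition cross_dens :: "(L2 \<Rightarrow> L2) \<Rightarrow> (L2 \<Rightarrow> L2) \<Rightarrow> real^3 \<Rightarrow> complex" where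
  "cross_dens X Y x = (\<Sum>n. fun_of (X (onb_seq n)) x * cnj (fun_of (Y (onb_seq n)) x))"

lemma dens_measurable [measurable]: "dens X \<in> borel_measurable lborel"
  unfolding dens_def[abs_def] by measurable

lemma cross_dens_measurable [measurable]: "cross_dens X Y \<in> borel_measurable lborel"
  unfolding cross_dens_def[abs_def] by measurable

lemma cmod_mult_le_half: "cmod (a * cnj b) \<le> ((cmod a)\<^sup>2 + (cmod b)\<^sup>2) / 2"
  using sum_squares_bound[of "cmod a" "cmod b"] by (simp add: norm_mult)

lemma dens_summable:
  assumes "dens X x < \<infinity>"
  shows "(\<lambda>n. (cmod (fun_of (X (onb_seq n)) x))\<^sup>2) sums enn2real (dens X x)"
proof -
  have s: "summable (\<lambda>n. (cmod (fun_of (X (onb_seq n)) x))\<^sup>2)"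
    by (rule summable_suminf_not_top) (use assms in \<open>auto simp: dens_def\<close>)
  then have "dens X x = ennreal (\<Sum>n. (cmod (fun_of (X (onb_seq n)) x))\<^sup>2)"
    unfolding dens_def by (intro suminf_ennreal2) auto
  then show ?thesis using s by (simp add: summable_sums_iff suminf_nonneg)
qed

lemma cross_dens_bound:
  assumes "dens X x < \<infinity>" "dens Y x < \<infinity>"
  shows "summable (\<lambda>n. cmod (fun_of (X (onb_seq n)) x * cnj (fun_of (Y (onb_seq n)) x)))"
    and "cmod (cross_dens X Y x) \<le> (enn2real (dens X x) + enn2real (dens Y x)) / 2"
proof -
  have s: "(\<lambda>n. ((cmod (fun_of (X (onb_seq n)) x))\<^sup>2 + (cmod (fun_of (Y (onb_seq n)) x))\<^sup>2) / 2) sums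
      ((enn2real (dens X x) + enn2real (dens Y x)) / 2)"
    by (intro sums_divide sums_add dens_summable assms)
  show sm: "summable (\<lambda>n. cmod (fun_of (X (onb_seq n)) x * cnj (fun_of (Y (onb_seq n)) x)))"
    by (rule summable_comparison_test'[OF sums_summable[OF s], where N = 0]) (use cmod_mult_le_half in auto)
  have "cmod (cross_dens X Y x) \<le> (\<Sum>n. cmod (fun_of (X (onb_seq n)) x * cnj (fun_of (Y (onb_seq n)) x)))"
    unfolding cross_dens_def by (rule summable_norm[OF sm])
  also have "\<dots> \<le> (\<Sum>n. ((cmod (fun_of (X (onb_seq n)) x))\<^sup>2 + (cmod (fun_of (Y (onb_seq n)) x))\<^sup>2) / 2)"
    by (intro suminf_le sm sums_summable[OF s] cmod_mult_le_half)
  also have "\<dots> = (enn2real (dens X x) + enn2real (dens Y x)) / 2"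
    using s by (simp add: sums_iff)
  finally show "cmod (cross_dens X Y x) \<le> (enn2real (dens X x) + enn2real (dens Y x)) / 2" .
qed

text \<open>Sum and integral are exchanged. This is how local integrability of the density becomes
  the Hilbert-Schmidt property after a cut-off.\<close>

lemma hs_sq_mult_op:
  assumes [measurable]: "m \<in> borel_measurable lborel" and K: "\<And>x. cmod (m x) \<le> K"
  shows "hs_sq (\<lambda>u. mult_op m (X u)) = (\<integral>\<^sup>+x. ennreal ((cmod (m x))\<^sup>2) * dens X x \<partial>lborel)"
proof -
  have "ennreal ((norm (mult_op m u))\<^sup>2) = (\<integral>\<^sup>+x. ennreal ((cmod (m x))\<^sup>2) * ennreal ((cmod (fun_of u x))\<^sup>2) \<partial>lborel)" for u
    unfolding mult_op_def norm_L2_of[OF square_integrable_mult_fun_of[OF assms]]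
    by (simp add: norm_mult power_mult_distrib ennreal_mult)
  then have "hs_sq (\<lambda>u. mult_op m (X u)) = (\<Sum>n. \<integral>\<^sup>+x. ennreal ((cmod (m x))\<^sup>2) * ennreal ((cmod (fun_of (X (onb_seq n)) x))\<^sup>2) \<partial>lborel)"
    by (simp add: hs_sq_def)
  also have "\<dots> = (\<integral>\<^sup>+x. (\<Sum>n. ennreal ((cmod (m x))\<^sup>2) * ennreal ((cmod (fun_of (X (onb_seq n)) x))\<^sup>2)) \<partial>lborel)"
    by (rule nn_integral_suminf[symmetric]) auto
  finally show ?thesis by (simp add: dens_def)
qed

lemma nn_integral_dens: "(\<integral>\<^sup>+x. dens X x \<partial>lborel) = hs_sq X"
  unfolding dens_def hs_sq_def by (subst nn_integral_suminf) (auto simp: nn_integral_norm_sq)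

lemma half_le: "c \<le> (a + b) / 2 \<Longrightarrow> 0 \<le> a \<Longrightarrow> 0 \<le> b \<Longrightarrow> c \<le> a + (b::real)"
  by simp

text \<open>Local integrability of the two densities makes V X and cnj \<eta> Y Hilbert-Schmidt. The
  trace of V X Y^* \<eta> is then the sum of the inner products of cnj \<eta> Y e with V X e, each
  the integral of V \<eta> times one term of \<open>cross_dens\<close>; the factor \<eta> drops out
  because it is 1 where V does not vanish.\<close>

lemma is_density_product:
  assumes X: "bounded_clinear X" and Y: "bounded_clinear Y"
    and dX: "\<And>K. compact K \<Longrightarrow> (\<integral>\<^sup>+x\<in>K. dens X x \<partial>lborel) < \<infinity>"
    and dY: "\<And>K. compact K \<Longrightarrow> (\<integral>\<^sup>+x\<in>K. dens Y x \<partial>lborel) < \<infinity>"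
    and h: "h > 0"
  shows "is_density h (\<lambda>u. X (adjoint Y u)) (\<lambda>x. of_real ((2 * pi * h) ^ 3) * cross_dens X Y x)"
proof -
  \<comment> \<open>Integrability on each of countably many balls covering the space gives
    finiteness almost everywhere.\<close>
  have fin: "AE x in lborel. Z x < \<infinity>"
    if [measurable]: "Z \<in> borel_measurable lborel" and Z: "\<And>K. compact K \<Longrightarrow> (\<integral>\<^sup>+x\<in>K. Z x \<partial>lborel) < \<infinity>"
    for Z :: "real^3 \<Rightarrow> ennreal"
  proof -
    have "AE x in lborel. Z x * indicator (cball 0 (real n)) x \<noteq> \<infinity>" for n
    proof (rule nn_integral_PInf_AE)
      show "(\<lambda>x. Z x * indicator (cball 0 (real n)) x) \<in> borel_measurable lborel"
        by (intro borel_measurable_times_ennreal borel_measurable_indicator that(1)) simp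
    qed (use Z[of "cball 0 (real n)"] in auto)
    then have "AE x in lborel. \<forall>n. Z x * indicator (cball 0 (real n)) x \<noteq> \<infinity>"
      unfolding AE_all_countable by blast
    then show ?thesis
    proof eventually_elim
      case (elim x)
      obtain n where "norm x \<le> real n" using real_arch_simple by blast
      then show ?case using elim[rule_format, of n] by (simp add: less_top)
    qed
  qed
  have fX: "AE x in lborel. dens X x < \<infinity>" and fY: "AE x in lborel. dens Y x < \<infinity>"
    by (rule fin; use dX dY in auto)+
  have int: "set_integrable lborel K (cross_dens X Y)" if K: "compact K" for K
    unfolding set_integrable_def
  proof (rule integrableI_bounded)
    have [measurable]: "K \<in> sets borel" using K by (simp add: borel_compact)
    show "(\<lambda>x. indicat_real K x *\<^sub>R cross_dens X Y x) \<in> borel_measurable lborel" by simp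
    have "(\<integral>\<^sup>+x. ennreal (norm (indicat_real K x *\<^sub>R cross_dens X Y x)) \<partial>lborel)
        \<le> (\<integral>\<^sup>+x. dens X x * indicator K x + dens Y x * indicator K x \<partial>lborel)"
    proof (rule nn_integral_mono_AE)
      show "AE x in lborel. ennreal (norm (indicat_real K x *\<^sub>R cross_dens X Y x))
          \<le> dens X x * indicator K x + dens Y x * indicator K x"
        using fX fY
      proof eventually_elim
        case (elim x)
        have "cmod (cross_dens X Y x) \<le> enn2real (dens X x) + enn2real (dens Y x)"
          by (rule half_le[OF cross_dens_bound(2)[OF elim]]) simp_all
        then have "ennreal (cmod (cross_dens X Y x)) \<le> ennreal (enn2real (dens X x) + enn2real (dens Y x))"
          by (rule ennreal_leI)
        also have "\<dots> = dens X x + dens Y x" using elim by (simp add: ennreal_plus)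
        finally show ?case by (auto split: split_indicator)
      qed
    qed
    also have "\<dots> < \<infinity>" using dX[OF K] dY[OF K] by (subst nn_integral_add) auto
    finally show "(\<integral>\<^sup>+x. ennreal (norm (indicat_real K x *\<^sub>R cross_dens X Y x)) \<partial>lborel) < \<infinity>" .
  qed
  have main: "trace_class (mult_op V \<circ> (\<lambda>u. X (adjoint Y u)) \<circ> mult_op \<eta>) \<and>
      (LINT x|lborel. V x * cross_dens X Y x) = op_trace (mult_op V \<circ> (\<lambda>u. X (adjoint Y u)) \<circ> mult_op \<eta>)"
    if V: "test_function V" and e: "test_function \<eta>" and one: "\<forall>x\<in>support V. \<eta> x = 1" for V \<eta>
  proof -
    obtain KV where KV: "\<And>x. cmod (V x) \<le> KV" "0 \<le> KV" using test_function_bounded[OF V] by blast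
    obtain Ke where Ke: "\<And>x. cmod (\<eta> x) \<le> Ke" "0 \<le> Ke" using test_function_bounded[OF e] by blast
    have mV [measurable]: "V \<in> borel_measurable lborel" and me [measurable]: "\<eta> \<in> borel_measurable lborel"
      using test_function_measurable V e by auto
    define X' where "X' u = mult_op V (X u)" for u
    \<comment> \<open>The conjugate appears because the cut-off stands to the right of
      \<open>adjoint Y\<close> and is moved to the left of Y as its adjoint.\<close>
    define Y' where "Y' u = mult_op (\<lambda>x. cnj (\<eta> x)) (Y u)" for u
    have bX: "bounded_clinear X'"
      unfolding X'_def by (rule bounded_clinear_compose[OF bounded_clinear_mult_op[OF mV KV(1)] X])
    have Ke': "cmod (cnj (\<eta> x)) \<le> Ke" for x using Ke(1)[of x] by simp
    have me': "(\<lambda>x. cnj (\<eta> x)) \<in> borel_measurable lborel" by simp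
    note be = bounded_clinear_mult_op[OF me' Ke']
    have bY: "bounded_clinear Y'"
      unfolding Y'_def by (rule bounded_clinear_compose[OF be Y])
    have hs: "hs_sq (\<lambda>u. mult_op m (Z u)) < \<infinity>"
      if [measurable]: "m \<in> borel_measurable lborel" and K: "\<And>x. cmod (m x) \<le> K" "0 \<le> K" and S: "compact S" "\<And>x. x \<notin> S \<Longrightarrow> m x = 0"
       and Z: "\<And>K. compact K \<Longrightarrow> (\<integral>\<^sup>+x\<in>K. dens Z x \<partial>lborel) < \<infinity>" for m K Z S
    proof -
      have [measurable]: "S \<in> sets borel" using S by (simp add: borel_compact)
      have "hs_sq (\<lambda>u. mult_op m (Z u)) = (\<integral>\<^sup>+x. ennreal ((cmod (m x))\<^sup>2) * dens Z x \<partial>lborel)"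
        by (rule hs_sq_mult_op[OF that(1) K(1)])
      also have "\<dots> \<le> (\<integral>\<^sup>+x. ennreal (K\<^sup>2) * (dens Z x * indicator S x) \<partial>lborel)"
      proof (rule nn_integral_mono)
        fix x
        show "ennreal ((cmod (m x))\<^sup>2) * dens Z x \<le> ennreal (K\<^sup>2) * (dens Z x * indicator S x)"
          by (cases "x \<in> S") (use S(2) K in \<open>auto intro!: mult_right_mono ennreal_leI power_mono\<close>)
      qed
      also have "\<dots> = ennreal (K\<^sup>2) * (\<integral>\<^sup>+x\<in>S. dens Z x \<partial>lborel)" by (rule nn_integral_cmult) simp
      also have "\<dots> < \<infinity>" using Z[OF S(1)] by (simp add: ennreal_mult_less_top)
      finally show ?thesis .
    qed
    have hX: "hs_sq X' < \<infinity>"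
      unfolding X'_def
    proof (rule hs[where S = "support V"])
      show "cmod (V x) \<le> KV" for x by (rule KV)
      show "V x = 0" if "x \<notin> support V" for x using that by (rule not_in_support)
      show "(\<integral>\<^sup>+x\<in>K. dens X x \<partial>lborel) < \<infinity>" if "compact K" for K using that by (rule dX)
    qed (use V KV mV in \<open>simp_all add: test_function_def\<close>)
    have hY: "hs_sq Y' < \<infinity>"
      unfolding Y'_def
    proof (rule hs[where S = "support \<eta>"])
      show "cmod (cnj (\<eta> x)) \<le> Ke" for x by (rule Ke')
      show "cnj (\<eta> x) = 0" if "x \<notin> support \<eta>" for x using not_in_support[OF that] by simp
      show "(\<integral>\<^sup>+x\<in>K. dens Y x \<partial>lborel) < \<infinity>" if "compact K" for K using that by (rule dY)
    qed (use e Ke me' in \<open>simp_all add: test_function_def\<close>)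
    have T: "mult_op V \<circ> (\<lambda>u. X (adjoint Y u)) \<circ> mult_op \<eta> = (\<lambda>u. X' (adjoint Y' u))"
    proof -
      have "adjoint Y' = (\<lambda>u. adjoint Y (mult_op \<eta> u))"
        unfolding Y'_def using adjoint_compose[OF be Y] adjoint_mult_op[OF me' Ke'] by simp
      then show ?thesis by (simp add: fun_eq_iff X'_def)
    qed
    have aeX: "AE x in lborel. fun_of (X' u) x = V x * fun_of (X u) x" for u
      unfolding X'_def by (rule fun_of_mult_op[OF mV KV(1)])
    have aeY: "AE x in lborel. fun_of (Y' u) x = cnj (\<eta> x) * fun_of (Y u) x" for u
      unfolding Y'_def by (rule fun_of_mult_op[OF me' Ke'])
    define F where "F n x = V x * (fun_of (X (onb_seq n)) x * cnj (fun_of (Y (onb_seq n)) x))" for n x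
    have Fc: "cinner (Y' u) (X' u) = (LINT x|lborel. V x * (fun_of (X u) x * cnj (fun_of (Y u) x)))" for u
    proof -
      have "cinner (Y' u) (X' u) = (LINT x|lborel. cnj (cnj (\<eta> x) * fun_of (Y u) x) * (V x * fun_of (X u) x))"
        by (rule cinner_cong_AE[OF _ _ aeY aeX]) auto
      also have "\<dots> = (LINT x|lborel. V x * (fun_of (X u) x * cnj (fun_of (Y u) x)))"
      proof (rule Bochner_Integration.integral_cong[OF refl])
        fix x
        show "cnj (cnj (\<eta> x) * fun_of (Y u) x) * (V x * fun_of (X u) x) = V x * (fun_of (X u) x * cnj (fun_of (Y u) x))"
          by (cases "x \<in> support V") (use one not_in_support in auto)
      qed
      finally show ?thesis .
    qed
    have Fle: "AE x in lborel. cmod (F n x) \<le> ((cmod (fun_of (X' (onb_seq n)) x))\<^sup>2 + (cmod (fun_of (Y' (onb_seq n)) x))\<^sup>2) / 2" for n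
      using aeX[of "onb_seq n"] aeY[of "onb_seq n"]
    proof eventually_elim
      case (elim x)
      have "F n x = fun_of (X' (onb_seq n)) x * cnj (fun_of (Y' (onb_seq n)) x)"
        unfolding F_def elim by (cases "x \<in> support V") (use one not_in_support in auto)
      then show ?case using cmod_mult_le_half by simp
    qed
    have iXY: "integrable lborel (\<lambda>x. ((cmod (fun_of (X' (onb_seq n)) x))\<^sup>2 + (cmod (fun_of (Y' (onb_seq n)) x))\<^sup>2) / 2)" for n
      by (intro integrable_divide Bochner_Integration.integrable_add integrable_norm_sq)
    have Fi: "integrable lborel (F n)" for n
      by (rule Bochner_Integration.integrable_bound[OF iXY[of n]]) (use Fle[of n] in \<open>auto simp: F_def[abs_def]\<close>)
    have sm: "AE x in lborel. summable (\<lambda>n. norm (F n x))"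
      using fX fY
    proof eventually_elim
      case (elim x)
      show ?case
        using summable_mult[OF cross_dens_bound(1)[OF elim], of "cmod (V x)"] by (simp add: F_def norm_mult)
    qed
    have smI: "summable (\<lambda>n. LINT x|lborel. norm (F n x))"
    proof (rule summable_comparison_test'[where N = 0])
      show "summable (\<lambda>n. ((norm (X' (onb_seq n)))\<^sup>2 + (norm (Y' (onb_seq n)))\<^sup>2) / 2)"
        using hs_sq_sums[OF hX] hs_sq_sums[OF hY] by (intro summable_divide summable_add) (auto simp: sums_iff)
      show "norm (LINT x|lborel. norm (F n x)) \<le> ((norm (X' (onb_seq n)))\<^sup>2 + (norm (Y' (onb_seq n)))\<^sup>2) / 2" for n
      proof -
        have "(LINT x|lborel. norm (F n x)) \<le> (LINT x|lborel. ((cmod (fun_of (X' (onb_seq n)) x))\<^sup>2 + (cmod (fun_of (Y' (onb_seq n)) x))\<^sup>2) / 2)"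
          by (rule integral_mono_AE[OF integrable_norm[OF Fi] iXY Fle])
        also have "\<dots> = ((norm (X' (onb_seq n)))\<^sup>2 + (norm (Y' (onb_seq n)))\<^sup>2) / 2"
          by (simp add: norm_L2_sq integrable_norm_sq)
        finally show ?thesis by simp
      qed
    qed
    \<comment> \<open>The exchange of sum and integral requires the integrals of the moduli to be
      summable, which \<open>smI\<close> obtains from the Hilbert-Schmidt property of X' and
      Y'.\<close>
    have "(\<lambda>n. LINT x|lborel. F n x) sums (LINT x|lborel. (\<Sum>n. F n x))"
      by (rule sums_integral[OF Fi sm smI])
    moreover have "(\<Sum>n. F n x) = V x * cross_dens X Y x" if "summable (\<lambda>n. fun_of (X (onb_seq n)) x * cnj (fun_of (Y (onb_seq n)) x))" for x
      unfolding F_def cross_dens_def by (rule suminf_mult[OF that])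
    then have "(LINT x|lborel. (\<Sum>n. F n x)) = (LINT x|lborel. V x * cross_dens X Y x)"
    proof (intro integral_cong_AE)
      show "AE x in lborel. (\<Sum>n. F n x) = V x * cross_dens X Y x"
        using fX fY
      proof eventually_elim
        case (elim x)
        show ?case
          unfolding F_def cross_dens_def by (rule suminf_mult[OF summable_norm_cancel[OF cross_dens_bound(1)[OF elim]]])
      qed
      show "(\<lambda>x. \<Sum>n. F n x) \<in> borel_measurable lborel" unfolding F_def by measurable
    qed auto
    ultimately have "(\<lambda>n. cinner (Y' (onb_seq n)) (X' (onb_seq n))) sums (LINT x|lborel. V x * cross_dens X Y x)"
      by (simp add: Fc F_def)
    then have "(LINT x|lborel. V x * cross_dens X Y x) = op_trace (\<lambda>u. X' (adjoint Y' u))"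
      using op_trace_hs_product[OF bX bY hX hY] by (rule sums_unique2)
    then show ?thesis unfolding T using trace_class_hs_product[OF bX bY hX hY] by blast
  qed
  show ?thesis
    unfolding is_density_def
  proof (intro conjI allI impI)
    show "(\<lambda>x. of_real ((2 * pi * h) ^ 3) * cross_dens X Y x) \<in> borel_measurable lborel" by simp
    show "set_integrable lborel K (\<lambda>x. of_real ((2 * pi * h) ^ 3) * cross_dens X Y x)" if "compact K" for K
      using int[OF that] by (rule set_integrable_mult_right)
    fix V \<eta> assume a: "test_function V \<and> test_function \<eta> \<and> (\<forall>x\<in>support V. \<eta> x = 1)"
    then show "trace_class (mult_op V \<circ> (\<lambda>u. X (adjoint Y u)) \<circ> mult_op \<eta>)" using main by blast
    have "(LINT x|lborel. V x * (of_real ((2 * pi * h) ^ 3) * cross_dens X Y x))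
        = (LINT x|lborel. of_real ((2 * pi * h) ^ 3) * (V x * cross_dens X Y x))"
      by (simp only: mult.left_commute)
    also have "\<dots> = of_real ((2 * pi * h) ^ 3) * (LINT x|lborel. V x * cross_dens X Y x)"
      by (rule integral_mult_right_zero)
    finally show "(LINT x|lborel. V x * (of_real ((2 * pi * h) ^ 3) * cross_dens X Y x))
        = of_real ((2 * pi * h) ^ 3) * op_trace (mult_op V \<circ> (\<lambda>u. X (adjoint Y u)) \<circ> mult_op \<eta>)"
      using main a by simp
  qed
qed

section \<open>Complex Gaussian integrals\<close>

definition gauss :: "complex \<Rightarrow> real \<Rightarrow> real \<Rightarrow> complex" where
  "gauss z x t = exp (- (z * of_real (t\<^sup>2) / 2) + \<i> * of_real (x * t))"

lemma gauss_measurable [measurable]: "gauss z x \<in> borel_measurable borel"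
  unfolding gauss_def[abs_def] by (intro borel_measurable_continuous_onI continuous_intros) auto

lemma cmod_gauss: "cmod (gauss z x t) = exp (- (Re z * t\<^sup>2 / 2))"
  by (simp add: gauss_def norm_exp_eq_Re)

lemma integrable_exp_square:
  assumes "0 < e"
  shows "integrable lborel (\<lambda>t::real. exp (- (e * t\<^sup>2 / 2)))"
proof -
  define s where "s = 1 / sqrt e"
  have s2: "s\<^sup>2 = 1 / e" and s0: "s > 0" using assms by (simp_all add: s_def power_divide)
  have "integrable lborel (\<lambda>t. sqrt (2 * pi * s\<^sup>2) * normal_density 0 s t)"
    using s0 by (intro integrable_mult_right integrable_normal_density)
  moreover have "sqrt (2 * pi * s\<^sup>2) * normal_density 0 s t = exp (- (e * t\<^sup>2 / 2))" for t
  proof -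
    have "- (t - 0)\<^sup>2 / (2 * s\<^sup>2) = - (e * t\<^sup>2 / 2)" using assms by (simp add: s2 field_simps)
    moreover define q where "q = sqrt (2 * pi * s\<^sup>2)"
    moreover have "q \<noteq> 0" using s0 by (simp add: q_def)
    ultimately show ?thesis unfolding normal_density_def q_def[symmetric] by simp
  qed
  ultimately show ?thesis by simp
qed

lemma integrable_gauss:
  assumes "0 < Re z"
  shows "integrable lborel (gauss z x)"
  by (rule Bochner_Integration.integrable_bound[OF integrable_exp_square[OF assms]]) (simp_all add: cmod_gauss)

text \<open>After rescaling by 1 / sqrt e this is the characteristic function of the standard normal
  distribution.\<close>

lemma integral_gauss_real:
  assumes e: "0 < e"
  shows "(LINT t|lborel. gauss (of_real e) x t) = of_real (sqrt (2 * pi / e) * exp (- x\<^sup>2 / (2 * e)))"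
proof -
  define c where "c = 1 / sqrt e"
  have c: "c > 0" "c\<^sup>2 = 1 / e" using e by (simp_all add: c_def power_divide)
  have eq: "gauss (of_real e) x (0 + c * t) = of_real (sqrt (2 * pi)) * (std_normal_density t *\<^sub>R iexp ((c * x) * t))" for t
  proof -
    have 1: "of_real e * of_real ((c * t)\<^sup>2) = complex_of_real (t\<^sup>2)"
      using e by (simp add: power_mult_distrib c(2) flip: of_real_mult)
    have 2: "sqrt (2 * pi) * std_normal_density t = exp (- t\<^sup>2 / 2)"
      by (simp add: std_normal_density_def)
    have "gauss (of_real e) x (0 + c * t) = exp (complex_of_real (- t\<^sup>2 / 2)) * iexp ((c * x) * t)"
      unfolding gauss_def exp_add[symmetric] add_0 1 by (simp add: algebra_simps)
    also have "exp (complex_of_real (- t\<^sup>2 / 2)) = of_real (sqrt (2 * pi) * std_normal_density t)"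
      unfolding 2 exp_of_real ..
    finally show ?thesis by (simp add: scaleR_conv_of_real)
  qed
  have "(LINT t|lborel. gauss (of_real e) x t) = \<bar>c\<bar> *\<^sub>R (LINT t|lborel. gauss (of_real e) x (0 + c * t))"
    by (rule lborel_integral_real_affine) (use c in simp)
  also have "(LINT t|lborel. gauss (of_real e) x (0 + c * t))
      = of_real (sqrt (2 * pi)) * (LINT t|lborel. std_normal_density t *\<^sub>R iexp ((c * x) * t))"
    unfolding eq by (rule integral_mult_right_zero)
  also have "(LINT t|lborel. std_normal_density t *\<^sub>R iexp ((c * x) * t)) = char std_normal_distribution (c * x)"
    unfolding char_def by (subst integral_density) (auto simp: normal_density_nonneg)
  also have "\<dots> = of_real (exp (- x\<^sup>2 / (2 * e)))"
    unfolding char_std_normal_distribution by (simp add: power_mult_distrib c(2) exp_of_real)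
  also have "\<bar>c\<bar> *\<^sub>R (of_real (sqrt (2 * pi)) * complex_of_real (exp (- x\<^sup>2 / (2 * e))))
      = of_real (sqrt (2 * pi / e) * exp (- x\<^sup>2 / (2 * e)))"
    using c(1) by (simp add: scaleR_conv_of_real c_def real_sqrt_divide)
  finally show ?thesis .
qed

text \<open>Integrals over compact intervals are holomorphic by differentiation under the integral,
  and they converge locally uniformly.\<close>

lemma holomorphic_gauss_integral:
  "(\<lambda>z. LINT t|lborel. gauss z x t) holomorphic_on {z. 0 < Re z}"
proof (rule holomorphic_uniform_sequence)
  show "open {z. 0 < Re z}" by (rule open_halfspace_Re_gt)
  show "(\<lambda>z. integral (cbox (- real n) (real n)) (gauss z x)) holomorphic_on {z. 0 < Re z}" for n
  proof (rule leibniz_rule_holomorphic)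
    show "((\<lambda>z. gauss z x t) has_field_derivative (- (of_real (t\<^sup>2) / 2)) * gauss z x t) (at z within {z. 0 < Re z})" for z t
      unfolding gauss_def by (auto intro!: derivative_eq_intros)
    show "gauss z x integrable_on cbox (- real n) (real n)" for z
      unfolding gauss_def[abs_def] by (intro integrable_continuous continuous_intros) auto
    show "continuous_on ({z. 0 < Re z} \<times> cbox (- real n) (real n)) (\<lambda>(z, t). (- (of_real (t\<^sup>2) / 2)) * gauss z x t)"
      unfolding gauss_def by (auto intro!: continuous_intros simp: split_beta)
    show "convex {z. 0 < Re z}" by (rule convex_halfspace_Re_gt)
  qed
  fix z :: complex assume "z \<in> {z. 0 < Re z}"
  then have z: "0 < Re z" by simp
  \<comment> \<open>On the closed disc of this radius about z the real part is at least d, so one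
    Gaussian dominates all integrands and its tail \<open>B n\<close> bounds the error
    uniformly.\<close>
  define d where "d = Re z / 2"
  have d: "d > 0" using z by (simp add: d_def)
  have Re_w: "d \<le> Re w" if "w \<in> cball z d" for w
    using that abs_Re_le_cmod[of "z - w"] by (simp add: d_def dist_norm)
  define B where "B n = (LINT t|lborel. indicator (- {- real n..real n}) t * exp (- (d * t\<^sup>2 / 2)))" for n
  have B0: "B \<longlonglongrightarrow> 0"
  proof -
    have "(\<lambda>n. LINT t|lborel. indicator (- {- real n..real n}) t * exp (- (d * t\<^sup>2 / 2))) \<longlonglongrightarrow> (LINT t::real|lborel. (0::real))"
    proof (rule integral_dominated_convergence[where w = "\<lambda>t. exp (- (d * t\<^sup>2 / 2))" and f = "\<lambda>t. 0"
          and s = "\<lambda>n t. indicator (- {- real n..real n}) t * exp (- (d * t\<^sup>2 / 2))" and M = lborel])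
      show "integrable lborel (\<lambda>t. exp (- (d * t\<^sup>2 / 2)))" by (rule integrable_exp_square[OF d])
      show "AE t in lborel. (\<lambda>n. indicator (- {- real n..real n}) t * exp (- (d * t\<^sup>2 / 2))) \<longlonglongrightarrow> 0"
      proof (rule AE_I2)
        fix t :: real
        obtain N where N: "\<bar>t\<bar> \<le> real N" using real_arch_simple by blast
        have "\<forall>\<^sub>F n in sequentially. indicator (- {- real n..real n}) t * exp (- (d * t\<^sup>2 / 2)) = 0"
          unfolding eventually_sequentially
          by (intro exI[of _ N]) (use N in \<open>auto split: split_indicator\<close>)
        then show "(\<lambda>n. indicator (- {- real n..real n}) t * exp (- (d * t\<^sup>2 / 2))) \<longlonglongrightarrow> 0"
          by (rule tendsto_eventually)
      qed
      show "AE t in lborel. norm (indicator (- {- real n..real n}) t * exp (- (d * t\<^sup>2 / 2))) \<le> exp (- (d * t\<^sup>2 / 2))" for n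
        by (auto split: split_indicator)
    qed auto
    then show ?thesis by (simp add: B_def[abs_def])
  qed
  have est: "norm (integral (cbox (- real n) (real n)) (gauss w x) - (LINT t|lborel. gauss w x t)) \<le> B n" if w: "w \<in> cball z d" for w n
  proof -
    have ig: "integrable lborel (gauss w x)" using Re_w[OF w] d by (intro integrable_gauss) simp
    have s: "set_integrable lborel {- real n..real n} (gauss w x)"
      using ig unfolding set_integrable_def by (intro integrable_mult_indicator) auto
    have "integral (cbox (- real n) (real n)) (gauss w x) = (LINT t:{- real n..real n}|lborel. gauss w x t)"
      using set_borel_integral_eq_integral(2)[OF s] by simp
    then have "integral (cbox (- real n) (real n)) (gauss w x) - (LINT t|lborel. gauss w x t)
        = (LINT t|lborel. indicator {- real n..real n} t *\<^sub>R gauss w x t - gauss w x t)"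
      using s ig by (simp add: set_lebesgue_integral_def set_integrable_def)
    also have "norm \<dots> \<le> B n"
      unfolding B_def
    proof (rule Bochner_Integration.integral_norm_bound_integral)
      show "integrable lborel (\<lambda>t. indicator {- real n..real n} t *\<^sub>R gauss w x t - gauss w x t)"
        using s ig by (simp add: set_integrable_def)
      have "integrable lborel (\<lambda>t. indicator (- {- real n..real n}) t *\<^sub>R exp (- (d * t\<^sup>2 / 2)))"
        by (intro integrable_mult_indicator integrable_exp_square d) auto
      then show "integrable lborel (\<lambda>t. indicator (- {- real n..real n}) t * exp (- (d * t\<^sup>2 / 2)))" by simp
      show "norm (indicator {- real n..real n} t *\<^sub>R gauss w x t - gauss w x t)
          \<le> indicator (- {- real n..real n}) t * exp (- (d * t\<^sup>2 / 2))" for t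
        using Re_w[OF w] by (auto simp: cmod_gauss intro!: mult_right_mono split: split_indicator)
    qed
    finally show ?thesis .
  qed
  show "\<exists>d>0. cball z d \<subseteq> {z. 0 < Re z} \<and> uniform_limit (cball z d)
      (\<lambda>n z. integral (cbox (- real n) (real n)) (gauss z x)) (\<lambda>z. LINT t|lborel. gauss z x t) sequentially"
  proof (intro exI[of _ d] conjI d)
    show "cball z d \<subseteq> {z. 0 < Re z}" using Re_w d by force
    show "uniform_limit (cball z d) (\<lambda>n z. integral (cbox (- real n) (real n)) (gauss z x))
        (\<lambda>z. LINT t|lborel. gauss z x t) sequentially"
    proof (rule uniform_limitI)
      fix e :: real assume "e > 0"
      with B0 have "\<forall>\<^sub>F n in sequentially. B n < e" by (rule order_tendstoD)
      then show "\<forall>\<^sub>F n in sequentially. \<forall>w\<in>cball z d.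
          dist (integral (cbox (- real n) (real n)) (gauss w x)) (LINT t|lborel. gauss w x t) < e"
      proof eventually_elim
        case (elim n)
        show ?case using le_less_trans[OF est elim] by (simp add: dist_norm)
      qed
    qed
  qed
qed

text \<open>The principal root is positive on the positive axis, holomorphic on the right half-plane
  and continuous up to the imaginary axis except at 0, so this branch remains correct in the limit
  that gives the propagator.\<close>

definition gauss_const :: "complex \<Rightarrow> complex" where
  "gauss_const z = of_real (sqrt (2 * pi)) / csqrt z"

text \<open>Both sides are holomorphic on the right half-plane and agree on the positive real axis,
  so the identity theorem applies.\<close>

lemma integral_gauss:
  assumes z: "0 < Re z"
  shows "(LINT t|lborel. gauss z x t) = gauss_const z * exp (- of_real (x\<^sup>2) / (2 * z))"
proof -
  define f where "f z = (LINT t|lborel. gauss z x t) - gauss_const z * exp (- of_real (x\<^sup>2) / (2 * z))" for z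
  define S where "S = {z. 0 < Re z}"
  have "f z = 0"
  proof (rule analytic_continuation[of f S "of_real ` {0<..}" 1])
    have nn: "w \<notin> \<real>\<^sub>\<le>\<^sub>0" if "w \<in> S" for w
      using that by (auto simp: S_def complex_nonpos_Reals_iff)
    have n0: "w \<noteq> 0" if "w \<in> S" for w using that by (auto simp: S_def)
    show "f holomorphic_on S"
      unfolding f_def gauss_const_def
    proof (intro holomorphic_intros)
      show "(\<lambda>z. LINT t|lborel. gauss z x t) holomorphic_on S"
        unfolding S_def by (rule holomorphic_gauss_integral)
    qed (use nn n0 in auto)
    show "open S" unfolding S_def by (rule open_halfspace_Re_gt)
    show "connected S" unfolding S_def by (intro convex_connected convex_halfspace_Re_gt)
    show "of_real ` {0<..} \<subseteq> S" "1 \<in> S" "z \<in> S" using z by (auto simp: S_def)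
    show "(1::complex) islimpt of_real ` {0<..}"
      unfolding islimpt_approachable
    proof (intro allI impI)
      fix e :: real assume "e > 0"
      then show "\<exists>x'\<in>complex_of_real ` {0<..}. x' \<noteq> 1 \<and> dist x' 1 < e"
      proof (intro bexI[of _ "of_real (1 + e / 2)"] conjI)
        have "dist (complex_of_real (1 + e / 2)) (of_real 1) = e / 2"
          unfolding dist_of_real using \<open>e > 0\<close> by (simp add: dist_real_def)
        then show "dist (complex_of_real (1 + e / 2)) 1 < e" using \<open>e > 0\<close> by simp
        have "complex_of_real (1 + e / 2) \<noteq> of_real 1"
          unfolding of_real_eq_iff using \<open>e > 0\<close> by simp
        then show "complex_of_real (1 + e / 2) \<noteq> 1" by simp
        show "complex_of_real (1 + e / 2) \<in> of_real ` {0<..}"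
          by (rule imageI) (use \<open>e > 0\<close> in simp)
      qed
    qed
    show "f w = 0" if "w \<in> of_real ` {0<..}" for w
    proof -
      from that obtain e where e: "e > 0" "w = of_real e" by auto
      have "csqrt w = of_real (sqrt e)" using e by simp
      then have 1: "gauss_const w = of_real (sqrt (2 * pi / e))"
        unfolding gauss_const_def real_sqrt_divide[of "2 * pi"] of_real_divide by (rule arg_cong)
      have 2: "exp (- of_real (x\<^sup>2) / (2 * w)) = of_real (exp (- x\<^sup>2 / (2 * e)))"
        unfolding e(2) exp_of_real[symmetric] by simp
      show ?thesis
        unfolding f_def 1 2 unfolding e(2) integral_gauss_real[OF e(1)] of_real_mult by (rule diff_self)
    qed
  qed
  then show ?thesis by (simp add: f_def)
qed

lemma lborel_integral_prod:
  fixes f :: "'a::euclidean_space \<Rightarrow> real \<Rightarrow> complex"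
  assumes "\<And>b. b \<in> Basis \<Longrightarrow> integrable lborel (f b)"
  shows "integrable lborel (\<lambda>x. \<Prod>b\<in>Basis. f b (x \<bullet> b))"
    and "(LINT x|lborel. (\<Prod>b\<in>Basis. f b (x \<bullet> b))) = (\<Prod>b\<in>Basis. (LINT t|lborel. f b t))"
proof -
  interpret product_sigma_finite "\<lambda>b::'a. lborel :: real measure"
    by standard
  have [measurable]: "\<And>b. b \<in> Basis \<Longrightarrow> f b \<in> borel_measurable borel"
    using borel_measurable_integrable[OF assms] by simp
  have T: "(\<lambda>g. \<Sum>b\<in>Basis. g b *\<^sub>R b) \<in> measurable (\<Pi>\<^sub>M b\<in>(Basis::'a set). (lborel :: real measure)) (borel :: 'a measure)"
    by measurable
  have m: "(\<lambda>x. \<Prod>b\<in>Basis. f b (x \<bullet> b)) \<in> borel_measurable (borel :: 'a measure)"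
    by measurable
  have eq: "(\<Prod>b\<in>Basis. f b ((\<Sum>b\<in>Basis. g b *\<^sub>R b) \<bullet> b)) = (\<Prod>b\<in>Basis. f b (g b))" for g :: "'a \<Rightarrow> real"
    by (intro prod.cong refl) simp
  have L: "(lborel :: 'a measure) = distr (\<Pi>\<^sub>M b\<in>Basis. lborel) borel (\<lambda>f. \<Sum>b\<in>Basis. f b *\<^sub>R b)"
    by (rule lborel_eq)
  show "integrable lborel (\<lambda>x. \<Prod>b\<in>Basis. f b (x \<bullet> b))"
    unfolding L using product_integrable_prod[of Basis f] assms
    by (subst integrable_distr_eq[OF T m]) (simp add: eq)
  show "(LINT x|lborel. (\<Prod>b\<in>Basis. f b (x \<bullet> b))) = (\<Prod>b\<in>Basis. (LINT t|lborel. f b t))"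
    unfolding L using product_integral_prod[of Basis f] assms
    by (subst integral_distr[OF T m]) (simp add: eq)
qed

lemma exp_norm_square_prod:
  fixes x t :: "'a::euclidean_space"
  shows "exp (- (z * of_real ((norm t)\<^sup>2) / 2)) * cis (x \<bullet> t) = (\<Prod>b\<in>Basis. gauss z (x \<bullet> b) (t \<bullet> b))"
proof -
  have n: "(norm t)\<^sup>2 = (\<Sum>b\<in>Basis. (t \<bullet> b)\<^sup>2)"
    unfolding power2_norm_eq_inner by (subst euclidean_inner) (simp add: power2_eq_square)
  have i: "x \<bullet> t = (\<Sum>b\<in>Basis. (x \<bullet> b) * (t \<bullet> b))" by (rule euclidean_inner)
  show ?thesis
    unfolding gauss_def exp_sum[OF finite_Basis, symmetric] cis_conv_exp exp_add[symmetric] n i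
    by (simp add: sum.distrib sum_distrib_left sum_divide_distrib sum_negf sum_subtractf)
qed

lemma gauss_ft:
  fixes x :: "real^3"
  assumes z: "0 < Re z"
  shows "integrable lborel (\<lambda>t. exp (- (z * of_real ((norm t)\<^sup>2) / 2)) * cis (x \<bullet> t))"
    and "(LINT t|lborel. exp (- (z * of_real ((norm t)\<^sup>2) / 2)) * cis (x \<bullet> t))
      = gauss_const z ^ 3 * exp (- of_real ((norm x)\<^sup>2) / (2 * z))"
proof -
  show "integrable lborel (\<lambda>t. exp (- (z * of_real ((norm t)\<^sup>2) / 2)) * cis (x \<bullet> t))"
    unfolding exp_norm_square_prod by (intro lborel_integral_prod integrable_gauss z)
  have n: "(norm x)\<^sup>2 = (\<Sum>b\<in>Basis. (x \<bullet> b)\<^sup>2)"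
    unfolding power2_norm_eq_inner by (subst euclidean_inner) (simp add: power2_eq_square)
  have "(LINT t|lborel. exp (- (z * of_real ((norm t)\<^sup>2) / 2)) * cis (x \<bullet> t))
      = (\<Prod>b\<in>Basis. gauss_const z * exp (- of_real ((x \<bullet> b)\<^sup>2) / (2 * z)))"
    unfolding exp_norm_square_prod by (subst lborel_integral_prod(2)) (simp_all add: integrable_gauss integral_gauss z)
  also have "\<dots> = gauss_const z ^ 3 * exp (- of_real ((norm x)\<^sup>2) / (2 * z))"
    unfolding n by (simp add: prod.distrib exp_sum[symmetric] sum_negf sum_divide_distrib)
  finally show "(LINT t|lborel. exp (- (z * of_real ((norm t)\<^sup>2) / 2)) * cis (x \<bullet> t))
      = gauss_const z ^ 3 * exp (- of_real ((norm x)\<^sup>2) / (2 * z))" .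
qed

section \<open>The unitary Fourier transform\<close>

text \<open>The normalisation that makes the kernel exp(i s x.y) unitary; the exponent is half the
  dimension.\<close>

definition ft_factor :: "real \<Rightarrow> real" where
  "ft_factor s = (\<bar>s\<bar> / (2 * pi)) powr (3 / 2)"

lemma ft_factor_nonneg: "0 \<le> ft_factor s"
  by (simp add: ft_factor_def)

lemma ft_factor_pos: "s \<noteq> 0 \<Longrightarrow> 0 < ft_factor s"
  by (simp add: ft_factor_def)

lemma ft_factor_sq:
  assumes "s \<noteq> 0"
  shows "(ft_factor s)\<^sup>2 = (\<bar>s\<bar> / (2 * pi)) ^ 3"
proof -
  have "(ft_factor s)\<^sup>2 = (\<bar>s\<bar> / (2 * pi)) powr (real 2 * (3 / 2))"
    unfolding ft_factor_def using assms by (subst powr_power) auto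
  also have "\<dots> = (\<bar>s\<bar> / (2 * pi)) powr (real 3)" by simp
  also have "\<dots> = (\<bar>s\<bar> / (2 * pi)) ^ 3" by (rule powr_realpow) (use assms in simp)
  finally show ?thesis .
qed

lemma ft_factor_minus: "ft_factor (- s) = ft_factor s"
  by (simp add: ft_factor_def)

definition fourier_int :: "real \<Rightarrow> (real^3 \<Rightarrow> complex) \<Rightarrow> real^3 \<Rightarrow> complex" where
  "fourier_int s f x = of_real (ft_factor s) * (LINT y|lborel. cis (s * (x \<bullet> y)) * f y)"

lemma cis_measurable [measurable]: "cis \<in> borel_measurable borel"
  by (intro borel_measurable_continuous_onI continuous_intros)

text \<open>Fubini's theorem applies because the bounded kernel leaves the product of the two
  integrable functions as majorant.\<close>

lemma kernel_swap:
  fixes a b :: "real^3 \<Rightarrow> complex" and k :: "real^3 \<Rightarrow> real^3 \<Rightarrow> complex"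
  assumes a: "integrable lborel a" and b: "integrable lborel b"
    and k [measurable]: "(\<lambda>(x, y). k x y) \<in> borel_measurable (lborel \<Otimes>\<^sub>M lborel)"
    and K: "\<And>x y. cmod (k x y) \<le> K"
  shows "(LINT x|lborel. a x * (LINT y|lborel. k x y * b y)) = (LINT y|lborel. b y * (LINT x|lborel. k x y * a x))"
proof -
  have [measurable]: "a \<in> borel_measurable lborel" "b \<in> borel_measurable lborel"
    using a b by auto
  have "integrable (lborel \<Otimes>\<^sub>M lborel) (\<lambda>(x, y). a x * b y)"
  proof (rule lborel_pair.Fubini_integrable)
    have "(\<lambda>x. LINT y|lborel. norm (case (x, y) of (x, y) \<Rightarrow> a x * b y)) = (\<lambda>x. norm (a x) * (LINT y|lborel. norm (b y)))"
      by (simp add: norm_mult)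
    then show "integrable lborel (\<lambda>x. LINT y|lborel. norm (case (x, y) of (x, y) \<Rightarrow> a x * b y))"
      using a by simp
    show "AE x in lborel. integrable lborel (\<lambda>y. case (x, y) of (x, y) \<Rightarrow> a x * b y)"
      using b by simp
  qed measurable
  then have "integrable (lborel \<Otimes>\<^sub>M lborel) (\<lambda>p. of_real K * (case p of (x, y) \<Rightarrow> a x * b y))"
    by (intro integrable_mult_right)
  then have int: "integrable (lborel \<Otimes>\<^sub>M lborel) (\<lambda>(x, y). a x * (k x y * b y))"
  proof (rule Bochner_Integration.integrable_bound)
    show "AE p in lborel \<Otimes>\<^sub>M lborel. norm (case p of (x, y) \<Rightarrow> a x * (k x y * b y))
        \<le> norm (of_real K * (case p of (x, y) \<Rightarrow> a x * b y))"
    proof (rule AE_I2)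
      fix p :: "(real^3) \<times> (real^3)"
      obtain x y where p: "p = (x, y)" by force
      have "cmod (k x y) * (cmod (a x) * cmod (b y)) \<le> \<bar>K\<bar> * (cmod (a x) * cmod (b y))"
        using K[of x y] by (intro mult_right_mono) auto
      then show "norm (case p of (x, y) \<Rightarrow> a x * (k x y * b y)) \<le> norm (of_real K * (case p of (x, y) \<Rightarrow> a x * b y))"
        by (simp add: p norm_mult mult_ac)
    qed
  qed measurable
  have "(LINT x|lborel. a x * (LINT y|lborel. k x y * b y)) = (LINT x|lborel. (LINT y|lborel. a x * (k x y * b y)))"
    by simp
  also have "\<dots> = (LINT y|lborel. (LINT x|lborel. a x * (k x y * b y)))"
    using lborel_pair.Fubini_integral[OF int] by simp
  also have "\<dots> = (LINT y|lborel. (LINT x|lborel. b y * (k x y * a x)))"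
    by (simp add: mult_ac)
  finally show ?thesis by simp
qed

lemma cis_kernel_measurable [measurable]: "(\<lambda>(x, y). cis (s * (x \<bullet> y))) \<in> borel_measurable (lborel \<Otimes>\<^sub>M lborel)"
  by measurable

lemma lborel_affine3:
  fixes t :: "real^3"
  assumes "c \<noteq> 0"
  shows "lborel = density (distr lborel borel (\<lambda>x. t + c *\<^sub>R x)) (\<lambda>_. ennreal (\<bar>c\<bar> ^ 3))"
  using lborel_affine[OF assms, of t] by (simp add: ennreal_power)

lemma lborel_integral_affine3:
  fixes f :: "real^3 \<Rightarrow> 'b::{banach, second_countable_topology}"
  assumes "c \<noteq> 0" and [measurable]: "f \<in> borel_measurable lborel"
  shows "(LINT y|lborel. f y) = \<bar>c\<bar> ^ 3 *\<^sub>R (LINT w|lborel. f (t + c *\<^sub>R w))"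
proof -
  have "(LINT y|lborel. f y) = (LINT y|density (distr lborel borel (\<lambda>x. t + c *\<^sub>R x)) (\<lambda>_. ennreal (\<bar>c\<bar> ^ 3)). f y)"
    using lborel_affine3[OF assms(1), of t] by simp
  also have "\<dots> = (LINT y|distr lborel borel (\<lambda>x. t + c *\<^sub>R x). \<bar>c\<bar> ^ 3 *\<^sub>R f y)"
    by (rule integral_density) auto
  also have "\<dots> = (LINT w|lborel. \<bar>c\<bar> ^ 3 *\<^sub>R f (t + c *\<^sub>R w))"
    by (rule integral_distr) auto
  finally show ?thesis by simp
qed

lemma lborel_nn_integral_affine3:
  fixes f :: "real^3 \<Rightarrow> ennreal"
  assumes "c \<noteq> 0" and [measurable]: "f \<in> borel_measurable lborel"
  shows "(\<integral>\<^sup>+y. f y \<partial>lborel) = ennreal (\<bar>c\<bar> ^ 3) * (\<integral>\<^sup>+w. f (t + c *\<^sub>R w) \<partial>lborel)"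
proof -
  have "(\<integral>\<^sup>+y. f y \<partial>lborel) = (\<integral>\<^sup>+y. f y \<partial>density (distr lborel borel (\<lambda>x. t + c *\<^sub>R x)) (\<lambda>_. ennreal (\<bar>c\<bar> ^ 3)))"
    using lborel_affine3[OF assms(1), of t] by simp
  also have "\<dots> = (\<integral>\<^sup>+y. ennreal (\<bar>c\<bar> ^ 3) * f y \<partial>distr lborel borel (\<lambda>x. t + c *\<^sub>R x))"
    by (rule nn_integral_density) auto
  also have "\<dots> = (\<integral>\<^sup>+w. ennreal (\<bar>c\<bar> ^ 3) * f (t + c *\<^sub>R w) \<partial>lborel)"
    by (rule nn_integral_distr) auto
  finally show ?thesis by (simp add: nn_integral_cmult)
qed

text \<open>A convergence factor: the product of two Fourier integrals of integrable functions is a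
  priori only bounded and becomes integrable with this factor, which is removed by letting e tend to
  0.\<close>

definition gauss_damp :: "real \<Rightarrow> real^3 \<Rightarrow> real" where
  "gauss_damp e x = exp (- (e * (norm x)\<^sup>2 / 2))"

text \<open>The unnormalised Fourier transform of \<open>gauss_damp e\<close>, as
  \<open>reg_ft\<close> shows.\<close>

definition gauss_kernel :: "real \<Rightarrow> real^3 \<Rightarrow> real" where
  "gauss_kernel e w = sqrt (2 * pi / e) ^ 3 * exp (- ((norm w)\<^sup>2 / (2 * e)))"

lemma gauss_damp_measurable [measurable]: "gauss_damp e \<in> borel_measurable borel"
  unfolding gauss_damp_def[abs_def] by measurable

lemma gauss_kernel_measurable [measurable]: "gauss_kernel e \<in> borel_measurable borel"
  unfolding gauss_kernel_def[abs_def] by measurable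

lemma gauss_kernel_nonneg: "0 < e \<Longrightarrow> 0 \<le> gauss_kernel e w"
  by (simp add: gauss_kernel_def)

lemma gauss_damp_bounds: "0 < e \<Longrightarrow> 0 \<le> gauss_damp e x" "0 < e \<Longrightarrow> gauss_damp e x \<le> 1"
  by (simp_all add: gauss_damp_def)

lemma reg_ft:
  assumes e: "0 < e"
  shows "integrable lborel (gauss_damp e)"
    and "(LINT x|lborel. of_real (gauss_damp e x) * cis (x \<bullet> w)) = of_real (gauss_kernel e w)"
proof -
  have z: "0 < Re (complex_of_real e)" using e by simp
  have eq: "exp (- (complex_of_real e * of_real ((norm t)\<^sup>2) / 2)) = of_real (gauss_damp e t)" for t :: "real^3"
    unfolding gauss_damp_def exp_of_real[symmetric] by simp
  have "integrable lborel (\<lambda>t::real^3. complex_of_real (gauss_damp e t) * cis (0 \<bullet> t))"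
    using gauss_ft(1)[OF z, of 0] unfolding eq .
  then have "integrable lborel (\<lambda>t::real^3. complex_of_real (gauss_damp e t))" by simp
  then show "integrable lborel (gauss_damp e)" by (simp only: complex_of_real_integrable_eq)
  have "csqrt (of_real e) = of_real (sqrt e)" using e by simp
  then have c: "gauss_const (of_real e) = of_real (sqrt (2 * pi / e))"
    unfolding gauss_const_def real_sqrt_divide[of "2 * pi"] of_real_divide by (rule arg_cong)
  have x: "exp (- complex_of_real ((norm w)\<^sup>2) / (2 * of_real e)) = of_real (exp (- ((norm w)\<^sup>2 / (2 * e))))"
    unfolding exp_of_real[symmetric] by simp
  show "(LINT x|lborel. of_real (gauss_damp e x) * cis (x \<bullet> w)) = of_real (gauss_kernel e w)"
    using gauss_ft(2)[OF z, of w] unfolding eq c x gauss_kernel_def by (simp add: inner_commute)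
qed

lemma integral_gauss_damp:
  assumes e: "0 < e"
  shows "(LINT x|lborel. gauss_damp e x) = sqrt (2 * pi / e) ^ 3"
proof -
  have "complex_of_real (LINT x|lborel. gauss_damp e x) = (LINT x|lborel. of_real (gauss_damp e x) * cis (x \<bullet> 0))"
    by simp
  also have "\<dots> = of_real (gauss_kernel e 0)" by (rule reg_ft(2)[OF e])
  finally have "(LINT x|lborel. gauss_damp e x) = gauss_kernel e 0" by (simp only: of_real_eq_iff)
  then show ?thesis by (simp add: gauss_kernel_def del: real_sqrt_divide)
qed

lemma nn_integral_gauss_damp: "0 < e \<Longrightarrow> (\<integral>\<^sup>+x. ennreal (gauss_damp e x) \<partial>lborel) = ennreal (sqrt (2 * pi / e) ^ 3)"
  by (subst nn_integral_eq_integral) (auto simp: reg_ft integral_gauss_damp gauss_damp_bounds)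

lemma gauss_kernel_scaled:
  assumes "s \<noteq> 0" "0 < e"
  shows "gauss_kernel e (s *\<^sub>R w) = sqrt (2 * pi / e) ^ 3 * gauss_damp (s\<^sup>2 / e) w"
  using assms by (simp add: gauss_kernel_def gauss_damp_def power_mult_distrib)

lemma ft_factor_gauss_kernel_norm:
  assumes s: "s \<noteq> 0" and e: "0 < e"
  shows "(ft_factor s)\<^sup>2 * (sqrt (2 * pi / e) ^ 3 * sqrt (2 * pi / (s\<^sup>2 / e)) ^ 3) = 1"
proof -
  have "sqrt (2 * pi / e) * sqrt (2 * pi / (s\<^sup>2 / e)) = sqrt ((2 * pi / s)\<^sup>2)"
    unfolding real_sqrt_mult[symmetric] using e by (simp add: power2_eq_square)
  also have "\<dots> = 2 * pi / \<bar>s\<bar>" by simp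
  finally have 1: "sqrt (2 * pi / e) * sqrt (2 * pi / (s\<^sup>2 / e)) = 2 * pi / \<bar>s\<bar>" .
  show ?thesis
    unfolding ft_factor_sq[OF s] power_mult_distrib[symmetric] 1 using s by simp
qed

text \<open>The squared normalisation turns the kernel into a probability density for every e, which
  is what makes the damped estimates uniform in e.\<close>

lemma gauss_kernel_total:
  assumes s: "s \<noteq> 0" and e: "0 < e"
  shows "(\<integral>\<^sup>+y'. ennreal ((ft_factor s)\<^sup>2 * gauss_kernel e (s *\<^sub>R (y - y'))) \<partial>lborel) = 1"
proof -
  have "(\<integral>\<^sup>+y'. ennreal ((ft_factor s)\<^sup>2 * gauss_kernel e (s *\<^sub>R (y - y'))) \<partial>lborel)
      = ennreal (\<bar>1\<bar> ^ 3) * (\<integral>\<^sup>+w. ennreal ((ft_factor s)\<^sup>2 * gauss_kernel e (s *\<^sub>R (y - (y + 1 *\<^sub>R w)))) \<partial>lborel)"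
    by (rule lborel_nn_integral_affine3) auto
  also have "\<dots> = (\<integral>\<^sup>+w. ennreal ((ft_factor s)\<^sup>2 * sqrt (2 * pi / e) ^ 3) * ennreal (gauss_damp (s\<^sup>2 / e) w) \<partial>lborel)"
  proof -
    have "gauss_kernel e (s *\<^sub>R (y - (y + 1 *\<^sub>R w))) = gauss_kernel e (s *\<^sub>R w)" for w
      by (simp add: gauss_kernel_def)
    then show ?thesis
      using e by (simp add: gauss_kernel_scaled[OF s e] ennreal_mult'[symmetric] gauss_damp_bounds mult.assoc del: real_sqrt_divide)
  qed
  also have "\<dots> = ennreal ((ft_factor s)\<^sup>2 * sqrt (2 * pi / e) ^ 3) * ennreal (sqrt (2 * pi / (s\<^sup>2 / e)) ^ 3)"
    using s e by (subst nn_integral_cmult) (auto simp: nn_integral_gauss_damp simp del: real_sqrt_divide)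
  also have "\<dots> = ennreal ((ft_factor s)\<^sup>2 * (sqrt (2 * pi / e) ^ 3 * sqrt (2 * pi / (s\<^sup>2 / e)) ^ 3))"
    using e by (simp add: ennreal_mult[symmetric] mult.assoc del: real_sqrt_divide)
  also have "\<dots> = 1" unfolding ft_factor_gauss_kernel_norm[OF s e] by simp
  finally show ?thesis .
qed

lemma fourier_int_measurable [measurable]:
  assumes [measurable]: "f \<in> borel_measurable lborel"
  shows "fourier_int s f \<in> borel_measurable lborel"
  unfolding fourier_int_def[abs_def] by measurable

lemma integrable_bounded_mult:
  fixes f m :: "real^3 \<Rightarrow> complex"
  assumes "integrable lborel f" "m \<in> borel_measurable lborel" "\<And>x. cmod (m x) \<le> K"
  shows "integrable lborel (\<lambda>x. m x * f x)"
proof (rule Bochner_Integration.integrable_bound)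
  show "integrable lborel (\<lambda>x. of_real K * f x)" using assms(1) by simp
  show "AE x in lborel. norm (m x * f x) \<le> norm (of_real K * f x)"
    using assms(3) by (auto simp: norm_mult intro!: mult_right_mono order_trans[OF assms(3) abs_ge_self])
  show "(\<lambda>x. m x * f x) \<in> borel_measurable lborel"
    using assms(1,2) by simp
qed

lemma integrable_cis_mult:
  fixes f :: "real^3 \<Rightarrow> complex"
  assumes "integrable lborel f"
  shows "integrable lborel (\<lambda>y. cis (s * (x \<bullet> y)) * f y)"
  by (rule integrable_bounded_mult[OF assms, where K = 1]) auto

lemma fourier_int_bounded:
  assumes "integrable lborel f"
  shows "cmod (fourier_int s f x) \<le> ft_factor s * (LINT y|lborel. cmod (f y))"
proof -
  have "cmod (LINT y|lborel. cis (s * (x \<bullet> y)) * f y) \<le> (LINT y|lborel. cmod (cis (s * (x \<bullet> y)) * f y))"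
    by (rule integral_norm_bound)
  then show ?thesis by (simp add: fourier_int_def norm_mult ft_factor_nonneg mult_left_mono)
qed

text \<open>With the damping all integrals converge absolutely; two applications of
  \<open>kernel_swap\<close> carry out the integration over x first, which leaves the Gaussian
  kernel between f and g.\<close>

lemma reg_inner:
  assumes f: "integrable lborel f" and g: "integrable lborel g" and e: "0 < e"
  shows "(LINT x|lborel. of_real (gauss_damp e x) * (cnj (fourier_int s g x) * fourier_int s f x))
    = of_real ((ft_factor s)\<^sup>2) * (LINT y|lborel. f y * (LINT y'|lborel. of_real (gauss_kernel e (s *\<^sub>R (y - y'))) * cnj (g y')))"
proof -
  have Ei: "integrable lborel (\<lambda>x. complex_of_real (gauss_damp e x))" using reg_ft(1)[OF e] by simp
  have [measurable]: "f \<in> borel_measurable lborel" "g \<in> borel_measurable lborel" using f g by auto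
  define a where "a x = cnj (fourier_int s g x) * of_real (gauss_damp e x)" for x
  have ai: "integrable lborel a"
    unfolding a_def by (rule integrable_bounded_mult[OF Ei, where K = "ft_factor s * (LINT y|lborel. cmod (g y))"])
      (use fourier_int_bounded[OF g] in auto)
  have gi: "integrable lborel (\<lambda>y. cnj (g y))" using g by simp
  have inner: "(LINT x|lborel. cis (s * (x \<bullet> y)) * a x)
      = of_real (ft_factor s) * (LINT y'|lborel. of_real (gauss_kernel e (s *\<^sub>R (y - y'))) * cnj (g y'))" for y
  proof -
    define a2 where "a2 x = cis (s * (x \<bullet> y)) * of_real (gauss_damp e x)" for x
    have a2i: "integrable lborel a2"
      unfolding a2_def by (rule integrable_bounded_mult[OF Ei, where K = 1]) auto
    have "cnj (fourier_int s g x) = of_real (ft_factor s) * (LINT y'|lborel. cis ((- s) * (x \<bullet> y')) * cnj (g y'))" for x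
      unfolding fourier_int_def complex_cnj_mult complex_cnj_complex_of_real Bochner_Integration.integral_cnj[symmetric] cis_cnj by simp
    then have "(LINT x|lborel. cis (s * (x \<bullet> y)) * a x)
        = (LINT x|lborel. of_real (ft_factor s) * (a2 x * (LINT y'|lborel. cis ((- s) * (x \<bullet> y')) * cnj (g y'))))"
      by (simp only: a_def a2_def mult_ac)
    also have "\<dots> = of_real (ft_factor s) * (LINT x|lborel. a2 x * (LINT y'|lborel. cis ((- s) * (x \<bullet> y')) * cnj (g y')))"
      by (rule integral_mult_right_zero)
    also have "(LINT x|lborel. a2 x * (LINT y'|lborel. cis ((- s) * (x \<bullet> y')) * cnj (g y')))
        = (LINT y'|lborel. cnj (g y') * (LINT x|lborel. cis ((- s) * (x \<bullet> y')) * a2 x))"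
      by (rule kernel_swap[OF a2i gi, where K = 1]) auto
    also have "\<dots> = (LINT y'|lborel. of_real (gauss_kernel e (s *\<^sub>R (y - y'))) * cnj (g y'))"
    proof -
      have "(LINT x|lborel. cis ((- s) * (x \<bullet> y')) * a2 x) = of_real (gauss_kernel e (s *\<^sub>R (y - y')))" for y'
      proof -
        have "cis ((- s) * (x \<bullet> y')) * a2 x = of_real (gauss_damp e x) * cis (x \<bullet> (s *\<^sub>R (y - y')))" for x
          unfolding a2_def mult.assoc[symmetric] cis_mult
          by (simp add: inner_diff_right algebra_simps)
        then show ?thesis by (simp only: reg_ft(2)[OF e])
      qed
      then show ?thesis by (simp only: mult.commute)
    qed
    finally show ?thesis .
  qed
  have "(LINT x|lborel. of_real (gauss_damp e x) * (cnj (fourier_int s g x) * fourier_int s f x))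
      = (LINT x|lborel. of_real (ft_factor s) * (a x * (LINT y|lborel. cis (s * (x \<bullet> y)) * f y)))"
    by (simp only: fourier_int_def[of s f] a_def mult_ac)
  also have "\<dots> = of_real (ft_factor s) * (LINT x|lborel. a x * (LINT y|lborel. cis (s * (x \<bullet> y)) * f y))"
    by (rule integral_mult_right_zero)
  also have "(LINT x|lborel. a x * (LINT y|lborel. cis (s * (x \<bullet> y)) * f y))
      = (LINT y|lborel. f y * (LINT x|lborel. cis (s * (x \<bullet> y)) * a x))"
    by (rule kernel_swap[OF ai f, where K = 1]) auto
  also have "\<dots> = (LINT y|lborel. of_real (ft_factor s) * (f y * (LINT y'|lborel. of_real (gauss_kernel e (s *\<^sub>R (y - y'))) * cnj (g y'))))"
    unfolding inner by (simp only: mult_ac)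
  also have "\<dots> = of_real (ft_factor s) * (LINT y|lborel. f y * (LINT y'|lborel. of_real (gauss_kernel e (s *\<^sub>R (y - y'))) * cnj (g y')))"
    by (rule integral_mult_right_zero)
  finally show ?thesis by (simp add: power2_eq_square mult.assoc)
qed

lemma integral_norm_le_nn:
  fixes f :: "'a \<Rightarrow> complex"
  assumes [measurable]: "f \<in> borel_measurable M"
  shows "ennreal (cmod (LINT x|M. f x)) \<le> (\<integral>\<^sup>+x. ennreal (cmod (f x)) \<partial>M)"
proof (cases "integrable M f")
  case True
  then show ?thesis by (rule integral_norm_bound_ennreal)
qed (simp add: not_integrable_integral_eq)

text \<open>At this stage only an inequality: for each e the damped integral is a double integral of
  f against the kernel \<open>k e\<close>, which has mass 1 in either variable, and is bounded by
  Schur's test; Fatou's lemma removes the damping. Equality comes later from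
  \<open>ft_inverse\<close>.\<close>

lemma fourier_int_contraction:
  assumes f: "integrable lborel f" and s: "s \<noteq> 0"
  shows "(\<integral>\<^sup>+x. ennreal ((cmod (fourier_int s f x))\<^sup>2) \<partial>lborel) \<le> (\<integral>\<^sup>+x. ennreal ((cmod (f x))\<^sup>2) \<partial>lborel)"
proof -
  have [measurable]: "f \<in> borel_measurable lborel" using f by auto
  define k where "k e y y' = ennreal ((ft_factor s)\<^sup>2 * gauss_kernel e (s *\<^sub>R (y - y')))" for e y y'
  have k_sym: "k e y y' = k e y' y" for e y y'
    by (simp add: k_def gauss_kernel_def norm_minus_commute)
  have km [measurable]: "(\<lambda>(y, y'). k e y y') \<in> borel_measurable (lborel \<Otimes>\<^sub>M lborel)" for e
    unfolding k_def by measurable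
  define N where "N = (\<integral>\<^sup>+x. ennreal ((cmod (f x))\<^sup>2) \<partial>lborel)"
  have ktot: "(\<integral>\<^sup>+y'. k e y y' \<partial>lborel) = 1" if "0 < e" for e y
    unfolding k_def by (rule gauss_kernel_total[OF s that])
  have reg: "(\<integral>\<^sup>+x. ennreal (gauss_damp e x * (cmod (fourier_int s f x))\<^sup>2) \<partial>lborel) \<le> N" if e: "0 < e" for e
  proof -
    have Ei: "integrable lborel (\<lambda>x. complex_of_real (gauss_damp e x))" using reg_ft(1)[OF e] by simp
    have ir: "integrable lborel (\<lambda>x. gauss_damp e x * (cmod (fourier_int s f x))\<^sup>2)"
    proof (rule Bochner_Integration.integrable_bound)
      show "integrable lborel (\<lambda>x. (ft_factor s * (LINT y|lborel. cmod (f y)))\<^sup>2 * gauss_damp e x)"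
        using reg_ft(1)[OF e] by simp
      show "AE x in lborel. norm (gauss_damp e x * (cmod (fourier_int s f x))\<^sup>2) \<le> norm ((ft_factor s * (LINT y|lborel. cmod (f y)))\<^sup>2 * gauss_damp e x)"
        using fourier_int_bounded[OF f, of s] gauss_damp_bounds[OF e]
        by (auto simp: abs_mult mult.commute[of "gauss_damp e _"] intro!: mult_right_mono power_mono)
    qed measurable
    have "(\<integral>\<^sup>+x. ennreal (gauss_damp e x * (cmod (fourier_int s f x))\<^sup>2) \<partial>lborel) = ennreal (LINT x|lborel. gauss_damp e x * (cmod (fourier_int s f x))\<^sup>2)"
      by (rule nn_integral_eq_integral[OF ir]) (use gauss_damp_bounds[OF e] in auto)
    also have "(LINT x|lborel. gauss_damp e x * (cmod (fourier_int s f x))\<^sup>2)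
        = cmod (of_real (LINT x|lborel. gauss_damp e x * (cmod (fourier_int s f x))\<^sup>2))"
      using gauss_damp_bounds[OF e] by (simp add: integral_nonneg_AE)
    also have "complex_of_real (LINT x|lborel. gauss_damp e x * (cmod (fourier_int s f x))\<^sup>2)
        = (LINT x|lborel. of_real (gauss_damp e x) * (cnj (fourier_int s f x) * fourier_int s f x))"
    proof -
      have "complex_of_real (gauss_damp e x * (cmod (fourier_int s f x))\<^sup>2) = of_real (gauss_damp e x) * (cnj (fourier_int s f x) * fourier_int s f x)" for x
        unfolding of_real_mult complex_norm_square by (simp only: mult_ac)
      then show ?thesis by (simp only: integral_complex_of_real[symmetric])
    qed
    also have "\<dots> = (LINT y|lborel. f y * (LINT y'|lborel. of_real ((ft_factor s)\<^sup>2 * gauss_kernel e (s *\<^sub>R (y - y'))) * cnj (f y')))"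
      unfolding reg_inner[OF f f e] of_real_mult mult.assoc integral_mult_right_zero
      unfolding mult.left_commute[of "f _"] integral_mult_right_zero ..
    also have "ennreal (cmod \<dots>) \<le> (\<integral>\<^sup>+y. ennreal (cmod (f y * (LINT y'|lborel. of_real ((ft_factor s)\<^sup>2 * gauss_kernel e (s *\<^sub>R (y - y'))) * cnj (f y')))) \<partial>lborel)"
      by (rule integral_norm_le_nn) measurable
    also have "\<dots> \<le> (\<integral>\<^sup>+y. ennreal (cmod (f y)) * (\<integral>\<^sup>+y'. k e y y' * ennreal (cmod (f y')) \<partial>lborel) \<partial>lborel)"
    proof (rule nn_integral_mono)
      fix y
      have "ennreal (cmod (LINT y'|lborel. of_real ((ft_factor s)\<^sup>2 * gauss_kernel e (s *\<^sub>R (y - y'))) * cnj (f y')))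
          \<le> (\<integral>\<^sup>+y'. ennreal (cmod (of_real ((ft_factor s)\<^sup>2 * gauss_kernel e (s *\<^sub>R (y - y'))) * cnj (f y'))) \<partial>lborel)"
        by (rule integral_norm_le_nn) measurable
      also have "\<dots> = (\<integral>\<^sup>+y'. k e y y' * ennreal (cmod (f y')) \<partial>lborel)"
      proof (rule nn_integral_cong)
        fix y'
        have "cmod (of_real ((ft_factor s)\<^sup>2 * gauss_kernel e (s *\<^sub>R (y - y'))) * cnj (f y')) = ((ft_factor s)\<^sup>2 * gauss_kernel e (s *\<^sub>R (y - y'))) * cmod (f y')"
          unfolding norm_mult norm_of_real using gauss_kernel_nonneg[OF e] by simp
        then show "ennreal (cmod (of_real ((ft_factor s)\<^sup>2 * gauss_kernel e (s *\<^sub>R (y - y'))) * cnj (f y'))) = k e y y' * ennreal (cmod (f y'))"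
          unfolding k_def using gauss_kernel_nonneg[OF e] by (simp only: ennreal_mult mult_nonneg_nonneg zero_le_power2 norm_ge_zero)
      qed
      finally show "ennreal (cmod (f y * (LINT y'|lborel. of_real ((ft_factor s)\<^sup>2 * gauss_kernel e (s *\<^sub>R (y - y'))) * cnj (f y'))))
          \<le> ennreal (cmod (f y)) * (\<integral>\<^sup>+y'. k e y y' * ennreal (cmod (f y')) \<partial>lborel)"
        unfolding norm_mult by (simp add: ennreal_mult mult_left_mono)
    qed
    also have "\<dots> = (\<integral>\<^sup>+y. (\<integral>\<^sup>+y'. k e y y' * (ennreal (cmod (f y)) * ennreal (cmod (f y'))) \<partial>lborel) \<partial>lborel)"
      by (simp add: nn_integral_cmult[symmetric] mult_ac)
    \<comment> \<open>Schur's test: the product is split by the arithmetic-geometric mean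
      inequality, and in each half the kernel integrates to 1 in the variable on which the other
      factor does not depend.\<close>
    also have "\<dots> \<le> (\<integral>\<^sup>+y. (\<integral>\<^sup>+y'. k e y y' * ennreal ((cmod (f y))\<^sup>2 / 2) + k e y y' * ennreal ((cmod (f y'))\<^sup>2 / 2) \<partial>lborel) \<partial>lborel)"
    proof (intro nn_integral_mono)
      fix y y'
      have "cmod (f y) * cmod (f y') \<le> (cmod (f y))\<^sup>2 / 2 + (cmod (f y'))\<^sup>2 / 2"
        using sum_squares_bound[of "cmod (f y)" "cmod (f y')"] by simp
      then have "ennreal (cmod (f y)) * ennreal (cmod (f y')) \<le> ennreal ((cmod (f y))\<^sup>2 / 2) + ennreal ((cmod (f y'))\<^sup>2 / 2)"
        by (simp add: ennreal_mult[symmetric] ennreal_plus[symmetric] ennreal_leI del: ennreal_plus)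
      then show "k e y y' * (ennreal (cmod (f y)) * ennreal (cmod (f y')))
          \<le> k e y y' * ennreal ((cmod (f y))\<^sup>2 / 2) + k e y y' * ennreal ((cmod (f y'))\<^sup>2 / 2)"
        unfolding distrib_left[symmetric] by (rule mult_left_mono) simp
    qed
    also have "\<dots> = (\<integral>\<^sup>+y. (\<integral>\<^sup>+y'. k e y y' * ennreal ((cmod (f y))\<^sup>2 / 2) \<partial>lborel) \<partial>lborel)
        + (\<integral>\<^sup>+y. (\<integral>\<^sup>+y'. k e y y' * ennreal ((cmod (f y'))\<^sup>2 / 2) \<partial>lborel) \<partial>lborel)"
      by (simp add: nn_integral_add)
    also have "(\<integral>\<^sup>+y. (\<integral>\<^sup>+y'. k e y y' * ennreal ((cmod (f y'))\<^sup>2 / 2) \<partial>lborel) \<partial>lborel)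
        = (\<integral>\<^sup>+y'. (\<integral>\<^sup>+y. k e y y' * ennreal ((cmod (f y'))\<^sup>2 / 2) \<partial>lborel) \<partial>lborel)"
      by (rule lborel_pair.Fubini'[symmetric]) measurable
    also have "\<dots> = (\<integral>\<^sup>+y'. (\<integral>\<^sup>+y. k e y' y * ennreal ((cmod (f y'))\<^sup>2 / 2) \<partial>lborel) \<partial>lborel)"
      by (simp only: k_sym[of e _ "_ :: real^3"] ) 
    also have "(\<integral>\<^sup>+y. (\<integral>\<^sup>+y'. k e y y' * ennreal ((cmod (f y))\<^sup>2 / 2) \<partial>lborel) \<partial>lborel) + \<dots> = N"
    proof -
      have "(\<integral>\<^sup>+y. (\<integral>\<^sup>+y'. k e y y' * ennreal ((cmod (f y))\<^sup>2 / 2) \<partial>lborel) \<partial>lborel) = (\<integral>\<^sup>+y. ennreal ((cmod (f y))\<^sup>2 / 2) \<partial>lborel)"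
        by (simp add: nn_integral_multc ktot[OF e])
      moreover have "(\<integral>\<^sup>+y. ennreal ((cmod (f y))\<^sup>2 / 2) \<partial>lborel) + (\<integral>\<^sup>+y. ennreal ((cmod (f y))\<^sup>2 / 2) \<partial>lborel) = N"
        unfolding N_def by (subst nn_integral_add[symmetric]) (auto simp: ennreal_plus[symmetric] simp del: ennreal_plus)
      ultimately show ?thesis by simp
    qed
    finally show ?thesis .
  qed
  define d where "d n = inverse (real (Suc n))" for n
  have d0: "d n > 0" for n by (simp add: d_def)
  have dlim: "d \<longlonglongrightarrow> 0" unfolding d_def by (rule LIMSEQ_inverse_real_of_nat)
  have "(\<integral>\<^sup>+x. ennreal ((cmod (fourier_int s f x))\<^sup>2) \<partial>lborel)
      = (\<integral>\<^sup>+x. liminf (\<lambda>n. ennreal (gauss_damp (d n) x * (cmod (fourier_int s f x))\<^sup>2)) \<partial>lborel)"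
  proof (rule nn_integral_cong)
    fix x :: "real^3"
    have "(\<lambda>n. gauss_damp (d n) x) \<longlonglongrightarrow> exp (- (0 * (norm x)\<^sup>2 / 2))"
      unfolding gauss_damp_def by (intro tendsto_intros dlim) simp
    then have "(\<lambda>n. gauss_damp (d n) x * (cmod (fourier_int s f x))\<^sup>2) \<longlonglongrightarrow> 1 * (cmod (fourier_int s f x))\<^sup>2"
      by (intro tendsto_mult tendsto_const) simp
    then have "(\<lambda>n. ennreal (gauss_damp (d n) x * (cmod (fourier_int s f x))\<^sup>2)) \<longlonglongrightarrow> ennreal ((cmod (fourier_int s f x))\<^sup>2)"
      by (intro tendsto_ennrealI) simp
    then show "ennreal ((cmod (fourier_int s f x))\<^sup>2) = liminf (\<lambda>n. ennreal (gauss_damp (d n) x * (cmod (fourier_int s f x))\<^sup>2))"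
      by (rule lim_imp_Liminf[symmetric, rotated]) simp
  qed
  also have "\<dots> \<le> liminf (\<lambda>n. \<integral>\<^sup>+x. ennreal (gauss_damp (d n) x * (cmod (fourier_int s f x))\<^sup>2) \<partial>lborel)"
    by (rule nn_integral_liminf) measurable
  also have "\<dots> \<le> N"
    by (rule Liminf_le) (use reg[OF d0] in auto)
  finally show ?thesis unfolding N_def .
qed

text \<open>The functions for which the Fourier integral converges absolutely and a class in
  \<open>L2\<close> exists. Truncations of any element are of this kind and converge to it.\<close>

definition L1_L2 :: "(real^3 \<Rightarrow> complex) \<Rightarrow> bool" where
  "L1_L2 f \<longleftrightarrow> square_integrable f \<and> integrable lborel f"

lemma L1_L2D: "L1_L2 f \<Longrightarrow> square_integrable f" "L1_L2 f \<Longrightarrow> integrable lborel f"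
  by (auto simp: L1_L2_def)

lemma fourier_int_square_integrable:
  assumes f: "L1_L2 f" and s: "s \<noteq> 0"
  shows "square_integrable (fourier_int s f)" and "norm (L2_of (fourier_int s f)) \<le> norm (L2_of f)"
proof -
  have [measurable]: "f \<in> borel_measurable lborel" using L1_L2D(2)[OF f] by auto
  have le: "(\<integral>\<^sup>+x. ennreal ((cmod (fourier_int s f x))\<^sup>2) \<partial>lborel) \<le> ennreal ((norm (L2_of f))\<^sup>2)"
    using fourier_int_contraction[OF L1_L2D(2)[OF f] s] norm_L2_of[OF L1_L2D(1)[OF f]] by simp
  then show sq: "square_integrable (fourier_int s f)"
    by (intro square_integrableI) (auto intro: le_less_trans)
  show "norm (L2_of (fourier_int s f)) \<le> norm (L2_of f)"
  proof (rule power2_le_imp_le)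
    show "(norm (L2_of (fourier_int s f)))\<^sup>2 \<le> (norm (L2_of f))\<^sup>2"
      using le unfolding norm_L2_of[OF sq, symmetric] by (subst (asm) ennreal_le_iff) auto
  qed simp
qed

lemma fourier_int_add:
  assumes "integrable lborel f" "integrable lborel g"
  shows "fourier_int s (\<lambda>x. f x + g x) x = fourier_int s f x + fourier_int s g x"
  unfolding fourier_int_def distrib_left
  by (subst Bochner_Integration.integral_add) (auto intro: integrable_cis_mult assms simp: distrib_left)

lemma fourier_int_cmult: "fourier_int s (\<lambda>x. c * f x) x = c * fourier_int s f x"
proof -
  have "(LINT y|lborel. cis (s * (x \<bullet> y)) * (c * f y)) = c * (LINT y|lborel. cis (s * (x \<bullet> y)) * f y)"
    unfolding mult.left_commute[of _ c] by (rule integral_mult_right_zero)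
  then show ?thesis by (simp add: fourier_int_def)
qed

lemma fourier_int_diff:
  assumes "integrable lborel f" "integrable lborel g"
  shows "fourier_int s (\<lambda>x. f x - g x) x = fourier_int s f x - fourier_int s g x"
  using fourier_int_add[of f "\<lambda>x. (-1) * g x" s x] fourier_int_cmult[of s "-1" g x] assms by simp

lemma fourier_int_cong_AE:
  assumes [measurable]: "f \<in> borel_measurable lborel" "g \<in> borel_measurable lborel"
    and "AE x in lborel. f x = g x"
  shows "fourier_int s f x = fourier_int s g x"
  unfolding fourier_int_def
proof (intro arg_cong[where f = "(*) _"] integral_cong_AE)
  show "AE y in lborel. cis (s * (x \<bullet> y)) * f y = cis (s * (x \<bullet> y)) * g y"
    using assms(3) by eventually_elim simp
qed measurable

lemma L1_L2_diff: "L1_L2 f \<Longrightarrow> L1_L2 g \<Longrightarrow> L1_L2 (\<lambda>x. f x - g x)"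
  unfolding L1_L2_def by (simp add: square_integrable_diff)

lemma norm_fourier_int_diff:
  assumes "L1_L2 f" "L1_L2 g" "s \<noteq> 0"
  shows "norm (L2_of (fourier_int s f) - L2_of (fourier_int s g)) \<le> norm (L2_of f - L2_of g)"
proof -
  have 1: "L2_of (\<lambda>x. f x - g x) = L2_of f - L2_of g" if "square_integrable f" "square_integrable g" for f g
    by (rule L2_of_eqI[OF square_integrable_diff[OF that]])
      (use fun_of_L2_of[OF that(1)] fun_of_L2_of[OF that(2)] fun_of_diff[of "L2_of f" "L2_of g"] in auto)
  have "fourier_int s (\<lambda>x. f x - g x) = (\<lambda>x. fourier_int s f x - fourier_int s g x)"
    by (rule ext, rule fourier_int_diff) (intro L1_L2D assms)+
  then have "L2_of (fourier_int s f) - L2_of (fourier_int s g) = L2_of (fourier_int s (\<lambda>x. f x - g x))"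
    using 1[OF fourier_int_square_integrable(1)[OF assms(1,3)] fourier_int_square_integrable(1)[OF assms(2,3)]] by simp
  then show ?thesis
    using fourier_int_square_integrable(2)[OF L1_L2_diff[OF assms(1,2)] assms(3)] 1[OF L1_L2D(1)[OF assms(1)] L1_L2D(1)[OF assms(2)]]
    by simp
qed

definition truncate :: "nat \<Rightarrow> L2 \<Rightarrow> real^3 \<Rightarrow> complex" where
  "truncate n u x = indicator (cball 0 (real n)) x *\<^sub>R fun_of u x"

lemma cball_sets [measurable]: "cball (a::real^3) r \<in> sets borel"
  by simp

lemma truncate_square_integrable: "square_integrable (truncate n u)"
proof -
  have "square_integrable (\<lambda>x. of_real (indicator (cball 0 (real n)) x) * fun_of u x)"
    by (rule square_integrable_bounded_mult[OF square_integrable_fun_of, where K = 1]) (auto split: split_indicator)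
  then show ?thesis by (simp add: truncate_def[abs_def] scaleR_conv_of_real)
qed

lemma square_integrable_indicator:
  assumes "S \<in> sets lborel" "emeasure lborel S < \<infinity>"
  shows "square_integrable (\<lambda>x. of_real (indicator S x))"
proof (rule square_integrableI)
  have "(\<integral>\<^sup>+x. ennreal ((cmod (complex_of_real (indicator S x)))\<^sup>2) \<partial>lborel) = (\<integral>\<^sup>+x. indicator S x \<partial>lborel)"
    by (intro nn_integral_cong) (auto split: split_indicator)
  then show "(\<integral>\<^sup>+x. ennreal ((cmod (complex_of_real (indicator S x)))\<^sup>2) \<partial>lborel) < \<infinity>"
    using assms by simp
qed (use assms in simp)

lemma L1_L2_truncate: "L1_L2 (truncate n u)"
proof -
  have "emeasure lborel (cball (0::real^3) (real n)) < \<infinity>"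
    using emeasure_bounded_finite[of "cball (0::real^3) (real n)"] by (simp add: less_top)
  then have "square_integrable (\<lambda>x. of_real (indicator (cball 0 (real n)) x))"
    by (intro square_integrable_indicator) auto
  from square_integrable_cnj_mult[OF this square_integrable_fun_of[of u]]
  have "integrable lborel (truncate n u)" by (simp add: truncate_def[abs_def] scaleR_conv_of_real)
  then show ?thesis using truncate_square_integrable by (simp add: L1_L2_def)
qed

lemma truncate_measurable [measurable]: "truncate n u \<in> borel_measurable lborel"
  using L1_L2D(2)[OF L1_L2_truncate[of n u]] by auto

lemma truncate_tendsto: "(\<lambda>n. L2_of (truncate n u)) \<longlonglongrightarrow> u"
proof -
  define D where "D n x = truncate n u x - fun_of u x" for n x
  have sD: "square_integrable (D n)" for n
    unfolding D_def by (intro square_integrable_diff truncate_square_integrable square_integrable_fun_of)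
  have [measurable]: "D n \<in> borel_measurable lborel" for n
    unfolding D_def by measurable
  have eq: "L2_of (truncate n u) - u = L2_of (D n)" for n
    by (rule L2_of_eqI[OF sD, symmetric])
      (use fun_of_L2_of[OF truncate_square_integrable[of n u]] fun_of_diff[of "L2_of (truncate n u)" u] in \<open>auto simp: D_def\<close>)
  have "(\<lambda>n. LINT x|lborel. (cmod (D n x))\<^sup>2) \<longlonglongrightarrow> (LINT x::real^3|lborel. 0)"
  proof (rule integral_dominated_convergence[where w = "\<lambda>x. (cmod (fun_of u x))\<^sup>2"])
    show "integrable lborel (\<lambda>x. (cmod (fun_of u x))\<^sup>2)" by (rule integrable_norm_sq)
    show "AE x in lborel. (\<lambda>n. (cmod (D n x))\<^sup>2) \<longlonglongrightarrow> 0"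
    proof (rule AE_I2)
      fix x :: "real^3"
      obtain N where "norm x \<le> real N" using real_arch_simple by blast
      then have "\<forall>\<^sub>F n in sequentially. (cmod (D n x))\<^sup>2 = 0"
        unfolding eventually_sequentially by (intro exI[of _ N]) (auto simp: D_def truncate_def)
      then show "(\<lambda>n. (cmod (D n x))\<^sup>2) \<longlonglongrightarrow> 0" by (rule tendsto_eventually)
    qed
    show "AE x in lborel. norm ((cmod (D n x))\<^sup>2) \<le> (cmod (fun_of u x))\<^sup>2" for n
      by (auto simp: D_def truncate_def split: split_indicator)
    show "(\<lambda>x. (cmod (D n x))\<^sup>2) \<in> borel_measurable lborel" for n
      by measurable
  qed simp
  moreover have "(LINT x|lborel. (cmod (D n x))\<^sup>2) = (norm (L2_of (truncate n u) - u))\<^sup>2" for n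
  proof -
    have "(norm (L2_of (D n)))\<^sup>2 = (LINT x|lborel. (cmod (D n x))\<^sup>2)"
      unfolding norm_L2_sq
    proof (rule integral_cong_AE)
      show "AE x in lborel. (cmod (fun_of (L2_of (D n)) x))\<^sup>2 = (cmod (D n x))\<^sup>2"
        using fun_of_L2_of[OF sD[of n]] by eventually_elim simp
    qed (use sD[of n] in \<open>simp_all add: square_integrable_def\<close>)
    then show ?thesis by (simp add: eq)
  qed
  ultimately have "(\<lambda>n. (norm (L2_of (truncate n u) - u))\<^sup>2) \<longlonglongrightarrow> 0" by simp
  then have "(\<lambda>n. sqrt ((norm (L2_of (truncate n u) - u))\<^sup>2)) \<longlonglongrightarrow> sqrt 0" by (intro tendsto_real_sqrt)
  then have "(\<lambda>n. norm (L2_of (truncate n u) - u)) \<longlonglongrightarrow> 0" by simp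
  then show ?thesis by (simp add: tendsto_norm_zero_iff LIM_zero_iff)
qed

text \<open>\<open>ft s\<close> is the unitary transform with kernel \<open>(\<bar>s\<bar>/2\<pi>)\<^sup>3\<^sup>/\<^sup>2 exp(i s x\<cdot>y)\<close>; \<open>s = -1\<close> is the Fourier transform.\<close>

definition ft :: "real \<Rightarrow> L2 \<Rightarrow> L2" where
  "ft s u = lim (\<lambda>n. L2_of (fourier_int s (truncate n u)))"

lemma fourier_eq_ft: "fourier = ft (- 1)"
proof
  fix u
  have "ft_factor (- 1) = (2 * pi) powr (- 3 / 2)"
    by (simp add: ft_factor_def powr_minus_divide powr_divide)
  then show "fourier u = ft (- 1) u"
    unfolding fourier_def ft_def fourier_int_def[abs_def] truncate_def set_lebesgue_integral_def by simp
qed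

lemma ft_tendsto:
  assumes s: "s \<noteq> 0"
  shows "(\<lambda>n. L2_of (fourier_int s (truncate n u))) \<longlonglongrightarrow> ft s u"
proof -
  have "Cauchy (\<lambda>n. L2_of (fourier_int s (truncate n u)))"
    unfolding Cauchy_iff
  proof (intro allI impI)
    fix e :: real assume e: "e > 0"
    have "Cauchy (\<lambda>n. L2_of (truncate n u))" using truncate_tendsto by (intro convergent_Cauchy convergentI)
    then obtain M where "\<And>m n. m \<ge> M \<Longrightarrow> n \<ge> M \<Longrightarrow> norm (L2_of (truncate m u) - L2_of (truncate n u)) < e"
      using e unfolding Cauchy_iff by blast
    then show "\<exists>M. \<forall>m\<ge>M. \<forall>n\<ge>M. norm (L2_of (fourier_int s (truncate m u)) - L2_of (fourier_int s (truncate n u))) < e"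
      using le_less_trans[OF norm_fourier_int_diff[OF L1_L2_truncate L1_L2_truncate s]] by blast
  qed
  then show ?thesis
    unfolding ft_def using Cauchy_convergent by (simp add: convergent_LIMSEQ_iff)
qed

text \<open>The truncations converge to f in norm, so the contraction estimate identifies the limit
  with the Fourier integral of f itself.\<close>

lemma ft_L2_of:
  assumes f: "L1_L2 f" and s: "s \<noteq> 0"
  shows "ft s (L2_of f) = L2_of (fourier_int s f)"
proof -
  have "(\<lambda>n. L2_of (fourier_int s (truncate n (L2_of f))) - L2_of (fourier_int s f)) \<longlonglongrightarrow> 0"
  proof (rule Lim_null_comparison)
    show "\<forall>\<^sub>F n in sequentially. norm (L2_of (fourier_int s (truncate n (L2_of f))) - L2_of (fourier_int s f)) \<le> norm (L2_of (truncate n (L2_of f)) - L2_of f)"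
      by (intro always_eventually allI norm_fourier_int_diff L1_L2_truncate f s)
    have "(\<lambda>n. norm (L2_of (truncate n (L2_of f)) - L2_of f)) \<longlonglongrightarrow> norm (L2_of f - L2_of f)"
      by (intro tendsto_intros truncate_tendsto)
    then show "(\<lambda>n. norm (L2_of (truncate n (L2_of f)) - L2_of f)) \<longlonglongrightarrow> 0" by simp
  qed
  then have "(\<lambda>n. L2_of (fourier_int s (truncate n (L2_of f)))) \<longlonglongrightarrow> L2_of (fourier_int s f)" by (simp add: LIM_zero_iff)
  then show ?thesis using ft_tendsto[OF s] LIMSEQ_unique by blast
qed

lemma L2_of_add:
  assumes "square_integrable f" "square_integrable g"
  shows "L2_of (\<lambda>x. f x + g x) = L2_of f + L2_of g"
  by (rule L2_of_eqI[OF square_integrable_add[OF assms]])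
    (use fun_of_L2_of[OF assms(1)] fun_of_L2_of[OF assms(2)] fun_of_add[of "L2_of f" "L2_of g"] in auto)

lemma L2_of_cmult:
  assumes "square_integrable f"
  shows "L2_of (\<lambda>x. c * f x) = scaleC c (L2_of f)"
  by (rule L2_of_eqI[OF square_integrable_cmult[OF assms]])
    (use fun_of_L2_of[OF assms(1)] fun_of_scaleC[of c "L2_of f"] in auto)

lemma tendsto_scaleC: "(f \<longlongrightarrow> a) F \<Longrightarrow> ((\<lambda>x. scaleC c (f x)) \<longlongrightarrow> scaleC c a) F"
  by (rule bounded_clinear_tendsto[OF bounded_clinear_scaleC_op[OF bounded_clinear_id]])

lemma norm_ft_le:
  assumes s: "s \<noteq> 0"
  shows "norm (ft s u) \<le> norm u"
proof (rule LIMSEQ_le)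
  show "(\<lambda>n. norm (L2_of (fourier_int s (truncate n u)))) \<longlonglongrightarrow> norm (ft s u)" by (intro tendsto_norm ft_tendsto s)
  show "(\<lambda>n. norm (L2_of (truncate n u))) \<longlonglongrightarrow> norm u" by (intro tendsto_norm truncate_tendsto)
  show "\<exists>N. \<forall>n\<ge>N. norm (L2_of (fourier_int s (truncate n u))) \<le> norm (L2_of (truncate n u))"
    using fourier_int_square_integrable(2)[OF L1_L2_truncate s] by blast
qed

lemma bounded_clinear_ft:
  assumes s: "s \<noteq> 0"
  shows "bounded_clinear (ft s)"
proof (rule bounded_clinearI[where K = 1])
  fix u v c
  have "L2_of (fourier_int s (truncate n (u + v))) = L2_of (fourier_int s (truncate n u)) + L2_of (fourier_int s (truncate n v))" for n
  proof -
    have "fourier_int s (truncate n (u + v)) = fourier_int s (\<lambda>x. truncate n u x + truncate n v x)"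
      by (rule ext, rule fourier_int_cong_AE) (use fun_of_add[of u v] in \<open>auto simp: truncate_def scaleR_add_right\<close>)
    also have "\<dots> = (\<lambda>x. fourier_int s (truncate n u) x + fourier_int s (truncate n v) x)"
      by (rule ext, rule fourier_int_add) (intro L1_L2D L1_L2_truncate)+
    finally show ?thesis by (simp add: L2_of_add fourier_int_square_integrable(1)[OF L1_L2_truncate s])
  qed
  then show "ft s (u + v) = ft s u + ft s v"
    using LIMSEQ_unique[OF ft_tendsto[OF s, of "u + v"]] tendsto_add[OF ft_tendsto[OF s, of u] ft_tendsto[OF s, of v]]
    by simp
  have "L2_of (fourier_int s (truncate n (scaleC c u))) = scaleC c (L2_of (fourier_int s (truncate n u)))" for n
  proof -
    have "fourier_int s (truncate n (scaleC c u)) = fourier_int s (\<lambda>x. c * truncate n u x)"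
      by (rule ext, rule fourier_int_cong_AE) (use fun_of_scaleC[of c u] in \<open>auto simp: truncate_def\<close>)
    also have "\<dots> = (\<lambda>x. c * fourier_int s (truncate n u) x)"
      by (rule ext, rule fourier_int_cmult)
    finally show ?thesis by (simp add: L2_of_cmult fourier_int_square_integrable(1)[OF L1_L2_truncate s])
  qed
  then show "ft s (scaleC c u) = scaleC c (ft s u)"
    using LIMSEQ_unique[OF ft_tendsto[OF s, of "scaleC c u"]] tendsto_scaleC[OF ft_tendsto[OF s, of u], of c]
    by simp
qed (simp add: norm_ft_le s)

lemma tendsto_cinner:
  assumes "(f \<longlongrightarrow> a) F" "(g \<longlongrightarrow> b) F"
  shows "((\<lambda>x. cinner (f x) (g x)) \<longlongrightarrow> cinner a b) F"
proof -
  have "bounded_bilinear cinner"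
  proof
    show "\<exists>K. \<forall>a b. norm (cinner a b) \<le> norm a * norm b * K"
      by (rule exI[of _ 1]) (simp add: cmod_cinner_le)
  qed (simp_all add: cinner_add_left cinner_add_right cinner_scaleR_left cinner_scaleR_right scaleR_conv_of_real)
  then show ?thesis by (rule bounded_bilinear.tendsto) (rule assms)+
qed

text \<open>Conjugating the kernel changes the sign of s; for integrable functions the identity is
  Fubini's theorem, and both sides are continuous under truncation.\<close>

lemma ft_adjoint:
  assumes s: "s \<noteq> 0"
  shows "cinner (ft s u) v = cinner u (ft (- s) v)"
proof -
  have s': "- s \<noteq> 0" using s by simp
  have L1_L2: "cinner (L2_of (fourier_int s f)) (L2_of g) = cinner (L2_of f) (L2_of (fourier_int (- s) g))" if f: "L1_L2 f" and g: "L1_L2 g" for f g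
  proof -
    have gi: "integrable lborel g" and fi: "integrable lborel (\<lambda>y. cnj (f y))" using L1_L2D[OF f] L1_L2D[OF g] by simp_all
    have "cinner (L2_of (fourier_int s f)) (L2_of g) = (LINT x|lborel. cnj (fourier_int s f x) * g x)"
      by (rule cinner_L2_of[OF fourier_int_square_integrable(1)[OF f s] L1_L2D(1)[OF g]])
    also have "\<dots> = (LINT x|lborel. of_real (ft_factor s) * (g x * (LINT y|lborel. cis ((- s) * (x \<bullet> y)) * cnj (f y))))"
      unfolding fourier_int_def complex_cnj_mult complex_cnj_complex_of_real Bochner_Integration.integral_cnj[symmetric] cis_cnj
      by (simp add: mult_ac)
    also have "\<dots> = of_real (ft_factor s) * (LINT x|lborel. g x * (LINT y|lborel. cis ((- s) * (x \<bullet> y)) * cnj (f y)))"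
      by (rule integral_mult_right_zero)
    also have "(LINT x|lborel. g x * (LINT y|lborel. cis ((- s) * (x \<bullet> y)) * cnj (f y)))
        = (LINT y|lborel. cnj (f y) * (LINT x|lborel. cis ((- s) * (x \<bullet> y)) * g x))"
      by (rule kernel_swap[OF gi fi, where K = 1]) auto
    also have "of_real (ft_factor s) * \<dots> = (LINT y|lborel. of_real (ft_factor s) * (cnj (f y) * (LINT x|lborel. cis ((- s) * (x \<bullet> y)) * g x)))"
      by (rule integral_mult_right_zero[symmetric])
    also have "\<dots> = (LINT y|lborel. cnj (f y) * fourier_int (- s) g y)"
      unfolding fourier_int_def ft_factor_minus by (simp add: mult_ac inner_commute)
    also have "\<dots> = cinner (L2_of f) (L2_of (fourier_int (- s) g))"
      by (rule cinner_L2_of[OF L1_L2D(1)[OF f] fourier_int_square_integrable(1)[OF g s'], symmetric])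
    finally show ?thesis .
  qed
  have "(\<lambda>n. cinner (L2_of (fourier_int s (truncate n u))) (L2_of (truncate n v))) \<longlonglongrightarrow> cinner (ft s u) v"
    by (intro tendsto_cinner ft_tendsto s truncate_tendsto)
  moreover have "(\<lambda>n. cinner (L2_of (truncate n u)) (L2_of (fourier_int (- s) (truncate n v)))) \<longlonglongrightarrow> cinner u (ft (- s) v)"
    by (intro tendsto_cinner ft_tendsto s' truncate_tendsto)
  ultimately show ?thesis unfolding L1_L2[OF L1_L2_truncate L1_L2_truncate] by (rule LIMSEQ_unique)
qed

lemma box_boundary_AE: "AE x in lborel. x \<in> box a b \<or> x \<notin> cbox a (b :: real^3)"
proof (rule AE_I[where N = "cbox a b - box a b"])
  show "{x \<in> space lborel. \<not> (x \<in> box a b \<or> x \<notin> cbox a b)} \<subseteq> cbox a b - box a b" by auto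
  have "emeasure lborel (cbox a b - box a b) = emeasure lborel (cbox a b) - emeasure lborel (box a b)"
    using emeasure_bounded_finite[of "box a b"] by (intro emeasure_Diff) (auto simp: box_subset_cbox bounded_box)
  then show "emeasure lborel (cbox a b - box a b) = 0"
    by (simp add: emeasure_lborel_cbox_eq emeasure_lborel_box_eq)
qed auto

definition box_ind :: "real^3 \<Rightarrow> real^3 \<Rightarrow> real^3 \<Rightarrow> complex" where
  "box_ind a b x = of_real (indicator (box a b) x)"

lemma L1_L2_box_ind: "L1_L2 (box_ind a b)"
proof -
  have "emeasure lborel (box a b) < \<infinity>" using emeasure_bounded_finite[of "box a b"] by (simp add: bounded_box less_top)
  then have "integrable lborel (indicat_real (box a b))" by (intro integrable_real_indicator) auto
  then show ?thesis using square_integrable_box by (simp add: L1_L2_def box_ind_def[abs_def])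
qed

lemma box_fun_eq: "box_fun a b = L2_of (box_ind a b)"
  by (simp add: box_fun_def box_ind_def[abs_def])

lemma box_ind_measurable [measurable]: "box_ind a b \<in> borel_measurable lborel"
  using L1_L2D(2)[OF L1_L2_box_ind[of a b]] by auto

text \<open>The substitution y' = y + c n w turns the kernel into one fixed Gaussian probability
  density in w, while the box is sampled at points converging to y. Its indicator is continuous off
  the boundary, a null set.\<close>

lemma mollified_box:
  fixes a b :: "real^3"
  assumes s: "s \<noteq> 0" and e: "\<And>n::nat. 0 < e n" and elim: "e \<longlonglongrightarrow> 0"
  defines "\<Phi> \<equiv> \<lambda>n y. (LINT y'|lborel. of_real ((ft_factor s)\<^sup>2 * gauss_kernel (e n) (s *\<^sub>R (y - y'))) * cnj (box_ind a b y'))"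
  shows "\<And>n y. cmod (\<Phi> n y) \<le> 1" and "AE y in lborel. (\<lambda>n. \<Phi> n y) \<longlonglongrightarrow> box_ind a b y"
proof -
  \<comment> \<open>The length scale on which the kernel of parameter \<open>e n\<close>, stretched
    by s, becomes \<open>gauss_damp 1\<close> up to a constant.\<close>
  define c where "c n = sqrt (e n) / s" for n
  have c0: "c n \<noteq> 0" for n using e[of n] s by (simp add: c_def)
  define A :: real where "A = sqrt (2 * pi) ^ 3"
  have A0: "A > 0" by (simp add: A_def)
  have IE: "(LINT w|lborel. gauss_damp 1 w) = A" using integral_gauss_damp[of 1] by (simp add: A_def)
  have eq: "\<Phi> n y = (LINT w|lborel. of_real (gauss_damp 1 w / A) * box_ind a b (y + c n *\<^sub>R w))" for n y
  proof -
    have "\<Phi> n y = \<bar>c n\<bar> ^ 3 *\<^sub>R (LINT w|lborel. of_real ((ft_factor s)\<^sup>2 * gauss_kernel (e n) (s *\<^sub>R (y - (y + c n *\<^sub>R w)))) * cnj (box_ind a b (y + c n *\<^sub>R w)))"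
      unfolding \<Phi>_def by (rule lborel_integral_affine3[OF c0]) measurable
    also have "\<dots> = (LINT w|lborel. \<bar>c n\<bar> ^ 3 *\<^sub>R (of_real ((ft_factor s)\<^sup>2 * gauss_kernel (e n) (s *\<^sub>R (y - (y + c n *\<^sub>R w)))) * cnj (box_ind a b (y + c n *\<^sub>R w))))"
      by (rule integral_scaleR_right[symmetric])
    also have "\<dots> = (LINT w|lborel. of_real (gauss_damp 1 w / A) * box_ind a b (y + c n *\<^sub>R w))"
    proof (rule Bochner_Integration.integral_cong[OF refl])
      fix w :: "real^3"
      have n: "norm (s *\<^sub>R (y - (y + c n *\<^sub>R w))) = sqrt (e n) * norm w"
        using s e[of n] by (simp add: c_def)
      have g: "gauss_kernel (e n) (s *\<^sub>R (y - (y + c n *\<^sub>R w))) = sqrt (2 * pi / e n) ^ 3 * gauss_damp 1 w"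
        unfolding gauss_kernel_def n gauss_damp_def using e[of n] by (simp add: power_mult_distrib)
      have "\<bar>c n\<bar> ^ 3 * ((ft_factor s)\<^sup>2 * sqrt (2 * pi / e n) ^ 3) = (\<bar>c n\<bar> * (\<bar>s\<bar> / (2 * pi)) * sqrt (2 * pi / e n)) ^ 3"
        unfolding ft_factor_sq[OF s] by (simp only: power_mult_distrib mult_ac)
      also have "\<bar>c n\<bar> * (\<bar>s\<bar> / (2 * pi)) * sqrt (2 * pi / e n) = 1 / sqrt (2 * pi)"
        using s e[of n] by (simp add: c_def real_sqrt_divide real_sqrt_mult field_simps)
      also have "(1 / sqrt (2 * pi)) ^ 3 = 1 / A" by (simp add: A_def power_divide)
      finally have "\<bar>c n\<bar> ^ 3 * ((ft_factor s)\<^sup>2 * gauss_kernel (e n) (s *\<^sub>R (y - (y + c n *\<^sub>R w)))) = gauss_damp 1 w / A"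
        unfolding g by (simp add: mult.assoc[symmetric])
      then have "complex_of_real (\<bar>c n\<bar> ^ 3) * of_real ((ft_factor s)\<^sup>2 * gauss_kernel (e n) (s *\<^sub>R (y - (y + c n *\<^sub>R w)))) = of_real (gauss_damp 1 w / A)"
        by (simp only: of_real_mult[symmetric])
      moreover have "cnj (box_ind a b (y + c n *\<^sub>R w)) = box_ind a b (y + c n *\<^sub>R w)" by (simp add: box_ind_def)
      ultimately show "\<bar>c n\<bar> ^ 3 *\<^sub>R (of_real ((ft_factor s)\<^sup>2 * gauss_kernel (e n) (s *\<^sub>R (y - (y + c n *\<^sub>R w)))) * cnj (box_ind a b (y + c n *\<^sub>R w)))
          = of_real (gauss_damp 1 w / A) * box_ind a b (y + c n *\<^sub>R w)"
        by (simp only: scaleR_conv_of_real mult.assoc[symmetric])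
    qed
    finally show ?thesis .
  qed
  have iE: "integrable lborel (\<lambda>w. gauss_damp 1 w / A)" using reg_ft(1)[of 1] by simp
  have IE1: "(LINT w|lborel. gauss_damp 1 w / A) = 1" using IE A0 by simp
  have bd: "cmod (of_real (gauss_damp 1 w / A) * box_ind a b z) \<le> gauss_damp 1 w / A" for w z
    using gauss_damp_bounds(1)[of 1 w] A0 by (auto simp: norm_mult box_ind_def simp del: of_real_divide split: split_indicator)
  have int: "integrable lborel (\<lambda>w. of_real (gauss_damp 1 w / A) * box_ind a b (y + c n *\<^sub>R w))" for n y
  proof (rule Bochner_Integration.integrable_bound[OF iE])
    show "AE w in lborel. norm (of_real (gauss_damp 1 w / A) * box_ind a b (y + c n *\<^sub>R w)) \<le> norm (gauss_damp 1 w / A)"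
      by (intro AE_I2 order_trans[OF bd]) (simp only: real_norm_def abs_ge_self)
  qed measurable
  show "cmod (\<Phi> n y) \<le> 1" for n y
  proof -
    have "cmod (\<Phi> n y) \<le> (LINT w|lborel. gauss_damp 1 w / A)"
      unfolding eq by (rule Bochner_Integration.integral_norm_bound_integral[OF int iE bd])
    then show ?thesis by (simp only: IE1)
  qed
  have clim: "c \<longlonglongrightarrow> 0"
  proof -
    have "(\<lambda>n. sqrt (e n) / s) \<longlonglongrightarrow> sqrt 0 / s" by (intro tendsto_intros elim s)
    then show ?thesis by (simp add: c_def[abs_def])
  qed
  show "AE y in lborel. (\<lambda>n. \<Phi> n y) \<longlonglongrightarrow> box_ind a b y"
    using box_boundary_AE[of a b]
  proof eventually_elim
    case (elim y)
    have pt: "(\<lambda>n. box_ind a b (y + c n *\<^sub>R w)) \<longlonglongrightarrow> box_ind a b y" for w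
    proof -
      have l: "(\<lambda>n. y + c n *\<^sub>R w) \<longlonglongrightarrow> y + 0 *\<^sub>R w" by (intro tendsto_intros clim)
      have "\<forall>\<^sub>F n in sequentially. box_ind a b (y + c n *\<^sub>R w) = box_ind a b y"
      proof (cases "y \<in> box a b")
        case True
        then have "\<forall>\<^sub>F n in sequentially. y + c n *\<^sub>R w \<in> box a b"
          using topological_tendstoD[OF l open_box] by simp
        then show ?thesis by eventually_elim (use True in \<open>simp add: box_ind_def\<close>)
      next
        case False
        then have "y \<in> - cbox a b" using elim by simp
        then have "\<forall>\<^sub>F n in sequentially. y + c n *\<^sub>R w \<in> - cbox a b"
          using topological_tendstoD[OF l, of "- cbox a b"] by (simp add: open_Compl closed_cbox)
        then show ?thesis
        proof eventually_elim
          case (elim n)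
          then have "y + c n *\<^sub>R w \<notin> box a b" using box_subset_cbox by blast
          then show ?case using False by (simp add: box_ind_def)
        qed
      qed
      then show ?thesis by (rule tendsto_eventually)
    qed
    have "(\<lambda>n. LINT w|lborel. of_real (gauss_damp 1 w / A) * box_ind a b (y + c n *\<^sub>R w))
        \<longlonglongrightarrow> (LINT w|lborel. of_real (gauss_damp 1 w / A) * box_ind a b y)"
    proof (rule integral_dominated_convergence[OF _ _ iE])
      show "AE w in lborel. (\<lambda>n. of_real (gauss_damp 1 w / A) * box_ind a b (y + c n *\<^sub>R w)) \<longlonglongrightarrow> of_real (gauss_damp 1 w / A) * box_ind a b y"
        by (intro AE_I2 tendsto_mult tendsto_const pt)
      show "AE w in lborel. norm (of_real (gauss_damp 1 w / A) * box_ind a b (y + c n *\<^sub>R w)) \<le> gauss_damp 1 w / A" for n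
        by (intro AE_I2 bd)
    qed measurable
    also have "(LINT w|lborel. of_real (gauss_damp 1 w / A) * box_ind a b y) = box_ind a b y"
    proof -
      have "(LINT w|lborel. of_real (gauss_damp 1 w / A) * box_ind a b y) = (LINT w|lborel. of_real (gauss_damp 1 w / A)) * box_ind a b y"
        by (rule integral_mult_left_zero)
      also have "(LINT w|lborel. complex_of_real (gauss_damp 1 w / A)) = of_real 1"
        unfolding integral_complex_of_real IE1 ..
      finally show ?thesis by simp
    qed
    finally show ?case unfolding eq .
  qed
qed

text \<open>\<open>reg_inner\<close> for two box functions, with dominated convergence on both
  sides: the damping tends to 1 on one, the mollified box to the box on the other.\<close>

lemma ft_isometry_box:
  assumes s: "s \<noteq> 0"
  shows "cinner (ft s (box_fun a b)) (ft s (box_fun a' b')) = cinner (box_fun a b) (box_fun a' b')"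
proof -
  define f g where "f = box_ind a' b'" and "g = box_ind a b"
  have f: "L1_L2 f" and g: "L1_L2 g" by (simp_all add: f_def g_def L1_L2_box_ind)
  have [measurable]: "f \<in> borel_measurable lborel" "g \<in> borel_measurable lborel"
    by (simp_all add: f_def g_def)
  define e where "e n = inverse (real (Suc n))" for n
  have e0: "e n > 0" for n by (simp add: e_def)
  have elim: "e \<longlonglongrightarrow> 0" unfolding e_def by (rule LIMSEQ_inverse_real_of_nat)
  define \<Phi> where "\<Phi> n y = (LINT y'|lborel. of_real ((ft_factor s)\<^sup>2 * gauss_kernel (e n) (s *\<^sub>R (y - y'))) * cnj (box_ind a b y'))" for n y
  note m = mollified_box[OF s e0 elim, where a = a and b = b, folded \<Phi>_def]
  have [measurable]: "\<Phi> n \<in> borel_measurable lborel" for n unfolding \<Phi>_def[abs_def] by measurable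
  have reg: "(LINT x|lborel. of_real (gauss_damp (e n) x) * (cnj (fourier_int s g x) * fourier_int s f x)) = (LINT y|lborel. f y * \<Phi> n y)" for n
  proof -
    have "\<Phi> n y = of_real ((ft_factor s)\<^sup>2) * (LINT y'|lborel. of_real (gauss_kernel (e n) (s *\<^sub>R (y - y'))) * cnj (g y'))" for y
      unfolding \<Phi>_def g_def of_real_mult mult.assoc by (rule integral_mult_right_zero)
    then have "(LINT y|lborel. f y * \<Phi> n y)
        = (LINT y|lborel. of_real ((ft_factor s)\<^sup>2) * (f y * (LINT y'|lborel. of_real (gauss_kernel (e n) (s *\<^sub>R (y - y'))) * cnj (g y'))))"
      by (simp only: mult.left_commute)
    then show ?thesis
      unfolding reg_inner[OF L1_L2D(2)[OF f] L1_L2D(2)[OF g] e0] by (simp only: integral_mult_right_zero)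
  qed
  have 1: "(\<lambda>n. LINT x|lborel. of_real (gauss_damp (e n) x) * (cnj (fourier_int s g x) * fourier_int s f x)) \<longlonglongrightarrow> (LINT x|lborel. cnj (fourier_int s g x) * fourier_int s f x)"
  proof (rule integral_dominated_convergence[where w = "\<lambda>x. norm (cnj (fourier_int s g x) * fourier_int s f x)"])
    show "integrable lborel (\<lambda>x. norm (cnj (fourier_int s g x) * fourier_int s f x))"
      by (intro integrable_norm square_integrable_cnj_mult fourier_int_square_integrable(1) f g s)
    show "AE x in lborel. (\<lambda>n. of_real (gauss_damp (e n) x) * (cnj (fourier_int s g x) * fourier_int s f x)) \<longlonglongrightarrow> cnj (fourier_int s g x) * fourier_int s f x"
    proof (rule AE_I2)
      fix x :: "real^3"
      have "(\<lambda>n. gauss_damp (e n) x) \<longlonglongrightarrow> exp (- (0 * (norm x)\<^sup>2 / 2))"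
        unfolding gauss_damp_def by (intro tendsto_intros elim) simp
      then have "(\<lambda>n. of_real (gauss_damp (e n) x) * (cnj (fourier_int s g x) * fourier_int s f x)) \<longlonglongrightarrow> of_real 1 * (cnj (fourier_int s g x) * fourier_int s f x)"
        by (intro tendsto_mult tendsto_const tendsto_of_real) simp
      then show "(\<lambda>n. of_real (gauss_damp (e n) x) * (cnj (fourier_int s g x) * fourier_int s f x)) \<longlonglongrightarrow> cnj (fourier_int s g x) * fourier_int s f x" by simp
    qed
    show "AE x in lborel. norm (of_real (gauss_damp (e n) x) * (cnj (fourier_int s g x) * fourier_int s f x)) \<le> norm (cnj (fourier_int s g x) * fourier_int s f x)" for n
      using gauss_damp_bounds[OF e0[of n]] by (auto simp: norm_mult intro!: mult_left_le_one_le)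
  qed measurable
  have 2: "(\<lambda>n. LINT y|lborel. f y * \<Phi> n y) \<longlonglongrightarrow> (LINT y|lborel. f y * g y)"
  proof (rule integral_dominated_convergence[where w = "\<lambda>y. norm (f y)"])
    show "integrable lborel (\<lambda>y. norm (f y))" using L1_L2D(2)[OF f] by simp
    show "AE y in lborel. (\<lambda>n. f y * \<Phi> n y) \<longlonglongrightarrow> f y * g y"
      using m(2) unfolding g_def by eventually_elim (intro tendsto_mult tendsto_const)
    show "AE y in lborel. norm (f y * \<Phi> n y) \<le> norm (f y)" for n
      using m(1) by (auto simp: norm_mult intro!: mult_left_le)
  qed measurable
  have "(LINT x|lborel. cnj (fourier_int s g x) * fourier_int s f x) = (LINT y|lborel. f y * g y)"
    using 1 2 unfolding reg by (rule LIMSEQ_unique)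
  also have "\<dots> = (LINT y|lborel. cnj (g y) * f y)"
    by (simp add: g_def box_ind_def mult.commute)
  finally show ?thesis
    unfolding box_fun_eq g_def[symmetric] f_def[symmetric] ft_L2_of[OF f s] ft_L2_of[OF g s]
    by (simp add: cinner_L2_of fourier_int_square_integrable(1)[OF f s] fourier_int_square_integrable(1)[OF g s] L1_L2D(1)[OF f] L1_L2D(1)[OF g])
qed

lemma box_fun_separating:
  assumes "\<And>a b. cinner (box_fun a b) u = cinner (box_fun a b) v"
  shows "u = v"
proof -
  have "u - v = 0" by (rule box_fun_total) (use assms in \<open>simp add: cinner_diff_right\<close>)
  then show ?thesis by simp
qed

text \<open>The isometry on boxes says that \<open>ft (- s) (ft s u)\<close> and u agree for box
  functions when tested against boxes, which are total. Moving both transforms to the other side by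
  \<open>ft_adjoint\<close> extends this to every u.\<close>

lemma ft_inverse:
  assumes s: "s \<noteq> 0"
  shows "ft (- s) (ft s u) = u"
proof -
  have s': "- s \<noteq> 0" using s by simp
  have b: "ft (- s) (ft s (box_fun a b)) = box_fun a b" for a b
  proof (rule box_fun_separating)
    fix a' b'
    show "cinner (box_fun a' b') (ft (- s) (ft s (box_fun a b))) = cinner (box_fun a' b') (box_fun a b)"
      by (rule trans[OF ft_adjoint[OF s, symmetric] ft_isometry_box[OF s]])
  qed
  show ?thesis
  proof (rule box_fun_separating)
    fix a b
    have "cinner (box_fun a b) (ft (- s) (ft s u)) = cinner (ft (- s) (ft s (box_fun a b))) u"
      using ft_adjoint[OF s, of "box_fun a b" "ft s u"] ft_adjoint[OF s', of "ft s (box_fun a b)" u] by simp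
    then show "cinner (box_fun a b) (ft (- s) (ft s u)) = cinner (box_fun a b) u" by (simp add: b)
  qed
qed

lemma norm_ft:
  assumes s: "s \<noteq> 0"
  shows "norm (ft s u) = norm u"
proof (rule antisym)
  show "norm (ft s u) \<le> norm u" by (rule norm_ft_le[OF s])
  have "norm (ft (- s) (ft s u)) \<le> norm (ft s u)" by (rule norm_ft_le) (use s in simp)
  then show "norm u \<le> norm (ft s u)" by (simp add: ft_inverse[OF s])
qed

section \<open>The kernel of the free propagator\<close>

lemma mult_graph_iff:
  assumes "m \<in> borel_measurable lborel" "\<And>x. cmod (m x) \<le> K"
  shows "(u, v) \<in> mult_graph m \<longleftrightarrow> v = mult_op m u"
proof
  assume "(u, v) \<in> mult_graph m"
  then have "AE x in lborel. fun_of v x = m x * fun_of u x" by (simp add: mult_graph_def)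
  then show "v = mult_op m u"
    by (intro L2_eqI) (use fun_of_mult_op[OF assms, of u] in auto)
next
  assume "v = mult_op m u"
  then show "(u, v) \<in> mult_graph m" using fun_of_mult_op[OF assms, of u] by (simp add: mult_graph_def)
qed

lemma ft_pm1: "ft 1 (ft (-1) u) = u" "ft (-1) (ft 1 u) = u"
  using ft_inverse[of "-1" u] ft_inverse[of 1 u] by simp_all

text \<open>For a bounded symbol the graph is that of an everywhere defined operator, so the
  definite description in \<open>free_propagator\<close> has a value.\<close>

lemma fourier_mult_graph_iff:
  assumes "m \<in> borel_measurable lborel" "\<And>x. cmod (m x) \<le> K"
  shows "(u, v) \<in> fourier_mult_graph m \<longleftrightarrow> v = ft 1 (mult_op m (ft (-1) u))"
  unfolding fourier_mult_graph_def fourier_eq_ft mem_Collect_eq prod.case mult_graph_iff[OF assms]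
  by (metis ft_pm1)

definition phase :: "real \<Rightarrow> real^3 \<Rightarrow> complex" where
  "phase a x = cis (a * (norm x)\<^sup>2)"

lemma phase_measurable [measurable]: "phase a \<in> borel_measurable borel"
  unfolding phase_def[abs_def] by measurable

lemma cmod_phase: "cmod (phase a x) = 1"
  by (simp add: phase_def)

lemma phase_measurable': "phase a \<in> borel_measurable lborel"
  by simp

lemma cmod_phase_le: "cmod (phase a x) \<le> 1"
  by (simp add: phase_def)

lemma free_propagator_eq: "free_propagator h t u = ft 1 (mult_op (phase (- (t * h / 2))) (ft (-1) u))"
proof -
  have "(\<lambda>\<xi>::real^3. cis (- (t * h / 2 * (norm \<xi>)\<^sup>2))) = phase (- (t * h / 2))"
    by (simp add: fun_eq_iff phase_def)
  then show ?thesis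
    unfolding free_propagator_def by (simp add: fourier_mult_graph_iff[OF phase_measurable' cmod_phase_le])
qed

lemma bounded_clinear_free_propagator: "bounded_clinear (free_propagator h t)"
proof -
  have b: "bounded_clinear (\<lambda>u. mult_op (phase (- (t * h / 2))) (ft (-1) u))"
    by (rule bounded_clinear_compose[OF bounded_clinear_mult_op[OF phase_measurable' cmod_phase_le] bounded_clinear_ft]) simp
  have "bounded_clinear (\<lambda>u. ft 1 (mult_op (phase (- (t * h / 2))) (ft (-1) u)))"
    by (rule bounded_clinear_compose[OF bounded_clinear_ft b]) simp
  then show ?thesis by (simp add: free_propagator_eq[abs_def])
qed

lemma mult_op_mult_op:
  assumes "m \<in> borel_measurable lborel" "\<And>x. cmod (m x) \<le> K" "m' \<in> borel_measurable lborel" "\<And>x. cmod (m' x) \<le> K'"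
  shows "mult_op m (mult_op m' u) = mult_op (\<lambda>x. m x * m' x) u"
proof (rule L2_eqI)
  have "cmod (m x * m' x) \<le> K * K'" for x
    unfolding norm_mult using assms(2)[of x] assms(4)[of x] by (intro mult_mono) (auto intro: order_trans[OF norm_ge_zero])
  then have "AE x in lborel. fun_of (mult_op (\<lambda>x. m x * m' x) u) x = m x * m' x * fun_of u x"
    by (intro fun_of_mult_op[where K = "K * K'"]) (use assms in auto)
  then show "AE x in lborel. fun_of (mult_op m (mult_op m' u)) x = fun_of (mult_op (\<lambda>x. m x * m' x) u) x"
    using fun_of_mult_op[OF assms(1,2), of "mult_op m' u"] fun_of_mult_op[OF assms(3,4), of u] by eventually_elim simp
qed

text \<open>Dominated convergence gives strong convergence; the removal of the damping needs this
  mode, since the symbols involved converge pointwise but not uniformly.\<close>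

lemma mult_op_tendsto:
  assumes m [measurable]: "\<And>n. m n \<in> borel_measurable lborel" "l \<in> borel_measurable lborel"
    and K: "\<And>n x. cmod (m n x) \<le> K" "\<And>x. cmod (l x) \<le> K" and lim: "\<And>x. (\<lambda>n. m n x) \<longlonglongrightarrow> l x"
  shows "(\<lambda>n. mult_op (m n) u) \<longlonglongrightarrow> mult_op l u"
proof -
  define D where "D n x = (m n x - l x) * fun_of u x" for n x
  have aeD: "AE x in lborel. fun_of (mult_op (m n) u - mult_op l u) x = D n x" for n
    using fun_of_mult_op[OF m(1) K(1), of n u] fun_of_mult_op[OF m(2) K(2), of u] fun_of_diff[of "mult_op (m n) u" "mult_op l u"]
    by eventually_elim (simp add: D_def algebra_simps)
  have n: "(norm (mult_op (m n) u - mult_op l u))\<^sup>2 = (LINT x|lborel. (cmod (D n x))\<^sup>2)" for n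
    unfolding norm_L2_sq
  proof (rule integral_cong_AE)
    show "AE x in lborel. (cmod (fun_of (mult_op (m n) u - mult_op l u) x))\<^sup>2 = (cmod (D n x))\<^sup>2"
      using aeD[of n] by eventually_elim simp
  qed (simp_all add: D_def)
  have "(\<lambda>n. LINT x|lborel. (cmod (D n x))\<^sup>2) \<longlonglongrightarrow> (LINT x::real^3|lborel. 0)"
  proof (rule integral_dominated_convergence[where w = "\<lambda>x. (2 * K)\<^sup>2 * (cmod (fun_of u x))\<^sup>2"])
    show "integrable lborel (\<lambda>x. (2 * K)\<^sup>2 * (cmod (fun_of u x))\<^sup>2)" by (intro integrable_mult_right integrable_norm_sq)
    show "AE x in lborel. (\<lambda>n. (cmod (D n x))\<^sup>2) \<longlonglongrightarrow> 0"
    proof (rule AE_I2)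
      fix x
      have "(\<lambda>n. (cmod (D n x))\<^sup>2) \<longlonglongrightarrow> (cmod ((l x - l x) * fun_of u x))\<^sup>2"
        unfolding D_def by (intro tendsto_intros lim)
      then show "(\<lambda>n. (cmod (D n x))\<^sup>2) \<longlonglongrightarrow> 0" by simp
    qed
    show "AE x in lborel. norm ((cmod (D n x))\<^sup>2) \<le> (2 * K)\<^sup>2 * (cmod (fun_of u x))\<^sup>2" for n
    proof (rule AE_I2)
      fix x
      have "cmod (m n x - l x) \<le> 2 * K" using norm_triangle_ineq4[of "m n x" "l x"] K(1)[of n x] K(2)[of x] by linarith
      then have "(cmod (m n x - l x))\<^sup>2 \<le> (2 * K)\<^sup>2" by (intro power_mono) auto
      then show "norm ((cmod (D n x))\<^sup>2) \<le> (2 * K)\<^sup>2 * (cmod (fun_of u x))\<^sup>2"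
        by (simp add: D_def norm_mult power_mult_distrib mult_right_mono)
    qed
    show "(\<lambda>x. (cmod (D n x))\<^sup>2) \<in> borel_measurable lborel" for n unfolding D_def by measurable
  qed simp
  then have "(\<lambda>n. (norm (mult_op (m n) u - mult_op l u))\<^sup>2) \<longlonglongrightarrow> 0" by (simp add: n)
  then have "(\<lambda>n. sqrt ((norm (mult_op (m n) u - mult_op l u))\<^sup>2)) \<longlonglongrightarrow> sqrt 0" by (intro tendsto_real_sqrt)
  then have "(\<lambda>n. norm (mult_op (m n) u - mult_op l u)) \<longlonglongrightarrow> 0" by simp
  then show ?thesis by (simp add: tendsto_norm_zero_iff LIM_zero_iff)
qed

definition cgauss :: "complex \<Rightarrow> real^3 \<Rightarrow> complex" where
  "cgauss z \<xi> = exp (- (z * of_real ((norm \<xi>)\<^sup>2) / 2))"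

lemma cgauss_measurable [measurable]: "cgauss z \<in> borel_measurable borel"
  unfolding cgauss_def[abs_def] by (intro borel_measurable_continuous_onI continuous_intros) auto

lemma cmod_cgauss: "cmod (cgauss z \<xi>) = gauss_damp (Re z) \<xi>"
  by (simp add: cgauss_def gauss_damp_def norm_exp_eq_Re)

text \<open>The damped propagator, \<open>z = e + i\<tau>\<close> with \<open>e > 0\<close>, has an integrable multiplier, so its kernel is a
  Gaussian integral; the kernel of the propagator is obtained as \<open>e\<close> tends to \<open>0\<close>.\<close>

lemma damped_propagator_kernel:
  assumes f: "L1_L2 f" and z: "0 < Re z"
  shows "L1_L2 (\<lambda>\<xi>. cgauss z \<xi> * fourier_int (-1) f \<xi>)"
    and "fourier_int 1 (\<lambda>\<xi>. cgauss z \<xi> * fourier_int (-1) f \<xi>) x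
      = of_real ((ft_factor 1)\<^sup>2) * gauss_const z ^ 3 * (LINT y|lborel. f y * exp (- of_real ((norm (x - y))\<^sup>2) / (2 * z)))"
proof -
  have [measurable]: "f \<in> borel_measurable lborel" using L1_L2D(2)[OF f] by auto
  have cgi: "integrable lborel (cgauss z)"
    by (rule Bochner_Integration.integrable_bound[OF reg_ft(1)[OF z]]) (auto simp: cmod_cgauss)
  have "integrable lborel (\<lambda>\<xi>. fourier_int (-1) f \<xi> * cgauss z \<xi>)"
    by (rule integrable_bounded_mult[OF cgi _ fourier_int_bounded[OF L1_L2D(2)[OF f]]]) measurable
  moreover have "square_integrable (\<lambda>\<xi>. cgauss z \<xi> * fourier_int (-1) f \<xi>)"
    by (rule square_integrable_bounded_mult[OF fourier_int_square_integrable(1)[OF f], where K = 1])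
      (use gauss_damp_bounds[OF z] in \<open>auto simp: cmod_cgauss\<close>)
  ultimately show "L1_L2 (\<lambda>\<xi>. cgauss z \<xi> * fourier_int (-1) f \<xi>)" by (simp add: L1_L2_def mult.commute)
  define a where "a \<xi> = cis (1 * (x \<bullet> \<xi>)) * cgauss z \<xi>" for \<xi>
  have ai: "integrable lborel a" unfolding a_def by (rule integrable_cis_mult[OF cgi])
  have in1: "(LINT \<xi>|lborel. cis ((-1) * (\<xi> \<bullet> y)) * a \<xi>) = gauss_const z ^ 3 * exp (- of_real ((norm (x - y))\<^sup>2) / (2 * z))" for y
  proof -
    have "cis ((-1) * (\<xi> \<bullet> y)) * a \<xi> = exp (- (z * of_real ((norm \<xi>)\<^sup>2) / 2)) * cis ((x - y) \<bullet> \<xi>)" for \<xi>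
      unfolding a_def mult.assoc[symmetric] cis_mult cgauss_def by (simp add: inner_diff_left inner_commute[of \<xi> y] mult.commute)
    then show ?thesis by (simp only: gauss_ft(2)[OF z])
  qed
  have "fourier_int 1 (\<lambda>\<xi>. cgauss z \<xi> * fourier_int (-1) f \<xi>) x
      = of_real (ft_factor 1) * (LINT \<xi>|lborel. of_real (ft_factor 1) * (a \<xi> * (LINT y|lborel. cis ((-1) * (\<xi> \<bullet> y)) * f y)))"
    unfolding fourier_int_def a_def by (simp add: ft_factor_minus mult_ac)
  also have "\<dots> = of_real (ft_factor 1) * (of_real (ft_factor 1) * (LINT \<xi>|lborel. a \<xi> * (LINT y|lborel. cis ((-1) * (\<xi> \<bullet> y)) * f y)))"
    by (simp only: integral_mult_right_zero)
  also have "(LINT \<xi>|lborel. a \<xi> * (LINT y|lborel. cis ((-1) * (\<xi> \<bullet> y)) * f y))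
      = (LINT y|lborel. f y * (LINT \<xi>|lborel. cis ((-1) * (\<xi> \<bullet> y)) * a \<xi>))"
    by (rule kernel_swap[OF ai L1_L2D(2)[OF f], where K = 1]) auto
  also have "\<dots> = (LINT y|lborel. gauss_const z ^ 3 * (f y * exp (- of_real ((norm (x - y))\<^sup>2) / (2 * z))))"
    unfolding in1 by (simp only: mult.left_commute)
  also have "\<dots> = gauss_const z ^ 3 * (LINT y|lborel. f y * exp (- of_real ((norm (x - y))\<^sup>2) / (2 * z)))"
    by (rule integral_mult_right_zero)
  finally show "fourier_int 1 (\<lambda>\<xi>. cgauss z \<xi> * fourier_int (-1) f \<xi>) x
      = of_real ((ft_factor 1)\<^sup>2) * gauss_const z ^ 3 * (LINT y|lborel. f y * exp (- of_real ((norm (x - y))\<^sup>2) / (2 * z)))"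
    by (simp add: power2_eq_square mult.assoc)
qed

text \<open>What remains of the constant in the kernel of the propagator after division by the
  normalisation of \<open>ft (- 1 / \<tau>)\<close>. Its modulus is 1, in accordance with
  unitarity.\<close>

definition prop_const :: "real \<Rightarrow> complex" where
  "prop_const \<tau> = of_real ((ft_factor 1)\<^sup>2) * gauss_const (\<i> * of_real \<tau>) ^ 3 / of_real (ft_factor (1 / \<tau>))"

lemma cmod_prop_const:
  assumes "\<tau> \<noteq> 0"
  shows "cmod (prop_const \<tau>) = 1"
proof -
  have "(cmod (csqrt (\<i> * of_real \<tau>)))\<^sup>2 = \<bar>\<tau>\<bar>"
    unfolding norm_power[symmetric] power2_csqrt by (simp add: norm_mult)
  then have g: "(cmod (gauss_const (\<i> * of_real \<tau>)))\<^sup>2 = 2 * pi / \<bar>\<tau>\<bar>"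
    by (simp add: gauss_const_def norm_divide power_divide)
  have "(cmod (prop_const \<tau>))\<^sup>2 = ((ft_factor 1)\<^sup>2)\<^sup>2 * ((cmod (gauss_const (\<i> * of_real \<tau>)))\<^sup>2) ^ 3 / (ft_factor (1 / \<tau>))\<^sup>2"
    unfolding prop_const_def norm_divide norm_mult norm_power norm_of_real power_divide power_mult_distrib
    by (simp add: power_mult[symmetric] mult.commute)
  also have "\<dots> = ((1 / (2 * pi)) ^ 3)\<^sup>2 * (2 * pi / \<bar>\<tau>\<bar>) ^ 3 / (\<bar>1 / \<tau>\<bar> / (2 * pi)) ^ 3"
    using assms unfolding g by (simp add: ft_factor_sq)
  also have "\<dots> = 1" using assms by (simp add: field_simps power2_eq_square power3_eq_cube)
  finally show ?thesis by (simp add: power2_eq_1_iff) (smt (verit) norm_ge_zero)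
qed

text \<open>Expanding |x - y|^2, the squares give phases in x and in y alone, and the mixed term is
  a Fourier kernel with parameter -1/\<tau>.\<close>

lemma quadratic_phase_split:
  assumes "\<tau> \<noteq> 0"
  shows "exp (- of_real ((norm (x - y))\<^sup>2) / (2 * (\<i> * of_real \<tau>)))
    = phase (1 / (2 * \<tau>)) x * (cis ((- 1 / \<tau>) * (x \<bullet> y)) * phase (1 / (2 * \<tau>)) y)"
proof -
  have "- complex_of_real ((norm (x - y))\<^sup>2) / (2 * (\<i> * of_real \<tau>)) = \<i> * of_real ((norm (x - y))\<^sup>2 / (2 * \<tau>))"
    using assms by (simp add: field_simps)
  then have "exp (- complex_of_real ((norm (x - y))\<^sup>2) / (2 * (\<i> * of_real \<tau>))) = cis ((norm (x - y))\<^sup>2 / (2 * \<tau>))"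
    by (simp add: cis_conv_exp)
  also have "(norm (x - y))\<^sup>2 / (2 * \<tau>) = (1 / (2 * \<tau>)) * (norm x)\<^sup>2 + ((- 1 / \<tau>) * (x \<bullet> y) + (1 / (2 * \<tau>)) * (norm y)\<^sup>2)"
    using assms unfolding power2_norm_eq_inner
    by (simp add: inner_diff_left inner_diff_right inner_commute[of y x] field_simps)
  finally show ?thesis unfolding phase_def cis_mult[symmetric] .
qed

text \<open>This keeps the Gaussian factors of modulus at most 1 while the damping is removed, so
  that |f| is a majorant.\<close>

lemma Re_neg_divide_le:
  assumes "0 < Re z" "0 \<le> d"
  shows "Re (- complex_of_real d / (2 * z)) \<le> 0"
proof -
  have eq: "- complex_of_real d / (2 * z) = of_real (- (d / 2)) * inverse z"
    unfolding divide_inverse inverse_mult_distrib by simp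
  have "Re (- complex_of_real d / (2 * z)) = - (d / 2) * (Re z / ((Re z)\<^sup>2 + (Im z)\<^sup>2))"
    unfolding eq times_complex.sel inverse_complex.sel by simp
  also have "\<dots> \<le> 0" using assms by (intro mult_nonpos_nonneg) auto
  finally show ?thesis .
qed

text \<open>The damped propagators applied to f converge in two ways: in norm, because their
  multipliers converge boundedly, and pointwise, by their Gaussian kernels.
  \<open>L2_limit_AE\<close> identifies the two limits.\<close>

lemma propagator_kernel_L1_L2:
  assumes f: "L1_L2 f" and t: "\<tau> \<noteq> 0"
  shows "ft 1 (mult_op (phase (- (\<tau> / 2))) (ft (-1) (L2_of f)))
    = scaleC (prop_const \<tau>) (mult_op (phase (1 / (2 * \<tau>))) (ft (- 1 / \<tau>) (mult_op (phase (1 / (2 * \<tau>))) (L2_of f))))"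
proof -
  have [measurable]: "f \<in> borel_measurable lborel" using L1_L2D(2)[OF f] by auto
  define e where "e n = inverse (real (Suc n))" for n
  have e0: "e n > 0" for n by (simp add: e_def)
  have elim: "e \<longlonglongrightarrow> 0" unfolding e_def by (rule LIMSEQ_inverse_real_of_nat)
  define z where "z n = of_real (e n) + \<i> * of_real \<tau>" for n
  have z: "0 < Re (z n)" "Re (z n) = e n" for n using e0[of n] by (simp_all add: z_def)
  have zlim: "z \<longlonglongrightarrow> \<i> * of_real \<tau>"
  proof -
    have "(\<lambda>n. of_real (e n) + \<i> * of_real \<tau>) \<longlonglongrightarrow> of_real 0 + \<i> * of_real \<tau>"
      by (intro tendsto_intros elim)
    then show ?thesis by (simp add: z_def[abs_def])
  qed
  define Fn where "Fn n \<xi> = cgauss (z n) \<xi> * fourier_int (-1) f \<xi>" for n \<xi>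
  have LFn: "L1_L2 (Fn n)" for n unfolding Fn_def by (rule damped_propagator_kernel(1)[OF f z(1)])
  define q where "q = phase (1 / (2 * \<tau>))"
  have q: "q \<in> borel_measurable lborel" "\<And>x. cmod (q x) \<le> 1" by (simp_all add: q_def cmod_phase)
  note [measurable] = q(1)
  define v where "v = ft (-1) (L2_of f)"
  have v: "v = L2_of (fourier_int (-1) f)" unfolding v_def by (rule ft_L2_of[OF f]) simp
  have LFn_eq: "L2_of (Fn n) = mult_op (cgauss (z n)) v" for n
  proof (rule L2_of_eqI[OF L1_L2D(1)[OF LFn]])
    have "AE x in lborel. fun_of (mult_op (cgauss (z n)) v) x = cgauss (z n) x * fun_of v x"
      by (rule fun_of_mult_op[where K = 1]) (use gauss_damp_bounds[OF e0] in \<open>auto simp: cmod_cgauss z(2)\<close>)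
    moreover have "AE x in lborel. fun_of v x = fourier_int (-1) f x"
      unfolding v by (rule fun_of_L2_of[OF fourier_int_square_integrable(1)[OF f]]) simp
    ultimately show "AE x in lborel. Fn n x = fun_of (mult_op (cgauss (z n)) v) x"
      by eventually_elim (simp add: Fn_def)
  qed
  have "(\<lambda>n. mult_op (cgauss (z n)) v) \<longlonglongrightarrow> mult_op (phase (- (\<tau> / 2))) v"
  proof (rule mult_op_tendsto[where K = 1])
    show "cmod (cgauss (z n) x) \<le> 1" for n x using gauss_damp_bounds[OF e0] by (simp add: cmod_cgauss z(2))
    fix x :: "real^3"
    have "(\<lambda>n. cgauss (z n) x) \<longlonglongrightarrow> exp (- (\<i> * of_real \<tau> * of_real ((norm x)\<^sup>2) / 2))"
      unfolding cgauss_def by (intro tendsto_intros zlim) simp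
    also have "exp (- (\<i> * of_real \<tau> * of_real ((norm x)\<^sup>2) / 2)) = phase (- (\<tau> / 2)) x"
      by (simp add: phase_def cis_conv_exp mult.assoc)
    finally show "(\<lambda>n. cgauss (z n) x) \<longlonglongrightarrow> phase (- (\<tau> / 2)) x" .
  qed (simp_all add: cmod_phase)
  then have lim1: "(\<lambda>n. ft 1 (L2_of (Fn n))) \<longlonglongrightarrow> ft 1 (mult_op (phase (- (\<tau> / 2))) v)"
    unfolding LFn_eq by (rule bounded_clinear_tendsto[OF bounded_clinear_ft, rotated]) simp
  define G where "G x = prop_const \<tau> * (q x * fourier_int (- 1 / \<tau>) (\<lambda>y. q y * f y) x)" for x
  have pt: "(\<lambda>n. fourier_int 1 (Fn n) x) \<longlonglongrightarrow> G x" for x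
  proof -
    \<comment> \<open>The limit point lies on the imaginary axis away from 0, hence off the branch
      cut of the root, so the constant passes to the limit.\<close>
    have n0: "\<i> * complex_of_real \<tau> \<notin> \<real>\<^sub>\<le>\<^sub>0" using t by (auto simp: complex_nonpos_Reals_iff)
    have zn0: "z n \<noteq> 0" for n using z(1)[of n] by auto
    have "(\<lambda>n. csqrt (z n)) \<longlonglongrightarrow> csqrt (\<i> * of_real \<tau>)"
      by (rule isCont_tendsto_compose[OF continuous_at_csqrt[OF n0] zlim])
    then have g: "(\<lambda>n. gauss_const (z n)) \<longlonglongrightarrow> gauss_const (\<i> * of_real \<tau>)"
      unfolding gauss_const_def by (intro tendsto_divide tendsto_const) (use t in auto)
    have "(\<lambda>n. LINT y|lborel. f y * exp (- of_real ((norm (x - y))\<^sup>2) / (2 * z n)))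
        \<longlonglongrightarrow> (LINT y|lborel. f y * exp (- of_real ((norm (x - y))\<^sup>2) / (2 * (\<i> * of_real \<tau>))))"
    proof (rule integral_dominated_convergence[where w = "\<lambda>y. norm (f y)"])
      show "integrable lborel (\<lambda>y. norm (f y))" using L1_L2D(2)[OF f] by simp
      show "AE y in lborel. (\<lambda>n. f y * exp (- of_real ((norm (x - y))\<^sup>2) / (2 * z n)))
          \<longlonglongrightarrow> f y * exp (- of_real ((norm (x - y))\<^sup>2) / (2 * (\<i> * of_real \<tau>)))"
        by (intro AE_I2 tendsto_intros zlim) (use t in auto)
      show "AE y in lborel. norm (f y * exp (- of_real ((norm (x - y))\<^sup>2) / (2 * z n))) \<le> norm (f y)" for n
      proof (rule AE_I2)
        fix y
        have "cmod (exp (- complex_of_real ((norm (x - y))\<^sup>2) / (2 * z n))) \<le> 1"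
          unfolding norm_exp_eq_Re using Re_neg_divide_le[OF z(1)[of n] zero_le_power2[of "norm (x - y)"]] by simp
        then show "norm (f y * exp (- of_real ((norm (x - y))\<^sup>2) / (2 * z n))) \<le> norm (f y)"
          unfolding norm_mult by (rule mult_left_le) simp
      qed
      have [measurable]: "(\<lambda>y. exp (- complex_of_real ((norm (x - y))\<^sup>2) / w)) \<in> borel_measurable borel" for w
        by (cases "w = 0") (auto intro!: borel_measurable_continuous_onI continuous_intros)
      show "(\<lambda>y. f y * exp (- complex_of_real ((norm (x - y))\<^sup>2) / (2 * (\<i> * complex_of_real \<tau>)))) \<in> borel_measurable lborel"
        by measurable
      show "(\<lambda>y. f y * exp (- complex_of_real ((norm (x - y))\<^sup>2) / (2 * z n))) \<in> borel_measurable lborel" for n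
        by measurable
    qed
    also have "(LINT y|lborel. f y * exp (- of_real ((norm (x - y))\<^sup>2) / (2 * (\<i> * of_real \<tau>))))
        = (LINT y|lborel. q x * (cis ((- 1 / \<tau>) * (x \<bullet> y)) * (q y * f y)))"
      unfolding quadratic_phase_split[OF t] q_def by (simp add: mult_ac)
    also have "\<dots> = q x * (LINT y|lborel. cis ((- 1 / \<tau>) * (x \<bullet> y)) * (q y * f y))"
      by (rule integral_mult_right_zero)
    finally have l: "(\<lambda>n. LINT y|lborel. f y * exp (- of_real ((norm (x - y))\<^sup>2) / (2 * z n)))
        \<longlonglongrightarrow> q x * (LINT y|lborel. cis ((- 1 / \<tau>) * (x \<bullet> y)) * (q y * f y))" .
    have "(\<lambda>n. fourier_int 1 (Fn n) x) \<longlonglongrightarrow> of_real ((ft_factor 1)\<^sup>2) * gauss_const (\<i> * of_real \<tau>) ^ 3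
        * (q x * (LINT y|lborel. cis ((- 1 / \<tau>) * (x \<bullet> y)) * (q y * f y)))"
      unfolding Fn_def damped_propagator_kernel(2)[OF f z(1)] by (intro tendsto_mult tendsto_const tendsto_power g l)
    also have "of_real ((ft_factor 1)\<^sup>2) * gauss_const (\<i> * of_real \<tau>) ^ 3
        * (q x * (LINT y|lborel. cis ((- 1 / \<tau>) * (x \<bullet> y)) * (q y * f y))) = G x"
    proof -
      have "ft_factor (- 1 / \<tau>) = ft_factor (1 / \<tau>)" using ft_factor_minus[of "1 / \<tau>"] by simp
      moreover have "ft_factor (1 / \<tau>) \<noteq> 0" using ft_factor_pos[of "1 / \<tau>"] t by simp
      ultimately show ?thesis by (simp add: G_def fourier_int_def prop_const_def)
    qed
    finally show ?thesis .
  qed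
  have s1: "- 1 / \<tau> \<noteq> 0" using t by simp
  have qf: "L1_L2 (\<lambda>y. q y * f y)"
    unfolding L1_L2_def using square_integrable_bounded_mult[OF L1_L2D(1)[OF f] q] integrable_bounded_mult[OF L1_L2D(2)[OF f] q] by blast
  have G_meas [measurable]: "G \<in> borel_measurable lborel" unfolding G_def[abs_def] by measurable
  have "Cauchy (\<lambda>n. ft 1 (L2_of (Fn n)))" using lim1 by (intro convergent_Cauchy convergentI)
  moreover have "AE x in lborel. (\<lambda>n. fun_of (ft 1 (L2_of (Fn n))) x) \<longlonglongrightarrow> G x"
  proof -
    have "AE x in lborel. fun_of (ft 1 (L2_of (Fn n))) x = fourier_int 1 (Fn n) x" for n
      using fun_of_L2_of[OF fourier_int_square_integrable(1)[OF LFn]] by (simp add: ft_L2_of[OF LFn])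
    then have "AE x in lborel. \<forall>n. fun_of (ft 1 (L2_of (Fn n))) x = fourier_int 1 (Fn n) x"
      unfolding AE_all_countable by blast
    then show ?thesis by eventually_elim (simp add: pt)
  qed
  ultimately have sG: "square_integrable G" and limG: "(\<lambda>n. ft 1 (L2_of (Fn n))) \<longlonglongrightarrow> L2_of G"
    using L2_limit_AE[OF _ G_meas] by blast+
  have "ft 1 (mult_op (phase (- (\<tau> / 2))) v) = L2_of G"
    by (rule LIMSEQ_unique[OF lim1 limG])
  also have "L2_of G = scaleC (prop_const \<tau>) (mult_op q (ft (- 1 / \<tau>) (mult_op q (L2_of f))))"
  proof (rule L2_of_eqI[OF sG])
    have m: "mult_op q (L2_of f) = L2_of (\<lambda>y. q y * f y)"
      by (rule L2_of_eqI[OF L1_L2D(1)[OF qf], symmetric])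
        (use fun_of_mult_op[OF q, of "L2_of f"] fun_of_L2_of[OF L1_L2D(1)[OF f]] in auto)
    have k: "ft (- 1 / \<tau>) (mult_op q (L2_of f)) = L2_of (fourier_int (- 1 / \<tau>) (\<lambda>y. q y * f y))"
      unfolding m by (rule ft_L2_of[OF qf s1])
    show "AE x in lborel. G x = fun_of (scaleC (prop_const \<tau>) (mult_op q (ft (- 1 / \<tau>) (mult_op q (L2_of f))))) x"
      using fun_of_scaleC[of "prop_const \<tau>" "mult_op q (ft (- 1 / \<tau>) (mult_op q (L2_of f)))"]
        fun_of_mult_op[OF q, of "ft (- 1 / \<tau>) (mult_op q (L2_of f))"]
        fun_of_L2_of[OF fourier_int_square_integrable(1)[OF qf s1]]
      unfolding k by eventually_elim (simp add: G_def)
  qed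
  finally show ?thesis unfolding v_def q_def .
qed

lemma propagator_kernel:
  assumes t: "\<tau> \<noteq> 0"
  shows "ft 1 (mult_op (phase (- (\<tau> / 2))) (ft (-1) u))
    = scaleC (prop_const \<tau>) (mult_op (phase (1 / (2 * \<tau>))) (ft (- 1 / \<tau>) (mult_op (phase (1 / (2 * \<tau>))) u)))"
proof -
  note mo = bounded_clinear_mult_op[OF phase_measurable' cmod_phase_le]
  have s: "- 1 / \<tau> \<noteq> 0" using t by simp
  have "(\<lambda>n. ft 1 (mult_op (phase (- (\<tau> / 2))) (ft (-1) (L2_of (truncate n u))))) \<longlonglongrightarrow> ft 1 (mult_op (phase (- (\<tau> / 2))) (ft (-1) u))"
    by (intro bounded_clinear_tendsto[OF bounded_clinear_ft] bounded_clinear_tendsto[OF mo] truncate_tendsto) simp_all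
  moreover have "(\<lambda>n. scaleC (prop_const \<tau>) (mult_op (phase (1 / (2 * \<tau>))) (ft (- 1 / \<tau>) (mult_op (phase (1 / (2 * \<tau>))) (L2_of (truncate n u))))))
      \<longlonglongrightarrow> scaleC (prop_const \<tau>) (mult_op (phase (1 / (2 * \<tau>))) (ft (- 1 / \<tau>) (mult_op (phase (1 / (2 * \<tau>))) u)))"
    by (intro tendsto_scaleC bounded_clinear_tendsto[OF bounded_clinear_ft[OF s]] bounded_clinear_tendsto[OF mo] truncate_tendsto)
  ultimately show ?thesis
    unfolding propagator_kernel_L1_L2[OF L1_L2_truncate t] by (rule LIMSEQ_unique)
qed

section \<open>Dyadic decomposition of the weight\<close>

definition shell :: "real \<Rightarrow> nat \<Rightarrow> (real^3) set" where
  "shell lam k = {y. 2 ^ k \<le> japanese_bracket (lam *\<^sub>R y) \<and> japanese_bracket (lam *\<^sub>R y) < 2 ^ Suc k}"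

lemma japanese_bracket_ge_1: "1 \<le> japanese_bracket y"
  by (simp add: japanese_bracket_def)

lemma norm_le_japanese_bracket: "norm y \<le> japanese_bracket y"
  unfolding japanese_bracket_def by (rule real_le_rsqrt) simp

lemma japanese_bracket_measurable [measurable]: "japanese_bracket \<in> borel_measurable borel"
  unfolding japanese_bracket_def[abs_def] by measurable

lemma shell_sets [measurable]: "shell lam k \<in> sets borel"
  unfolding shell_def by measurable

lemma ex1_dyadic:
  assumes "1 \<le> (x::real)"
  shows "\<exists>!k::nat. 2 ^ k \<le> x \<and> x < 2 ^ Suc k"
proof (rule ex_ex1I)
  define n where "n = (LEAST n. x < 2 ^ n)"
  have ex: "\<exists>n. x < 2 ^ n" using real_arch_pow[of 2 x] by simp
  have n: "x < 2 ^ n" unfolding n_def by (rule LeastI_ex[OF ex])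
  then have "n \<noteq> 0" using assms by (cases n) auto
  then obtain k where k: "n = Suc k" using not0_implies_Suc by blast
  have "\<not> x < 2 ^ k" using not_less_Least[of k "\<lambda>n. x < 2 ^ n"] k unfolding n_def by simp
  then show "\<exists>k::nat. 2 ^ k \<le> x \<and> x < 2 ^ Suc k" using n k by (intro exI[of _ k]) simp
next
  fix k k' :: nat
  assume a: "2 ^ k \<le> x \<and> x < 2 ^ Suc k" "2 ^ k' \<le> x \<and> x < 2 ^ Suc k'"
  have *: False if "k < k'" "x < 2 ^ Suc k" "2 ^ k' \<le> x" for k k' :: nat
  proof -
    have "(2::real) ^ Suc k \<le> 2 ^ k'" by (rule power_increasing) (use that in auto)
    then show False using that by linarith
  qed
  show "k = k'" using *[of k k'] *[of k' k] a by (cases k k' rule: linorder_cases) auto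
qed

text \<open>Every point lies in exactly one shell, as the bracket is at least 1, so a single term of
  the series is nonzero.\<close>

lemma shell_sums: "(\<lambda>k. indicator (shell lam k) y *\<^sub>R (z :: 'a::real_normed_vector)) sums z"
proof -
  obtain k0 where k0: "\<And>k. y \<in> shell lam k \<longleftrightarrow> k = k0"
    using ex1_dyadic[OF japanese_bracket_ge_1[of "lam *\<^sub>R y"]] unfolding shell_def by auto
  have "(\<lambda>k. indicator (shell lam k) y *\<^sub>R z) = (\<lambda>k. if k = k0 then z else 0)"
    by (simp add: fun_eq_iff k0 indicator_def)
  then show ?thesis using sums_single[of k0 "\<lambda>_. z"] by simp
qed

text \<open>The bound is the volume of the enclosing cube of side 2R with R = 2^(k+1) / lam, that is
  4^3 8^k / lam^3.\<close>

lemma emeasure_shell: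
  assumes "0 < lam"
  shows "emeasure lborel (shell lam k) \<le> ennreal (64 * 8 ^ k / lam ^ 3)"
proof -
  define R where "R = 2 ^ Suc k / lam"
  have R: "R > 0" using assms by (simp add: R_def)
  have "shell lam k \<subseteq> cbox (- (R *\<^sub>R One)) (R *\<^sub>R One)"
  proof
    fix y assume "y \<in> shell lam k"
    then have "norm (lam *\<^sub>R y) < 2 ^ Suc k"
      unfolding shell_def using norm_le_japanese_bracket[of "lam *\<^sub>R y"] by auto
    then have "norm y < R" using assms by (simp add: R_def field_simps)
    then have "\<bar>y \<bullet> b\<bar> \<le> R" if "b \<in> Basis" for b using Basis_le_norm[OF that, of y] by linarith
    then show "y \<in> cbox (- (R *\<^sub>R One)) (R *\<^sub>R One)" by (auto simp: mem_box abs_le_iff minus_le_iff)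
  qed
  then have "emeasure lborel (shell lam k) \<le> emeasure lborel (cbox (- (R *\<^sub>R One)) (R *\<^sub>R (One::real^3)))"
    by (rule emeasure_mono) simp
  also have "\<dots> = ennreal (\<Prod>b\<in>(Basis::(real^3) set). 2 * R)"
  proof -
    have 1: "(R *\<^sub>R (One::real^3)) \<bullet> b = R" if "b \<in> Basis" for b using that by simp
    have 2: "(R *\<^sub>R One - - (R *\<^sub>R (One::real^3))) \<bullet> b = 2 * R" if "b \<in> Basis" for b
      unfolding inner_diff_left inner_minus_left 1[OF that] by simp
    have 3: "(- (R *\<^sub>R (One::real^3))) \<bullet> b \<le> (R *\<^sub>R One) \<bullet> b" if "b \<in> Basis" for b
      unfolding inner_minus_left 1[OF that] using R by simp
    have "emeasure lborel (cbox (- (R *\<^sub>R One)) (R *\<^sub>R (One::real^3)))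
        = ennreal (\<Prod>b\<in>Basis. (R *\<^sub>R One - - (R *\<^sub>R (One::real^3))) \<bullet> b)"
      by (rule emeasure_lborel_cbox) (rule 3)
    also have "\<dots> = ennreal (\<Prod>b\<in>(Basis::(real^3) set). 2 * R)"
      by (intro arg_cong[where f = ennreal] prod.cong refl 2)
    finally show ?thesis .
  qed
  also have "(\<Prod>b\<in>(Basis::(real^3) set). 2 * R) = (2 * R) ^ 3" by simp
  also have "(2 * R) ^ 3 = 64 * 8 ^ k / lam ^ 3"
  proof -
    have "(2::real) ^ (3 * k) = 8 ^ k" by (simp add: power_mult)
    then show ?thesis by (simp add: R_def power_divide power_mult_distrib power_mult[symmetric] mult.commute)
  qed
  finally show ?thesis .
qed

section \<open>The transform, its shells and their kernel vectors\<close>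

text \<open>A common form of both weights, so that the estimates are proved once. Here
  \<open>sigma\<close> is only positive; the threshold 3/(2r') enters the density bounds as a
  condition on the constants c and a.\<close>

locale weighted_transform =
  fixes q m :: "real^3 \<Rightarrow> complex" and Y :: "L2 \<Rightarrow> L2" and s lam sigma :: real
  assumes q: "q \<in> borel_measurable lborel" "\<And>x. cmod (q x) = 1"
    and m: "m \<in> borel_measurable lborel" "\<And>y. cmod (m y) = japanese_bracket (lam *\<^sub>R y) powr (- sigma)"
    and Y: "bounded_clinear Y" "\<And>u. norm (Y u) \<le> norm u"
    and s: "s \<noteq> 0" and lam: "0 < lam" and sigma: "0 < sigma"
begin

lemma q_le: "cmod (q x) \<le> 1"
  by (simp add: q)

lemma m_le: "cmod (m y) \<le> 1"
proof -
  have "japanese_bracket (lam *\<^sub>R y) powr (- sigma) \<le> japanese_bracket (lam *\<^sub>R y) powr 0"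
    by (rule powr_mono) (use sigma japanese_bracket_ge_1 in auto)
  then show ?thesis using japanese_bracket_ge_1[of "lam *\<^sub>R y"] by (simp add: m(2))
qed

definition transform :: "L2 \<Rightarrow> L2" where
  "transform u = mult_op q (ft s (mult_op m (Y u)))"

definition shell_symbol :: "nat \<Rightarrow> real^3 \<Rightarrow> complex" where
  "shell_symbol k y = indicator (shell lam k) y *\<^sub>R m y"

definition shell_transform :: "nat \<Rightarrow> L2 \<Rightarrow> L2" where
  "shell_transform k u = mult_op q (ft s (mult_op (shell_symbol k) (Y u)))"

text \<open>The squared \<open>ft_factor\<close> times the volume scale lam^(-3); it carries the
  whole dependence of the bounds on s and lam.\<close>

definition theta :: real where
  "theta = (\<bar>s\<bar> / (2 * pi * lam)) ^ 3"

text \<open>The bound of the symbol on shell k, and thereby of the operator norm of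
  \<open>shell_transform k\<close>.\<close>

definition nu :: "nat \<Rightarrow> real" where
  "nu k = 2 powr (- (sigma * real k))"

text \<open>The bound of the squared norm of the kernel vectors: squared \<open>ft_factor\<close>,
  volume of the shell and squared bound of the symbol.\<close>

definition beta :: "nat \<Rightarrow> real" where
  "beta k = 64 * theta * 8 ^ k * (nu k)\<^sup>2"

text \<open>The vector that represents evaluation of \<open>shell_transform k u\<close> at x; the
  conjugate makes up for the antilinearity of \<open>cinner\<close> in its first argument.\<close>

definition shell_kernel :: "nat \<Rightarrow> real^3 \<Rightarrow> L2" where
  "shell_kernel k x = adjoint Y (L2_of (\<lambda>y. cnj (q x * of_real (ft_factor s) * cis (s * (x \<bullet> y)) * shell_symbol k y)))"

lemma theta_pos: "0 < theta"
  using s lam by (simp add: theta_def)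

lemma nu_pos: "0 < nu k"
  by (simp add: nu_def)

lemma beta_pos: "0 < beta k"
  using theta_pos nu_pos[of k] by (simp add: beta_def)

lemma shell_symbol_measurable [measurable]: "shell_symbol k \<in> borel_measurable lborel"
  using m(1) unfolding shell_symbol_def[abs_def] by measurable

lemma shell_symbol_le: "cmod (shell_symbol k y) \<le> nu k"
proof (cases "y \<in> shell lam k")
  case True
  then have "2 ^ k \<le> japanese_bracket (lam *\<^sub>R y)" by (simp add: shell_def)
  then have "japanese_bracket (lam *\<^sub>R y) powr (- sigma) \<le> (2 ^ k) powr (- sigma)"
    using sigma by (intro powr_mono2') auto
  also have "\<dots> = nu k" unfolding nu_def by (simp add: powr_realpow[symmetric] powr_powr mult.commute)
  finally show ?thesis using True by (simp add: shell_symbol_def m)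
qed (use nu_pos[of k] in \<open>simp add: shell_symbol_def\<close>)

lemma bounded_clinear_transform: "bounded_clinear transform"
proof -
  have 1: "bounded_clinear (\<lambda>u. mult_op m (Y u))"
    by (rule bounded_clinear_compose[OF bounded_clinear_mult_op[OF m(1) m_le] Y(1)])
  have 2: "bounded_clinear (\<lambda>u. ft s (mult_op m (Y u)))"
    by (rule bounded_clinear_compose[OF bounded_clinear_ft[OF s] 1])
  have "bounded_clinear (\<lambda>u. mult_op q (ft s (mult_op m (Y u))))"
    by (rule bounded_clinear_compose[OF bounded_clinear_mult_op[OF q(1) q_le] 2])
  then show ?thesis by (simp add: transform_def[abs_def])
qed

lemma norm_shell_transform_le: "norm (shell_transform k u) \<le> nu k * norm u"
proof -
  have "norm (shell_transform k u) \<le> 1 * norm (ft s (mult_op (shell_symbol k) (Y u)))"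
    unfolding shell_transform_def by (rule norm_mult_op_le[OF q(1) q_le])
  also have "\<dots> = norm (mult_op (shell_symbol k) (Y u))" by (simp add: norm_ft[OF s])
  also have "\<dots> \<le> nu k * norm (Y u)" by (rule norm_mult_op_le[OF shell_symbol_measurable shell_symbol_le])
  also have "\<dots> \<le> nu k * norm u" using nu_pos[of k] by (intro mult_left_mono Y) simp
  finally show ?thesis .
qed

lemma nu_summable: "summable nu"
proof -
  have "nu = (\<lambda>k. (2 powr (- sigma)) ^ k)"
    by (simp add: fun_eq_iff nu_def powr_realpow[symmetric] powr_powr)
  moreover have "2 powr (- sigma) < 1" using sigma by (simp add: powr_less_one)
  ultimately show ?thesis by (simp add: summable_geometric)
qed

text \<open>\<open>L2_series\<close> is applied twice: before the Fourier transform, to identify the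
  sum of the shells with the full symbol, and after it, to get convergence almost everywhere. Both
  series are dominated by multiples of \<open>nu\<close>, a geometric sequence because
  \<open>sigma\<close> is positive.\<close>

lemma transform_series: "AE x in lborel. (\<lambda>k. fun_of (shell_transform k u) x) sums fun_of (transform u) x"
proof -
  define v where "v = Y u"
  have n1: "norm (mult_op (shell_symbol k) v) \<le> nu k * norm v" for k by (rule norm_mult_op_le[OF shell_symbol_measurable shell_symbol_le])
  have sm: "summable (\<lambda>k. nu k * c)" for c by (rule summable_mult2[OF nu_summable])
  have "summable (\<lambda>k. norm (mult_op (shell_symbol k) v))"
    by (rule summable_comparison_test'[OF sm, where N = 0]) (use n1 in auto)
  from L2_series[OF this] obtain w where w: "(\<lambda>k. mult_op (shell_symbol k) v) sums w"
    "AE x in lborel. (\<lambda>k. fun_of (mult_op (shell_symbol k) v) x) sums fun_of w x" by blast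
  have "w = mult_op m v"
  proof (rule L2_eqI)
    have "AE x in lborel. fun_of (mult_op (shell_symbol k) v) x = shell_symbol k x * fun_of v x" for k
      by (rule fun_of_mult_op[OF shell_symbol_measurable shell_symbol_le])
    then have "AE x in lborel. \<forall>k. fun_of (mult_op (shell_symbol k) v) x = shell_symbol k x * fun_of v x"
      unfolding AE_all_countable by blast
    then show "AE x in lborel. fun_of w x = fun_of (mult_op m v) x"
      using w(2) fun_of_mult_op[OF m(1) m_le, of v]
    proof eventually_elim
      case (elim x)
      have "(\<lambda>k. indicator (shell lam k) x *\<^sub>R (m x * fun_of v x)) sums (m x * fun_of v x)" by (rule shell_sums)
      then have "(\<lambda>k. fun_of (mult_op (shell_symbol k) v) x) sums (m x * fun_of v x)"
        using elim(1) by (simp add: shell_symbol_def)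
      then show ?case using elim(2,3) sums_unique2 by metis
    qed
  qed
  then have "(\<lambda>k. mult_op (shell_symbol k) v) sums mult_op m v" using w(1) by simp
  then have "(\<lambda>k. ft s (mult_op (shell_symbol k) v)) sums ft s (mult_op m v)"
    by (rule bounded_linear.sums[OF bounded_clinear_bounded_linear[OF bounded_clinear_ft[OF s]]])
  then have Bs: "(\<lambda>k. shell_transform k u) sums transform u"
    unfolding shell_transform_def transform_def v_def[symmetric]
    by (rule bounded_linear.sums[OF bounded_clinear_bounded_linear[OF bounded_clinear_mult_op[OF q(1) q_le]]])
  have "summable (\<lambda>k. norm (shell_transform k u))"
    by (rule summable_comparison_test'[OF sm, where N = 0]) (use norm_shell_transform_le in auto)
  from L2_series[OF this] obtain w' where "(\<lambda>k. shell_transform k u) sums w'"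
    "AE x in lborel. (\<lambda>k. fun_of (shell_transform k u) x) sums fun_of w' x" by blast
  then show ?thesis using sums_unique2[OF Bs] by metis
qed

lemma shell_symbol_nn_integral: "(\<integral>\<^sup>+y. ennreal ((cmod (shell_symbol k y))\<^sup>2) \<partial>lborel) \<le> ennreal ((nu k)\<^sup>2 * (64 * 8 ^ k / lam ^ 3))"
proof -
  have "(\<integral>\<^sup>+y. ennreal ((cmod (shell_symbol k y))\<^sup>2) \<partial>lborel) \<le> (\<integral>\<^sup>+y. ennreal ((nu k)\<^sup>2) * indicator (shell lam k) y \<partial>lborel)"
  proof (rule nn_integral_mono)
    fix y
    show "ennreal ((cmod (shell_symbol k y))\<^sup>2) \<le> ennreal ((nu k)\<^sup>2) * indicator (shell lam k) y"
    proof (cases "y \<in> shell lam k")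
      case True
      have "(cmod (shell_symbol k y))\<^sup>2 \<le> (nu k)\<^sup>2" by (intro power_mono shell_symbol_le) simp
      then show ?thesis using True by (simp add: ennreal_leI)
    qed (simp add: shell_symbol_def)
  qed
  also have "\<dots> = ennreal ((nu k)\<^sup>2) * emeasure lborel (shell lam k)" by (simp add: nn_integral_cmult_indicator)
  also have "\<dots> \<le> ennreal ((nu k)\<^sup>2) * ennreal (64 * 8 ^ k / lam ^ 3)" by (intro mult_left_mono emeasure_shell lam) simp
  also have "\<dots> = ennreal ((nu k)\<^sup>2 * (64 * 8 ^ k / lam ^ 3))" using lam by (intro ennreal_mult[symmetric]) auto
  finally show ?thesis .
qed

lemma shell_symbol_square_integrable: "square_integrable (shell_symbol k)"
  by (rule square_integrableI[OF shell_symbol_measurable])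
    (use le_less_trans[OF shell_symbol_nn_integral ennreal_less_top] in simp)

lemma kernel_square_integrable:
  "square_integrable (\<lambda>y. cnj (q x * of_real (ft_factor s) * cis (s * (x \<bullet> y)) * shell_symbol k y))"
proof (rule square_integrableI)
  have "cmod (cnj (q x * of_real (ft_factor s) * cis (s * (x \<bullet> y)) * shell_symbol k y)) = ft_factor s * cmod (shell_symbol k y)" for y
    by (simp add: norm_mult q(2) ft_factor_nonneg)
  then have "(\<integral>\<^sup>+y. ennreal ((cmod (cnj (q x * of_real (ft_factor s) * cis (s * (x \<bullet> y)) * shell_symbol k y)))\<^sup>2) \<partial>lborel)
      = ennreal ((ft_factor s)\<^sup>2) * (\<integral>\<^sup>+y. ennreal ((cmod (shell_symbol k y))\<^sup>2) \<partial>lborel)"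
    by (simp only: power_mult_distrib) (subst nn_integral_cmult[symmetric], auto simp: ennreal_mult)
  also have "\<dots> < \<infinity>" using shell_symbol_nn_integral[of k] by (auto intro!: ennreal_mult_less_top[THEN iffD2] intro: le_less_trans)
  finally show "(\<integral>\<^sup>+y. ennreal ((cmod (cnj (q x * of_real (ft_factor s) * cis (s * (x \<bullet> y)) * shell_symbol k y)))\<^sup>2) \<partial>lborel) < \<infinity>" .
qed measurable

lemma norm_shell_kernel_le: "(norm (shell_kernel k x))\<^sup>2 \<le> beta k"
proof -
  define w where "w = L2_of (\<lambda>y. cnj (q x * of_real (ft_factor s) * cis (s * (x \<bullet> y)) * shell_symbol k y))"
  have "norm (shell_kernel k x) \<le> 1 * norm w"
    unfolding shell_kernel_def w_def by (rule norm_adjoint_le[OF Y(1)]) (use Y(2) in auto)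
  then have 1: "(norm (shell_kernel k x))\<^sup>2 \<le> (norm w)\<^sup>2" by (intro power_mono) auto
  have "ennreal ((norm w)\<^sup>2) = (\<integral>\<^sup>+y. ennreal ((cmod (cnj (q x * of_real (ft_factor s) * cis (s * (x \<bullet> y)) * shell_symbol k y)))\<^sup>2) \<partial>lborel)"
    unfolding w_def by (rule norm_L2_of[OF kernel_square_integrable])
  also have "\<dots> = ennreal ((ft_factor s)\<^sup>2) * (\<integral>\<^sup>+y. ennreal ((cmod (shell_symbol k y))\<^sup>2) \<partial>lborel)"
  proof -
    have "cmod (cnj (q x * of_real (ft_factor s) * cis (s * (x \<bullet> y)) * shell_symbol k y)) = ft_factor s * cmod (shell_symbol k y)" for y
      by (simp add: norm_mult q(2) ft_factor_nonneg)
    then show ?thesis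
      by (simp only: power_mult_distrib) (subst nn_integral_cmult[symmetric], auto simp: ennreal_mult)
  qed
  also have "\<dots> \<le> ennreal ((ft_factor s)\<^sup>2) * ennreal ((nu k)\<^sup>2 * (64 * 8 ^ k / lam ^ 3))"
    by (intro mult_left_mono shell_symbol_nn_integral) simp
  also have "\<dots> = ennreal ((ft_factor s)\<^sup>2 * ((nu k)\<^sup>2 * (64 * 8 ^ k / lam ^ 3)))"
    using lam by (intro ennreal_mult[symmetric]) auto
  also have "(ft_factor s)\<^sup>2 * ((nu k)\<^sup>2 * (64 * 8 ^ k / lam ^ 3)) = beta k"
    unfolding ft_factor_sq[OF s] beta_def theta_def by (simp add: power_divide power_mult_distrib)
  finally have "(norm w)\<^sup>2 \<le> beta k" using beta_pos[of k] by (subst (asm) ennreal_le_iff) auto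
  then show ?thesis using 1 by linarith
qed

lemma shell_transform_kernel: "AE x in lborel. fun_of (shell_transform k u) x = cinner (shell_kernel k x) u"
proof -
  define f where "f y = shell_symbol k y * fun_of (Y u) y" for y
  have sf: "square_integrable f"
    unfolding f_def by (rule square_integrable_mult_fun_of[OF shell_symbol_measurable shell_symbol_le])
  have "square_integrable (\<lambda>y. cnj (shell_symbol k y))"
    using shell_symbol_square_integrable[of k] by (simp add: square_integrable_def)
  from square_integrable_cnj_mult[OF this square_integrable_fun_of[of "Y u"]]
  have Lf: "L1_L2 f" using sf by (simp add: L1_L2_def f_def[abs_def])
  have "mult_op (shell_symbol k) (Y u) = L2_of f" by (simp add: mult_op_def f_def[abs_def])
  then have ftf: "ft s (mult_op (shell_symbol k) (Y u)) = L2_of (fourier_int s f)" by (simp add: ft_L2_of[OF Lf s])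
  have ip: "cinner (shell_kernel k x) u = q x * fourier_int s f x" for x
  proof -
    have "cinner (shell_kernel k x) u = cinner (L2_of (\<lambda>y. cnj (q x * of_real (ft_factor s) * cis (s * (x \<bullet> y)) * shell_symbol k y))) (L2_of (fun_of (Y u)))"
      unfolding shell_kernel_def by (simp add: cinner_adjoint_left[OF Y(1)])
    also have "\<dots> = (LINT y|lborel. cnj (cnj (q x * of_real (ft_factor s) * cis (s * (x \<bullet> y)) * shell_symbol k y)) * fun_of (Y u) y)"
      by (rule cinner_L2_of[OF kernel_square_integrable square_integrable_fun_of])
    also have "\<dots> = (LINT y|lborel. (q x * of_real (ft_factor s)) * (cis (s * (x \<bullet> y)) * f y))"
      by (simp add: f_def mult.assoc)
    also have "\<dots> = (q x * of_real (ft_factor s)) * (LINT y|lborel. cis (s * (x \<bullet> y)) * f y)"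
      by (rule integral_mult_right_zero)
    finally show ?thesis by (simp add: fourier_int_def mult.assoc)
  qed
  show ?thesis
    using fun_of_mult_op[OF q(1) q_le, of "L2_of (fourier_int s f)"] fun_of_L2_of[OF fourier_int_square_integrable(1)[OF Lf s]]
    unfolding shell_transform_def ftf by eventually_elim (simp add: ip)
qed

section \<open>Pointwise and integrated bounds of the density\<close>

text \<open>Parseval: the vector that represents evaluation at x on the basis has the density as its
  squared norm.\<close>

lemma dens_norm:
  assumes Z: "bounded_clinear Z" and eq: "\<And>n. fun_of (X (onb_seq n)) x = cinner v (Z (onb_seq n))"
  shows "dens X x = ennreal ((norm (adjoint Z v))\<^sup>2)"
proof -
  have "cmod (fun_of (X (onb_seq n)) x) = cmod (cinner (onb_seq n) (adjoint Z v))" for n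
    unfolding eq cinner_adjoint[OF Z] by (subst cinner_commute) simp
  then show ?thesis by (simp add: dens_def parseval_ennreal)
qed

lemma dens_shell_transform:
  assumes Z: "bounded_clinear Z"
  shows "AE x in lborel. \<forall>k. dens (\<lambda>u. shell_transform k (Z u)) x = ennreal ((norm (adjoint Z (shell_kernel k x)))\<^sup>2)"
proof -
  have "AE x in lborel. \<forall>k n. fun_of (shell_transform k (Z (onb_seq n))) x = cinner (shell_kernel k x) (Z (onb_seq n))"
    unfolding AE_all_countable using shell_transform_kernel by blast
  then show ?thesis
    by eventually_elim (auto intro: dens_norm[OF Z])
qed

text \<open>If the shell vectors decay like c^k, their sum converges and represents evaluation of
  the whole transform, bounded by the geometric series. The quantifier over y stands inside the
  almost-everywhere statement, so that y may depend on x.\<close>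

lemma dens_transform_bound:
  assumes Z: "bounded_clinear Z" and c: "0 < c" "c < 1"
  shows "AE x in lborel. \<forall>y\<ge>0. (\<forall>k. (norm (adjoint Z (shell_kernel k x)))\<^sup>2 \<le> (c ^ k)\<^sup>2 * y) \<longrightarrow>
    dens (\<lambda>u. transform (Z u)) x \<le> ennreal ((1 / (1 - c))\<^sup>2 * y)"
proof -
  have "AE x in lborel. \<forall>n. (\<lambda>k. fun_of (shell_transform k (Z (onb_seq n))) x) sums fun_of (transform (Z (onb_seq n))) x"
    unfolding AE_all_countable using transform_series by blast
  moreover have "AE x in lborel. \<forall>k n. fun_of (shell_transform k (Z (onb_seq n))) x = cinner (shell_kernel k x) (Z (onb_seq n))"
    unfolding AE_all_countable using shell_transform_kernel by blast
  ultimately show ?thesis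
  proof eventually_elim
    case (elim x)
    show ?case
    proof (intro allI impI)
      fix y :: real assume y: "0 \<le> y" and k: "\<forall>k. (norm (adjoint Z (shell_kernel k x)))\<^sup>2 \<le> (c ^ k)\<^sup>2 * y"
      have nk: "norm (adjoint Z (shell_kernel k x)) \<le> c ^ k * sqrt y" for k
      proof (rule power2_le_imp_le)
        show "(norm (adjoint Z (shell_kernel k x)))\<^sup>2 \<le> (c ^ k * sqrt y)\<^sup>2"
          using k[rule_format, of k] y by (simp only: power_mult_distrib real_sqrt_pow2)
      qed (use c y in simp)
      have g: "(\<lambda>k. c ^ k * sqrt y) sums (1 / (1 - c) * sqrt y)"
        by (intro sums_mult2 geometric_sums) (use c in simp)
      have sn: "summable (\<lambda>k. norm (adjoint Z (shell_kernel k x)))"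
        by (rule summable_comparison_test'[OF sums_summable[OF g], where N = 0]) (use nk in auto)
      define v where "v = (\<Sum>k. adjoint Z (shell_kernel k x))"
      have v: "(\<lambda>k. adjoint Z (shell_kernel k x)) sums v"
        unfolding v_def by (rule summable_sums[OF summable_norm_cancel[OF sn]])
      have "norm v \<le> (\<Sum>k. norm (adjoint Z (shell_kernel k x)))"
        unfolding v_def by (rule summable_norm[OF sn])
      also have "\<dots> \<le> 1 / (1 - c) * sqrt y"
        unfolding sums_unique[OF g] by (intro suminf_le nk sn sums_summable[OF g])
      finally have nv: "(norm v)\<^sup>2 \<le> (1 / (1 - c) * sqrt y)\<^sup>2" by (intro power_mono) auto
      have "fun_of (transform (Z (onb_seq n))) x = cinner v (onb_seq n)" for n
      proof -
        have "(\<lambda>k. cinner (adjoint Z (shell_kernel k x)) (onb_seq n)) sums cinner v (onb_seq n)"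
          by (rule bounded_linear.sums[OF bounded_linear_cinner_left v])
        moreover have "cinner (adjoint Z (shell_kernel k x)) (onb_seq n) = fun_of (shell_transform k (Z (onb_seq n))) x" for k
          using elim(2) by (simp add: cinner_adjoint_left[OF Z])
        ultimately show ?thesis using elim(1) sums_unique2 by (metis (no_types, lifting) ext)
      qed
      then have "dens (\<lambda>u. transform (Z u)) x = ennreal ((norm (adjoint (\<lambda>u. u) v))\<^sup>2)"
        by (intro dens_norm[OF bounded_clinear_id])
      also have "adjoint (\<lambda>u. u) v = v"
        by (rule fun_cong[OF adjoint_eqI[of "\<lambda>u. u" "\<lambda>u. u"]]) simp
      also have "ennreal ((norm v)\<^sup>2) \<le> ennreal ((1 / (1 - c))\<^sup>2 * y)"
        using nv y by (intro ennreal_leI) (simp only: power_mult_distrib real_sqrt_pow2)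
      finally show "dens (\<lambda>u. transform (Z u)) x \<le> ennreal ((1 / (1 - c))\<^sup>2 * y)" .
    qed
  qed
qed

text \<open>Conjugating by \<open>V \<surd>S\<close> turns the kernel vectors into the quadratic form of \<open>S\<close>.\<close>

lemma sqrt_form:
  assumes S: "pos_op S" and V: "bounded_clinear V"
  defines "Z \<equiv> \<lambda>u. V (pos_cfc sqrt S u)"
  shows "bounded_clinear Z" and "(norm (adjoint Z b))\<^sup>2 = Re (cinner (adjoint V b) (S (adjoint V b)))"
proof -
  have c: "continuous_on {0..onorm S} sqrt" by (intro continuous_intros)
  note bR = pos_cfc_spec(1)[OF S c]
  show "bounded_clinear Z" unfolding Z_def by (rule bounded_clinear_compose[OF V bR])
  have "adjoint (pos_cfc sqrt S) = pos_cfc sqrt S"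
    by (rule adjoint_eqI) (rule pos_cfc_selfadjoint[OF S c])
  then have aZ: "adjoint Z b = pos_cfc sqrt S (adjoint V b)"
    unfolding Z_def adjoint_compose[OF V bR] by simp
  have "cinner u (pos_cfc (\<lambda>x. x) S u) = of_real ((norm (pos_cfc sqrt S u))\<^sup>2)" for u
    by (rule pos_cfc_sqrt_norm[OF S continuous_on_id, of u]) simp
  then have "cinner (adjoint V b) (S (adjoint V b)) = of_real ((norm (adjoint Z b))\<^sup>2)"
    unfolding aZ pos_cfc_id[OF S] .
  then show "(norm (adjoint Z b))\<^sup>2 = Re (cinner (adjoint V b) (S (adjoint V b)))" by simp
qed

lemma norm_adjoint_shell_kernel_le:
  assumes V: "bounded_clinear V" "\<And>u. norm (V u) \<le> norm u"
  shows "(norm (adjoint V (shell_kernel k x)))\<^sup>2 \<le> beta k"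
proof -
  have "norm (adjoint V (shell_kernel k x)) \<le> 1 * norm (shell_kernel k x)"
    by (rule norm_adjoint_le[OF V(1)]) (use V(2) in auto)
  then have "(norm (adjoint V (shell_kernel k x)))\<^sup>2 \<le> (norm (shell_kernel k x))\<^sup>2" by (intro power_mono) auto
  then show ?thesis using norm_shell_kernel_le[of k x] by linarith
qed

text \<open>For r infinite no integration is involved: the norm of S times \<open>beta k\<close>
  bounds the contribution of shell k at every point, and the condition on c says that
  \<open>beta k\<close> decays at least like c^(2k).\<close>

lemma dens_bound_infinity:
  assumes S: "pos_op S" and V: "bounded_clinear V" "\<And>u. norm (V u) \<le> norm u"
    and c: "0 < c" "c < 1" "8 * 2 powr (- (2 * sigma)) \<le> c\<^sup>2"
  shows "AE x in lborel. dens (\<lambda>u. transform (V (pos_cfc sqrt S u))) x \<le> ennreal ((1 / (1 - c))\<^sup>2 * (64 * theta * onorm S))"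
proof -
  define Z where "Z u = V (pos_cfc sqrt S u)" for u
  note Z = sqrt_form[OF S V(1), folded Z_def]
  have nS: "0 \<le> onorm S" by (rule bounded_clinear_onorm_pos[OF pos_opD(1)[OF S]])
  have bd: "(norm (adjoint Z (shell_kernel k x)))\<^sup>2 \<le> (c ^ k)\<^sup>2 * (64 * theta * onorm S)" for k x
  proof -
    have "(norm (adjoint Z (shell_kernel k x)))\<^sup>2 \<le> onorm S * (norm (adjoint V (shell_kernel k x)))\<^sup>2"
      unfolding Z(2) by (rule pos_op_le_onorm[OF S])
    also have "\<dots> \<le> onorm S * beta k" by (intro mult_left_mono norm_adjoint_shell_kernel_le V nS)
    also have "beta k = 64 * theta * (8 * 2 powr (- (2 * sigma))) ^ k"
    proof -
      have "(nu k)\<^sup>2 = (2 powr (- (2 * sigma))) ^ k"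
        by (simp add: nu_def powr_realpow[symmetric] powr_powr mult_ac)
      then show ?thesis by (simp add: beta_def power_mult_distrib)
    qed
    also have "onorm S * (64 * theta * (8 * 2 powr (- (2 * sigma))) ^ k) \<le> onorm S * (64 * theta * (c\<^sup>2) ^ k)"
      using nS theta_pos by (intro mult_left_mono power_mono c) auto
    also have "\<dots> = (c ^ k)\<^sup>2 * (64 * theta * onorm S)" by (simp add: power_mult[symmetric] mult_ac)
    finally show ?thesis .
  qed
  show ?thesis
    using dens_transform_bound[OF Z(1) c(1,2)]
  proof eventually_elim
    case (elim x)
    have "0 \<le> 64 * theta * onorm S" using nS theta_pos by simp
    then show ?case using elim bd unfolding Z_def by blast
  qed
qed

text \<open>With T the square root of S^r, \<open>Q\<close> sums over the shells the densities of
  \<open>shell_transform k\<close> after V T, with weights \<open>w k\<close>. Jensen's inequality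
  bounds the squared shell vectors at x by c^(2k) Q(x)^(1/r), and the integral of Q is bounded by a
  geometric series of ratio a times the trace of S^r.\<close>

lemma dens_bound_finite:
  assumes S: "pos_op S" and V: "bounded_clinear V" "\<And>u. norm (V u) \<le> norm u"
    and r: "1 \<le> r" and c: "0 < c" "c < 1"
    and a: "a = c powr (- 2 * r) * 8 powr (r - 1) * 2 powr (- 2 * sigma * r)" "a < 1"
    and tr: "hs_sq (pos_cfc (\<lambda>t. sqrt (t powr r)) S) < \<infinity>"
  defines "X \<equiv> \<lambda>u. transform (V (pos_cfc sqrt S u))"
  shows "AE x in lborel. dens X x < \<infinity>"
    and "(\<integral>\<^sup>+x. ennreal (enn2real (dens X x) powr r) \<partial>lborel)
      \<le> ennreal ((1 / (1 - c)) powr (2 * r) * (64 powr (r - 1) / (1 - a)) * theta powr (r - 1)) * hs_sq (pos_cfc (\<lambda>t. sqrt (t powr r)) S)"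
proof -
  define Z where "Z u = V (pos_cfc sqrt S u)" for u
  note Z = sqrt_form[OF S V(1), folded Z_def]
  have cr: "continuous_on {0..onorm S} (\<lambda>t. t powr r)" using r by (intro continuous_on_powr_nonneg) simp
  define T where "T = pos_cfc (\<lambda>t. sqrt (t powr r)) S"
  have ct: "continuous_on {0..onorm S} (\<lambda>t. sqrt (t powr r))" by (intro continuous_intros cr)
  have bT: "bounded_clinear T" unfolding T_def by (rule pos_cfc_spec(1)[OF S ct])
  have bVT: "bounded_clinear (\<lambda>u. V (T u))" by (rule bounded_clinear_compose[OF V(1) bT])
  have aVT: "adjoint (\<lambda>u. V (T u)) b = T (adjoint V b)" for b
  proof -
    have "adjoint T = T" unfolding T_def by (rule adjoint_eqI) (rule pos_cfc_selfadjoint[OF S ct])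
    then show ?thesis unfolding adjoint_compose[OF V(1) bT] by simp
  qed
  \<comment> \<open>The factor c^(-2rk) becomes the decay c^(2k) after the r-th root is taken, and
    \<open>beta k\<close> to the power r - 1 is the factor in Jensen's inequality.\<close>
  define w where "w k = c powr (- 2 * r * real k) * beta k powr (r - 1)" for k
  have w0: "w k > 0" for k using c beta_pos[of k] by (simp add: w_def)
  define Q where "Q x = (\<Sum>k. ennreal (w k) * dens (\<lambda>u. shell_transform k (V (T u))) x)" for x
  have Qm [measurable]: "Q \<in> borel_measurable lborel" unfolding Q_def[abs_def] by measurable
  have a0: "a > 0" using c by (simp add: a)
  define G where "G = 64 powr (r - 1) * theta powr (r - 1)"
  \<comment> \<open>Integrated, shell k contributes its weight times its squared operator bound; the
    powers collect to the ratio a.\<close>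
  have wnu: "w k * (nu k)\<^sup>2 = G * a ^ k" for k
  proof -
    have n2: "(nu k)\<^sup>2 = 2 powr (- 2 * sigma * real k)"
      by (simp add: nu_def power2_eq_square powr_add[symmetric] mult.assoc)
    have b: "beta k powr (r - 1) = G * (8 powr (r - 1)) ^ k * 2 powr (- 2 * sigma * real k * (r - 1))"
      unfolding beta_def n2 G_def using theta_pos
      by (simp add: powr_mult powr_powr powr_realpow[symmetric] powr_powr mult_ac)
    have "a ^ k = c powr (- 2 * r * real k) * (8 powr (r - 1)) ^ k * 2 powr (- 2 * sigma * r * real k)"
      unfolding a power_mult_distrib using c by (simp add: powr_realpow[symmetric] powr_powr)
    moreover have "2 powr (- 2 * sigma * real k * (r - 1)) * 2 powr (- 2 * sigma * real k) = 2 powr (- 2 * sigma * r * real k)"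
      unfolding powr_add[symmetric] by (simp add: algebra_simps)
    ultimately show ?thesis unfolding w_def b n2 by (simp only: mult_ac)
  qed
  have intQ: "(\<integral>\<^sup>+x. Q x \<partial>lborel) \<le> ennreal (G / (1 - a)) * hs_sq T"
  proof -
    have "(\<integral>\<^sup>+x. Q x \<partial>lborel) = (\<Sum>k. ennreal (w k) * hs_sq (\<lambda>u. shell_transform k (V (T u))))"
      unfolding Q_def by (subst nn_integral_suminf) (auto simp: nn_integral_cmult nn_integral_dens)
    also have "\<dots> \<le> (\<Sum>k. ennreal (G * a ^ k) * hs_sq T)"
    proof (intro suminf_le)
      fix k
      have "norm (shell_transform k (V u)) \<le> nu k * norm u" for u
        using norm_shell_transform_le[of k "V u"] V(2)[of u] nu_pos[of k] by (meson less_imp_le mult_left_mono order_trans)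
      then have "hs_sq (\<lambda>u. shell_transform k (V (T u))) \<le> ennreal ((nu k)\<^sup>2) * hs_sq T" by (rule hs_sq_comp_left)
      then have "ennreal (w k) * hs_sq (\<lambda>u. shell_transform k (V (T u))) \<le> ennreal (w k) * (ennreal ((nu k)\<^sup>2) * hs_sq T)"
        by (rule mult_left_mono) simp
      also have "\<dots> = ennreal (w k * (nu k)\<^sup>2) * hs_sq T"
        using w0[of k] by (simp add: ennreal_mult mult.assoc less_imp_le)
      finally show "ennreal (w k) * hs_sq (\<lambda>u. shell_transform k (V (T u))) \<le> ennreal (G * a ^ k) * hs_sq T" unfolding wnu .
    qed auto
    also have "\<dots> = (\<Sum>k. ennreal (G * a ^ k)) * hs_sq T" by simp
    also have "(\<Sum>k. ennreal (G * a ^ k)) = ennreal (G * (1 / (1 - a)))"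
      by (intro suminf_ennreal_eq sums_mult geometric_sums) (use a0 a(2) in \<open>auto simp: G_def\<close>)
    finally show ?thesis by simp
  qed
  have "(\<integral>\<^sup>+x. Q x \<partial>lborel) < \<infinity>"
    using intQ tr unfolding T_def[symmetric] by (auto simp: ennreal_mult_less_top intro: le_less_trans)
  then have Qfin: "AE x in lborel. Q x \<noteq> \<infinity>" by (intro nn_integral_PInf_AE) auto
  have main: "AE x in lborel. dens X x \<le> ennreal ((1 / (1 - c))\<^sup>2 * enn2real (Q x) powr (1 / r)) \<and> Q x \<noteq> \<infinity>"
    using dens_transform_bound[OF Z(1) c] dens_shell_transform[OF bVT] Qfin
  proof eventually_elim
    case (elim x)
    define y where "y = enn2real (Q x) powr (1 / r)"
    have "(norm (adjoint Z (shell_kernel k x)))\<^sup>2 \<le> (c ^ k)\<^sup>2 * y" for k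
    proof -
      define p where "p = (norm (adjoint Z (shell_kernel k x)))\<^sup>2"
      define d where "d = adjoint V (shell_kernel k x)"
      have p: "p = Re (cinner d (S d))" unfolding p_def d_def by (rule Z(2))
      have "p powr r \<le> beta k powr (r - 1) * Re (cinner d (pos_cfc (\<lambda>t. t powr r) S d))"
        unfolding p by (rule pos_op_jensen[OF S r _ beta_pos]) (unfold d_def, rule norm_adjoint_shell_kernel_le[OF V])
      also have "Re (cinner d (pos_cfc (\<lambda>t. t powr r) S d)) = (norm (T d))\<^sup>2"
        unfolding T_def by (subst pos_cfc_sqrt_norm[OF S cr]) auto
      finally have 1: "p powr r \<le> beta k powr (r - 1) * (norm (T d))\<^sup>2" .
      have "ennreal (w k * (norm (T d))\<^sup>2) = ennreal (w k) * dens (\<lambda>u. shell_transform k (V (T u))) x"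
        using elim(2) w0[of k] by (simp add: aVT d_def ennreal_mult less_imp_le)
      also have "\<dots> \<le> Q x"
      proof -
        have "(\<Sum>j\<in>{k}. ennreal (w j) * dens (\<lambda>u. shell_transform j (V (T u))) x) \<le> Q x"
          unfolding Q_def by (rule sum_le_suminf) auto
        then show ?thesis by simp
      qed
      finally have "enn2real (ennreal (w k * (norm (T d))\<^sup>2)) \<le> enn2real (Q x)"
        using elim(3) by (intro enn2real_mono) (auto simp: less_top)
      then have 2: "w k * (norm (T d))\<^sup>2 \<le> enn2real (Q x)" using w0[of k] by simp
      have "c powr (- 2 * r * real k) * p powr r \<le> c powr (- 2 * r * real k) * (beta k powr (r - 1) * (norm (T d))\<^sup>2)"
        by (intro mult_left_mono 1) simp
      also have "\<dots> \<le> enn2real (Q x)" using 2 by (simp add: w_def mult.assoc)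
      finally have 3: "c powr (- 2 * r * real k) * p powr r \<le> enn2real (Q x)" .
      have p0: "p \<ge> 0" by (simp add: p_def)
      have "(c powr (- 2 * real k) * p) powr r = c powr (- 2 * r * real k) * p powr r"
        using p0 by (simp add: powr_mult powr_powr mult_ac)
      then have "((c powr (- 2 * real k) * p) powr r) powr (1 / r) \<le> y"
        unfolding y_def using 3 r by (intro powr_mono2) auto
      then have "c powr (- 2 * real k) * p \<le> y"
        using p0 r by (simp add: powr_powr)
      then have "c powr (2 * real k) * (c powr (- 2 * real k) * p) \<le> c powr (2 * real k) * y"
        by (intro mult_left_mono) auto
      moreover have "c powr (2 * real k) * c powr (- 2 * real k) = 1"
        unfolding powr_add[symmetric] using c by simp
      moreover have "c powr (2 * real k) = (c ^ k)\<^sup>2"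
        using c by (simp add: powr_realpow[symmetric] powr_powr power2_eq_square powr_add[symmetric])
      ultimately show ?thesis unfolding p_def[symmetric] by (simp add: mult.assoc[symmetric])
    qed
    then have "dens (\<lambda>u. transform (Z u)) x \<le> ennreal ((1 / (1 - c))\<^sup>2 * y)"
      using elim(1) by (simp add: y_def)
    then show ?case using elim(3) unfolding X_def Z_def y_def by simp
  qed
  show "AE x in lborel. dens X x < \<infinity>"
    using main by eventually_elim (auto intro: le_less_trans)
  have "(\<integral>\<^sup>+x. ennreal (enn2real (dens X x) powr r) \<partial>lborel) \<le> (\<integral>\<^sup>+x. ennreal ((1 / (1 - c)) powr (2 * r)) * Q x \<partial>lborel)"
  proof (rule nn_integral_mono_AE)
    show "AE x in lborel. ennreal (enn2real (dens X x) powr r) \<le> ennreal ((1 / (1 - c)) powr (2 * r)) * Q x"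
      using main
    proof eventually_elim
      case (elim x)
      define K where "K = 1 / (1 - c)"
      have K: "K > 0" using c by (simp add: K_def)
      have "enn2real (dens X x) \<le> enn2real (ennreal (K\<^sup>2 * enn2real (Q x) powr (1 / r)))"
        using elim by (intro enn2real_mono) (auto simp: K_def)
      then have "enn2real (dens X x) powr r \<le> (K\<^sup>2 * enn2real (Q x) powr (1 / r)) powr r"
        using r by (intro powr_mono2) auto
      also have "\<dots> = K powr (2 * r) * enn2real (Q x)"
      proof -
        have "K\<^sup>2 = K powr 2" using K by simp
        then have "(K\<^sup>2) powr r = K powr (2 * r)" by (simp only: powr_powr)
        then show ?thesis using r by (simp add: powr_mult powr_powr)
      qed
      finally have "ennreal (enn2real (dens X x) powr r) \<le> ennreal (K powr (2 * r) * enn2real (Q x))"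
        by (rule ennreal_leI)
      also have "\<dots> = ennreal (K powr (2 * r)) * Q x"
        using elim by (simp add: ennreal_mult less_top)
      finally show ?case unfolding K_def .
    qed
  qed
  also have "\<dots> = ennreal ((1 / (1 - c)) powr (2 * r)) * (\<integral>\<^sup>+x. Q x \<partial>lborel)"
    by (rule nn_integral_cmult) measurable
  also have "\<dots> \<le> ennreal ((1 / (1 - c)) powr (2 * r)) * (ennreal (G / (1 - a)) * hs_sq T)"
    by (intro mult_left_mono intQ) simp
  also have "\<dots> = ennreal ((1 / (1 - c)) powr (2 * r) * (G / (1 - a))) * hs_sq T"
    using a(2) by (subst ennreal_mult) (auto simp: G_def mult.assoc)
  also have "(1 / (1 - c)) powr (2 * r) * (G / (1 - a))
      = (1 / (1 - c)) powr (2 * r) * (64 powr (r - 1) / (1 - a)) * theta powr (r - 1)"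
    by (simp add: G_def)
  finally show "(\<integral>\<^sup>+x. ennreal (enn2real (dens X x) powr r) \<partial>lborel)
      \<le> ennreal ((1 / (1 - c)) powr (2 * r) * (64 powr (r - 1) / (1 - a)) * theta powr (r - 1)) * hs_sq (pos_cfc (\<lambda>t. sqrt (t powr r)) S)"
    unfolding T_def .
qed

end

section \<open>Density estimates\<close>

text \<open>The reciprocal of the weight is bounded. Membership of (u, v) in the graph of the weight
  becomes u = G v with an everywhere defined G, so questions of domains disappear.\<close>

definition inv_weight :: "real \<Rightarrow> real \<Rightarrow> real^3 \<Rightarrow> complex" where
  "inv_weight lam \<sigma> x = of_real (japanese_bracket (lam *\<^sub>R x) powr (- \<sigma>))"

lemma inv_weight_measurable [measurable]: "inv_weight lam \<sigma> \<in> borel_measurable borel"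
  unfolding inv_weight_def[abs_def] by measurable

lemma inv_weight_measurable': "inv_weight lam \<sigma> \<in> borel_measurable lborel"
  by simp

lemma cmod_inv_weight: "cmod (inv_weight lam \<sigma> x) = japanese_bracket (lam *\<^sub>R x) powr (- \<sigma>)"
  by (simp add: inv_weight_def)

lemma inv_weight_nonzero: "inv_weight lam \<sigma> x \<noteq> 0"
  using japanese_bracket_ge_1[of "lam *\<^sub>R x"] by (simp add: inv_weight_def)

lemma cmod_inv_weight_le:
  assumes "0 < \<sigma>"
  shows "cmod (inv_weight lam \<sigma> x) \<le> 1"
proof -
  have "japanese_bracket (lam *\<^sub>R x) powr (- \<sigma>) \<le> japanese_bracket (lam *\<^sub>R x) powr 0"
    by (rule powr_mono) (use assms japanese_bracket_ge_1 in auto)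
  then show ?thesis using japanese_bracket_ge_1[of "lam *\<^sub>R x"] by (simp add: cmod_inv_weight)
qed

lemma weight_graph_iff:
  assumes "0 < \<sigma>"
  shows "(u, v) \<in> mult_graph (\<lambda>x. of_real (japanese_bracket (lam *\<^sub>R x) powr \<sigma>)) \<longleftrightarrow> u = mult_op (inv_weight lam \<sigma>) v"
proof -
  have w: "complex_of_real (japanese_bracket (lam *\<^sub>R x) powr \<sigma>) * inv_weight lam \<sigma> x = 1" for x
    using japanese_bracket_ge_1[of "lam *\<^sub>R x"]
    unfolding inv_weight_def of_real_mult[symmetric] powr_add[symmetric] by simp
  have iff: "a = of_real (japanese_bracket (lam *\<^sub>R x) powr \<sigma>) * b \<longleftrightarrow> b = inv_weight lam \<sigma> x * a" for a b x
  proof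
    assume "a = of_real (japanese_bracket (lam *\<^sub>R x) powr \<sigma>) * b"
    then show "b = inv_weight lam \<sigma> x * a" using w[of x] by (simp add: mult.assoc[symmetric] mult.commute)
  next
    assume "b = inv_weight lam \<sigma> x * a"
    then show "a = of_real (japanese_bracket (lam *\<^sub>R x) powr \<sigma>) * b" using w[of x] by (simp add: mult.assoc[symmetric])
  qed
  note f = fun_of_mult_op[OF inv_weight_measurable' cmod_inv_weight_le[OF assms], where u = v]
  show ?thesis
    unfolding mult_graph_def mem_Collect_eq prod.case iff
  proof
    assume "AE x in lborel. fun_of u x = inv_weight lam \<sigma> x * fun_of v x"
    then have "AE x in lborel. fun_of u x = fun_of (mult_op (inv_weight lam \<sigma>) v) x"
      using f[of lam] by eventually_elim simp
    then show "u = mult_op (inv_weight lam \<sigma>) v" by (rule L2_eqI)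
  next
    assume "u = mult_op (inv_weight lam \<sigma>) v"
    then show "AE x in lborel. fun_of u x = inv_weight lam \<sigma> x * fun_of v x" using f by simp
  qed
qed

lemma mult_op_inv_weight_inj:
  assumes "0 < \<sigma>" "mult_op (inv_weight lam \<sigma>) u = mult_op (inv_weight lam \<sigma>) v"
  shows "u = v"
proof (rule L2_eqI)
  note f = fun_of_mult_op[OF inv_weight_measurable' cmod_inv_weight_le[OF assms(1)]]
  show "AE x in lborel. fun_of u x = fun_of v x"
    using f[of lam u] f[of lam v] unfolding assms(2)
    by eventually_elim (use inv_weight_nonzero in auto)
qed

lemma mult_op_inv_weight_symmetric:
  assumes "0 < \<sigma>"
  shows "cinner (mult_op (inv_weight lam \<sigma>) u) v = cinner u (mult_op (inv_weight lam \<sigma>) v)"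
proof -
  have "(\<lambda>x. cnj (inv_weight lam \<sigma> x)) = inv_weight lam \<sigma>" by (simp add: fun_eq_iff inv_weight_def)
  then show ?thesis using cinner_mult_op[OF inv_weight_measurable' cmod_inv_weight_le[OF assms], of lam u v] by simp
qed

lemma position_weight_iff:
  assumes "0 < \<sigma>"
  shows "(u, v) \<in> position_weight \<sigma> \<longleftrightarrow> u = mult_op (inv_weight 1 \<sigma>) v"
  using weight_graph_iff[OF assms, of u v 1] by (simp add: position_weight_def)

lemma momentum_weight_iff:
  assumes "0 < \<sigma>"
  shows "(u, v) \<in> momentum_weight h \<sigma> \<longleftrightarrow> u = ft 1 (mult_op (inv_weight h \<sigma>) (ft (-1) v))"
  unfolding momentum_weight_def fourier_mult_graph_def fourier_eq_ft mem_Collect_eq prod.case weight_graph_iff[OF assms]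
  by (metis ft_pm1)

text \<open>The definite description needs uniqueness of A. Two candidates agree on the range of G;
  by symmetry G then agrees after their adjoints, and injectivity of G makes the adjoints equal.
  This expresses the density of the range of G.\<close>

lemma sandwich_norm_cases:
  assumes W: "\<And>u v. (u, v) \<in> W \<longleftrightarrow> u = G v"
    and G: "bounded_clinear G" "\<And>u v. cinner (G u) v = cinner u (G v)" "\<And>u v. G u = G v \<Longrightarrow> u = v"
    and fin: "sandwich_norm h r W \<gamma> < \<infinity>"
  obtains A where "bounded_clinear A" "\<And>u. \<gamma> u = G (A (G u))" "sandwich_norm h r W \<gamma> = schatten_norm h r A"
proof -
  have sw: "is_sandwich W \<gamma> A \<longleftrightarrow> bounded_clinear A \<and> (\<forall>v. \<gamma> v = G (A (G v)))" for A
    unfolding is_sandwich_def by (auto simp: W)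
  from fin obtain A where A: "is_sandwich W \<gamma> A"
    unfolding sandwich_norm_def by (auto split: if_splits)
  have uniq: "A' = A" if "is_sandwich W \<gamma> A'" for A'
  proof -
    have bA: "bounded_clinear A" "bounded_clinear A'" using A that by (auto simp: sw)
    have "A' (G v) = A (G v)" for v
      using A that G(3) unfolding sw by metis
    then have "G (adjoint A' w) = G (adjoint A w)" for w
    proof (intro cinner_eqI)
      fix v
      show "cinner v (G (adjoint A' w)) = cinner v (G (adjoint A w))"
        using \<open>\<And>v. A' (G v) = A (G v)\<close> by (simp add: G(2)[symmetric] cinner_adjoint bA)
    qed
    then have "adjoint A' = adjoint A" using G(3) by blast
    then show ?thesis using adjoint_adjoint_L2[OF bA(1)] adjoint_adjoint_L2[OF bA(2)] by metis
  qed
  have "(THE A. is_sandwich W \<gamma> A) = A" by (rule the_equality) (fact A, fact uniq)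
  then have "sandwich_norm h r W \<gamma> = schatten_norm h r A" using A unfolding sandwich_norm_def by auto
  then show ?thesis using that A by (auto simp: sw)
qed

lemma evolve_sandwich:
  assumes G: "bounded_clinear G" "\<And>u v. cinner (G u) v = cinner u (G v)" and A: "\<And>u. \<gamma> u = G (A (G u))"
  shows "evolve h t \<gamma> = (\<lambda>u. free_propagator h t (G (A (adjoint (\<lambda>u. free_propagator h t (G u)) u))))"
proof -
  have "adjoint G = G" by (rule adjoint_eqI) (rule G(2))
  then show ?thesis
    unfolding evolve_def adjoint_compose[OF bounded_clinear_free_propagator G(1)] by (simp add: fun_eq_iff A)
qed

text \<open>\<open>density_of\<close> chooses some density; by uniqueness it coincides almost
  everywhere with the one constructed, which leaves the norm unchanged.\<close>

lemma Lr_norm_density_of_le: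
  assumes d: "is_density h A \<rho>" and le: "Lr_norm r \<rho> \<le> c"
  shows "has_density h A \<and> Lr_norm r (density_of h A) \<le> c"
proof -
  have h: "has_density h A" using d unfolding has_density_def by blast
  then have d': "is_density h A (density_of h A)" unfolding has_density_def density_of_def by (rule someI_ex)
  have [measurable]: "density_of h A \<in> borel_measurable lborel" "\<rho> \<in> borel_measurable lborel"
    using is_densityD(1) d d' by auto
  have ae: "AE x in lborel. density_of h A x = \<rho> x" by (rule is_density_unique[OF d' d])
  have "Lr_norm r (density_of h A) = Lr_norm r \<rho>"
  proof (cases "r = \<infinity>")
    case True
    have "esssup lborel (\<lambda>x. ennreal (cmod (density_of h A x))) = esssup lborel (\<lambda>x. ennreal (cmod (\<rho> x)))"
      by (intro antisym esssup_AE_mono) (use ae in \<open>auto elim: eventually_mono\<close>)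
    then show ?thesis using True by (simp add: Lr_norm_def)
  next
    case False
    have "(\<integral>\<^sup>+x. ennreal (cmod (density_of h A x) powr enn2real r) \<partial>lborel) = (\<integral>\<^sup>+x. ennreal (cmod (\<rho> x) powr enn2real r) \<partial>lborel)"
      by (rule nn_integral_cong_AE) (use ae in \<open>auto elim: eventually_mono\<close>)
    then show ?thesis using False by (simp add: Lr_norm_def)
  qed
  then show ?thesis using h le by simp
qed

lemma ennpowr_mono:
  assumes "x \<le> y" "0 \<le> a"
  shows "ennpowr x a \<le> ennpowr y a"
proof (cases "y = \<infinity>")
  case False
  then have "x \<noteq> \<infinity>" using assms(1) by (auto simp: top_unique)
  then show ?thesis
    using False assms unfolding ennpowr_def
    by (auto intro!: ennreal_leI powr_mono2 enn2real_mono simp: less_top)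
qed (simp add: ennpowr_def)

lemma ennpowr_mult_ennreal:
  assumes "0 \<le> k" "t < \<infinity>"
  shows "ennpowr (ennreal k * t) a = ennreal (k powr a) * ennpowr t a"
proof -
  have "ennreal k * t \<noteq> \<infinity>" using assms by (simp add: ennreal_mult_eq_top_iff less_top)
  then show ?thesis
    using assms(2) unfolding ennpowr_def by (simp add: enn2real_mult powr_mult ennreal_mult assms(1) less_top[symmetric])
qed

context weighted_transform
begin

text \<open>The root of \<open>op_abs A\<close> is self-adjoint, so the two factors multiply to
  \<open>op_abs A\<close> between the transforms, and V restores A.\<close>

lemma transform_polar:
  assumes A: "bounded_clinear A"
  obtains V where "bounded_clinear V" "\<And>u. norm (V u) \<le> norm u"
    "(\<lambda>u. transform (V (pos_cfc sqrt (op_abs A) (adjoint (\<lambda>u. transform (pos_cfc sqrt (op_abs A) u)) u)))) = (\<lambda>u. transform (A (adjoint transform u)))"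
proof -
  obtain V where V: "bounded_clinear V" "\<And>u. norm (V u) \<le> norm u" "\<And>u. V (op_abs A u) = A u"
    using polar_decomposition[OF A] by blast
  define R where "R = pos_cfc sqrt (op_abs A)"
  have S: "pos_op (op_abs A)" by (rule op_abs_pos[OF A])
  have c: "continuous_on {0..onorm (op_abs A)} sqrt" by (intro continuous_intros)
  have bR: "bounded_clinear R" unfolding R_def by (rule pos_cfc_spec(1)[OF S c])
  have aR: "adjoint R = R" unfolding R_def by (rule adjoint_eqI) (rule pos_cfc_selfadjoint[OF S c])
  have RR: "R (R u) = op_abs A u" for u
  proof -
    have "pos_cfc (\<lambda>x. sqrt x * sqrt x) (op_abs A) = pos_cfc (\<lambda>x. x) (op_abs A)" by (rule pos_cfc_cong) simp
    then show ?thesis unfolding R_def using pos_cfc_mult[OF S c c, of u] by (simp only: pos_cfc_id[OF S])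
  qed
  have "(\<lambda>u. transform (V (R (adjoint (\<lambda>u. transform (R u)) u)))) = (\<lambda>u. transform (A (adjoint transform u)))"
    unfolding adjoint_compose[OF bounded_clinear_transform bR] aR RR V(3) ..
  then show ?thesis using that V unfolding R_def by blast
qed

text \<open>d <= 1 + d^r for r >= 1, and compact sets have finite measure.\<close>

lemma dens_local_finite:
  assumes "AE x in lborel. dens X x < \<infinity>" "(\<integral>\<^sup>+x. ennreal (enn2real (dens X x) powr r) \<partial>lborel) < \<infinity>" "1 \<le> r" "compact K"
  shows "(\<integral>\<^sup>+x\<in>K. dens X x \<partial>lborel) < \<infinity>"
proof -
  have [measurable]: "K \<in> sets borel" using assms(4) by (simp add: borel_compact)
  have "(\<integral>\<^sup>+x\<in>K. dens X x \<partial>lborel) \<le> (\<integral>\<^sup>+x. indicator K x + ennreal (enn2real (dens X x) powr r) \<partial>lborel)"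
  proof (rule nn_integral_mono_AE)
    show "AE x in lborel. dens X x * indicator K x \<le> indicator K x + ennreal (enn2real (dens X x) powr r)"
      using assms(1)
    proof eventually_elim
      case (elim x)
      define d where "d = enn2real (dens X x)"
      have "d \<le> 1 + d powr r"
      proof (cases "d \<le> 1")
        case False
        then have "d powr 1 \<le> d powr r" using assms(3) by (intro powr_mono) auto
        then show ?thesis using False by simp
      qed (auto intro: order_trans)
      then have "ennreal d \<le> ennreal (1 + d powr r)" by (rule ennreal_leI)
      also have "\<dots> = 1 + ennreal (d powr r)" by (simp add: ennreal_plus)
      finally have "dens X x \<le> 1 + ennreal (d powr r)" using elim by (simp add: d_def less_top)
      then show ?case by (auto simp: d_def split: split_indicator)
    qed
  qed
  also have "\<dots> = emeasure lborel K + (\<integral>\<^sup>+x. ennreal (enn2real (dens X x) powr r) \<partial>lborel)"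
    by (subst nn_integral_add) auto
  also have "\<dots> < \<infinity>"
    using assms(2) emeasure_bounded_finite[OF compact_imp_bounded[OF assms(4)]] by (simp add: less_top)
  finally show ?thesis .
qed

text \<open>M contains none of h, s and lam; they are collected in the separate factor with
  \<open>theta\<close>. Its factor 2 comes from adding the contributions of X and X'.\<close>

lemma density_estimate_finite:
  assumes A: "bounded_clinear A" and h: "0 < h" and r: "1 \<le> r" and c: "0 < c" "c < 1"
    and a: "a = c powr (- 2 * r) * 8 powr (r - 1) * 2 powr (- 2 * sigma * r)" "a < 1"
    and tr: "pos_trace (op_powr (op_abs A) r) < \<infinity>"
    and M: "M = (2 * ((1 / (1 - c)) powr (2 * r) * (64 powr (r - 1) / (1 - a)))) powr (1 / r)"
  shows "has_density h (\<lambda>u. transform (A (adjoint transform u))) \<and>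
    Lr_norm (ennreal r) (density_of h (\<lambda>u. transform (A (adjoint transform u))))
      \<le> ennreal (M * ((2 * pi * h) ^ 3 * theta powr ((r - 1) / r))) * ennpowr (pos_trace (op_powr (op_abs A) r)) (1 / r)"
proof -
  define S where "S = op_abs A"
  have S: "pos_op S" unfolding S_def by (rule op_abs_pos[OF A])
  define tau where "tau = pos_trace (op_powr S r)"
  have cr: "continuous_on {0..onorm S} (\<lambda>t. t powr r)" using r by (intro continuous_on_powr_nonneg) simp
  have tau: "tau = hs_sq (pos_cfc (\<lambda>t. sqrt (t powr r)) S)"
    unfolding tau_def op_powr_def by (rule pos_trace_pos_cfc[OF S cr]) simp
  have tfin: "tau < \<infinity>" using tr by (simp add: tau_def S_def)
  obtain V where V: "bounded_clinear V" "\<And>u. norm (V u) \<le> norm u"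
    "(\<lambda>u. transform (V (pos_cfc sqrt S (adjoint (\<lambda>u. transform (pos_cfc sqrt S u)) u)))) = (\<lambda>u. transform (A (adjoint transform u)))"
    using transform_polar[OF A] unfolding S_def by metis
  define X where "X u = transform (V (pos_cfc sqrt S u))" for u
  define X' where "X' u = transform (pos_cfc sqrt S u)" for u
  have bR: "bounded_clinear (pos_cfc sqrt S)" by (rule pos_cfc_spec(1)[OF S]) (intro continuous_intros)
  have bX: "bounded_clinear X"
    unfolding X_def by (rule bounded_clinear_compose[OF bounded_clinear_transform bounded_clinear_compose[OF V(1) bR]])
  have bX': "bounded_clinear X'"
    unfolding X'_def by (rule bounded_clinear_compose[OF bounded_clinear_transform bR])
  define L where "L = (1 / (1 - c)) powr (2 * r) * (64 powr (r - 1) / (1 - a))"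
  define P where "P = theta powr (r - 1)"
  have L0: "0 \<le> L" using a(2) by (simp add: L_def)
  have P0: "0 \<le> P" by (simp add: P_def)
  note f = dens_bound_finite[OF S _ _ r c a tfin[unfolded tau]]
  have fX: "AE x in lborel. dens X x < \<infinity>" "(\<integral>\<^sup>+x. ennreal (enn2real (dens X x) powr r) \<partial>lborel) \<le> ennreal (L * P) * tau"
    using f[OF V(1,2)] unfolding X_def L_def P_def tau by blast+
  have fX': "AE x in lborel. dens X' x < \<infinity>" "(\<integral>\<^sup>+x. ennreal (enn2real (dens X' x) powr r) \<partial>lborel) \<le> ennreal (L * P) * tau"
    using f[OF bounded_clinear_id order_refl] unfolding X'_def L_def P_def tau by blast+
  have LPfin: "ennreal (L * P) * tau < \<infinity>" using tfin by (simp add: ennreal_mult_less_top)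
  have dens: "is_density h (\<lambda>u. X (adjoint X' u)) (\<lambda>x. of_real ((2 * pi * h) ^ 3) * cross_dens X X' x)"
    by (rule is_density_product[OF bX bX' dens_local_finite[OF fX(1) le_less_trans[OF fX(2) LPfin] r]
          dens_local_finite[OF fX'(1) le_less_trans[OF fX'(2) LPfin] r] h])
  define H where "H = (2 * pi * h) ^ 3"
  have H: "H > 0" using h by (simp add: H_def)
  have "(\<integral>\<^sup>+x. ennreal (cmod (of_real H * cross_dens X X' x) powr r) \<partial>lborel)
      \<le> (\<integral>\<^sup>+x. ennreal (H powr r) * (ennreal (enn2real (dens X x) powr r) + ennreal (enn2real (dens X' x) powr r)) \<partial>lborel)"
  proof (rule nn_integral_mono_AE)
    show "AE x in lborel. ennreal (cmod (of_real H * cross_dens X X' x) powr r)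
        \<le> ennreal (H powr r) * (ennreal (enn2real (dens X x) powr r) + ennreal (enn2real (dens X' x) powr r))"
      using fX(1) fX'(1)
    proof eventually_elim
      case (elim x)
      define p q where "p = enn2real (dens X x)" and "q = enn2real (dens X' x)"
      have pq: "0 \<le> p" "0 \<le> q" by (simp_all add: p_def q_def)
      have "cmod (cross_dens X X' x) \<le> (p + q) / 2" unfolding p_def q_def by (rule cross_dens_bound(2)[OF elim])
      \<comment> \<open>The mean is replaced by the maximum because the r-th power of a maximum is
        at most the sum of the r-th powers.\<close>
      also have "\<dots> \<le> max p q" by simp
      finally have "cmod (cross_dens X X' x) powr r \<le> max p q powr r" using r by (intro powr_mono2) auto
      also have "\<dots> \<le> p powr r + q powr r" by (simp add: max_def)
      finally have "cmod (of_real H * cross_dens X X' x) powr r \<le> H powr r * (p powr r + q powr r)"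
        using H by (simp add: norm_mult powr_mult mult_left_mono)
      then have "ennreal (cmod (of_real H * cross_dens X X' x) powr r) \<le> ennreal (H powr r * (p powr r + q powr r))"
        by (rule ennreal_leI)
      then show ?case unfolding p_def[symmetric] q_def[symmetric] by (simp add: ennreal_mult ennreal_plus)
    qed
  qed
  also have "\<dots> = ennreal (H powr r) * ((\<integral>\<^sup>+x. ennreal (enn2real (dens X x) powr r) \<partial>lborel)
      + (\<integral>\<^sup>+x. ennreal (enn2real (dens X' x) powr r) \<partial>lborel))"
    by (subst nn_integral_cmult) (auto simp: nn_integral_add)
  also have "\<dots> \<le> ennreal (H powr r) * (ennreal (L * P) * tau + ennreal (L * P) * tau)"
    by (intro mult_left_mono add_mono fX fX') simp
  also have "\<dots> = ennreal (H powr r * (2 * L * P)) * tau"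
  proof -
    have "ennreal (L * P) + ennreal (L * P) = ennreal (2 * L * P)"
      using L0 P0 by (simp add: ennreal_plus[symmetric] mult.assoc del: ennreal_plus)
    moreover have "ennreal (H powr r * (2 * L * P)) = ennreal (H powr r) * ennreal (2 * L * P)"
      by (rule ennreal_mult) (use L0 P0 in auto)
    ultimately show ?thesis unfolding distrib_right[symmetric] by (simp only: mult.assoc)
  qed
  finally have I: "(\<integral>\<^sup>+x. ennreal (cmod (of_real H * cross_dens X X' x) powr r) \<partial>lborel) \<le> ennreal (H powr r * (2 * L * P)) * tau" .
  have "Lr_norm (ennreal r) (\<lambda>x. of_real H * cross_dens X X' x)
      = ennpowr (\<integral>\<^sup>+x. ennreal (cmod (of_real H * cross_dens X X' x) powr r) \<partial>lborel) (1 / r)"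
    using r by (simp add: Lr_norm_def)
  also have "\<dots> \<le> ennpowr (ennreal (H powr r * (2 * L * P)) * tau) (1 / r)"
    by (rule ennpowr_mono[OF I]) (use r in simp)
  also have "\<dots> = ennreal ((H powr r * (2 * L * P)) powr (1 / r)) * ennpowr tau (1 / r)"
    by (rule ennpowr_mult_ennreal) (use L0 P0 tfin in auto)
  also have "(H powr r * (2 * L * P)) powr (1 / r) = M * (H * theta powr ((r - 1) / r))"
  proof -
    have "(H powr r * (2 * L * P)) powr (1 / r) = (H powr r) powr (1 / r) * (2 * L) powr (1 / r) * P powr (1 / r)"
      using L0 P0 by (simp add: powr_mult)
    also have "(H powr r) powr (1 / r) = H" using H r by (simp add: powr_powr)
    also have "P powr (1 / r) = theta powr ((r - 1) / r)" by (simp add: P_def powr_powr)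
    also have "(2 * L) powr (1 / r) = M" unfolding M L_def ..
    finally show ?thesis by (simp only: mult_ac)
  qed
  finally have "Lr_norm (ennreal r) (\<lambda>x. of_real H * cross_dens X X' x)
      \<le> ennreal (M * (H * theta powr ((r - 1) / r))) * ennpowr tau (1 / r)" .
  from Lr_norm_density_of_le[OF dens[folded H_def] this]
  show ?thesis unfolding X_def X'_def V(3) unfolding H_def tau_def S_def .
qed

lemma density_estimate_infinity:
  assumes A: "bounded_clinear A" and h: "0 < h" and c: "0 < c" "c < 1" "8 * 2 powr (- (2 * sigma)) \<le> c\<^sup>2"
  shows "has_density h (\<lambda>u. transform (A (adjoint transform u))) \<and>
    Lr_norm \<infinity> (density_of h (\<lambda>u. transform (A (adjoint transform u))))
      \<le> ennreal (64 * (1 / (1 - c))\<^sup>2 * ((2 * pi * h) ^ 3 * theta)) * ennreal (onorm A)"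
proof -
  define S where "S = op_abs A"
  have S: "pos_op S" unfolding S_def by (rule op_abs_pos[OF A])
  have oS: "onorm S = onorm A" unfolding S_def by (rule onorm_op_abs[OF A])
  obtain V where V: "bounded_clinear V" "\<And>u. norm (V u) \<le> norm u"
    "(\<lambda>u. transform (V (pos_cfc sqrt S (adjoint (\<lambda>u. transform (pos_cfc sqrt S u)) u)))) = (\<lambda>u. transform (A (adjoint transform u)))"
    using transform_polar[OF A] unfolding S_def by metis
  define X where "X u = transform (V (pos_cfc sqrt S u))" for u
  define X' where "X' u = transform (pos_cfc sqrt S u)" for u
  have bR: "bounded_clinear (pos_cfc sqrt S)" by (rule pos_cfc_spec(1)[OF S]) (intro continuous_intros)
  have bX: "bounded_clinear X"
    unfolding X_def by (rule bounded_clinear_compose[OF bounded_clinear_transform bounded_clinear_compose[OF V(1) bR]])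
  have bX': "bounded_clinear X'"
    unfolding X'_def by (rule bounded_clinear_compose[OF bounded_clinear_transform bR])
  define D where "D = (1 / (1 - c))\<^sup>2 * (64 * theta * onorm S)"
  have D0: "0 \<le> D" using theta_pos bounded_clinear_onorm_pos[OF pos_opD(1)[OF S]] by (simp add: D_def)
  have fX: "AE x in lborel. dens X x \<le> ennreal D"
    using dens_bound_infinity[OF S V(1,2) c] unfolding X_def D_def .
  have fX': "AE x in lborel. dens X' x \<le> ennreal D"
    using dens_bound_infinity[OF S bounded_clinear_id order_refl c] unfolding X'_def D_def .
  have loc: "(\<integral>\<^sup>+x\<in>K. dens Z x \<partial>lborel) < \<infinity>" if "AE x in lborel. dens Z x \<le> ennreal D" and K: "compact K" for Z K
  proof -
    have [measurable]: "K \<in> sets borel" using K by (simp add: borel_compact)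
    have "(\<integral>\<^sup>+x\<in>K. dens Z x \<partial>lborel) \<le> (\<integral>\<^sup>+x. ennreal D * indicator K x \<partial>lborel)"
      by (rule nn_integral_mono_AE) (use that(1) in \<open>auto elim!: eventually_mono split: split_indicator\<close>)
    also have "\<dots> = ennreal D * emeasure lborel K" by (simp add: nn_integral_cmult_indicator)
    also have "\<dots> < \<infinity>"
      using emeasure_bounded_finite[OF compact_imp_bounded[OF K]] by (simp add: ennreal_mult_less_top less_top)
    finally show ?thesis .
  qed
  have dens: "is_density h (\<lambda>u. X (adjoint X' u)) (\<lambda>x. of_real ((2 * pi * h) ^ 3) * cross_dens X X' x)"
    by (rule is_density_product[OF bX bX' loc[OF fX] loc[OF fX'] h])
  define H where "H = (2 * pi * h) ^ 3"
  have H: "H > 0" using h by (simp add: H_def)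
  have "Lr_norm \<infinity> (\<lambda>x. of_real H * cross_dens X X' x) \<le> ennreal (H * D)"
  proof -
    have "esssup lborel (\<lambda>x. ennreal (cmod (of_real H * cross_dens X X' x))) \<le> ennreal (H * D)"
    proof (rule esssup_I)
      show "AE x in lborel. ennreal (cmod (of_real H * cross_dens X X' x)) \<le> ennreal (H * D)"
        using fX fX'
      proof eventually_elim
        case (elim x)
        have fin: "dens X x < \<infinity>" "dens X' x < \<infinity>" using elim by (auto intro: le_less_trans)
        have "enn2real (dens X x) \<le> enn2real (ennreal D)" "enn2real (dens X' x) \<le> enn2real (ennreal D)"
          using elim by (intro enn2real_mono; simp)+
        then have "(enn2real (dens X x) + enn2real (dens X' x)) / 2 \<le> D" using D0 by simp
        then have "cmod (cross_dens X X' x) \<le> D" using cross_dens_bound(2)[OF fin] by linarith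
        then have "cmod (of_real H * cross_dens X X' x) \<le> H * D" using H by (simp add: norm_mult)
        then show ?case by (rule ennreal_leI)
      qed
    qed simp
    then show ?thesis by (simp add: Lr_norm_def)
  qed
  also have "ennreal (H * D) = ennreal (64 * (1 / (1 - c))\<^sup>2 * (H * theta)) * ennreal (onorm A)"
  proof -
    have "H * D = (64 * (1 / (1 - c))\<^sup>2 * (H * theta)) * onorm A" by (simp add: D_def oS)
    then show ?thesis using H theta_pos by (simp only:) (rule ennreal_mult', simp add: bounded_clinear_onorm_pos[OF A])
  qed
  finally have "Lr_norm \<infinity> (\<lambda>x. of_real H * cross_dens X X' x)
      \<le> ennreal (64 * (1 / (1 - c))\<^sup>2 * (H * theta)) * ennreal (onorm A)" .
  from Lr_norm_density_of_le[OF dens[folded H_def] this]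
  show ?thesis unfolding X_def X'_def V(3) unfolding H_def .
qed

end

lemma weighted_transform_momentum:
  assumes "0 < h" "0 < \<sigma>"
  shows "weighted_transform (\<lambda>x. 1) (\<lambda>x. phase (- (t * h / 2)) x * inv_weight h \<sigma> x) (ft (-1)) 1 h \<sigma>"
proof
  show "bounded_clinear (ft (-1))" by (rule bounded_clinear_ft) simp
  show "norm (ft (-1) u) \<le> norm u" for u by (rule norm_ft_le) simp
qed (use assms in \<open>simp_all add: norm_mult cmod_phase cmod_inv_weight\<close>)

lemma mult_op_1: "mult_op (\<lambda>x. 1) u = u"
  by (simp add: mult_op_def)

lemma free_propagator_momentum:
  assumes "0 < h" "0 < \<sigma>"
  shows "free_propagator h t (ft 1 (mult_op (inv_weight h \<sigma>) (ft (-1) u)))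
    = weighted_transform.transform (\<lambda>x. 1) (\<lambda>x. phase (- (t * h / 2)) x * inv_weight h \<sigma> x) (ft (-1)) 1 u"
  unfolding weighted_transform.transform_def[OF weighted_transform_momentum[OF assms]]
  unfolding free_propagator_eq ft_pm1 mult_op_1
    mult_op_mult_op[OF phase_measurable' cmod_phase_le inv_weight_measurable' cmod_inv_weight_le[OF assms(2)]] ..

text \<open>The parameters are read off from \<open>propagator_kernel\<close> with \<tau> = t h. The
  weight acts directly on positions, so the contraction in front is the identity.\<close>

lemma weighted_transform_position:
  assumes "0 < h" "0 < \<sigma>" "t \<noteq> 0"
  shows "weighted_transform (\<lambda>x. prop_const (t * h) * phase (1 / (2 * (t * h))) x)
    (\<lambda>x. phase (1 / (2 * (t * h))) x * inv_weight 1 \<sigma> x) (\<lambda>u. u) (- 1 / (t * h)) 1 \<sigma>"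
proof
  have "t * h \<noteq> 0" using assms by simp
  note c = cmod_prop_const[OF this]
  show "cmod (prop_const (t * h) * phase (1 / (2 * (t * h))) x) = 1" for x
    by (simp add: norm_mult cmod_phase c)
qed (use assms in \<open>simp_all add: norm_mult cmod_phase cmod_inv_weight bounded_clinear_id\<close>)

lemma free_propagator_position:
  assumes "0 < h" "0 < \<sigma>" "t \<noteq> 0"
  shows "free_propagator h t (mult_op (inv_weight 1 \<sigma>) u)
    = weighted_transform.transform (\<lambda>x. prop_const (t * h) * phase (1 / (2 * (t * h))) x)
        (\<lambda>x. phase (1 / (2 * (t * h))) x * inv_weight 1 \<sigma> x) (\<lambda>u. u) (- 1 / (t * h)) u"
proof -
  have th: "t * h \<noteq> 0" using assms by simp
  define p where "p = phase (1 / (2 * (t * h)))"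
  have p: "p \<in> borel_measurable lborel" "\<And>x. cmod (p x) \<le> 1" by (simp_all add: p_def cmod_phase)
  have "mult_op (\<lambda>x. prop_const (t * h) * p x) v = scaleC (prop_const (t * h)) (mult_op p v)" for v
    unfolding mult_op_def mult.assoc by (rule L2_of_cmult[OF square_integrable_mult_fun_of[OF p]])
  then show ?thesis
    unfolding weighted_transform.transform_def[OF weighted_transform_position[OF assms]]
    unfolding free_propagator_eq propagator_kernel[OF th] p_def[symmetric]
      mult_op_mult_op[OF p inv_weight_measurable' cmod_inv_weight_le[OF assms(2)]] by simp
qed

text \<open>The exponents of the theorem are extended numbers. The real number x = 1/r' exists also
  for r' infinite, where it is 0, and all exponents are expressed through it.\<close>

lemma dual_exponent:
  fixes r' :: ennreal
  assumes "1 / r' = ennreal x" "0 \<le> x"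
  shows "enn2real (3 / r') = 3 * x" and "3 / (2 * r') = ennreal (3 / 2 * x)"
proof -
  have i: "inverse r' = ennreal x" using assms(1) by (simp add: divide_ennreal_def)
  show "enn2real (3 / r') = 3 * x"
    using assms(2) unfolding divide_ennreal_def i by (simp add: enn2real_mult)
  have "inverse (2 * r') = inverse 2 * inverse r'" by (rule ennreal_inverse_mult') simp
  also have "inverse 2 = ennreal (1 / 2)" using inverse_ennreal[of 2] by simp
  finally have "3 / (2 * r') = ennreal 3 * (ennreal (1 / 2) * ennreal x)"
    unfolding divide_ennreal_def i by simp
  also have "\<dots> = ennreal (3 * (1 / 2 * x))"
    using assms(2) by (subst ennreal_mult[symmetric], simp, simp)+ simp
  finally show "3 / (2 * r') = ennreal (3 / 2 * x)" by simp
qed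

text \<open>C is chosen before the transform, h and A. The powers of h fit because 3x + 3/r = 3: of
  the factor (2 pi h)^3 in the density, the power 3/r is the normalisation of the Schatten norm, and
  the power 3x combines with \<open>theta\<close> to the factor in h |s| / lam.\<close>

lemma density_estimate:
  assumes r: "1 \<le> r" "1 / r + ennreal x = 1" and x: "0 \<le> x" "3 / 2 * x < \<sigma>"
  obtains C :: real where "0 < C"
    "\<And>q m Y s lam h A. weighted_transform q m Y s lam \<sigma> \<Longrightarrow> 0 < h \<Longrightarrow> bounded_clinear A \<Longrightarrow>
       schatten_norm h r A < \<infinity> \<Longrightarrow>
       has_density h (\<lambda>u. weighted_transform.transform q m Y s (A (adjoint (weighted_transform.transform q m Y s) u))) \<and>
       Lr_norm r (density_of h (\<lambda>u. weighted_transform.transform q m Y s (A (adjoint (weighted_transform.transform q m Y s) u))))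
         \<le> ennreal (C * (h * \<bar>s\<bar> / lam) powr (3 * x)) * schatten_norm h r A"
proof -
  \<comment> \<open>Half of the excess of \<open>\<sigma>\<close> pays for the summation over the shells, the rest for the decay.\<close>
  define \<delta> where "\<delta> = (\<sigma> - 3 / 2 * x) / 2"
  define c where "c = 2 powr (- \<delta>)"
  have \<delta>: "0 < \<delta>" "\<sigma> = 3 / 2 * x + 2 * \<delta>" using x(2) by (simp_all add: \<delta>_def field_simps)
  have c: "0 < c" "c < 1" using \<delta> by (simp_all add: c_def powr_less_one)
  show ?thesis
  proof (cases "r = \<infinity>")
    case True
    have x1: "x = 1" using r(2) x(1) unfolding True by (simp add: ennreal_eq_1)
    have cc: "8 * 2 powr (- (2 * \<sigma>)) \<le> c\<^sup>2"
    proof -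
      have "8 * 2 powr (- (2 * \<sigma>)) = 2 powr (3 - 2 * \<sigma>)" by (simp add: powr_diff powr_minus field_simps)
      \<comment> \<open>As x = 1, the exponent 3 - 2\<sigma> equals -4\<delta>.\<close>
      also have "\<dots> \<le> 2 powr (- (2 * \<delta>))" by (rule powr_mono) (use \<delta> x1 in auto)
      also have "\<dots> = c\<^sup>2" unfolding c_def power2_eq_square powr_add[symmetric] by simp
      finally show ?thesis .
    qed
    show ?thesis
    proof (rule that)
      show "0 < 64 * (1 / (1 - c))\<^sup>2" using c by simp
      fix q m Y s lam A and h :: real
      assume wt: "weighted_transform q m Y s lam \<sigma>" and h: "0 < h" and A: "bounded_clinear A"
      interpret weighted_transform q m Y s lam \<sigma> by fact
      have "(2 * pi * h) ^ 3 * theta = (h * \<bar>s\<bar> / lam) powr (3 * x)"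
        using h s lam unfolding x1 theta_def by (simp add: powr_numeral power_mult_distrib power_divide)
      then show "has_density h (\<lambda>u. transform (A (adjoint transform u))) \<and> Lr_norm r (density_of h (\<lambda>u. transform (A (adjoint transform u))))
          \<le> ennreal (64 * (1 / (1 - c))\<^sup>2 * (h * \<bar>s\<bar> / lam) powr (3 * x)) * schatten_norm h r A"
        using density_estimate_infinity[OF A h c cc] unfolding True by (simp add: schatten_norm_def)
    qed
  next
    case False
    then obtain \<rho> where \<rho>: "r = ennreal \<rho>" "0 \<le> \<rho>" by (cases r) auto
    then have \<rho>1: "1 \<le> \<rho>" using r(1) by (simp add: ennreal_1[symmetric] del: ennreal_1)
    have "1 / r = ennreal (1 / \<rho>)" using divide_ennreal[of 1 \<rho>] \<rho>1 \<rho>(1) by simp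
    then have "ennreal (1 / \<rho> + x) = 1" using r(2) x(1) \<rho>1 by (simp add: ennreal_plus)
    then have "1 / \<rho> + x = 1" using ennreal_eq_1 by blast
    then have x': "x = (\<rho> - 1) / \<rho>" using \<rho>1 by (simp add: field_simps)
    define a where "a = c powr (- 2 * \<rho>) * 8 powr (\<rho> - 1) * 2 powr (- 2 * \<sigma> * \<rho>)"
    have a: "a < 1"
    proof -
      have "(8::real) = 2 powr 3" by simp
      then have "(8::real) powr (\<rho> - 1) = 2 powr (3 * (\<rho> - 1))" by (metis powr_powr)
      then have "a = 2 powr (2 * \<delta> * \<rho> + 3 * (\<rho> - 1) + (- 2 * \<sigma> * \<rho>))"
        unfolding a_def c_def powr_powr powr_add by (simp add: mult_ac)
      \<comment> \<open>As x = (\<rho> - 1) / \<rho>, the power of 8 is cancelled by the part 3x/2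
        of \<sigma>; of the remaining decay 4 \<delta> \<rho> one half is spent on c.\<close>
      also have "2 * \<delta> * \<rho> + 3 * (\<rho> - 1) + (- 2 * \<sigma> * \<rho>) = - (2 * \<delta> * \<rho>)"
        using \<rho>1 unfolding \<delta>(2) x' by (simp add: field_simps)
      also have "2 powr (- (2 * \<delta> * \<rho>)) < (1::real)" using \<delta>(1) \<rho>1 by (intro powr_less_one) auto
      finally show ?thesis .
    qed
    define M where "M = (2 * ((1 / (1 - c)) powr (2 * \<rho>) * (64 powr (\<rho> - 1) / (1 - a)))) powr (1 / \<rho>)"
    show ?thesis
    proof (rule that)
      show M: "0 < M" using c a by (simp add: M_def)
      fix q m Y s lam A and h :: real
      assume wt: "weighted_transform q m Y s lam \<sigma>" and h: "0 < h" and A: "bounded_clinear A"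
        and fin: "schatten_norm h r A < \<infinity>"
      interpret weighted_transform q m Y s lam \<sigma> by fact
      define T where "T = pos_trace (op_powr (op_abs A) \<rho>)"
      have sch: "schatten_norm h r A = ennreal ((2 * pi * h) powr (3 / \<rho>)) * ennpowr T (1 / \<rho>)"
        using \<rho> by (simp add: schatten_norm_def T_def)
      \<comment> \<open>An infinite trace would make the Schatten norm infinite, since its other
        factor is positive.\<close>
      have "T < \<infinity>"
      proof (rule ccontr)
        assume "\<not> T < \<infinity>"
        then have "ennpowr T (1 / \<rho>) = top" by (simp add: ennpowr_def less_top[symmetric])
        then have "schatten_norm h r A = top" using h unfolding sch by (simp add: ennreal_mult_top)
        then show False using fin by simp
      qed
      note est = density_estimate_finite[OF A h \<rho>1 c a_def a this[unfolded T_def] M_def, folded T_def]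
      have "(2 * pi * h) ^ 3 * theta powr ((\<rho> - 1) / \<rho>) = (h * \<bar>s\<bar> / lam) powr (3 * x) * (2 * pi * h) powr (3 / \<rho>)"
      proof -
        define H where "H = 2 * pi * h"
        define k where "k = \<bar>s\<bar> / (2 * pi * lam)"
        have pos: "0 < H" "0 < k" using h s lam by (simp_all add: H_def k_def)
        have Hk: "h * \<bar>s\<bar> / lam = H * k" by (simp add: H_def k_def)
        have e: "3 * x + 3 / \<rho> = 3" using \<rho>1 unfolding x' by (simp add: field_simps)
        have "H ^ 3 = H powr (3 * x) * H powr (3 / \<rho>)"
          unfolding powr_add[symmetric] e using pos(1) by (simp add: powr_numeral)
        moreover have "(k ^ 3) powr ((\<rho> - 1) / \<rho>) = k powr (3 * x)"
        proof -
          have "k ^ 3 = k powr 3" using pos(2) by (simp add: powr_numeral)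
          then show ?thesis unfolding x'[symmetric] by (simp only: powr_powr)
        qed
        moreover have "(H * k) powr (3 * x) = H powr (3 * x) * k powr (3 * x)"
          by (rule powr_mult)
        ultimately show ?thesis
          unfolding theta_def Hk unfolding H_def[symmetric] k_def[symmetric] by (simp only: mult_ac)
      qed
      then have "ennreal (M * ((2 * pi * h) ^ 3 * theta powr ((\<rho> - 1) / \<rho>)))
          = ennreal (M * (h * \<bar>s\<bar> / lam) powr (3 * x)) * ennreal ((2 * pi * h) powr (3 / \<rho>))"
        using M by (subst ennreal_mult[symmetric]) (simp_all add: mult_ac)
      then show "has_density h (\<lambda>u. transform (A (adjoint transform u))) \<and> Lr_norm r (density_of h (\<lambda>u. transform (A (adjoint transform u))))
          \<le> ennreal (M * (h * \<bar>s\<bar> / lam) powr (3 * x)) * schatten_norm h r A"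
        using est unfolding \<rho>(1)[symmetric] sch by (simp only: mult.assoc)
    qed
  qed
qed

theorem proposition3p1:
  fixes r r' :: ennreal and \<sigma> :: real
  assumes "1 \<le> r" and "1 / r + 1 / r' = 1" and "3 / (2 * r') < ennreal \<sigma>"
  shows "\<exists>C::real. C > 0 \<and>
    (\<forall>h::real. h > 0 \<longrightarrow> (\<forall>\<gamma>\<^sub>0 :: L2 \<Rightarrow> L2. clinear \<gamma>\<^sub>0 \<longrightarrow>
      (sandwich_norm h r (momentum_weight h \<sigma>) \<gamma>\<^sub>0 < \<infinity> \<longrightarrow>
        (\<forall>t::real. has_density h (evolve h t \<gamma>\<^sub>0) \<and>
           Lr_norm r (density_of h (evolve h t \<gamma>\<^sub>0))
             \<le> ennreal C * sandwich_norm h r (momentum_weight h \<sigma>) \<gamma>\<^sub>0)) \<and>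
      (sandwich_norm h r (position_weight \<sigma>) \<gamma>\<^sub>0 < \<infinity> \<longrightarrow>
        (\<forall>t::real. t \<noteq> 0 \<longrightarrow> has_density h (evolve h t \<gamma>\<^sub>0) \<and>
           Lr_norm r (density_of h (evolve h t \<gamma>\<^sub>0))
             \<le> ennreal (C / \<bar>t\<bar> powr enn2real (3 / r')) *
               sandwich_norm h r (position_weight \<sigma>) \<gamma>\<^sub>0))))"
proof -
  define x where "x = enn2real (1 / r')"
  \<comment> \<open>The relation between r and r' excludes r' = 0, whose inverse is infinite, so x
    represents 1/r' faithfully.\<close>
  have "1 / r' \<le> 1" using assms(2) by (metis add.commute le_iff_add)
  then have "1 / r' < top" by (rule le_less_trans) simp
  then have x: "1 / r' = ennreal x" "0 \<le> x" by (simp_all add: x_def)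
  note dual = dual_exponent[OF x]
  have x\<sigma>: "3 / 2 * x < \<sigma>" using assms(3) x(2) unfolding dual(2) by (simp add: ennreal_less_iff)
  then have \<sigma>: "0 < \<sigma>" using x(2) by linarith
  obtain C where C: "0 < C" and est: "\<And>q m Y s lam h A. weighted_transform q m Y s lam \<sigma> \<Longrightarrow> 0 < h \<Longrightarrow>
      bounded_clinear A \<Longrightarrow> schatten_norm h r A < \<infinity> \<Longrightarrow>
      has_density h (\<lambda>u. weighted_transform.transform q m Y s (A (adjoint (weighted_transform.transform q m Y s) u))) \<and>
      Lr_norm r (density_of h (\<lambda>u. weighted_transform.transform q m Y s (A (adjoint (weighted_transform.transform q m Y s) u))))
        \<le> ennreal (C * (h * \<bar>s\<bar> / lam) powr (3 * x)) * schatten_norm h r A"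
    using density_estimate[OF assms(1) assms(2)[unfolded x(1)] x(2) x\<sigma>] by metis
  \<comment> \<open>Both weights at once: G stands for the inverse of the weight, and
    \<open>transform\<close> says that the propagator after G has the form covered by
    \<open>est\<close>.\<close>
  have sandwich: "has_density h (evolve h t \<gamma>) \<and>
      Lr_norm r (density_of h (evolve h t \<gamma>)) \<le> ennreal (C * (h * \<bar>s\<bar> / lam) powr (3 * x)) * sandwich_norm h r W \<gamma>"
    if h: "0 < h" and fin: "sandwich_norm h r W \<gamma> < \<infinity>"
      and W: "\<And>u v. (u, v) \<in> W \<longleftrightarrow> u = G v"
      and G: "bounded_clinear G" "\<And>u v. cinner (G u) v = cinner u (G v)" "\<And>u v. G u = G v \<Longrightarrow> u = v"
      and wt: "weighted_transform q m Y s lam \<sigma>"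
      and transform: "\<And>u. free_propagator h t (G u) = weighted_transform.transform q m Y s u"
    for h t s lam \<gamma> G W q m Y
  proof -
    obtain A where A: "bounded_clinear A" "\<And>u. \<gamma> u = G (A (G u))" "sandwich_norm h r W \<gamma> = schatten_norm h r A"
      using sandwich_norm_cases[OF W G fin] by metis
    have "evolve h t \<gamma> = (\<lambda>u. weighted_transform.transform q m Y s (A (adjoint (weighted_transform.transform q m Y s) u)))"
      using evolve_sandwich[where h = h and t = t and G = G and A = A and \<gamma> = \<gamma>, OF G(1,2) A(2)] unfolding transform by simp
    then show ?thesis using est[OF wt h A(1)] fin unfolding A(3) by simp
  qed
  have Gx: "bounded_clinear (mult_op (inv_weight lam \<sigma>))" for lam
    by (rule bounded_clinear_mult_op[OF inv_weight_measurable' cmod_inv_weight_le[OF \<sigma>]])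
  note sym = mult_op_inv_weight_symmetric[OF \<sigma>] and inj = mult_op_inv_weight_inj[OF \<sigma>]
  have "has_density h (evolve h t \<gamma>) \<and>
      Lr_norm r (density_of h (evolve h t \<gamma>)) \<le> ennreal C * sandwich_norm h r (momentum_weight h \<sigma>) \<gamma>"
    if h: "0 < h" and fin: "sandwich_norm h r (momentum_weight h \<sigma>) \<gamma> < \<infinity>" for h t \<gamma>
  proof -
    define G where "G v = ft 1 (mult_op (inv_weight h \<sigma>) (ft (-1) v))" for v
    have ft: "bounded_clinear (ft 1)" "bounded_clinear (ft (-1))" by (simp_all add: bounded_clinear_ft)
    have bG: "bounded_clinear G"
      unfolding G_def by (rule bounded_clinear_compose[OF ft(1) bounded_clinear_compose[OF Gx ft(2)]])
    have symG: "cinner (G u) v = cinner u (G v)" for u v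
    proof -
      have "cinner (G u) v = cinner (mult_op (inv_weight h \<sigma>) (ft (-1) u)) (ft (-1) v)"
        unfolding G_def using ft_adjoint[of 1] by simp
      also have "\<dots> = cinner (ft (-1) u) (mult_op (inv_weight h \<sigma>) (ft (-1) v))" by (rule sym)
      also have "\<dots> = cinner u (G v)" unfolding G_def using ft_adjoint[of "-1"] by simp
      finally show ?thesis .
    qed
    have injG: "u = v" if "G u = G v" for u v
      using inj[of h "ft (-1) u" "ft (-1) v"] that unfolding G_def by (metis ft_pm1)
    show ?thesis
      using sandwich[OF h fin momentum_weight_iff[OF \<sigma>, where h = h, folded G_def] bG symG injG weighted_transform_momentum[OF h \<sigma>, of t]
          free_propagator_momentum[OF h \<sigma>, where t = t, folded G_def]] h by simp
  qed
  moreover have "has_density h (evolve h t \<gamma>) \<and> Lr_norm r (density_of h (evolve h t \<gamma>))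
      \<le> ennreal (C / \<bar>t\<bar> powr enn2real (3 / r')) * sandwich_norm h r (position_weight \<sigma>) \<gamma>"
    if h: "0 < h" and fin: "sandwich_norm h r (position_weight \<sigma>) \<gamma> < \<infinity>" and t: "t \<noteq> 0" for h t \<gamma>
  proof -
    have "C * (h * \<bar>- 1 / (t * h)\<bar> / 1) powr (3 * x) = C / \<bar>t\<bar> powr enn2real (3 / r')"
      using h t unfolding dual(1) by (simp add: abs_mult powr_divide)
    then show ?thesis
      using sandwich[OF h fin position_weight_iff[OF \<sigma>] Gx sym inj weighted_transform_position[OF h \<sigma> t]
          free_propagator_position[OF h \<sigma> t]] by simp
  qed
  ultimately show ?thesis using C by blast
qed

end
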